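(* Let $A$ and $B$ be unital $C^*$-algebras and $H$ a finite dimensional $C^*$-Hopf algebra with dual $C^*$-Hopf algebra $H^0$. Let $(\rho,u)$ and $(\sigma,v)$ be twisted coactions of $H^0$ on $A$ and $B$, respectively. Let $C=A\rtimes_{\rho,u}H$ and $D=B\rtimes_{\sigma,v}H$. Suppose that the unital inclusions $A\subset C$ and $B\subset D$ are strongly Morita equivalent, and suppose that $A'\cap C=\mathbf{C}1$. Then there is a $C^*$-Hopf algebra automorphism $\lambda^0$ of $H^0$ such that the twisted coaction $(\rho,u)$ of $H^0$ on $A$ is strongly Morita equivalent to the twisted coaction $$((\mathrm{id}_B\otimes\lambda^0)\circ\sigma,\ (\mathrm{id}_B\otimes\lambda^0\otimes\lambda^0)(v))$$ of $H^0$ on $B$ induced by $(\sigma,v)$ and $\lambda^0$.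
   Context: Hopf algebra conventions. $\Delta,\epsilon,S$ denote comultiplication, counit and antipode of the finite dimensional $C^*$-Hopf algebra $H$, with Sweedler notation $\Delta(h)=h_{(1)}\otimes h_{(2)}$. The dual $C^*$-Hopf algebra $H^0$ is the dual space of $H$ with $(\phi\psi)(h)=\phi(h_{(1)})\psi(h_{(2)})$, $\phi^*(h)=\overline{\phi(S(h)^* )}$, $\Delta^0(\phi)(h\otimes l)=\phi(hl)$, unit $1^0=\epsilon$, counit $\epsilon^0(\phi)=\phi(1)$, antipode $S^0(\phi)=\phi\circ S$. A $C^*$-Hopf algebra automorphism is a $C^*$-algebra automorphism commuting with comultiplication and antipode and preserving the counit. Twisted coactions. A weak coaction of $H^0$ on a unital $C^*$-algebra $A$ is a unital $*$-homomorphism $\rho:A\to A\otimes H^0$ with $(\mathrm{id}\otimes\epsilon^0)\circ\rho=\mathrm{id}$. A twisted coaction $(\rho,u)$ is a weak coaction $\rho$ and a unitary $u\in A\otimes H^0\otimes H^0$ such that (1) $(\rho\otimes\mathrm{id})\circ\rho=\mathrm{Ad}(u)\circ(\mathrm{id}\otimes\Delta^0)\circ\rho$; (2) $(u\otimes 1^0)(\mathrm{id}\otimes\Delta^0\otimes\mathrm{id})(u)=(\rho\otimes\mathrm{id}\otimes\mathrm{id})(u)(\mathrm{id}\otimes\mathrm{id}\otimes\Delta^0)(u)$; (3) $(\mathrm{id}\otimes h\otimes\epsilon^0)(u)=(\mathrm{id}\otimes\epsilon^0\otimes h)(u)=\epsilon(h)1$ for all $h\in H$ (elements of $H$ are viewed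 as functionals on $H^0$; here $\epsilon^0$ corresponds to $1\in H$). Twisted crossed product. Put $h\cdot_{\rho,u}x=(\mathrm{id}\otimes h)(\rho(x))$ and $\widehat u(h,l)=(\mathrm{id}\otimes h\otimes l)(u)$. Then $A\rtimes_{\rho,u}H$ is the unital $C^*$-algebra with underlying space $A\otimes H$ (elements written $x\rtimes_{\rho,u}h$), product $(x\rtimes h)(y\rtimes l)=x[h_{(1)}\cdot_{\rho,u}y]\widehat u(h_{(2)},l_{(1)})\rtimes h_{(3)}l_{(2)}$ and involution $(x\rtimes h)^*=\widehat u(S(h_{(2)}),h_{(1)})^*[h_{(3)}^*\cdot_{\rho,u}x^*]\rtimes h_{(4)}^*$. $A$ is identified with the unital $C^*$-subalgebra $A\rtimes_{\rho,u}1$, and $A'\cap C$ is its relative commutant. Strong Morita equivalence of inclusions. Unital inclusions $A\subset C$ and $B\subset D$ of unital $C^*$-algebras are strongly Morita equivalent (with respect to $Y$ and $X$) if there are a $C$-$D$-equivalence bimodule $Y$ and a closed subspace $X\subset Y$ such that (1) $a\cdot x\in X$, $x\cdot b\in X$, ${}_C\langle x,y\rangle\in A$, $\langle x,y\rangle_D\in B$ for all $a\in A,b\in B,x,y\in X$, and the linear spans of ${}_C\langle X,X\rangle$ and $\langle X,X\rangle_D$ are $A$ and $B$; (2) the linear spans of ${}_C\langle Y,X\rangle$ and $\langle Y,X\rangle_D$ are $C$ and $D$. Strong Morita equivalence of twisted coactions. Twisted coactions $(\rho,u)$ of $H^0$ on $A$ and $(\sigma,v)$ of $H^0$ on $B$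 are strongly Morita equivalent if there are an $A$-$B$-equivalence bimodule $X$ and a linear map $\nu:X\to X\otimes H^0$ such that for $a\in A,b\in B,x,y\in X$: $\nu(a\cdot x)=\rho(a)\cdot\nu(x)$; $\nu(x\cdot b)=\nu(x)\cdot\sigma(b)$; $\rho({}_A\langle x,y\rangle)={}_{A\otimes H^0}\langle\nu(x),\nu(y)\rangle$; $\sigma(\langle x,y\rangle_B)=\langle\nu(x),\nu(y)\rangle_{B\otimes H^0}$; $(\mathrm{id}\otimes\epsilon^0)(\nu(x))=x$; $(\nu\otimes\mathrm{id})(\nu(x))=u\cdot(\mathrm{id}\otimes\Delta^0)(\nu(x))\cdot v^*$. Here $X\otimes H^0$ is the exterior tensor product $A\otimes H^0$-$B\otimes H^0$-equivalence bimodule. *)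

theory Defs
  imports Complex_Main "HOL-Library.Multiset"
begin

section \<open>Complex vector spaces\<close>

class complex_vector = ab_group_add +
  fixes scaleC :: "complex \<Rightarrow> 'a \<Rightarrow> 'a"  (infixr "*\<^sub>C" 75)
  assumes scaleC_add_right: "c *\<^sub>C (x + y) = c *\<^sub>C x + c *\<^sub>C y"
    and scaleC_add_left: "(c + d) *\<^sub>C x = c *\<^sub>C x + d *\<^sub>C x"
    and scaleC_scaleC: "c *\<^sub>C (d *\<^sub>C x) = (c * d) *\<^sub>C x"
    and scaleC_one: "1 *\<^sub>C x = x"

global_interpretation cvector: vector_space "scaleC :: complex \<Rightarrow> 'a \<Rightarrow> 'a::complex_vector"
  by unfold_locales (simp_all add: scaleC_add_right scaleC_add_left scaleC_scaleC scaleC_one)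

abbreviation clinear :: "('a::complex_vector \<Rightarrow> 'b::complex_vector) \<Rightarrow> bool"
  where "clinear \<equiv> Vector_Spaces.linear scaleC scaleC"

abbreviation cspan :: "'a::complex_vector set \<Rightarrow> 'a set"
  where "cspan \<equiv> module.span scaleC"

abbreviation csubspace :: "'a::complex_vector set \<Rightarrow> bool"
  where "csubspace \<equiv> module.subspace scaleC"

instantiation complex :: complex_vector
begin
definition scaleC_complex :: "complex \<Rightarrow> complex \<Rightarrow> complex"
  where "scaleC_complex c z = c * z"
instance by standard (simp_all add: scaleC_complex_def algebra_simps)
end

lemma clinearI:
  fixes f :: "'a::complex_vector \<Rightarrow> 'b::complex_vector"
  assumes "\<And>x y. f (x + y) = f x + f y" "\<And>c x. f (c *\<^sub>C x) = c *\<^sub>C f x"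
  shows "clinear f"
  by unfold_locales (simp_all add: assms)

lemma clinear_add: "clinear f \<Longrightarrow> f (x + y) = f x + f y"
  and clinear_scale: "clinear f \<Longrightarrow> f (c *\<^sub>C x) = c *\<^sub>C f x"
  unfolding Vector_Spaces.linear_def module_hom_def module_hom_axioms_def by auto

definition finite_dim :: "'a::complex_vector itself \<Rightarrow> bool"
  where "finite_dim _ \<longleftrightarrow> (\<exists>b::'a set. finite b \<and> cspan b = UNIV)"


section \<open>The algebraic tensor product, by generators and relations\<close>

text \<open>A multiset of pairs stands for the formal sum of the corresponding elementary tensors.\<close>

inductive tensor_rel ::
  "('a::complex_vector \<times> 'b::complex_vector) multiset \<Rightarrow> ('a \<times> 'b) multiset \<Rightarrow> bool" where
  refl: "tensor_rel p p"
| sym: "tensor_rel p q \<Longrightarrow> tensor_rel q p"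
| trans: "tensor_rel p q \<Longrightarrow> tensor_rel q r \<Longrightarrow> tensor_rel p r"
| cong: "tensor_rel p q \<Longrightarrow> tensor_rel (p + r) (q + r)"
| add_left: "tensor_rel {#(a + a', b)#} {#(a, b), (a', b)#}"
| add_right: "tensor_rel {#(a, b + b')#} {#(a, b), (a, b')#}"
| scale: "tensor_rel {#(c *\<^sub>C a, b)#} {#(a, c *\<^sub>C b)#}"
| zero: "tensor_rel {#(0, b)#} {#}"

lemma equivp_tensor_rel: "equivp tensor_rel"
  by (intro equivpI reflpI sympI transpI) (auto intro: tensor_rel.refl tensor_rel.sym tensor_rel.trans)

quotient_type (overloaded) ('a, 'b) tensor = "('a::complex_vector \<times> 'b::complex_vector) multiset" / tensor_rel
  by (rule equivp_tensor_rel)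

lemma tensor_rel_plus:
  assumes "tensor_rel p p'" "tensor_rel q q'"
  shows "tensor_rel (p + q) (p' + q')"
  using tensor_rel.cong[OF assms(1), of q] tensor_rel.cong[OF assms(2), of p']
  by (metis add.commute tensor_rel.trans)

lemma tensor_rel_scale:
  assumes "tensor_rel p q"
  shows "tensor_rel (image_mset (\<lambda>(a, b). (c *\<^sub>C a, b)) p) (image_mset (\<lambda>(a, b). (c *\<^sub>C a, b)) q)"
  using assms
proof induction
  case (scale d a b)
  then show ?case
    using tensor_rel.scale[of d "c *\<^sub>C a" b] by (simp add: scaleC_scaleC mult.commute)
qed (auto intro: tensor_rel.intros simp: scaleC_add_right)

lemma tensor_rel_distrib:
  "tensor_rel (image_mset (\<lambda>(a, b). ((c + d) *\<^sub>C a, b)) p)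
     (image_mset (\<lambda>(a, b). (c *\<^sub>C a, b)) p + image_mset (\<lambda>(a, b). (d *\<^sub>C a, b)) p)"
proof (induction p)
  case empty
  show ?case by (simp add: tensor_rel.refl)
next
  case (add x p)
  obtain a b where x: "x = (a, b)" by (cases x)
  have "tensor_rel {#((c + d) *\<^sub>C a, b)#} {#(c *\<^sub>C a, b), (d *\<^sub>C a, b)#}"
    by (simp add: scaleC_add_left tensor_rel.add_left)
  from tensor_rel_plus[OF this add] show ?case by (simp add: x add_mset_commute)
qed

lemma tensor_rel_zero: "tensor_rel (image_mset (\<lambda>(a, b). (0 *\<^sub>C a, b)) p) {#}"
proof (induction p)
  case empty
  show ?case by (simp add: tensor_rel.refl)
next
  case (add x p)
  obtain a b where x: "x = (a, b)" by (cases x)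
  from tensor_rel_plus[OF tensor_rel.zero[of b] add] show ?case by (simp add: x)
qed

instantiation tensor :: (complex_vector, complex_vector) complex_vector
begin

lift_definition zero_tensor :: "('a, 'b) tensor" is "{#}" .

lift_definition plus_tensor :: "('a, 'b) tensor \<Rightarrow> ('a, 'b) tensor \<Rightarrow> ('a, 'b) tensor" is "(+)"
  by (rule tensor_rel_plus)

lift_definition scaleC_tensor :: "complex \<Rightarrow> ('a, 'b) tensor \<Rightarrow> ('a, 'b) tensor"
  is "\<lambda>c. image_mset (\<lambda>(a, b). (c *\<^sub>C a, b))"
  by (rule tensor_rel_scale)

definition uminus_tensor :: "('a, 'b) tensor \<Rightarrow> ('a, 'b) tensor"
  where "uminus_tensor t = (-1) *\<^sub>C t"

definition minus_tensor :: "('a, 'b) tensor \<Rightarrow> ('a, 'b) tensor \<Rightarrow> ('a, 'b) tensor"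
  where "minus_tensor s t = s + - t"

instance
proof
  fix s t r :: "('a, 'b) tensor" and c d :: complex
  show "s + t + r = s + (t + r)" "s + t = t + s" "0 + t = t"
    by (transfer, simp add: ac_simps tensor_rel.refl)+
  show "c *\<^sub>C (s + t) = c *\<^sub>C s + c *\<^sub>C t" by transfer (simp add: tensor_rel.refl)
  show distr: "(c + d) *\<^sub>C t = c *\<^sub>C t + d *\<^sub>C t" for c d and t :: "('a, 'b) tensor"
    by transfer (rule tensor_rel_distrib)
  show "c *\<^sub>C (d *\<^sub>C t) = (c * d) *\<^sub>C t"
    by transfer (simp add: image_mset.compositionality comp_def case_prod_unfold scaleC_scaleC tensor_rel.refl)
  show one: "1 *\<^sub>C t = t" for t :: "('a, 'b) tensor"
    by transfer (simp add: scaleC_one tensor_rel.refl)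
  have zero: "0 *\<^sub>C t = 0" by transfer (rule tensor_rel_zero)
  show "- t + t = 0"
    using distr[of "-1" 1 t] by (simp add: one zero uminus_tensor_def)
  show "s - t = s + - t" by (simp add: minus_tensor_def)
qed

end

lift_definition pure_tensor ::
  "'a::complex_vector \<Rightarrow> 'b::complex_vector \<Rightarrow> ('a, 'b) tensor"  (infixr "\<otimes>\<^sub>t" 73)
  is "\<lambda>a b. {#(a, b)#}" .

text \<open>
  For \<open>t = (\<Sum>i. a\<^sub>i \<otimes>\<^sub>t b\<^sub>i)\<close> with all \<open>a\<^sub>i\<close> in the subspace \<open>S\<close>, \<open>tensor_lift_on S f t\<close> is
  \<open>\<Sum>i. f a\<^sub>i b\<^sub>i\<close>. This does not depend on the chosen representation of \<open>t\<close> whenever \<open>f\<close> is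
  biadditive and balanced on \<open>S\<close> (lemma \<open>tensor_lift_on_eq\<close>); in particular \<open>f\<close> may be
  linear in both or conjugate linear in both arguments.
\<close>

definition tensor_lift_on ::
  "'a::complex_vector set \<Rightarrow> ('a \<Rightarrow> 'b::complex_vector \<Rightarrow> 'c::comm_monoid_add) \<Rightarrow> ('a, 'b) tensor \<Rightarrow> 'c"
  where "tensor_lift_on S f t =
    (\<Sum>(a, b)\<in>#(SOME p. abs_tensor p = t \<and> fst ` set_mset p \<subseteq> S). f a b)"

abbreviation tensor_lift ::
  "('a::complex_vector \<Rightarrow> 'b::complex_vector \<Rightarrow> 'c::comm_monoid_add) \<Rightarrow> ('a, 'b) tensor \<Rightarrow> 'c"
  where "tensor_lift \<equiv> tensor_lift_on UNIV"

definition balanced_on ::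
  "'a::complex_vector set \<Rightarrow> ('a \<Rightarrow> 'b::complex_vector \<Rightarrow> 'c::comm_monoid_add) \<Rightarrow> bool"
  where "balanced_on S f \<longleftrightarrow>
    (\<forall>a\<in>S. \<forall>a'\<in>S. \<forall>b. f (a + a') b = f a b + f a' b) \<and>
    (\<forall>a\<in>S. \<forall>b b'. f a (b + b') = f a b + f a b') \<and>
    (\<forall>c. \<forall>a\<in>S. \<forall>b. f (c *\<^sub>C a) b = f a (c *\<^sub>C b))"

lemma tensor_rel_balanced:
  fixes f :: "'a::complex_vector \<Rightarrow> 'b::complex_vector \<Rightarrow> 'c::ab_group_add"
  assumes "tensor_rel p q" "balanced_on UNIV f"
  shows "(\<Sum>(a, b)\<in>#p. f a b) = (\<Sum>(a, b)\<in>#q. f a b)"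
  using assms(1)
proof induction
  case (zero b)
  have "f (0 + 0) b = f 0 b + f 0 b" using assms(2) unfolding balanced_on_def by blast
  then show ?case by simp
qed (use assms(2) in \<open>auto simp: balanced_on_def\<close>)

lemma tensor_lift_on_eq:
  fixes f :: "'a::complex_vector \<Rightarrow> 'b::complex_vector \<Rightarrow> 'c::ab_group_add"
  assumes S: "csubspace S" and f: "balanced_on S f" and p: "fst ` set_mset p \<subseteq> S"
  shows "tensor_lift_on S f (abs_tensor p) = (\<Sum>(a, b)\<in>#p. f a b)"
proof -
  obtain P :: "'a \<Rightarrow> 'a" where P: "clinear P" "range P \<subseteq> S" "\<And>a. a \<in> S \<Longrightarrow> P a = a"
  proof -
    interpret vp: vector_space_pair "scaleC :: complex \<Rightarrow> 'a \<Rightarrow> 'a" "scaleC :: complex \<Rightarrow> 'a \<Rightarrow> 'a"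
      by unfold_locales
    obtain B where B: "B \<subseteq> S" "cvector.independent B" "S \<subseteq> cspan B"
      using cvector.maximal_independent_subset[of S] by metis
    have SB: "cspan B = S"
      using B S by (meson cvector.span_minimal subset_antisym)
    define P where "P = vp.construct B (\<lambda>x. x)"
    have lin: "clinear P" unfolding P_def by (rule vp.linear_construct[OF B(2)])
    have "range P = cspan ((\<lambda>x. x) ` B)" unfolding P_def by (rule vp.range_construct_eq_span[OF B(2)])
    then have "range P \<subseteq> S" using SB by simp
    moreover have "P a = a" if "a \<in> S" for a
    proof -
      have "P b = b" if "b \<in> B" for b
        unfolding P_def using vp.construct_basis[OF B(2) that] .
      moreover have "clinear (\<lambda>x::'a. x)" by (rule clinearI) simp_all
      ultimately show ?thesis
        using vp.linear_eq_on[OF lin, of "\<lambda>x. x" a B] that SB by auto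
    qed
    ultimately show thesis using that lin by blast
  qed
  define g where "g = (\<lambda>a b. f (P a) b)"
  have g: "balanced_on UNIV g"
    using f P(2) unfolding balanced_on_def g_def
    by (auto simp: clinear_add[OF P(1)] clinear_scale[OF P(1)] image_subset_iff)
  have fg: "(\<Sum>(a, b)\<in>#q. f a b) = (\<Sum>(a, b)\<in>#q. g a b)" if "fst ` set_mset q \<subseteq> S" for q
    using that by (intro arg_cong[of _ _ sum_mset] image_mset_cong) (auto simp: g_def P(3))
  define q where "q = (SOME q. abs_tensor q = abs_tensor p \<and> fst ` set_mset q \<subseteq> S)"
  have q: "abs_tensor q = abs_tensor p \<and> fst ` set_mset q \<subseteq> S"
    unfolding q_def by (rule someI[of _ p]) (simp add: p)
  then have "tensor_rel q p" by (simp add: tensor.abs_eq_iff)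
  then have "(\<Sum>(a, b)\<in>#q. g a b) = (\<Sum>(a, b)\<in>#p. g a b)" using g by (rule tensor_rel_balanced)
  then show ?thesis
    unfolding tensor_lift_on_def q_def[symmetric] using fg p q by auto
qed

lemma tensor_lift_on_pure [simp]:
  fixes f :: "'a::complex_vector \<Rightarrow> 'b::complex_vector \<Rightarrow> 'c::ab_group_add"
  assumes "csubspace S" "balanced_on S f" "a \<in> S"
  shows "tensor_lift_on S f (a \<otimes>\<^sub>t b) = f a b"
  using tensor_lift_on_eq[OF assms(1,2), of "{#(a, b)#}"] assms(3)
  by (simp add: pure_tensor.abs_eq)

definition tensor_map_on ::
  "'a::complex_vector set \<Rightarrow> ('a \<Rightarrow> 'c::complex_vector) \<Rightarrow> ('b::complex_vector \<Rightarrow> 'd::complex_vector) \<Rightarrow>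
    ('a, 'b) tensor \<Rightarrow> ('c, 'd) tensor"
  where "tensor_map_on S f g = tensor_lift_on S (\<lambda>a b. f a \<otimes>\<^sub>t g b)"

abbreviation tensor_map ::
  "('a::complex_vector \<Rightarrow> 'c::complex_vector) \<Rightarrow> ('b::complex_vector \<Rightarrow> 'd::complex_vector) \<Rightarrow>
    ('a, 'b) tensor \<Rightarrow> ('c, 'd) tensor"
  where "tensor_map \<equiv> tensor_map_on UNIV"

text \<open>Iterated tensor products are bracketed to the left.\<close>

definition tensor_assoc ::
  "('a::complex_vector, ('b::complex_vector, 'c::complex_vector) tensor) tensor \<Rightarrow> (('a, 'b) tensor, 'c) tensor"
  where "tensor_assoc = tensor_lift (\<lambda>a. tensor_lift (\<lambda>b c. (a \<otimes>\<^sub>t b) \<otimes>\<^sub>t c))"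

definition slice ::
  "('b::complex_vector \<Rightarrow> complex) \<Rightarrow> ('a::complex_vector, 'b) tensor \<Rightarrow> 'a"
  where "slice f = tensor_lift (\<lambda>a b. f b *\<^sub>C a)"


section \<open>Unital C*-algebras\<close>

record 'a star_algebra =
  amult :: "'a \<Rightarrow> 'a \<Rightarrow> 'a"  (infixl "\<odot>\<index>" 70)
  aone :: 'a  ("\<one>\<index>")
  astar :: "'a \<Rightarrow> 'a"

locale unital_star_algebra =
  fixes A :: "('a::complex_vector, 'm) star_algebra_scheme" (structure)
  assumes amult_assoc: "(a \<odot> b) \<odot> c = a \<odot> (b \<odot> c)"
    and amult_one_left: "\<one> \<odot> a = a"
    and amult_one_right: "a \<odot> \<one> = a"
    and amult_add_left: "(a + b) \<odot> c = a \<odot> c + b \<odot> c"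
    and amult_add_right: "a \<odot> (b + c) = a \<odot> b + a \<odot> c"
    and amult_scale_left: "(z *\<^sub>C a) \<odot> b = z *\<^sub>C (a \<odot> b)"
    and amult_scale_right: "a \<odot> (z *\<^sub>C b) = z *\<^sub>C (a \<odot> b)"
    and astar_astar: "astar A (astar A a) = a"
    and astar_mult: "astar A (a \<odot> b) = astar A b \<odot> astar A a"
    and astar_add: "astar A (a + b) = astar A a + astar A b"
    and astar_scale: "astar A (z *\<^sub>C a) = cnj z *\<^sub>C astar A a"

definition complete_wrt :: "'v::ab_group_add set \<Rightarrow> ('v \<Rightarrow> real) \<Rightarrow> bool"
  where "complete_wrt S n \<longleftrightarrow>
    (\<forall>f::nat \<Rightarrow> 'v. range f \<subseteq> S \<longrightarrow> (\<forall>e>0. \<exists>N. \<forall>i\<ge>N. \<forall>j\<ge>N. n (f i - f j) < e) \<longrightarrow>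
      (\<exists>l\<in>S. (\<lambda>i. n (f i - l)) \<longlonglongrightarrow> 0))"

definition is_cstar_norm :: "('a::complex_vector, 'm) star_algebra_scheme \<Rightarrow> ('a \<Rightarrow> real) \<Rightarrow> bool"
  where "is_cstar_norm A n \<longleftrightarrow>
    (\<forall>a. n a \<ge> 0) \<and> (\<forall>a. n a = 0 \<longleftrightarrow> a = 0) \<and>
    (\<forall>a b. n (a + b) \<le> n a + n b) \<and> (\<forall>z a. n (z *\<^sub>C a) = cmod z * n a) \<and>
    (\<forall>a b. n (a \<odot>\<^bsub>A\<^esub> b) \<le> n a * n b) \<and> (\<forall>a. n (astar A a \<odot>\<^bsub>A\<^esub> a) = (n a)\<^sup>2) \<and>
    complete_wrt UNIV n"

text \<open>
  A *-algebra carries at most one complete C*-norm, so being a C*-algebra is a property of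
  the *-algebra and the norm is not recorded as data. This applies in particular to
  \<open>A \<otimes> H\<^sup>0\<close> (algebraic tensor product, \<open>H\<^sup>0\<close> finite dimensional) and to the twisted
  crossed product.
\<close>

locale cstar_algebra = unital_star_algebra +
  assumes ex_cstar_norm: "\<exists>n. is_cstar_norm A n"

definition cstar_norm :: "('a::complex_vector, 'm) star_algebra_scheme \<Rightarrow> 'a \<Rightarrow> real"
  where "cstar_norm A = (SOME n. is_cstar_norm A n)"

definition aspectrum :: "('a::complex_vector, 'm) star_algebra_scheme \<Rightarrow> 'a \<Rightarrow> complex set"
  where "aspectrum A a =
    {z. \<not> (\<exists>b. b \<odot>\<^bsub>A\<^esub> (z *\<^sub>C \<one>\<^bsub>A\<^esub> - a) = \<one>\<^bsub>A\<^esub> \<and> (z *\<^sub>C \<one>\<^bsub>A\<^esub> - a) \<odot>\<^bsub>A\<^esub> b = \<one>\<^bsub>A\<^esub>)}"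

definition apositive :: "('a::complex_vector, 'm) star_algebra_scheme \<Rightarrow> 'a \<Rightarrow> bool"
  where "apositive A a \<longleftrightarrow> astar A a = a \<and> (\<forall>z\<in>aspectrum A a. z \<in> \<real> \<and> Re z \<ge> 0)"

definition aunitary :: "('a::complex_vector, 'm) star_algebra_scheme \<Rightarrow> 'a \<Rightarrow> bool"
  where "aunitary A a \<longleftrightarrow> astar A a \<odot>\<^bsub>A\<^esub> a = \<one>\<^bsub>A\<^esub> \<and> a \<odot>\<^bsub>A\<^esub> astar A a = \<one>\<^bsub>A\<^esub>"

definition unital_star_hom ::
  "('a::complex_vector, 'm) star_algebra_scheme \<Rightarrow> ('b::complex_vector, 'n) star_algebra_scheme \<Rightarrow>
    ('a \<Rightarrow> 'b) \<Rightarrow> bool"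
  where "unital_star_hom A B f \<longleftrightarrow> clinear f \<and> f \<one>\<^bsub>A\<^esub> = \<one>\<^bsub>B\<^esub> \<and>
    (\<forall>a a'. f (a \<odot>\<^bsub>A\<^esub> a') = f a \<odot>\<^bsub>B\<^esub> f a') \<and> (\<forall>a. f (astar A a) = astar B (f a))"

definition tensor_algebra ::
  "('a::complex_vector, 'm) star_algebra_scheme \<Rightarrow> ('b::complex_vector, 'n) star_algebra_scheme \<Rightarrow>
    ('a, 'b) tensor star_algebra"
  where "tensor_algebra A B = \<lparr>
    amult = (\<lambda>s t. tensor_lift (\<lambda>a b. tensor_lift (\<lambda>a' b'. (a \<odot>\<^bsub>A\<^esub> a') \<otimes>\<^sub>t (b \<odot>\<^bsub>B\<^esub> b')) t) s),
    aone = \<one>\<^bsub>A\<^esub> \<otimes>\<^sub>t \<one>\<^bsub>B\<^esub>,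
    astar = tensor_lift (\<lambda>a b. astar A a \<otimes>\<^sub>t astar B b)\<rparr>"

definition complex_star_algebra :: "complex star_algebra"
  where "complex_star_algebra = \<lparr>amult = (*), aone = 1, astar = cnj\<rparr>"

definition relative_commutant :: "('a::complex_vector, 'm) star_algebra_scheme \<Rightarrow> 'a set \<Rightarrow> 'a set"
  where "relative_commutant C A = {c. \<forall>a\<in>A. a \<odot>\<^bsub>C\<^esub> c = c \<odot>\<^bsub>C\<^esub> a}"


section \<open>Finite dimensional C*-Hopf algebras and their duals\<close>

record (overloaded) ('h::complex_vector) hopf_algebra = "'h star_algebra" +
  comult :: "'h \<Rightarrow> ('h, 'h) tensor"
  counit :: "'h \<Rightarrow> complex"
  antipode :: "'h \<Rightarrow> 'h"

text \<open>Sweedler notation: \<open>sweedler2 H f h\<close> is \<open>f h\<^sub>(\<^sub>1\<^sub>) h\<^sub>(\<^sub>2\<^sub>)\<close>, etc.\<close>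

definition sweedler2 ::
  "'h::complex_vector hopf_algebra \<Rightarrow> ('h \<Rightarrow> 'h \<Rightarrow> 'c::comm_monoid_add) \<Rightarrow> 'h \<Rightarrow> 'c"
  where "sweedler2 H f h = tensor_lift f (comult H h)"

definition sweedler3 ::
  "'h::complex_vector hopf_algebra \<Rightarrow> ('h \<Rightarrow> 'h \<Rightarrow> 'h \<Rightarrow> 'c::comm_monoid_add) \<Rightarrow> 'h \<Rightarrow> 'c"
  where "sweedler3 H f = sweedler2 H (\<lambda>k h3. sweedler2 H (\<lambda>h1 h2. f h1 h2 h3) k)"

definition sweedler4 ::
  "'h::complex_vector hopf_algebra \<Rightarrow> ('h \<Rightarrow> 'h \<Rightarrow> 'h \<Rightarrow> 'h \<Rightarrow> 'c::comm_monoid_add) \<Rightarrow> 'h \<Rightarrow> 'c"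
  where "sweedler4 H f = sweedler2 H (\<lambda>k h4. sweedler3 H (\<lambda>h1 h2 h3. f h1 h2 h3 h4) k)"

locale cstar_hopf_algebra = cstar_algebra H
  for H :: "'h::complex_vector hopf_algebra" (structure) +
  assumes finite_dim: "finite_dim TYPE('h)"
    and comult_hom: "unital_star_hom H (tensor_algebra H H) (comult H)"
    and coassoc: "tensor_assoc (tensor_map id (comult H) (comult H h)) = tensor_map (comult H) id (comult H h)"
    and counit_hom: "unital_star_hom H complex_star_algebra (counit H)"
    and counit_left: "sweedler2 H (\<lambda>h1 h2. counit H h1 *\<^sub>C h2) h = h"
    and counit_right: "sweedler2 H (\<lambda>h1 h2. counit H h2 *\<^sub>C h1) h = h"
    and antipode_linear: "clinear (antipode H)"
    and antipode_left: "sweedler2 H (\<lambda>h1 h2. antipode H h1 \<odot> h2) h = counit H h *\<^sub>C \<one>"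
    and antipode_right: "sweedler2 H (\<lambda>h1 h2. h1 \<odot> antipode H h2) h = counit H h *\<^sub>C \<one>"

typedef (overloaded) 'h dual = "{f :: 'h::complex_vector \<Rightarrow> complex. clinear f}"
  morphisms dual_apply Abs_dual
  by (rule exI[of _ "\<lambda>_. 0"]) (auto intro!: clinearI simp: scaleC_complex_def)

setup_lifting type_definition_dual

instantiation dual :: (complex_vector) complex_vector
begin

lift_definition zero_dual :: "'a dual" is "\<lambda>_. 0"
  by (rule clinearI) (simp_all add: scaleC_complex_def)

lift_definition plus_dual :: "'a dual \<Rightarrow> 'a dual \<Rightarrow> 'a dual" is "\<lambda>f g x. f x + g x"
  by (rule clinearI) (simp_all add: clinear_add clinear_scale scaleC_add_right)

lift_definition uminus_dual :: "'a dual \<Rightarrow> 'a dual" is "\<lambda>f x. - f x"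
  by (rule clinearI) (simp_all add: clinear_add clinear_scale scaleC_complex_def)

lift_definition minus_dual :: "'a dual \<Rightarrow> 'a dual \<Rightarrow> 'a dual" is "\<lambda>f g x. f x - g x"
  by (rule clinearI) (simp_all add: clinear_add clinear_scale scaleC_complex_def algebra_simps)

lift_definition scaleC_dual :: "complex \<Rightarrow> 'a dual \<Rightarrow> 'a dual" is "\<lambda>c f x. c * f x"
  by (rule clinearI) (simp_all add: clinear_add clinear_scale scaleC_complex_def algebra_simps)

instance by standard (transfer, simp add: fun_eq_iff algebra_simps)+

end

text \<open>
  The pairing of \<open>H\<^sup>0 \<otimes> H\<^sup>0\<close> with \<open>H \<otimes> H\<close>; it is nondegenerate and perfect for
  finite dimensional \<open>H\<close>, which makes the definite description in \<open>dual_hopf\<close> meaningful.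
\<close>

definition dual_pairing2 :: "('h::complex_vector dual, 'h dual) tensor \<Rightarrow> 'h \<Rightarrow> 'h \<Rightarrow> complex"
  where "dual_pairing2 t h l = tensor_lift (\<lambda>\<phi> \<psi>. dual_apply \<phi> h * dual_apply \<psi> l) t"

definition dual_hopf :: "'h::complex_vector hopf_algebra \<Rightarrow> 'h dual hopf_algebra"
  where "dual_hopf H = \<lparr>
    amult = (\<lambda>\<phi> \<psi>. Abs_dual (sweedler2 H (\<lambda>h1 h2. dual_apply \<phi> h1 * dual_apply \<psi> h2))),
    aone = Abs_dual (counit H),
    astar = (\<lambda>\<phi>. Abs_dual (\<lambda>h. cnj (dual_apply \<phi> (astar H (antipode H h))))),
    comult = (\<lambda>\<phi>. THE t. \<forall>h l. dual_pairing2 t h l = dual_apply \<phi> (h \<odot>\<^bsub>H\<^esub> l)),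
    counit = (\<lambda>\<phi>. dual_apply \<phi> \<one>\<^bsub>H\<^esub>),
    antipode = (\<lambda>\<phi>. Abs_dual (\<lambda>h. dual_apply \<phi> (antipode H h)))\<rparr>"

definition cstar_hopf_automorphism :: "'h::complex_vector hopf_algebra \<Rightarrow> ('h \<Rightarrow> 'h) \<Rightarrow> bool"
  where "cstar_hopf_automorphism H f \<longleftrightarrow> bij f \<and> unital_star_hom H H f \<and>
    (\<forall>h. comult H (f h) = tensor_map f f (comult H h)) \<and>
    (\<forall>h. antipode H (f h) = f (antipode H h)) \<and>
    (\<forall>h. counit H (f h) = counit H h)"


section \<open>Twisted coactions and twisted crossed products\<close>

text \<open>\<open>coefn H A\<close> is \<open>A\<close> tensored with \<open>n\<close> copies of \<open>H\<^sup>0\<close>.\<close>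

abbreviation coef1 where "coef1 H A \<equiv> tensor_algebra A (dual_hopf H)"
abbreviation coef2 where "coef2 H A \<equiv> tensor_algebra (coef1 H A) (dual_hopf H)"
abbreviation coef3 where "coef3 H A \<equiv> tensor_algebra (coef2 H A) (dual_hopf H)"

text \<open>\<open>id \<otimes> \<Delta>\<^sup>0\<close>, where \<open>id\<close> acts on all tensor factors but the last.\<close>

definition comult_last ::
  "'h::complex_vector hopf_algebra \<Rightarrow> ('a::complex_vector, 'h dual) tensor \<Rightarrow> (('a, 'h dual) tensor, 'h dual) tensor"
  where "comult_last H t = tensor_assoc (tensor_map id (comult (dual_hopf H)) t)"

definition weak_coaction ::
  "'h::complex_vector hopf_algebra \<Rightarrow> ('a::complex_vector, 'm) star_algebra_scheme \<Rightarrow>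
    ('a \<Rightarrow> ('a, 'h dual) tensor) \<Rightarrow> bool"
  where "weak_coaction H A \<rho> \<longleftrightarrow> unital_star_hom A (coef1 H A) \<rho> \<and>
    (\<forall>a. slice (counit (dual_hopf H)) (\<rho> a) = a)"

text \<open>\<open>act \<rho> h x\<close> is \<open>h \<cdot> x\<close>, and \<open>hat u h l\<close> is \<open>(id \<otimes> h \<otimes> l)(u)\<close>.\<close>

definition act ::
  "('a \<Rightarrow> ('a::complex_vector, 'h::complex_vector dual) tensor) \<Rightarrow> 'h \<Rightarrow> 'a \<Rightarrow> 'a"
  where "act \<rho> h x = slice (\<lambda>\<phi>. dual_apply \<phi> h) (\<rho> x)"

definition hat ::
  "(('a::complex_vector, 'h::complex_vector dual) tensor, 'h dual) tensor \<Rightarrow> 'h \<Rightarrow> 'h \<Rightarrow> 'a"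
  where "hat u h l = slice (\<lambda>\<phi>. dual_apply \<phi> h) (slice (\<lambda>\<phi>. dual_apply \<phi> l) u)"

locale twisted_coaction =
  hopf: cstar_hopf_algebra H + alg: cstar_algebra A
  for H :: "'h::complex_vector hopf_algebra"
    and A :: "('a::complex_vector, 'm) star_algebra_scheme"
    and \<rho> :: "'a \<Rightarrow> ('a, 'h dual) tensor"
    and u :: "(('a, 'h dual) tensor, 'h dual) tensor" +
  assumes weak: "weak_coaction H A \<rho>"
    and unitary: "aunitary (coef2 H A) u"
    and twisted_coassoc:
      "tensor_map \<rho> id (\<rho> a) = u \<odot>\<^bsub>coef2 H A\<^esub> comult_last H (\<rho> a) \<odot>\<^bsub>coef2 H A\<^esub> astar (coef2 H A) u"
    and cocycle:
      "(u \<otimes>\<^sub>t \<one>\<^bsub>dual_hopf H\<^esub>) \<odot>\<^bsub>coef3 H A\<^esub> tensor_map (comult_last H) id u =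
       tensor_map (tensor_map \<rho> id) id u \<odot>\<^bsub>coef3 H A\<^esub> comult_last H u"
    and normalized_right: "hat u h \<one>\<^bsub>H\<^esub> = counit H h *\<^sub>C \<one>\<^bsub>A\<^esub>"
    and normalized_left: "hat u \<one>\<^bsub>H\<^esub> h = counit H h *\<^sub>C \<one>\<^bsub>A\<^esub>"

definition crossed_product ::
  "'h::complex_vector hopf_algebra \<Rightarrow> ('a::complex_vector, 'm) star_algebra_scheme \<Rightarrow>
    ('a \<Rightarrow> ('a, 'h dual) tensor) \<Rightarrow> (('a, 'h dual) tensor, 'h dual) tensor \<Rightarrow> ('a, 'h) tensor star_algebra"
  where "crossed_product H A \<rho> u = \<lparr>
    amult = (\<lambda>s t. tensor_lift (\<lambda>x h. tensor_lift (\<lambda>y l.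
      sweedler3 H (\<lambda>h1 h2 h3. sweedler2 H (\<lambda>l1 l2.
        (x \<odot>\<^bsub>A\<^esub> act \<rho> h1 y \<odot>\<^bsub>A\<^esub> hat u h2 l1) \<otimes>\<^sub>t (h3 \<odot>\<^bsub>H\<^esub> l2)) l) h) t) s),
    aone = \<one>\<^bsub>A\<^esub> \<otimes>\<^sub>t \<one>\<^bsub>H\<^esub>,
    astar = tensor_lift (\<lambda>x h. sweedler4 H (\<lambda>h1 h2 h3 h4.
      (astar A (hat u (antipode H h2) h1) \<odot>\<^bsub>A\<^esub> act \<rho> (astar H h3) (astar A x)) \<otimes>\<^sub>t astar H h4) h)\<rparr>"

definition coefficient_algebra ::
  "'h::complex_vector hopf_algebra \<Rightarrow> ('a::complex_vector, 'h) tensor set"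
  where "coefficient_algebra H = range (\<lambda>a. a \<otimes>\<^sub>t \<one>\<^bsub>H\<^esub>)"


section \<open>Equivalence bimodules\<close>

record ('a, 'b, 'x) bimodule =
  bcarrier :: "'x set"
  lact :: "'a \<Rightarrow> 'x \<Rightarrow> 'x"
  ract :: "'x \<Rightarrow> 'b \<Rightarrow> 'x"
  lip :: "'x \<Rightarrow> 'x \<Rightarrow> 'a"
  rip :: "'x \<Rightarrow> 'x \<Rightarrow> 'b"

definition cstar_dense :: "('a::complex_vector, 'm) star_algebra_scheme \<Rightarrow> 'a set \<Rightarrow> bool"
  where "cstar_dense A S \<longleftrightarrow> (\<forall>a. \<forall>e>0. \<exists>s\<in>S. cstar_norm A (a - s) < e)"

locale equivalence_bimodule =
  left: cstar_algebra A + right: cstar_algebra B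
  for A :: "('a::complex_vector, 'm) star_algebra_scheme"
    and B :: "('b::complex_vector, 'n) star_algebra_scheme"
    and X :: "('a, 'b, 'x::complex_vector) bimodule" +
  assumes subspace: "csubspace (bcarrier X)"
    and lact_closed: "x \<in> bcarrier X \<Longrightarrow> lact X a x \<in> bcarrier X"
    and lact_add_left: "x \<in> bcarrier X \<Longrightarrow> lact X (a + a') x = lact X a x + lact X a' x"
    and lact_add_right: "x \<in> bcarrier X \<Longrightarrow> y \<in> bcarrier X \<Longrightarrow> lact X a (x + y) = lact X a x + lact X a y"
    and lact_scale_left: "x \<in> bcarrier X \<Longrightarrow> lact X (z *\<^sub>C a) x = z *\<^sub>C lact X a x"
    and lact_scale_right: "x \<in> bcarrier X \<Longrightarrow> lact X a (z *\<^sub>C x) = z *\<^sub>C lact X a x"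
    and lact_mult: "x \<in> bcarrier X \<Longrightarrow> lact X (a \<odot>\<^bsub>A\<^esub> a') x = lact X a (lact X a' x)"
    and lact_one: "x \<in> bcarrier X \<Longrightarrow> lact X \<one>\<^bsub>A\<^esub> x = x"
    and ract_closed: "x \<in> bcarrier X \<Longrightarrow> ract X x b \<in> bcarrier X"
    and ract_add_left: "x \<in> bcarrier X \<Longrightarrow> y \<in> bcarrier X \<Longrightarrow> ract X (x + y) b = ract X x b + ract X y b"
    and ract_add_right: "x \<in> bcarrier X \<Longrightarrow> ract X x (b + b') = ract X x b + ract X x b'"
    and ract_scale_left: "x \<in> bcarrier X \<Longrightarrow> ract X (z *\<^sub>C x) b = z *\<^sub>C ract X x b"
    and ract_scale_right: "x \<in> bcarrier X \<Longrightarrow> ract X x (z *\<^sub>C b) = z *\<^sub>C ract X x b"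
    and ract_mult: "x \<in> bcarrier X \<Longrightarrow> ract X x (b \<odot>\<^bsub>B\<^esub> b') = ract X (ract X x b) b'"
    and ract_one: "x \<in> bcarrier X \<Longrightarrow> ract X x \<one>\<^bsub>B\<^esub> = x"
    and lact_ract: "x \<in> bcarrier X \<Longrightarrow> ract X (lact X a x) b = lact X a (ract X x b)"
    and lip_add: "x \<in> bcarrier X \<Longrightarrow> y \<in> bcarrier X \<Longrightarrow> w \<in> bcarrier X \<Longrightarrow>
      lip X (x + y) w = lip X x w + lip X y w"
    and lip_scale: "x \<in> bcarrier X \<Longrightarrow> y \<in> bcarrier X \<Longrightarrow> lip X (z *\<^sub>C x) y = z *\<^sub>C lip X x y"
    and lip_lact: "x \<in> bcarrier X \<Longrightarrow> y \<in> bcarrier X \<Longrightarrow> lip X (lact X a x) y = a \<odot>\<^bsub>A\<^esub> lip X x y"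
    and lip_star: "x \<in> bcarrier X \<Longrightarrow> y \<in> bcarrier X \<Longrightarrow> astar A (lip X x y) = lip X y x"
    and lip_positive: "x \<in> bcarrier X \<Longrightarrow> apositive A (lip X x x)"
    and lip_definite: "x \<in> bcarrier X \<Longrightarrow> lip X x x = 0 \<Longrightarrow> x = 0"
    and lip_full: "cstar_dense A (cspan {lip X x y | x y. x \<in> bcarrier X \<and> y \<in> bcarrier X})"
    and lip_complete: "complete_wrt (bcarrier X) (\<lambda>x. sqrt (cstar_norm A (lip X x x)))"
    and rip_add: "x \<in> bcarrier X \<Longrightarrow> y \<in> bcarrier X \<Longrightarrow> w \<in> bcarrier X \<Longrightarrow>
      rip X w (x + y) = rip X w x + rip X w y"
    and rip_scale: "x \<in> bcarrier X \<Longrightarrow> y \<in> bcarrier X \<Longrightarrow> rip X x (z *\<^sub>C y) = z *\<^sub>C rip X x y"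
    and rip_ract: "x \<in> bcarrier X \<Longrightarrow> y \<in> bcarrier X \<Longrightarrow> rip X x (ract X y b) = rip X x y \<odot>\<^bsub>B\<^esub> b"
    and rip_star: "x \<in> bcarrier X \<Longrightarrow> y \<in> bcarrier X \<Longrightarrow> astar B (rip X x y) = rip X y x"
    and rip_positive: "x \<in> bcarrier X \<Longrightarrow> apositive B (rip X x x)"
    and rip_definite: "x \<in> bcarrier X \<Longrightarrow> rip X x x = 0 \<Longrightarrow> x = 0"
    and rip_full: "cstar_dense B (cspan {rip X x y | x y. x \<in> bcarrier X \<and> y \<in> bcarrier X})"
    and rip_complete: "complete_wrt (bcarrier X) (\<lambda>x. sqrt (cstar_norm B (rip X x x)))"
    and rip_lact: "x \<in> bcarrier X \<Longrightarrow> y \<in> bcarrier X \<Longrightarrow>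
      rip X (lact X a x) y = rip X x (lact X (astar A a) y)"
    and lip_ract: "x \<in> bcarrier X \<Longrightarrow> y \<in> bcarrier X \<Longrightarrow>
      lip X (ract X x b) y = lip X x (ract X y (astar B b))"
    and imprimitivity: "x \<in> bcarrier X \<Longrightarrow> y \<in> bcarrier X \<Longrightarrow> w \<in> bcarrier X \<Longrightarrow>
      lact X (lip X x y) w = ract X x (rip X y w)"

text \<open>
  The exterior tensor product of \<open>X\<close> with the \<open>K\<close>-\<open>K\<close>-equivalence bimodule \<open>K\<close>. Tensors are
  expanded within the carrier of \<open>X\<close>, since the operations of \<open>X\<close> are unspecified outside it.
\<close>

definition ext_tensor ::
  "('a::complex_vector, 'b::complex_vector, 'x::complex_vector) bimodule \<Rightarrow>
    ('k::complex_vector, 'm) star_algebra_scheme \<Rightarrow>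
    (('a, 'k) tensor, ('b, 'k) tensor, ('x, 'k) tensor) bimodule"
  where "ext_tensor X K = \<lparr>
    bcarrier = cspan {x \<otimes>\<^sub>t k | x k. x \<in> bcarrier X},
    lact = (\<lambda>s t. tensor_lift (\<lambda>a k. tensor_lift_on (bcarrier X)
      (\<lambda>x l. lact X a x \<otimes>\<^sub>t (k \<odot>\<^bsub>K\<^esub> l)) t) s),
    ract = (\<lambda>t s. tensor_lift_on (bcarrier X) (\<lambda>x l. tensor_lift
      (\<lambda>b k. ract X x b \<otimes>\<^sub>t (l \<odot>\<^bsub>K\<^esub> k)) s) t),
    lip = (\<lambda>s t. tensor_lift_on (bcarrier X) (\<lambda>x k. tensor_lift_on (bcarrier X)
      (\<lambda>y l. lip X x y \<otimes>\<^sub>t (k \<odot>\<^bsub>K\<^esub> astar K l)) t) s),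
    rip = (\<lambda>s t. tensor_lift_on (bcarrier X) (\<lambda>x k. tensor_lift_on (bcarrier X)
      (\<lambda>y l. rip X x y \<otimes>\<^sub>t (astar K k \<odot>\<^bsub>K\<^esub> l)) t) s)\<rparr>"


section \<open>Strong Morita equivalence\<close>

text \<open>Here \<open>A\<close> and \<open>B\<close> are the unital C*-subalgebras of \<open>C\<close> and \<open>D\<close>, given as subsets.\<close>

locale inclusions_strongly_morita_equivalent =
  equivalence_bimodule C D Y
  for C :: "('c::complex_vector, 'm) star_algebra_scheme" and A :: "'c set"
    and D :: "('d::complex_vector, 'n) star_algebra_scheme" and B :: "'d set"
    and Y :: "('c, 'd, 'y::complex_vector) bimodule" and X :: "'y set" +
  assumes X_subset: "X \<subseteq> bcarrier Y"
    and X_subspace: "csubspace X"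
    and X_closed: "range f \<subseteq> X \<Longrightarrow> y \<in> bcarrier Y \<Longrightarrow>
      (\<lambda>i::nat. sqrt (cstar_norm D (rip Y (f i - y) (f i - y)))) \<longlonglongrightarrow> 0 \<Longrightarrow> y \<in> X"
    and X_lact: "a \<in> A \<Longrightarrow> x \<in> X \<Longrightarrow> lact Y a x \<in> X"
    and X_ract: "b \<in> B \<Longrightarrow> x \<in> X \<Longrightarrow> ract Y x b \<in> X"
    and X_lip_span: "cspan {lip Y x y | x y. x \<in> X \<and> y \<in> X} = A"
    and X_rip_span: "cspan {rip Y x y | x y. x \<in> X \<and> y \<in> X} = B"
    and YX_lip_span: "cspan {lip Y y x | y x. y \<in> bcarrier Y \<and> x \<in> X} = UNIV"
    and YX_rip_span: "cspan {rip Y y x | y x. y \<in> bcarrier Y \<and> x \<in> X} = UNIV"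

abbreviation ext1 where "ext1 H X \<equiv> ext_tensor X (dual_hopf H)"
abbreviation ext2 where "ext2 H X \<equiv> ext_tensor (ext1 H X) (dual_hopf H)"

locale coactions_strongly_morita_equivalent =
  left: twisted_coaction H A \<rho> u + right: twisted_coaction H B \<sigma> v + equivalence_bimodule A B X
  for H :: "'h::complex_vector hopf_algebra"
    and A :: "('a::complex_vector, 'm) star_algebra_scheme"
    and \<rho> :: "'a \<Rightarrow> ('a, 'h dual) tensor" and u :: "(('a, 'h dual) tensor, 'h dual) tensor"
    and B :: "('b::complex_vector, 'n) star_algebra_scheme"
    and \<sigma> :: "'b \<Rightarrow> ('b, 'h dual) tensor" and v :: "(('b, 'h dual) tensor, 'h dual) tensor"
    and X :: "('a, 'b, 'x::complex_vector) bimodule"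
    and \<nu> :: "'x \<Rightarrow> ('x, 'h dual) tensor" +
  assumes \<nu>_closed: "x \<in> bcarrier X \<Longrightarrow> \<nu> x \<in> bcarrier (ext1 H X)"
    and \<nu>_add: "x \<in> bcarrier X \<Longrightarrow> y \<in> bcarrier X \<Longrightarrow> \<nu> (x + y) = \<nu> x + \<nu> y"
    and \<nu>_scale: "x \<in> bcarrier X \<Longrightarrow> \<nu> (z *\<^sub>C x) = z *\<^sub>C \<nu> x"
    and \<nu>_lact: "x \<in> bcarrier X \<Longrightarrow> \<nu> (lact X a x) = lact (ext1 H X) (\<rho> a) (\<nu> x)"
    and \<nu>_ract: "x \<in> bcarrier X \<Longrightarrow> \<nu> (ract X x b) = ract (ext1 H X) (\<nu> x) (\<sigma> b)"
    and \<nu>_lip: "x \<in> bcarrier X \<Longrightarrow> y \<in> bcarrier X \<Longrightarrow> \<rho> (lip X x y) = lip (ext1 H X) (\<nu> x) (\<nu> y)"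
    and \<nu>_rip: "x \<in> bcarrier X \<Longrightarrow> y \<in> bcarrier X \<Longrightarrow> \<sigma> (rip X x y) = rip (ext1 H X) (\<nu> x) (\<nu> y)"
    and \<nu>_counit: "x \<in> bcarrier X \<Longrightarrow> slice (counit (dual_hopf H)) (\<nu> x) = x"
    and \<nu>_twisted: "x \<in> bcarrier X \<Longrightarrow>
      tensor_map_on (bcarrier X) \<nu> id (\<nu> x) =
        ract (ext2 H X) (lact (ext2 H X) u (comult_last H (\<nu> x))) (astar (coef2 H B) v)"

end

theory Submission
  imports Defs "HOL-Computational_Algebra.Fundamental_Theorem_Algebra"
begin

text \<open>
  The elements \<open>1 \<rtimes> h\<close> of the crossed product assemble to a unitary \<open>V\<close> in \<open>C \<otimes> H\<^sup>0\<close> that implements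
  \<open>\<rho>\<close> and satisfies \<open>V\<^sub>1\<^sub>2 V\<^sub>1\<^sub>3 = u (id \<otimes> \<Delta>\<^sup>0)(V)\<close>. The dual action of \<open>H\<^sup>0\<close> on \<open>D\<close>
  is linear over \<open>B\<close>, hence is carried by \<open>X\<close> to an action \<open>\<alpha>\<close> of \<open>H\<^sup>0\<close> on \<open>C\<close> that is linear over \<open>A\<close>.
  Then the coefficients of \<open>V\<^sup>* \<alpha>\<^sub>\<psi>(V)\<close> commute with \<open>A\<close>, so \<open>\<alpha>\<^sub>\<psi>(V) = V (1 \<otimes> \<theta>(\<psi>))\<close> by the triviality
  of the relative commutant, and the properties of an action make \<open>\<theta>\<close> an automorphism of \<open>H\<^sup>0\<close>.
  If \<open>W\<close> is the image under \<open>id \<otimes> \<theta>\<close> of the unitary in \<open>D \<otimes> H\<^sup>0\<close> corresponding to \<open>V\<close>, then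
  \<open>\<nu>(x) = V (x \<otimes> 1) W\<^sup>*\<close> maps \<open>X\<close> to \<open>X \<otimes> H\<^sup>0\<close> because the two actions cancel, and the relations
  for \<open>V\<close> and \<open>W\<close> become the axioms for \<open>\<nu>\<close>.
\<close>

section \<open>Linear maps and tensors\<close>

text \<open>The axioms of \<open>cstar_hopf_algebra\<close> do not relate the antipode to the
  involution, but the involutions of H^0 and of the crossed product are written with S. Hence S^2 =
  id has to be derived from the C*-structure of H; every compatibility of the dual action with
  adjoints rests on it. The action \<alpha> is given by a finite formula, because the inner products
  over X span A and B without closure, so that the units are finite sums of them. Compatibility of
  \<theta> with S and with adjoints comes from uniqueness of convolution inverses, and the two
  actions cancel because V contributes \<theta>(\<psi>_1), the adjoint of W contributes
  \<theta>(S(\<psi>_2)), and \<psi>_1 S(\<psi>_2) sums to the counit. The analytic obstacle is that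
  X must be an equivalence bimodule for the norms of A and B themselves: the two norms on X must
  agree, and A and B must lie isometrically in C and D. Both facts rest on one contractivity
  estimate, proved by a fixed point iteration for a square root instead of functional
  calculus.\<close>

lemma clinear_zero: "clinear f \<Longrightarrow> f 0 = 0"
  using clinear_scale[of f 0 0] by simp

lemma clinear_minus: "clinear f \<Longrightarrow> f (- x) = - f x"
  using clinear_add[of f x "-x"] clinear_zero[of f] by (simp add: eq_neg_iff_add_eq_0 add.commute)

lemma clinear_diff: "clinear f \<Longrightarrow> f (x - y) = f x - f y"
  using clinear_add[of f x "-y"] clinear_minus[of f y] by simp

lemma clinear_sum: "clinear f \<Longrightarrow> f (sum g I) = (\<Sum>i\<in>I. f (g i))"
  by (induction I rule: infinite_finite_induct) (simp_all add: clinear_zero clinear_add)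

lemmas clinear_simps = clinear_add clinear_scale clinear_zero clinear_minus clinear_diff clinear_sum

lemma clinear_id [simp]: "clinear id" "clinear (\<lambda>x. x)"
  by (simp_all add: clinearI)

lemma clinear_compose: "clinear f \<Longrightarrow> clinear g \<Longrightarrow> clinear (\<lambda>x. f (g x))"
  by (rule clinearI) (simp_all add: clinear_simps)

lemma clinear_scaleC: "clinear ((*\<^sub>C) c)" and clinear_scaleC_left: "clinear (\<lambda>c. c *\<^sub>C x)"
  by (rule clinearI; simp add: scaleC_add_right scaleC_add_left scaleC_scaleC scaleC_complex_def mult.commute)+

lemma clinear_sumI: "(\<And>i. i \<in> I \<Longrightarrow> clinear (f i)) \<Longrightarrow> clinear (\<lambda>x. \<Sum>i\<in>I. f i x)"
  by (rule clinearI) (simp_all add: clinear_simps sum.distrib cvector.scale_sum_right)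

definition cbilinear :: "('a::complex_vector \<Rightarrow> 'b::complex_vector \<Rightarrow> 'c::complex_vector) \<Rightarrow> bool"
  where "cbilinear f \<longleftrightarrow> (\<forall>b. clinear (\<lambda>a. f a b)) \<and> (\<forall>a. clinear (f a))"

lemma cbilinearI:
  assumes "\<And>x y b. f (x + y) b = f x b + f y b" "\<And>c x b. f (c *\<^sub>C x) b = c *\<^sub>C f x b"
    and "\<And>a x y. f a (x + y) = f a x + f a y" "\<And>a c x. f a (c *\<^sub>C x) = c *\<^sub>C f a x"
  shows "cbilinear f"
  using assms unfolding cbilinear_def by (auto intro: clinearI)

lemma cbilinear_left: "cbilinear f \<Longrightarrow> clinear (\<lambda>a. f a b)"
  and cbilinear_right: "cbilinear f \<Longrightarrow> clinear (f a)"
  by (simp_all add: cbilinear_def)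

lemma cbilinear_left_simps:
  assumes "cbilinear f"
  shows "f (x + y) b = f x b + f y b" "f (c *\<^sub>C x) b = c *\<^sub>C f x b" "f 0 b = 0" "f (- x) b = - f x b"
    "f (x - y) b = f x b - f y b" "f (sum g I) b = (\<Sum>i\<in>I. f (g i) b)"
  using clinear_simps[OF cbilinear_left[OF assms, of b]] by auto

lemma cbilinear_right_simps:
  assumes "cbilinear f"
  shows "f a (x + y) = f a x + f a y" "f a (c *\<^sub>C x) = c *\<^sub>C f a x" "f a 0 = 0" "f a (- x) = - f a x"
    "f a (x - y) = f a x - f a y" "f a (sum g I) = (\<Sum>i\<in>I. f a (g i))"
  using clinear_simps[OF cbilinear_right[OF assms, of a]] by auto

lemmas cbilinear_simps = cbilinear_left_simps cbilinear_right_simps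

lemma cbilinear_balanced: "cbilinear f \<Longrightarrow> balanced_on S f"
  unfolding balanced_on_def by (auto simp: cbilinear_simps)

lemma cbilinear_compose:
  "cbilinear f \<Longrightarrow> clinear g \<Longrightarrow> clinear h \<Longrightarrow> cbilinear (\<lambda>x y. f (g x) (h y))"
  "cbilinear f \<Longrightarrow> clinear k \<Longrightarrow> cbilinear (\<lambda>x y. k (f x y))"
  "cbilinear f \<Longrightarrow> cbilinear (\<lambda>x y. f y x)"
  by (auto intro!: cbilinearI simp: clinear_simps cbilinear_simps)

section \<open>Elementary tensors and induction over tensors\<close>

lemma pure_tensor_add_left: "(a + a') \<otimes>\<^sub>t b = a \<otimes>\<^sub>t b + a' \<otimes>\<^sub>t b"
  by transfer (use tensor_rel.add_left in \<open>simp add: add_mset_commute\<close>)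

lemma pure_tensor_add_right: "a \<otimes>\<^sub>t (b + b') = a \<otimes>\<^sub>t b + a \<otimes>\<^sub>t b'"
  by transfer (use tensor_rel.add_right in \<open>simp add: add_mset_commute\<close>)

lemma pure_tensor_scale_left: "(c *\<^sub>C a) \<otimes>\<^sub>t b = c *\<^sub>C (a \<otimes>\<^sub>t b)"
  by transfer (simp add: tensor_rel.refl)

lemma pure_tensor_scale_right: "a \<otimes>\<^sub>t (c *\<^sub>C b) = c *\<^sub>C (a \<otimes>\<^sub>t b)"
proof -
  have "a \<otimes>\<^sub>t (c *\<^sub>C b) = (c *\<^sub>C a) \<otimes>\<^sub>t b"
    by transfer (rule tensor_rel.sym[OF tensor_rel.scale])
  then show ?thesis by (simp add: pure_tensor_scale_left)
qed

lemma cbilinear_pure: "cbilinear (\<otimes>\<^sub>t)"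
  by (rule cbilinearI)
    (simp_all add: pure_tensor_add_left pure_tensor_add_right pure_tensor_scale_left pure_tensor_scale_right)

lemmas pure_tensor_left = cbilinear_left[OF cbilinear_pure]
lemmas pure_tensor_right = cbilinear_right[OF cbilinear_pure]
lemmas pure_tensor_simps = cbilinear_simps[OF cbilinear_pure]

lemma abs_tensor_empty: "abs_tensor {#} = 0"
  by (simp add: zero_tensor.abs_eq)

lemma abs_tensor_add_mset: "abs_tensor (add_mset (a, b) p) = a \<otimes>\<^sub>t b + abs_tensor p"
  by (simp add: pure_tensor.abs_eq plus_tensor.abs_eq)

text \<open>Zero and scalar multiples are covered by the first case: 0 is
  \<open>0 \<otimes>\<^sub>t 0\<close>, and a scalar moves into a factor. Hence statements about
  maps that are merely additive, such as conjugate linear ones, can be proved this way.\<close>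

lemma tensor_induct [case_names pure add]:
  assumes pure: "\<And>a b. P (a \<otimes>\<^sub>t b)" and add: "\<And>s t. P s \<Longrightarrow> P t \<Longrightarrow> P (s + t)"
  shows "P t"
proof -
  have "P (abs_tensor p)" for p
  proof (induction p)
    case empty
    show ?case using pure[of 0 0] by (simp add: abs_tensor_empty pure_tensor_simps)
  next
    case (add x p)
    then show ?case using pure assms(2) by (cases x) (simp add: abs_tensor_add_mset)
  qed
  then show ?thesis by (metis Quotient_abs_rep Quotient_tensor)
qed

lemma tensor_eqI:
  assumes "clinear f" "clinear g" "\<And>a b. f (a \<otimes>\<^sub>t b) = g (a \<otimes>\<^sub>t b)"
  shows "f t = g t"
  by (induction t rule: tensor_induct) (simp_all add: assms clinear_simps)

text \<open>The carrier of the exterior tensor product with a bimodule whose carrier is S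
  (\<open>bcarrier_ext\<close>). A lift over S is computed from representatives with left entries in
  S, and these exist exactly for the elements of this span.\<close>

definition tensor_carrier :: "'a::complex_vector set \<Rightarrow> ('a, 'b::complex_vector) tensor set"
  where "tensor_carrier S = cspan {a \<otimes>\<^sub>t b | a b. a \<in> S}"

lemma csubspace_tensor_carrier: "csubspace (tensor_carrier S)"
  unfolding tensor_carrier_def by (rule cvector.subspace_span)

lemma tensor_carrier_add: "s \<in> tensor_carrier S \<Longrightarrow> t \<in> tensor_carrier S \<Longrightarrow> s + t \<in> tensor_carrier S"
  and tensor_carrier_scale: "t \<in> tensor_carrier S \<Longrightarrow> c *\<^sub>C t \<in> tensor_carrier S"
  and tensor_carrier_sum: "(\<And>i. i \<in> I \<Longrightarrow> r i \<in> tensor_carrier S) \<Longrightarrow> (\<Sum>i\<in>I. r i) \<in> tensor_carrier S"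
  unfolding tensor_carrier_def
  by (auto intro: cvector.span_add cvector.span_scale cvector.span_zero cvector.span_sum)

lemma tensor_carrier_pure: "a \<in> S \<Longrightarrow> a \<otimes>\<^sub>t b \<in> tensor_carrier S"
  unfolding tensor_carrier_def by (rule cvector.span_base) auto

lemma tensor_carrier_induct [consumes 2, case_names pure add]:
  assumes S: "csubspace S" and t: "t \<in> tensor_carrier S"
    and pure: "\<And>a b. a \<in> S \<Longrightarrow> P (a \<otimes>\<^sub>t b)"
    and add: "\<And>s t. s \<in> tensor_carrier S \<Longrightarrow> t \<in> tensor_carrier S \<Longrightarrow> P s \<Longrightarrow> P t \<Longrightarrow> P (s + t)"
  shows "P t"
proof -
  have "P t \<and> t \<in> tensor_carrier S"
    using t unfolding tensor_carrier_def
  proof (induction rule: cvector.span_induct_alt)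
    case base
    have "0 \<in> S" using S by (rule cvector.subspace_0)
    then show ?case using pure[of 0 0] cvector.span_zero by (simp add: pure_tensor_simps)
  next
    case (step c x y)
    then obtain a b where x: "x = a \<otimes>\<^sub>t b" "a \<in> S" by auto
    have "c *\<^sub>C a \<in> S" using x(2) S by (rule cvector.subspace_scale[rotated])
    then have "P (c *\<^sub>C x)" "c *\<^sub>C x \<in> tensor_carrier S"
      using pure[of "c *\<^sub>C a" b] tensor_carrier_pure[of "c *\<^sub>C a" S b]
      by (simp_all add: x pure_tensor_scale_left)
    then show ?case using step add tensor_carrier_add by (auto simp: tensor_carrier_def)
  qed
  then show ?thesis by blast
qed

lemma tensor_carrier_rep:
  assumes S: "csubspace S" and t: "t \<in> tensor_carrier S"
  shows "\<exists>p. abs_tensor p = t \<and> fst ` set_mset p \<subseteq> S"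
  using assms
proof (induction rule: tensor_carrier_induct)
  case (pure a b)
  then show ?case by (intro exI[of _ "{#(a, b)#}"]) (simp add: pure_tensor.abs_eq)
next
  case (add s t)
  then obtain p q where "abs_tensor p = s" "fst ` set_mset p \<subseteq> S" "abs_tensor q = t" "fst ` set_mset q \<subseteq> S"
    by blast
  then show ?case by (intro exI[of _ "p + q"]) (auto simp: plus_tensor.abs_eq[symmetric])
qed

lemma tensor_carrier_UNIV [simp]: "t \<in> tensor_carrier UNIV"
  by (induction t rule: tensor_induct) (simp_all add: tensor_carrier_pure tensor_carrier_add)

lemma csubspace_UNIV [simp]: "csubspace (UNIV :: 'a::complex_vector set)"
  by (rule cvector.subspace_UNIV)

section \<open>Lifting maps to tensor products\<close>

lemma tensor_lift_on_add:
  fixes f :: "'a::complex_vector \<Rightarrow> 'b::complex_vector \<Rightarrow> 'c::ab_group_add"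
  assumes S: "csubspace S" and f: "balanced_on S f"
    and s: "s \<in> tensor_carrier S" and t: "t \<in> tensor_carrier S"
  shows "tensor_lift_on S f (s + t) = tensor_lift_on S f s + tensor_lift_on S f t"
proof -
  obtain p q where *: "abs_tensor p = s" "fst ` set_mset p \<subseteq> S" "abs_tensor q = t" "fst ` set_mset q \<subseteq> S"
    using tensor_carrier_rep[OF S s] tensor_carrier_rep[OF S t] by blast
  then have "s + t = abs_tensor (p + q)" "fst ` set_mset (p + q) \<subseteq> S"
    by (auto simp: plus_tensor.abs_eq[symmetric])
  then show ?thesis
    using tensor_lift_on_eq[OF S f] * by auto
qed

lemma tensor_lift_add:
  fixes f :: "'a::complex_vector \<Rightarrow> 'b::complex_vector \<Rightarrow> 'c::ab_group_add"
  shows "balanced_on UNIV f \<Longrightarrow> tensor_lift f (s + t) = tensor_lift f s + tensor_lift f t"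
  by (rule tensor_lift_on_add) simp_all

lemma clinear_tensor_lift:
  fixes f :: "'a::complex_vector \<Rightarrow> 'b::complex_vector \<Rightarrow> 'c::complex_vector"
  assumes "cbilinear f"
  shows "clinear (tensor_lift f)"
proof (rule clinearI)
  have f: "balanced_on UNIV f" using assms by (rule cbilinear_balanced)
  show add: "tensor_lift f (s + t) = tensor_lift f s + tensor_lift f t" for s t
    using f by (rule tensor_lift_add)
  show "tensor_lift f (c *\<^sub>C t) = c *\<^sub>C tensor_lift f t" for c t
    by (induction t rule: tensor_induct)
      (simp_all add: add scaleC_add_right pure_tensor_scale_left[symmetric] f
        cbilinear_simps[OF assms])
qed

lemma tensor_lift_pure [simp]:
  fixes f :: "'a::complex_vector \<Rightarrow> 'b::complex_vector \<Rightarrow> 'c::complex_vector"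
  shows "cbilinear f \<Longrightarrow> tensor_lift f (a \<otimes>\<^sub>t b) = f a b"
  by (simp add: cbilinear_balanced)

text \<open>Here and in the next lemmas f is arbitrary: the representative chosen in
  \<open>tensor_lift_on\<close> depends on S and t alone, so both sides are sums over the same
  multiset.\<close>

lemma tensor_lift_on_fun_add:
  fixes f :: "'a::complex_vector \<Rightarrow> 'b::complex_vector \<Rightarrow> 'c::comm_monoid_add"
  shows "tensor_lift_on S (\<lambda>a b. f a b + g a b) t = tensor_lift_on S f t + tensor_lift_on S g t"
  unfolding tensor_lift_on_def by (simp add: case_prod_unfold sum_mset.distrib)

lemma tensor_lift_on_hom:
  fixes f :: "'a::complex_vector \<Rightarrow> 'b::complex_vector \<Rightarrow> 'c::comm_monoid_add"
  assumes "F 0 = 0" "\<And>x y. F (x + y) = F x + F y"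
  shows "tensor_lift_on S (\<lambda>a b. F (f a b)) t = F (tensor_lift_on S f t)"
proof -
  have "(\<Sum>x\<in>#p. F (g x)) = F (\<Sum>x\<in>#p. g x)" for p :: "('a \<times> 'b) multiset" and g
    by (induction p) (simp_all add: assms)
  then show ?thesis unfolding tensor_lift_on_def by (simp add: case_prod_unfold)
qed

lemma tensor_lift_on_clinear:
  fixes f :: "'a::complex_vector \<Rightarrow> 'b::complex_vector \<Rightarrow> 'c::complex_vector"
  shows "clinear F \<Longrightarrow> tensor_lift_on S (\<lambda>a b. F (f a b)) t = F (tensor_lift_on S f t)"
  by (rule tensor_lift_on_hom) (simp_all add: clinear_simps)

lemma tensor_lift_on_fun_scale:
  fixes f :: "'a::complex_vector \<Rightarrow> 'b::complex_vector \<Rightarrow> 'c::complex_vector"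
  shows "tensor_lift_on S (\<lambda>a b. c *\<^sub>C f a b) t = c *\<^sub>C tensor_lift_on S f t"
  by (rule tensor_lift_on_clinear[OF clinear_scaleC])

lemma tensor_lift_on_swap:
  fixes f :: "'a::complex_vector \<Rightarrow> 'b::complex_vector \<Rightarrow> 'c::complex_vector \<Rightarrow> 'd::complex_vector \<Rightarrow> 'e::comm_monoid_add"
  shows "tensor_lift_on S (\<lambda>a b. tensor_lift_on T (\<lambda>c d. f a b c d) t) s =
    tensor_lift_on T (\<lambda>c d. tensor_lift_on S (\<lambda>a b. f a b c d) s) t"
proof -
  have "(\<Sum>x\<in>#p. \<Sum>y\<in>#q. g x y) = (\<Sum>y\<in>#q. \<Sum>x\<in>#p. g x y)"
    for p :: "('a \<times> 'b) multiset" and q :: "('c \<times> 'd) multiset" and g :: "_ \<Rightarrow> _ \<Rightarrow> 'e"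
    by (induction p) (simp_all add: sum_mset.distrib)
  then show ?thesis unfolding tensor_lift_on_def by (simp add: case_prod_unfold)
qed

lemma clinear_tensor_lift_fun:
  fixes f :: "'x::complex_vector \<Rightarrow> 'a::complex_vector \<Rightarrow> 'b::complex_vector \<Rightarrow> 'c::complex_vector"
  assumes "\<And>a b. clinear (\<lambda>x. f x a b)"
  shows "clinear (\<lambda>x. tensor_lift_on S (f x) t)"
proof (rule clinearI)
  have "f (x + y) = (\<lambda>a b. f x a b + f y a b)" for x y
    by (intro ext) (rule clinear_add[OF assms])
  then show "tensor_lift_on S (f (x + y)) t = tensor_lift_on S (f x) t + tensor_lift_on S (f y) t" for x y
    by (simp only: tensor_lift_on_fun_add)
  have "f (c *\<^sub>C x) = (\<lambda>a b. c *\<^sub>C f x a b)" for c x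
    by (intro ext) (rule clinear_scale[OF assms])
  then show "tensor_lift_on S (f (c *\<^sub>C x)) t = c *\<^sub>C tensor_lift_on S (f x) t" for c x
    by (simp only: tensor_lift_on_fun_scale)
qed

lemma tensor_map_pure [simp]:
  "clinear f \<Longrightarrow> clinear g \<Longrightarrow> tensor_map f g (a \<otimes>\<^sub>t b) = f a \<otimes>\<^sub>t g b"
  unfolding tensor_map_on_def
  by (rule tensor_lift_pure) (rule cbilinear_compose[OF cbilinear_pure])

lemma clinear_tensor_map:
  "clinear f \<Longrightarrow> clinear g \<Longrightarrow> clinear (tensor_map f g)"
  unfolding tensor_map_on_def
  by (rule clinear_tensor_lift) (rule cbilinear_compose[OF cbilinear_pure])

lemma tensor_map_compose:
  assumes "clinear f" "clinear g" "clinear f'" "clinear g'"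
  shows "tensor_map f g (tensor_map f' g' t) = tensor_map (\<lambda>x. f (f' x)) (\<lambda>x. g (g' x)) t"
  by (rule tensor_eqI[of "\<lambda>t. tensor_map f g (tensor_map f' g' t)"])
    (simp_all add: assms clinear_tensor_map clinear_compose)

lemma tensor_map_id [simp]: "tensor_map id id t = t" "tensor_map (\<lambda>x. x) (\<lambda>x. x) t = t"
  by (rule tensor_eqI[of _ "\<lambda>x. x"]; simp add: clinear_tensor_map)+

lemma tensor_map_fun_left:
  "tensor_map (\<lambda>x. f x + f' x) g t = tensor_map f g t + tensor_map f' g t"
  "tensor_map (\<lambda>x. c *\<^sub>C f x) g t = c *\<^sub>C tensor_map f g t"
  unfolding tensor_map_on_def
  by (simp_all add: pure_tensor_simps tensor_lift_on_fun_add tensor_lift_on_fun_scale)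

lemma cbilinear_slice: "clinear \<phi> \<Longrightarrow> cbilinear (\<lambda>a b. \<phi> b *\<^sub>C a)"
  by (rule cbilinearI) (simp_all add: clinear_simps scaleC_add_left scaleC_add_right scaleC_scaleC
      scaleC_complex_def mult.commute)

lemma slice_pure [simp]: "clinear \<phi> \<Longrightarrow> slice \<phi> (a \<otimes>\<^sub>t b) = \<phi> b *\<^sub>C a"
  unfolding slice_def by (rule tensor_lift_pure) (rule cbilinear_slice)

lemma clinear_slice: "clinear \<phi> \<Longrightarrow> clinear (slice \<phi>)"
  unfolding slice_def by (rule clinear_tensor_lift) (rule cbilinear_slice)

lemma slice_fun_add: "slice (\<lambda>b. \<phi> b + \<psi> b) t = slice \<phi> t + slice \<psi> t"
  and slice_fun_scale: "slice (\<lambda>b. c * \<phi> b) t = c *\<^sub>C slice \<phi> t"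
  unfolding slice_def
  by (simp_all only: scaleC_add_left tensor_lift_on_fun_add scaleC_scaleC[symmetric] tensor_lift_on_fun_scale)

lemma slice_tensor_map:
  assumes "clinear f" "clinear g" "clinear \<phi>"
  shows "slice \<phi> (tensor_map f g t) = f (slice (\<lambda>b. \<phi> (g b)) t)"
  by (rule tensor_eqI[of "\<lambda>t. slice \<phi> (tensor_map f g t)"])
    (simp_all add: assms clinear_tensor_map clinear_slice clinear_compose clinear_simps)

lemma cbilinear_tensor_lift_outer:
  assumes "\<And>a b. cbilinear (\<lambda>c d. f a b c d)" "\<And>c d. cbilinear (\<lambda>a b. f a b c d)"
  shows "cbilinear (\<lambda>s t. tensor_lift (\<lambda>a b. tensor_lift (\<lambda>c d. f a b c d) t) s)"
  unfolding cbilinear_def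
proof safe
  show "clinear (\<lambda>s. tensor_lift (\<lambda>a b. tensor_lift (\<lambda>c d. f a b c d) t) s)" for t
  proof (rule clinear_tensor_lift)
    show "cbilinear (\<lambda>a b. tensor_lift (\<lambda>c d. f a b c d) t)"
      using assms(2) unfolding cbilinear_def by (intro conjI allI clinear_tensor_lift_fun) simp_all
  qed
  show "clinear (\<lambda>t. tensor_lift (\<lambda>a b. tensor_lift (\<lambda>c d. f a b c d) t) s)" for s
    by (rule clinear_tensor_lift_fun) (rule clinear_tensor_lift[OF assms(1)])
qed

lemma tensor_assoc_inner: "cbilinear (\<lambda>b c. (a \<otimes>\<^sub>t b) \<otimes>\<^sub>t c)"
  by (rule cbilinearI) (simp_all add: pure_tensor_simps)

lemma tensor_assoc_outer: "cbilinear (\<lambda>a. tensor_lift (\<lambda>b c. (a \<otimes>\<^sub>t b) \<otimes>\<^sub>t c))"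
  unfolding cbilinear_def
  by (intro conjI allI clinear_tensor_lift tensor_assoc_inner clinear_tensor_lift_fun)
    (rule clinearI; simp add: pure_tensor_simps)

lemma tensor_assoc_pure [simp]: "tensor_assoc (a \<otimes>\<^sub>t (b \<otimes>\<^sub>t c)) = (a \<otimes>\<^sub>t b) \<otimes>\<^sub>t c"
  unfolding tensor_assoc_def
  by (simp only: tensor_lift_pure[OF tensor_assoc_outer] tensor_lift_pure[OF tensor_assoc_inner])

lemma clinear_tensor_assoc: "clinear tensor_assoc"
  unfolding tensor_assoc_def by (rule clinear_tensor_lift[OF tensor_assoc_outer])

section \<open>Finite dimension and duality\<close>

lemma clinear_dual_apply: "clinear (dual_apply \<phi>)"
  using dual_apply by auto

lemma dual_apply_simps [simp]:
  "dual_apply (\<phi> + \<psi>) h = dual_apply \<phi> h + dual_apply \<psi> h"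
  "dual_apply (c *\<^sub>C \<phi>) h = c * dual_apply \<phi> h"
  "dual_apply 0 h = 0"
  by (transfer, simp)+

lemma clinear_eval: "clinear (\<lambda>\<phi>. dual_apply \<phi> h)"
  by (rule clinearI) (simp_all add: scaleC_complex_def)

lemma dual_apply_sum: "dual_apply (\<Sum>i\<in>I. \<phi> i) h = (\<Sum>i\<in>I. dual_apply (\<phi> i) h)"
  by (rule clinear_sum[OF clinear_eval])

lemma dual_apply_Abs: "clinear f \<Longrightarrow> dual_apply (Abs_dual f) = f"
  by (rule Abs_dual_inverse) simp

lemma dual_eqI: "(\<And>h. dual_apply \<phi> h = dual_apply \<psi> h) \<Longrightarrow> \<phi> = \<psi>"
  by (metis dual_apply_inject ext)

definition fbasis :: "'h::complex_vector itself \<Rightarrow> 'h set"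
  where "fbasis _ = (SOME B. finite B \<and> cvector.independent B \<and> cspan B = UNIV)"

definition fcoord :: "'h::complex_vector \<Rightarrow> 'h \<Rightarrow> complex"
  where "fcoord b x = cvector.representation (fbasis TYPE('h)) x b"

definition dbasis :: "'h::complex_vector \<Rightarrow> 'h dual"
  where "dbasis b = Abs_dual (fcoord b)"

lemma fbasis:
  assumes "finite_dim TYPE('h::complex_vector)"
  shows "finite (fbasis TYPE('h))" "cvector.independent (fbasis TYPE('h))" "cspan (fbasis TYPE('h)) = UNIV"
proof -
  obtain b :: "'h set" where b: "finite b" "cspan b = UNIV" using assms unfolding finite_dim_def by blast
  obtain B where "B \<subseteq> b" "cvector.independent B" "b \<subseteq> cspan B"
    using cvector.maximal_independent_subset[of b] by metis
  then have "finite B \<and> cvector.independent B \<and> cspan B = UNIV"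
    using b by (metis cvector.span_minimal cvector.subspace_span finite_subset top.extremum_uniqueI)
  then have "finite (fbasis TYPE('h)) \<and> cvector.independent (fbasis TYPE('h)) \<and> cspan (fbasis TYPE('h)) = UNIV"
    unfolding fbasis_def by (rule someI)
  then show "finite (fbasis TYPE('h))" "cvector.independent (fbasis TYPE('h))" "cspan (fbasis TYPE('h)) = UNIV"
    by blast+
qed

lemma clinear_fcoord:
  assumes "finite_dim TYPE('h::complex_vector)"
  shows "clinear (fcoord (b :: 'h))"
  unfolding fcoord_def using fbasis[OF assms]
  by (intro clinearI) (simp_all add: cvector.representation_add cvector.representation_scale scaleC_complex_def)

lemma fcoord_expand:
  assumes "finite_dim TYPE('h::complex_vector)"
  shows "(\<Sum>b\<in>fbasis TYPE('h). fcoord b x *\<^sub>C b) = (x :: 'h)"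
  unfolding fcoord_def using fbasis[OF assms]
  by (intro cvector.sum_representation_eq) auto

lemma dbasis_apply:
  assumes "finite_dim TYPE('h::complex_vector)"
  shows "dual_apply (dbasis b) = fcoord (b :: 'h)"
  unfolding dbasis_def by (rule dual_apply_Abs[OF clinear_fcoord[OF assms]])

lemma dual_expand:
  assumes "finite_dim TYPE('h::complex_vector)"
  shows "(\<Sum>b\<in>fbasis TYPE('h). dual_apply \<phi> b *\<^sub>C dbasis b) = (\<phi> :: 'h dual)"
proof (rule dual_eqI)
  fix h :: 'h
  have "dual_apply \<phi> h = dual_apply \<phi> (\<Sum>b\<in>fbasis TYPE('h). fcoord b h *\<^sub>C b)"
    by (simp add: fcoord_expand[OF assms])
  also have "\<dots> = (\<Sum>b\<in>fbasis TYPE('h). fcoord b h * dual_apply \<phi> b)"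
    by (simp add: clinear_simps[OF clinear_dual_apply] scaleC_complex_def)
  finally show "dual_apply (\<Sum>b\<in>fbasis TYPE('h). dual_apply \<phi> b *\<^sub>C dbasis b) h = dual_apply \<phi> h"
    by (simp add: dual_apply_sum dbasis_apply[OF assms] mult.commute)
qed

text \<open>\<open>ev h\<close> reads off the coefficient at h. By \<open>ev_eqI\<close> and
  \<open>coeff_tensor\<close> an element of A \<otimes> H^0 is the same as a linear map from H to A,
  and nearly all identities below are checked on coefficients.\<close>

abbreviation ev :: "'h::complex_vector \<Rightarrow> ('a::complex_vector, 'h dual) tensor \<Rightarrow> 'a"
  where "ev h \<equiv> slice (\<lambda>\<phi>. dual_apply \<phi> h)"

lemma clinear_ev: "clinear (ev h)"
  by (rule clinear_slice[OF clinear_eval])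

lemma ev_pure: "ev h (a \<otimes>\<^sub>t \<phi>) = dual_apply \<phi> h *\<^sub>C a"
  by (rule slice_pure[OF clinear_eval])

lemma clinear_ev_arg: "clinear (\<lambda>h. ev h t)"
  by (rule clinearI)
    (simp_all add: clinear_simps[OF clinear_dual_apply] slice_fun_add slice_fun_scale scaleC_complex_def)

lemma ev_tensor_map: "clinear f \<Longrightarrow> ev h (tensor_map f id t) = f (ev h t)"
  by (simp add: slice_tensor_map clinear_eval)

text \<open>Inverse of reading off coefficients: the tensor in A \<otimes> H^0 of a linear map from
  H to A, written with the dual basis.\<close>

definition coeff_tensor :: "('h::complex_vector \<Rightarrow> 'a::complex_vector) \<Rightarrow> ('a, 'h dual) tensor"
  where "coeff_tensor f = (\<Sum>b\<in>fbasis TYPE('h). f b \<otimes>\<^sub>t dbasis b)"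

lemma ev_coeff_tensor:
  assumes fd: "finite_dim TYPE('h::complex_vector)" and f: "clinear f"
  shows "ev (h :: 'h) (coeff_tensor f) = f h"
proof -
  have "f h = f (\<Sum>b\<in>fbasis TYPE('h). fcoord b h *\<^sub>C b)" by (simp add: fcoord_expand[OF fd])
  then show ?thesis
    unfolding coeff_tensor_def
    by (simp add: clinear_simps[OF clinear_ev] ev_pure dbasis_apply[OF fd] clinear_simps[OF f])
qed

lemma coeff_tensor_ev:
  assumes "finite_dim TYPE('h::complex_vector)"
  shows "coeff_tensor (\<lambda>h::'h. ev h t) = t"
proof (rule tensor_eqI[of "\<lambda>t. coeff_tensor (\<lambda>h::'h. ev h t)" "\<lambda>t. t"])
  show "clinear (\<lambda>t. coeff_tensor (\<lambda>h::'h. ev h t))"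
    unfolding coeff_tensor_def
    by (rule clinear_sumI) (rule clinear_compose[OF pure_tensor_left clinear_ev])
  show "coeff_tensor (\<lambda>h::'h. ev h (a \<otimes>\<^sub>t \<phi>)) = a \<otimes>\<^sub>t \<phi>" for a :: 'a and \<phi>
  proof -
    have "coeff_tensor (\<lambda>h::'h. ev h (a \<otimes>\<^sub>t \<phi>)) = a \<otimes>\<^sub>t (\<Sum>b\<in>fbasis TYPE('h). dual_apply \<phi> b *\<^sub>C dbasis b)"
      unfolding coeff_tensor_def by (simp add: ev_pure pure_tensor_simps)
    then show ?thesis by (simp add: dual_expand[OF assms])
  qed
qed simp

lemma ev_eqI:
  assumes "finite_dim TYPE('h::complex_vector)" "\<And>h::'h. ev h s = ev h t"
  shows "s = t"
proof -
  have "coeff_tensor (\<lambda>h::'h. ev h s) = coeff_tensor (\<lambda>h::'h. ev h t)"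
    unfolding coeff_tensor_def by (rule sum.cong[OF HOL.refl]) (simp only: assms(2))
  then show ?thesis by (simp only: coeff_tensor_ev[OF assms(1)])
qed

lemma tensor_expand:
  assumes "finite_dim TYPE('h::complex_vector)"
  shows "(\<Sum>b\<in>fbasis TYPE('h). slice (fcoord b) t \<otimes>\<^sub>t b) = (t :: ('a::complex_vector, 'h) tensor)"
proof (rule tensor_eqI[of "\<lambda>t. \<Sum>b\<in>fbasis TYPE('h). slice (fcoord b) t \<otimes>\<^sub>t b" "\<lambda>t. t"])
  show "clinear (\<lambda>t. \<Sum>b\<in>fbasis TYPE('h). slice (fcoord b) t \<otimes>\<^sub>t b)"
    by (rule clinear_sumI) (rule clinear_compose[OF pure_tensor_left clinear_slice[OF clinear_fcoord[OF assms]]])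
  show "(\<Sum>b\<in>fbasis TYPE('h). slice (fcoord b) (a \<otimes>\<^sub>t h) \<otimes>\<^sub>t b) = a \<otimes>\<^sub>t h" for a :: 'a and h
  proof -
    have "(\<Sum>b\<in>fbasis TYPE('h). slice (fcoord b) (a \<otimes>\<^sub>t h) \<otimes>\<^sub>t b)
        = a \<otimes>\<^sub>t (\<Sum>b\<in>fbasis TYPE('h). fcoord b h *\<^sub>C b)"
      by (simp add: clinear_fcoord[OF assms] pure_tensor_simps)
    then show ?thesis by (simp add: fcoord_expand[OF assms])
  qed
qed simp

lemma tensor_carrier_evI:
  assumes "finite_dim TYPE('h::complex_vector)" "\<And>h::'h. ev h t \<in> S"
  shows "t \<in> tensor_carrier S"
proof -
  have "coeff_tensor (\<lambda>h::'h. ev h t) \<in> tensor_carrier S"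
    unfolding coeff_tensor_def by (intro tensor_carrier_sum tensor_carrier_pure assms(2))
  then show ?thesis by (simp only: coeff_tensor_ev[OF assms(1)])
qed

lemma ev_in_carrier:
  assumes "csubspace S" "t \<in> tensor_carrier S"
  shows "ev h t \<in> S"
  using assms
  by (induction rule: tensor_carrier_induct)
    (simp_all add: ev_pure clinear_simps[OF clinear_ev] cvector.subspace_scale[OF assms(1)]
      cvector.subspace_add[OF assms(1)])

section \<open>Algebras and their tensor products\<close>

text \<open>Split off from \<open>unital_star_algebra\<close> because H^0 is first available without
  its involution: that the involution of H^0 is involutive and antimultiplicative rests on
  properties of S whose proofs already compute in algebras tensored with H^0.\<close>

locale unital_algebra =
  fixes A :: "('a::complex_vector, 'm) star_algebra_scheme" (structure)
  assumes amult_assoc: "(a \<odot> b) \<odot> c = a \<odot> (b \<odot> c)"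
    and amult_one_left: "\<one> \<odot> a = a"
    and amult_one_right: "a \<odot> \<one> = a"
    and cbilinear_amult: "cbilinear (amult A)"

sublocale unital_star_algebra \<subseteq> unital: unital_algebra
  by unfold_locales
    (auto intro!: cbilinearI simp: amult_assoc amult_one_left amult_one_right amult_add_left amult_add_right
      amult_scale_left amult_scale_right)

context unital_algebra
begin

lemmas amult_simps = cbilinear_simps[OF cbilinear_amult]
lemmas clinear_amult_left = cbilinear_left[OF cbilinear_amult]
lemmas clinear_amult_right = cbilinear_right[OF cbilinear_amult]

end

context unital_star_algebra
begin

lemma astar_zero: "astar A 0 = 0"
  using astar_scale[of 0 0] by simp

lemma astar_one: "astar A \<one> = \<one>"
  by (metis amult_one_left amult_one_right astar_astar astar_mult)

lemma astar_minus: "astar A (- a) = - astar A a"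
  using astar_add[of a "- a"] by (simp add: astar_zero eq_neg_iff_add_eq_0 add.commute)

lemma astar_diff: "astar A (a - b) = astar A a - astar A b"
  using astar_add[of a "- b"] by (simp add: astar_minus)

lemma astar_sum: "astar A (sum f I) = (\<Sum>i\<in>I. astar A (f i))"
  by (induction I rule: infinite_finite_induct) (simp_all add: astar_zero astar_add)

lemmas astar_simps = astar_astar astar_mult astar_add astar_scale astar_zero astar_one astar_minus astar_diff astar_sum

end

lemma tensor_product_bilinear:
  assumes "cbilinear m" "cbilinear n"
  shows "cbilinear (\<lambda>s t. tensor_lift (\<lambda>a b. tensor_lift (\<lambda>a' b'. m a a' \<otimes>\<^sub>t n b b') t) s)"
    and "tensor_lift (\<lambda>a b. tensor_lift (\<lambda>a' b'. m a a' \<otimes>\<^sub>t n b b') (c' \<otimes>\<^sub>t d')) (c \<otimes>\<^sub>t d) = m c c' \<otimes>\<^sub>t n d d'"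
proof -
  have 1: "cbilinear (\<lambda>a' b'. m a a' \<otimes>\<^sub>t n b b')" "cbilinear (\<lambda>a b. m a a' \<otimes>\<^sub>t n b b')" for a b a' b'
    by (rule cbilinear_compose[OF cbilinear_pure]; simp add: assms cbilinear_left cbilinear_right)+
  then show "cbilinear (\<lambda>s t. tensor_lift (\<lambda>a b. tensor_lift (\<lambda>a' b'. m a a' \<otimes>\<^sub>t n b b') t) s)"
    by (rule cbilinear_tensor_lift_outer)
  show "tensor_lift (\<lambda>a b. tensor_lift (\<lambda>a' b'. m a a' \<otimes>\<^sub>t n b b') (c' \<otimes>\<^sub>t d')) (c \<otimes>\<^sub>t d) = m c c' \<otimes>\<^sub>t n d d'"
    by (simp only: tensor_lift_pure[OF 1(1)] tensor_lift_pure[OF 1(2)])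
qed

lemma tensor_algebra_one: "\<one>\<^bsub>tensor_algebra A B\<^esub> = \<one>\<^bsub>A\<^esub> \<otimes>\<^sub>t \<one>\<^bsub>B\<^esub>"
  by (simp add: tensor_algebra_def)

lemma tensor_algebra_mult:
  assumes "unital_algebra A" "unital_algebra B"
  shows "(a \<otimes>\<^sub>t b) \<odot>\<^bsub>tensor_algebra A B\<^esub> (a' \<otimes>\<^sub>t b') = (a \<odot>\<^bsub>A\<^esub> a') \<otimes>\<^sub>t (b \<odot>\<^bsub>B\<^esub> b')"
    and "cbilinear (amult (tensor_algebra A B))"
  using tensor_product_bilinear[OF unital_algebra.cbilinear_amult[OF assms(1)]
      unital_algebra.cbilinear_amult[OF assms(2)]]
  by (simp_all add: tensor_algebra_def)

lemma unital_algebra_tensor: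
  assumes A: "unital_algebra A" and B: "unital_algebra B"
  shows "unital_algebra (tensor_algebra A B)"
proof
  note m = tensor_algebra_mult[OF A B] and b = cbilinear_simps[OF tensor_algebra_mult(2)[OF A B]]
  fix r s t
  show "r \<odot>\<^bsub>tensor_algebra A B\<^esub> s \<odot>\<^bsub>tensor_algebra A B\<^esub> t = r \<odot>\<^bsub>tensor_algebra A B\<^esub> (s \<odot>\<^bsub>tensor_algebra A B\<^esub> t)"
  proof (induction r rule: tensor_induct)
    case (pure r1 r2)
    show ?case
    proof (induction s rule: tensor_induct)
      case (pure s1 s2)
      show ?case
        by (induction t rule: tensor_induct)
          (simp_all add: m(1) b unital_algebra.amult_assoc[OF A] unital_algebra.amult_assoc[OF B])
    qed (simp add: b)
  qed (simp add: b)
  show "\<one>\<^bsub>tensor_algebra A B\<^esub> \<odot>\<^bsub>tensor_algebra A B\<^esub> t = t" "t \<odot>\<^bsub>tensor_algebra A B\<^esub> \<one>\<^bsub>tensor_algebra A B\<^esub> = t"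
    by (induction t rule: tensor_induct; simp add: m(1) b tensor_algebra_one
        unital_algebra.amult_one_left[OF A] unital_algebra.amult_one_left[OF B]
        unital_algebra.amult_one_right[OF A] unital_algebra.amult_one_right[OF B])+
  show "cbilinear (amult (tensor_algebra A B))" by (rule m(2))
qed

lemma tensor_algebra_star:
  assumes A: "unital_star_algebra A" and B: "unital_star_algebra B"
  shows "astar (tensor_algebra A B) (a \<otimes>\<^sub>t b) = astar A a \<otimes>\<^sub>t astar B b"
    and "astar (tensor_algebra A B) (s + t) = astar (tensor_algebra A B) s + astar (tensor_algebra A B) t"
    and "astar (tensor_algebra A B) (c *\<^sub>C t) = cnj c *\<^sub>C astar (tensor_algebra A B) t"
proof -
  note a = unital_star_algebra.astar_add[OF A] unital_star_algebra.astar_add[OF B]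
    unital_star_algebra.astar_scale[OF A] unital_star_algebra.astar_scale[OF B]
  have bal: "balanced_on UNIV (\<lambda>a b. astar A a \<otimes>\<^sub>t astar B b)"
    by (simp add: balanced_on_def a pure_tensor_simps)
  have pure: "astar (tensor_algebra A B) (a \<otimes>\<^sub>t b) = astar A a \<otimes>\<^sub>t astar B b" for a b
    by (simp add: tensor_algebra_def bal)
  have add: "astar (tensor_algebra A B) (s + t) = astar (tensor_algebra A B) s + astar (tensor_algebra A B) t" for s t
    by (simp add: tensor_algebra_def tensor_lift_add[OF bal])
  show "astar (tensor_algebra A B) (a \<otimes>\<^sub>t b) = astar A a \<otimes>\<^sub>t astar B b"
    and "astar (tensor_algebra A B) (s + t) = astar (tensor_algebra A B) s + astar (tensor_algebra A B) t"
    by (fact pure add)+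
  show "astar (tensor_algebra A B) (c *\<^sub>C t) = cnj c *\<^sub>C astar (tensor_algebra A B) t"
    by (induction t rule: tensor_induct)
      (simp_all add: add scaleC_add_right pure a flip: pure_tensor_scale_left)
qed

lemma unital_star_algebraI:
  assumes "unital_algebra A" "\<And>a. astar A (astar A a) = a"
    and "\<And>a b. astar A (a \<odot>\<^bsub>A\<^esub> b) = astar A b \<odot>\<^bsub>A\<^esub> astar A a"
    and "\<And>a b. astar A (a + b) = astar A a + astar A b" "\<And>z a. astar A (z *\<^sub>C a) = cnj z *\<^sub>C astar A a"
  shows "unital_star_algebra A"
proof -
  interpret unital_algebra A by fact
  show ?thesis
    by unfold_locales (simp_all add: amult_assoc amult_one_left amult_one_right amult_simps assms)
qed

lemma unital_star_algebra_unital: "unital_star_algebra A \<Longrightarrow> unital_algebra A"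
proof -
  assume "unital_star_algebra A"
  then interpret unital_star_algebra A .
  show ?thesis by unfold_locales
qed

lemma unital_star_algebra_tensor:
  assumes A: "unital_star_algebra A" and B: "unital_star_algebra B"
  shows "unital_star_algebra (tensor_algebra A B)"
proof (rule unital_star_algebraI)
  note u = unital_star_algebra_unital[OF A] unital_star_algebra_unital[OF B]
  note m = tensor_algebra_mult[OF u] and b = cbilinear_simps[OF tensor_algebra_mult(2)[OF u]]
  note st = tensor_algebra_star[OF A B]
  show "unital_algebra (tensor_algebra A B)" by (rule unital_algebra_tensor[OF u])
  show "astar (tensor_algebra A B) (astar (tensor_algebra A B) t) = t" for t
    by (induction t rule: tensor_induct)
      (simp_all add: st unital_star_algebra.astar_astar[OF A] unital_star_algebra.astar_astar[OF B])
  show "astar (tensor_algebra A B) (s \<odot>\<^bsub>tensor_algebra A B\<^esub> t) =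
    astar (tensor_algebra A B) t \<odot>\<^bsub>tensor_algebra A B\<^esub> astar (tensor_algebra A B) s" for s t
  proof (induction s rule: tensor_induct)
    case (pure s1 s2)
    show ?case
      by (induction t rule: tensor_induct)
        (simp_all add: st m b unital_star_algebra.astar_mult[OF A] unital_star_algebra.astar_mult[OF B])
  qed (simp add: st b)
qed (simp_all add: tensor_algebra_star[OF A B])

lemma tensor_map_mult:
  assumes alg: "unital_algebra A" "unital_algebra B" "unital_algebra A'" "unital_algebra B'"
    and f: "clinear f" "\<And>x y. f (x \<odot>\<^bsub>A\<^esub> y) = f x \<odot>\<^bsub>A'\<^esub> f y"
    and g: "clinear g" "\<And>x y. g (x \<odot>\<^bsub>B\<^esub> y) = g x \<odot>\<^bsub>B'\<^esub> g y"
  shows "tensor_map f g (s \<odot>\<^bsub>tensor_algebra A B\<^esub> t) = tensor_map f g s \<odot>\<^bsub>tensor_algebra A' B'\<^esub> tensor_map f g t"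
proof -
  note m = tensor_algebra_mult(1)[OF alg(1,2)] cbilinear_simps[OF tensor_algebra_mult(2)[OF alg(1,2)]]
    tensor_algebra_mult(1)[OF alg(3,4)] cbilinear_simps[OF tensor_algebra_mult(2)[OF alg(3,4)]]
    clinear_simps[OF clinear_tensor_map[OF f(1) g(1)]]
  show ?thesis
  proof (induction s rule: tensor_induct)
    case (pure s1 s2)
    show ?case by (induction t rule: tensor_induct) (simp_all add: f g m)
  qed (simp add: m)
qed

lemma unital_star_homD:
  assumes "unital_star_hom A B f"
  shows "clinear f" "f \<one>\<^bsub>A\<^esub> = \<one>\<^bsub>B\<^esub>" "f (a \<odot>\<^bsub>A\<^esub> a') = f a \<odot>\<^bsub>B\<^esub> f a'" "f (astar A a) = astar B (f a)"
  using assms unfolding unital_star_hom_def by blast+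

lemma unital_star_hom_compose:
  "unital_star_hom A B f \<Longrightarrow> unital_star_hom B C g \<Longrightarrow> unital_star_hom A C (\<lambda>x. g (f x))"
  unfolding unital_star_hom_def by (auto intro: clinear_compose)

lemma unital_star_hom_id: "unital_star_hom A A id"
  by (simp add: unital_star_hom_def)

lemma unital_star_hom_tensor_map:
  assumes alg: "unital_star_algebra A" "unital_star_algebra B" "unital_star_algebra A'" "unital_star_algebra B'"
    and f: "unital_star_hom A A' f" and g: "unital_star_hom B B' g"
  shows "unital_star_hom (tensor_algebra A B) (tensor_algebra A' B') (tensor_map f g)"
proof -
  note f' = unital_star_homD[OF f] and g' = unital_star_homD[OF g]
  have "tensor_map f g (astar (tensor_algebra A B) t) = astar (tensor_algebra A' B') (tensor_map f g t)" for t
    by (induction t rule: tensor_induct)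
      (simp_all add: f' g' tensor_algebra_star alg clinear_simps[OF clinear_tensor_map])
  then show ?thesis
    using clinear_tensor_map[OF f'(1) g'(1)]
      tensor_map_mult[of A B A' B' f g] f' g' alg[THEN unital_star_algebra_unital]
    by (simp add: unital_star_hom_def tensor_algebra_one)
qed

lemma unital_star_hom_left:
  assumes "unital_star_algebra A" "unital_star_algebra B"
  shows "unital_star_hom A (tensor_algebra A B) (\<lambda>a. a \<otimes>\<^sub>t \<one>\<^bsub>B\<^esub>)"
  unfolding unital_star_hom_def
  by (simp add: pure_tensor_left tensor_algebra_one tensor_algebra_star assms
      unital_algebra.amult_one_left unital_star_algebra.astar_one tensor_algebra_mult unital_star_algebra_unital)

section \<open>Sweedler calculus\<close>

lemma sweedler2_add: "sweedler2 H (\<lambda>a b. f a b + g a b) h = sweedler2 H f h + sweedler2 H g h"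
  unfolding sweedler2_def by (rule tensor_lift_on_fun_add)

lemma sweedler2_linear:
  "clinear F \<Longrightarrow> sweedler2 H (\<lambda>a b. F (f a b)) h = F (sweedler2 H f h)"
  unfolding sweedler2_def by (rule tensor_lift_on_clinear)

lemma sweedler2_hom:
  "F 0 = 0 \<Longrightarrow> (\<And>x y. F (x + y) = F x + F y) \<Longrightarrow> sweedler2 H (\<lambda>a b. F (f a b)) h = F (sweedler2 H f h)"
  unfolding sweedler2_def by (rule tensor_lift_on_hom)

lemma sweedler2_swap:
  "sweedler2 H (\<lambda>a b. sweedler2 H' (\<lambda>c d. f a b c d) k) h = sweedler2 H' (\<lambda>c d. sweedler2 H (\<lambda>a b. f a b c d) h) k"
  unfolding sweedler2_def by (rule tensor_lift_on_swap)

lemma clinear_sweedler2_fun: "(\<And>a b. clinear (\<lambda>x. f x a b)) \<Longrightarrow> clinear (\<lambda>x. sweedler2 H (f x) h)"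
  unfolding sweedler2_def by (rule clinear_tensor_lift_fun)

lemma sweedler2_zero: "sweedler2 H (\<lambda>a b. 0) h = 0"
  using sweedler2_hom[of "\<lambda>_. 0" H "\<lambda>a b. 0" h] by simp

lemma sweedler2_sum: "sweedler2 H (\<lambda>a b. \<Sum>i\<in>I. f i a b) h = (\<Sum>i\<in>I. sweedler2 H (f i) h)"
  by (induction I rule: infinite_finite_induct) (simp_all add: sweedler2_zero sweedler2_add)

lemma sweedler2_scale:
  "sweedler2 H (\<lambda>a b. c *\<^sub>C f a b) h = c *\<^sub>C sweedler2 H f h"
  "sweedler2 H (\<lambda>a b. c * g a b) h = c * sweedler2 H g h" for g :: "'h::complex_vector \<Rightarrow> 'h \<Rightarrow> complex"
  by (simp_all add: sweedler2_linear[OF clinear_scaleC] sweedler2_hom[of "(*) c"] distrib_left)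

definition ctrilinear ::
  "('a::complex_vector \<Rightarrow> 'b::complex_vector \<Rightarrow> 'c::complex_vector \<Rightarrow> 'd::complex_vector) \<Rightarrow> bool"
  where "ctrilinear f \<longleftrightarrow> (\<forall>b c. clinear (\<lambda>a. f a b c)) \<and> (\<forall>a. cbilinear (f a))"

lemma ctrilinearI:
  assumes "\<And>b c. clinear (\<lambda>a. f a b c)" "\<And>a c. clinear (\<lambda>b. f a b c)" "\<And>a b. clinear (\<lambda>c. f a b c)"
  shows "ctrilinear f"
  using assms by (simp add: ctrilinear_def cbilinear_def)

lemma ctrilinear_bilinear:
  assumes "ctrilinear f"
  shows "cbilinear (f a)" "cbilinear (\<lambda>a b. f a b c)"
  using assms by (simp_all add: ctrilinear_def cbilinear_def)

context cstar_hopf_algebra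
begin

lemma comult_linear: "clinear (comult H)"
  and comult_one: "comult H \<one> = \<one> \<otimes>\<^sub>t \<one>"
  and comult_mult: "comult H (h \<odot> l) = comult H h \<odot>\<^bsub>tensor_algebra H H\<^esub> comult H l"
  and comult_star: "comult H (astar H h) = astar (tensor_algebra H H) (comult H h)"
  using unital_star_homD[OF comult_hom] by (simp_all add: tensor_algebra_one)

lemma counit_linear: "clinear (counit H)"
  and counit_one: "counit H \<one> = 1"
  and counit_mult: "counit H (h \<odot> l) = counit H h * counit H l"
  and counit_star: "counit H (astar H h) = cnj (counit H h)"
  using unital_star_homD[OF counit_hom] by (simp_all add: complex_star_algebra_def)

lemma clinear_sweedler2: "cbilinear f \<Longrightarrow> clinear (sweedler2 H f)"
  using clinear_compose[OF clinear_tensor_lift comult_linear] unfolding sweedler2_def by blast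

text \<open>The map f becomes one linear map L on (H \<otimes> H) \<otimes> H, and the two sides are
  the values of L on the two sides of \<open>coassoc\<close>.\<close>

lemma sweedler2_coassoc:
  assumes f: "ctrilinear f"
  shows "sweedler2 H (\<lambda>k c. sweedler2 H (\<lambda>a b. f a b c) k) h = sweedler2 H (\<lambda>a k. sweedler2 H (f a) k) h"
proof -
  define L where "L = tensor_lift (\<lambda>s c. tensor_lift (\<lambda>a b. f a b c) s)"
  note b = ctrilinear_bilinear[OF f]
  have c3: "clinear (\<lambda>c. f a b c)" for a b
    using f by (simp add: ctrilinear_def cbilinear_def)
  have b1: "cbilinear (\<lambda>s c. tensor_lift (\<lambda>a b. f a b c) s)"
    using clinear_tensor_lift[OF b(2)] clinear_tensor_lift_fun[of "\<lambda>c a b. f a b c", OF c3] by (simp add: cbilinear_def)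
  have b2: "cbilinear (\<lambda>k c. sweedler2 H (\<lambda>a b. f a b c) k)"
    using clinear_sweedler2[OF b(2)] clinear_sweedler2_fun[of "\<lambda>c a b. f a b c", OF c3] by (simp add: cbilinear_def)
  have b3: "cbilinear (\<lambda>a k. sweedler2 H (f a) k)"
    unfolding cbilinear_def
    using clinear_sweedler2[OF b(1)] clinear_sweedler2_fun[of "\<lambda>a. f a" H] f
    by (auto simp: ctrilinear_def)
  have lin: "clinear L" unfolding L_def by (rule clinear_tensor_lift[OF b1])
  have Lp: "L (s \<otimes>\<^sub>t c) = tensor_lift (\<lambda>a b. f a b c) s" for s c
    unfolding L_def by (rule tensor_lift_pure[OF b1])
  have "L (tensor_map (comult H) id t) = tensor_lift (\<lambda>k c. sweedler2 H (\<lambda>a b. f a b c) k) t" for t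
  proof (rule tensor_eqI[of "\<lambda>t. L (tensor_map (comult H) id t)"])
    show "clinear (\<lambda>t. L (tensor_map (comult H) id t))"
      by (rule clinear_compose[OF lin clinear_tensor_map]) (simp_all add: comult_linear)
  qed (simp_all add: clinear_tensor_lift b2 comult_linear Lp sweedler2_def[symmetric])
  moreover have L2: "L (tensor_assoc (a \<otimes>\<^sub>t s)) = tensor_lift (f a) s" for a s
  proof (rule tensor_eqI[of "\<lambda>s. L (tensor_assoc (a \<otimes>\<^sub>t s))"])
    show "clinear (\<lambda>t. L (tensor_assoc (a \<otimes>\<^sub>t t)))"
      by (rule clinear_compose[OF lin clinear_compose[OF clinear_tensor_assoc pure_tensor_right]])
  qed (simp_all add: clinear_tensor_lift b Lp)
  have "L (tensor_assoc (tensor_map id (comult H) t)) = tensor_lift (\<lambda>a k. sweedler2 H (f a) k) t" for t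
  proof (rule tensor_eqI[of "\<lambda>t. L (tensor_assoc (tensor_map id (comult H) t))"])
    show "clinear (\<lambda>t. L (tensor_assoc (tensor_map id (comult H) t)))"
      by (rule clinear_compose[OF lin clinear_compose[OF clinear_tensor_assoc clinear_tensor_map]])
        (simp_all add: comult_linear)
  qed (simp_all add: clinear_tensor_lift b3 comult_linear L2 sweedler2_def[symmetric])
  ultimately show ?thesis
    using coassoc[of h] unfolding sweedler2_def[of H _ h] by metis
qed

lemma sweedler2_mult:
  assumes f: "cbilinear f"
  shows "sweedler2 H f (h \<odot> l) = sweedler2 H (\<lambda>a b. sweedler2 H (\<lambda>c d. f (a \<odot> c) (b \<odot> d)) l) h"
proof -
  note m = tensor_algebra_mult[OF unital.unital_algebra_axioms unital.unital_algebra_axioms]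
  have b: "cbilinear (\<lambda>c d. f (a \<odot> c) (b \<odot> d))" "cbilinear (\<lambda>a b. f (a \<odot> c) (b \<odot> d))" for a b c d
    by (rule cbilinear_compose[OF f]; rule unital.clinear_amult_left unital.clinear_amult_right)+
  note b' = cbilinear_simps[OF cbilinear_tensor_lift_outer[OF b]]
  have "tensor_lift f (s \<odot>\<^bsub>tensor_algebra H H\<^esub> t)
      = tensor_lift (\<lambda>a b. tensor_lift (\<lambda>c d. f (a \<odot> c) (b \<odot> d)) t) s" for s t
  proof (induction s rule: tensor_induct)
    case (pure s1 s2)
    show ?case
    proof (induction t rule: tensor_induct)
      case (pure t1 t2)
      show ?case by (simp add: m f tensor_lift_pure[OF b(1)] tensor_lift_pure[OF b(2)])
    qed (simp add: cbilinear_simps[OF m(2)] b' clinear_simps[OF clinear_tensor_lift[OF f]])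
  qed (simp add: cbilinear_simps[OF m(2)] b' clinear_simps[OF clinear_tensor_lift[OF f]])
  then show ?thesis by (simp add: sweedler2_def comult_mult)
qed

lemma sweedler2_star:
  assumes f: "cbilinear f"
  shows "sweedler2 H f (astar H h) = sweedler2 H (\<lambda>a b. f (astar H a) (astar H b)) h"
proof -
  \<comment> \<open>Conjugate linear in both arguments: balanced, though not bilinear, so the lift
    is only additive here.\<close>
  have bal: "balanced_on UNIV (\<lambda>a b. f (astar H a) (astar H b))"
    by (simp add: balanced_on_def astar_add astar_scale cbilinear_simps[OF f])
  have "tensor_lift f (astar (tensor_algebra H H) t) = tensor_lift (\<lambda>a b. f (astar H a) (astar H b)) t" for t
    by (induction t rule: tensor_induct)
      (simp_all add: tensor_algebra_star[OF unital_star_algebra_axioms unital_star_algebra_axioms]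
        f bal tensor_lift_add[OF bal] clinear_simps[OF clinear_tensor_lift[OF f]])
  then show ?thesis by (simp add: sweedler2_def comult_star)
qed

lemma sweedler2_one: "cbilinear f \<Longrightarrow> sweedler2 H f \<one> = f \<one> \<one>"
  by (simp add: sweedler2_def comult_one)

lemma sweedler2_counit:
  assumes "clinear f"
  shows "sweedler2 H (\<lambda>a b. counit H a *\<^sub>C f b) h = f h" "sweedler2 H (\<lambda>a b. counit H b *\<^sub>C f a) h = f h"
  using sweedler2_linear[OF assms, of H "\<lambda>a b. counit H a *\<^sub>C b" h] counit_left[of h]
    sweedler2_linear[OF assms, of H "\<lambda>a b. counit H b *\<^sub>C a" h] counit_right[of h]
  by (simp_all add: clinear_simps[OF assms])

lemma sweedler2_antipode:
  assumes "clinear f"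
  shows "sweedler2 H (\<lambda>a b. f (antipode H a \<odot> b)) h = counit H h *\<^sub>C f \<one>"
    and "sweedler2 H (\<lambda>a b. f (a \<odot> antipode H b)) h = counit H h *\<^sub>C f \<one>"
  by (simp_all add: sweedler2_linear[OF assms] antipode_left antipode_right clinear_simps[OF assms])

end

section \<open>The dual algebra\<close>

lemma clinear_complex_mult: "cbilinear ((*) :: complex \<Rightarrow> _)"
  by (rule cbilinearI) (simp_all add: scaleC_complex_def algebra_simps)

lemma dual_pairing2_eq: "dual_pairing2 t h l = dual_apply (ev l t) h"
proof -
  have b: "cbilinear (\<lambda>\<phi> \<psi>. dual_apply \<phi> h * dual_apply \<psi> l)"
    by (rule cbilinear_compose(1)[OF clinear_complex_mult clinear_eval clinear_eval])
  show ?thesis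
    unfolding dual_pairing2_def
    by (rule tensor_eqI)
      (simp_all add: clinear_tensor_lift b clinear_compose[OF clinear_eval clinear_ev] ev_pure mult.commute)
qed

context cstar_hopf_algebra
begin

lemma cbilinear_dual_apply: "cbilinear (\<lambda>a b. dual_apply \<phi> a * dual_apply \<psi> b)"
  by (rule cbilinear_compose(1)[OF clinear_complex_mult clinear_dual_apply clinear_dual_apply])

lemma dual_mult_apply:
  "dual_apply (\<phi> \<odot>\<^bsub>dual_hopf H\<^esub> \<psi>) h = sweedler2 H (\<lambda>a b. dual_apply \<phi> a * dual_apply \<psi> b) h"
  by (simp add: dual_hopf_def dual_apply_Abs clinear_sweedler2 cbilinear_dual_apply)

lemma dual_one_apply: "dual_apply \<one>\<^bsub>dual_hopf H\<^esub> h = counit H h"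
  by (simp add: dual_hopf_def dual_apply_Abs counit_linear)

lemma dual_counit: "counit (dual_hopf H) \<phi> = dual_apply \<phi> \<one>"
  by (simp add: dual_hopf_def)

lemma dual_antipode_apply: "dual_apply (antipode (dual_hopf H) \<phi>) h = dual_apply \<phi> (antipode H h)"
  by (simp add: dual_hopf_def dual_apply_Abs clinear_compose[OF clinear_dual_apply antipode_linear])

lemma dual_star_apply: "dual_apply (astar (dual_hopf H) \<phi>) h = cnj (dual_apply \<phi> (astar H (antipode H h)))"
proof -
  have "clinear (\<lambda>h. cnj (dual_apply \<phi> (astar H (antipode H h))))"
    by (rule clinearI)
      (simp_all add: clinear_simps[OF antipode_linear] astar_add astar_scale
        clinear_simps[OF clinear_dual_apply] scaleC_complex_def)
  then show ?thesis by (simp add: dual_hopf_def dual_apply_Abs)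
qed

lemma cbilinear_dual_mult: "cbilinear (amult (dual_hopf H))"
  by (rule cbilinearI; rule dual_eqI)
    (simp_all add: dual_mult_apply algebra_simps sweedler2_add sweedler2_scale)

lemma unital_algebra_dual: "unital_algebra (dual_hopf H)"
proof (rule unital_algebra.intro)
  fix \<phi> \<psi> \<chi> :: "'h dual"
  show "\<phi> \<odot>\<^bsub>dual_hopf H\<^esub> \<psi> \<odot>\<^bsub>dual_hopf H\<^esub> \<chi> = \<phi> \<odot>\<^bsub>dual_hopf H\<^esub> (\<psi> \<odot>\<^bsub>dual_hopf H\<^esub> \<chi>)"
  proof (rule dual_eqI)
    fix h
    have c: "clinear (\<lambda>x. x * c)" "clinear (\<lambda>x. c * x)" for c :: complex
      by (rule clinearI; simp add: scaleC_complex_def algebra_simps)+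
    have t: "ctrilinear (\<lambda>a b c. dual_apply \<phi> a * dual_apply \<psi> b * dual_apply \<chi> c)"
      by (rule ctrilinearI; rule clinearI;
          simp add: clinear_simps[OF clinear_dual_apply] scaleC_complex_def algebra_simps)
    show "dual_apply (\<phi> \<odot>\<^bsub>dual_hopf H\<^esub> \<psi> \<odot>\<^bsub>dual_hopf H\<^esub> \<chi>) h = dual_apply (\<phi> \<odot>\<^bsub>dual_hopf H\<^esub> (\<psi> \<odot>\<^bsub>dual_hopf H\<^esub> \<chi>)) h"
      using sweedler2_coassoc[OF t, of h]
      by (simp only: dual_mult_apply sweedler2_linear[OF c(1), symmetric]
          sweedler2_linear[OF c(2), symmetric] mult.assoc)
  qed
  show "\<one>\<^bsub>dual_hopf H\<^esub> \<odot>\<^bsub>dual_hopf H\<^esub> \<phi> = \<phi>" "\<phi> \<odot>\<^bsub>dual_hopf H\<^esub> \<one>\<^bsub>dual_hopf H\<^esub> = \<phi>"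
    using sweedler2_counit[OF clinear_dual_apply[of \<phi>]]
    by (auto intro!: dual_eqI simp: dual_mult_apply dual_one_apply scaleC_complex_def mult.commute)
  show "cbilinear (amult (dual_hopf H))" by (rule cbilinear_dual_mult)
qed

text \<open>The product of H^0 is dual to the coproduct of H, so A \<otimes> H^0 is the convolution
  algebra of maps from H to A. Identities in it become Sweedler computations in A.\<close>

lemma ev_mult:
  assumes A: "unital_algebra A"
  shows "ev h (s \<odot>\<^bsub>coef1 H A\<^esub> t) = sweedler2 H (\<lambda>a b. ev a s \<odot>\<^bsub>A\<^esub> ev b t) h"
proof -
  note m = tensor_algebra_mult(1)[OF A unital_algebra_dual]
    cbilinear_simps[OF tensor_algebra_mult(2)[OF A unital_algebra_dual]] clinear_simps[OF clinear_ev]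
    unital_algebra.amult_simps[OF A] sweedler2_add
  show ?thesis
  proof (induction s rule: tensor_induct)
    case (pure s1 s2)
    show ?case
    proof (induction t rule: tensor_induct)
      case (pure t1 t2)
      show ?case
        using sweedler2_linear[OF clinear_scaleC_left[of "s1 \<odot>\<^bsub>A\<^esub> t1"], of H
            "\<lambda>a b. dual_apply s2 a * dual_apply t2 b" h]
        by (simp add: m(1) ev_pure dual_mult_apply m(7-) mult.commute unital_algebra.amult_simps[OF A])
    qed (simp add: m)
  qed (simp add: m)
qed

lemma ev_one: "ev h \<one>\<^bsub>coef1 H A\<^esub> = counit H h *\<^sub>C \<one>\<^bsub>A\<^esub>"
  by (simp add: tensor_algebra_one ev_pure dual_one_apply)

lemma dual_comult: "dual_apply (ev l (comult (dual_hopf H) \<phi>)) h = dual_apply \<phi> (h \<odot> l)"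
proof -
  \<comment> \<open>The witness for the definite description in \<open>dual_hopf\<close>: the tensor
    whose coefficient at l is the functional h \<mapsto> \<phi>(h l).\<close>
  define t where "t = coeff_tensor (\<lambda>l. Abs_dual (\<lambda>h. dual_apply \<phi> (h \<odot> l)))"
  have 1: "clinear (\<lambda>h. dual_apply \<phi> (h \<odot> l))" for l
    by (rule clinear_compose[OF clinear_dual_apply unital.clinear_amult_left])
  have "clinear (\<lambda>l. Abs_dual (\<lambda>h. dual_apply \<phi> (h \<odot> l)))"
    by (rule clinearI; rule dual_eqI; simp only: dual_apply_Abs[OF 1] dual_apply_simps)
      (simp_all add: unital.amult_simps clinear_simps[OF clinear_dual_apply] scaleC_complex_def)
  then have ex: "\<forall>h l. dual_pairing2 t h l = dual_apply \<phi> (h \<odot> l)"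
    by (simp add: dual_pairing2_eq t_def ev_coeff_tensor[OF finite_dim] dual_apply_Abs[OF 1])
  have "comult (dual_hopf H) \<phi> = t"
    unfolding dual_hopf_def hopf_algebra.simps
  proof (rule the_equality)
    fix s assume "\<forall>h l. dual_pairing2 s h l = dual_apply \<phi> (h \<odot> l)"
    then show "s = t"
      using ex by (intro ev_eqI[OF finite_dim] dual_eqI) (simp add: dual_pairing2_eq)
  qed (rule ex)
  with ex show ?thesis by (simp add: dual_pairing2_eq)
qed

lemma dual_tensor_eqI:
  assumes "\<And>h l. dual_apply (ev l s) h = dual_apply (ev l t) h"
  shows "s = (t :: ('h dual, 'h dual) tensor)"
  by (intro ev_eqI[OF finite_dim] dual_eqI assms)

lemma clinear_dual_comult: "clinear (comult (dual_hopf H))"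
  by (rule clinearI; rule dual_tensor_eqI) (simp_all add: dual_comult clinear_simps[OF clinear_ev])

lemma clinear_comult_last: "clinear (comult_last H)"
proof -
  have "clinear (\<lambda>t. tensor_assoc (tensor_map id (comult (dual_hopf H)) t))"
    by (rule clinear_compose[OF clinear_tensor_assoc clinear_tensor_map]) (simp_all add: clinear_dual_comult)
  then show ?thesis by (simp add: comult_last_def[abs_def])
qed

text \<open>The coproduct of H^0 is dual to the product of H; \<open>ev l\<close> removes the last
  leg first, so l is the right factor.\<close>

lemma ev_comult_last: "ev h (ev l (comult_last H t)) = ev (h \<odot> l) t"
proof -
  have *: "ev h (ev l (tensor_assoc (a \<otimes>\<^sub>t s))) = dual_apply (ev l s) h *\<^sub>C a" for a :: "'z::complex_vector" and s
    by (rule tensor_eqI[of "\<lambda>s. ev h (ev l (tensor_assoc (a \<otimes>\<^sub>t s)))"])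
      (simp_all add: clinear_compose[OF clinear_ev] clinear_ev clinear_tensor_assoc pure_tensor_right
        clinear_compose[OF clinear_tensor_assoc] clinear_compose[OF clinear_scaleC_left]
        clinear_compose[OF clinear_eval] ev_pure mult.commute clinear_simps[OF clinear_ev])
  show ?thesis
    by (rule tensor_eqI[of "\<lambda>t. ev h (ev l (comult_last H t))"])
      (simp_all add: clinear_compose[OF clinear_ev] clinear_ev clinear_comult_last,
        simp add: comult_last_def clinear_dual_comult * dual_comult ev_pure)
qed

lemma ev2_eqI:
  assumes "\<And>(h :: 'h) (l :: 'h). ev h (ev l s) = ev h (ev l t)"
  shows "s = t"
  by (rule ev_eqI[OF finite_dim], rule ev_eqI[OF finite_dim], rule assms)

lemma comult_last_mult:
  assumes A: "unital_algebra A"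
  shows "comult_last H (s \<odot>\<^bsub>coef1 H A\<^esub> t) = comult_last H s \<odot>\<^bsub>coef2 H A\<^esub> comult_last H t"
proof (rule ev2_eqI)
  fix h l
  have b: "cbilinear (\<lambda>a b. ev a s \<odot>\<^bsub>A\<^esub> ev b t)"
    by (rule cbilinear_compose(1)[OF unital_algebra.cbilinear_amult[OF A] clinear_ev_arg clinear_ev_arg])
  have "ev h (ev l (comult_last H s \<odot>\<^bsub>coef2 H A\<^esub> comult_last H t))
      = sweedler2 H (\<lambda>c d. sweedler2 H (\<lambda>a b. ev (a \<odot> c) s \<odot>\<^bsub>A\<^esub> ev (b \<odot> d) t) h) l"
    by (simp add: ev_mult[OF unital_algebra_tensor[OF A unital_algebra_dual]]
        sweedler2_linear[OF clinear_ev, symmetric] ev_mult[OF A] ev_comult_last)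
  also have "\<dots> = sweedler2 H (\<lambda>a b. sweedler2 H (\<lambda>c d. ev (a \<odot> c) s \<odot>\<^bsub>A\<^esub> ev (b \<odot> d) t) l) h"
    by (rule sweedler2_swap)
  finally show "ev h (ev l (comult_last H (s \<odot>\<^bsub>coef1 H A\<^esub> t)))
      = ev h (ev l (comult_last H s \<odot>\<^bsub>coef2 H A\<^esub> comult_last H t))"
    by (simp add: ev_comult_last ev_mult[OF A] sweedler2_mult[OF b])
qed

lemma comult_last_one: "unital_algebra A \<Longrightarrow> comult_last H \<one>\<^bsub>coef1 H A\<^esub> = \<one>\<^bsub>coef2 H A\<^esub>"
  by (rule ev2_eqI)
    (simp add: ev_comult_last ev_one counit_mult clinear_simps[OF clinear_ev] mult.commute)

end

section \<open>Legs, antipode and the dual *-algebra\<close>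

text \<open>Leg notation: for t in A \<otimes> H^0 this and \<open>leg13\<close> are the elements
  t_12 and t_13 of A \<otimes> H^0 \<otimes> H^0. It also serves as a \<mapsto> a \<otimes>
  1.\<close>

definition leg12 :: "'h::complex_vector hopf_algebra \<Rightarrow> 'a::complex_vector \<Rightarrow> ('a, 'h dual) tensor"
  where "leg12 H t = t \<otimes>\<^sub>t \<one>\<^bsub>dual_hopf H\<^esub>"

definition leg13 ::
  "'h::complex_vector hopf_algebra \<Rightarrow> ('a::complex_vector, 'k::complex_vector) tensor \<Rightarrow> (('a, 'h dual) tensor, 'k) tensor"
  where "leg13 H = tensor_map (leg12 H) id"

lemma clinear_leg12: "clinear (leg12 H)"
  unfolding leg12_def[abs_def] by (rule pure_tensor_left)

lemma clinear_leg13: "clinear (leg13 H)"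
  unfolding leg13_def by (rule clinear_tensor_map) (simp_all add: clinear_leg12)

lemma leg13_pure: "leg13 H (a \<otimes>\<^sub>t k) = leg12 H a \<otimes>\<^sub>t k"
  by (simp add: leg13_def clinear_leg12)

lemma tensor_lift_pure_id: "tensor_lift (\<otimes>\<^sub>t) t = t"
  by (rule tensor_eqI[of "tensor_lift (\<otimes>\<^sub>t)" "\<lambda>t. t"]) (simp_all add: clinear_tensor_lift cbilinear_pure)

context cstar_hopf_algebra
begin

lemma ev_leg12: "ev h (leg12 H t) = counit H h *\<^sub>C t"
  by (simp add: leg12_def ev_pure dual_one_apply)

lemma ev_leg13: "ev l (leg13 H t) = leg12 H (ev l t)"
  by (simp add: leg13_def ev_tensor_map clinear_leg12)

lemma leg12_mult: "unital_algebra A \<Longrightarrow> leg12 H (s \<odot>\<^bsub>A\<^esub> t) = leg12 H s \<odot>\<^bsub>coef1 H A\<^esub> leg12 H t"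
  by (simp add: leg12_def tensor_algebra_mult unital_algebra_dual unital_algebra.amult_one_left)

lemma leg13_mult:
  assumes A: "unital_algebra A" and K: "unital_algebra K"
  shows "leg13 H (s \<odot>\<^bsub>tensor_algebra A K\<^esub> t) = leg13 H s \<odot>\<^bsub>tensor_algebra (coef1 H A) K\<^esub> leg13 H t"
  unfolding leg13_def
  by (rule tensor_map_mult)
    (simp_all add: A K unital_algebra_tensor unital_algebra_dual clinear_leg12 leg12_mult)

lemma leg12_one: "leg12 H \<one>\<^bsub>A\<^esub> = \<one>\<^bsub>coef1 H A\<^esub>"
  and leg13_one: "leg13 H \<one>\<^bsub>tensor_algebra A K\<^esub> = \<one>\<^bsub>tensor_algebra (coef1 H A) K\<^esub>"
  by (simp_all add: leg12_def tensor_algebra_one leg13_pure)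

lemma ev_leg12_mult:
  assumes A: "unital_algebra A"
  shows "ev h (s \<odot>\<^bsub>coef1 H A\<^esub> leg12 H x) = ev h s \<odot>\<^bsub>A\<^esub> x"
    and "ev h (leg12 H x \<odot>\<^bsub>coef1 H A\<^esub> s) = x \<odot>\<^bsub>A\<^esub> ev h s"
proof -
  note l = unital_algebra.clinear_amult_left[OF A] unital_algebra.clinear_amult_right[OF A]
  show "ev h (s \<odot>\<^bsub>coef1 H A\<^esub> leg12 H x) = ev h s \<odot>\<^bsub>A\<^esub> x"
    using sweedler2_counit(2)[where f = "\<lambda>a. ev a s \<odot>\<^bsub>A\<^esub> x" and h = h, OF clinear_compose[OF l(1) clinear_ev_arg]]
    by (simp add: ev_mult[OF A] ev_leg12 unital_algebra.amult_simps[OF A])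
  show "ev h (leg12 H x \<odot>\<^bsub>coef1 H A\<^esub> s) = x \<odot>\<^bsub>A\<^esub> ev h s"
    using sweedler2_counit(1)[where f = "\<lambda>a. x \<odot>\<^bsub>A\<^esub> ev a s" and h = h, OF clinear_compose[OF l(2) clinear_ev_arg]]
    by (simp add: ev_mult[OF A] ev_leg12 unital_algebra.amult_simps[OF A])
qed

text \<open>In each copy of H^0 one of the two factors is the unit, so both convolutions collapse by
  the counit law.\<close>

lemma ev_legs:
  assumes A: "unital_algebra A"
  shows "ev h (ev l (leg12 H s \<odot>\<^bsub>coef2 H A\<^esub> leg13 H t)) = ev h s \<odot>\<^bsub>A\<^esub> ev l t"
    and "ev h (ev l (leg13 H t \<odot>\<^bsub>coef2 H A\<^esub> leg12 H s)) = ev l t \<odot>\<^bsub>A\<^esub> ev h s"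
  by (simp_all add: ev_leg12_mult unital_algebra_tensor[OF A unital_algebra_dual] ev_leg13 A)

lemma antipode_one: "antipode H \<one> = \<one>"
proof -
  have "cbilinear (\<lambda>a b. antipode H a \<odot> b)"
    by (rule cbilinear_compose(1)[OF unital.cbilinear_amult antipode_linear clinear_id(2)])
  from sweedler2_one[OF this] show ?thesis
    using antipode_left[of \<one>] by (simp add: counit_one amult_one_right scaleC_one)
qed

lemma counit_antipode: "counit H (antipode H h) = counit H h"
proof -
  have "sweedler2 H (\<lambda>a b. counit H (antipode H a \<odot> b)) h = counit H h"
    using sweedler2_antipode(1)[OF counit_linear] by (simp add: counit_one scaleC_complex_def)
  then show ?thesis
    using sweedler2_counit(2)[OF clinear_compose[OF counit_linear antipode_linear]]
    by (simp add: counit_mult scaleC_complex_def mult.commute)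
qed

text \<open>The antipode law says that id and S are convolution inverses. As invertibility in H
  \<otimes> H^0 it reduces laws for S to uniqueness of inverses.\<close>

lemma coeff_inverse:
  "coeff_tensor id \<odot>\<^bsub>coef1 H H\<^esub> coeff_tensor (antipode H) = \<one>\<^bsub>coef1 H H\<^esub>"
  "coeff_tensor (antipode H) \<odot>\<^bsub>coef1 H H\<^esub> coeff_tensor id = \<one>\<^bsub>coef1 H H\<^esub>"
  by (rule ev_eqI[OF finite_dim];
      simp add: ev_mult[OF unital.unital_algebra_axioms] ev_one ev_coeff_tensor[OF finite_dim]
        antipode_linear antipode_left antipode_right)+

text \<open>The dual coproduct takes \<open>?I\<close> to the product of its legs 12 and 13, so the
  inverse of that product can be written in two ways: as the dual coproduct of \<open>?J\<close>,
  and as the reversed product of the legs of \<open>?J\<close>. Coefficients at h and l give the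
  claim.\<close>

lemma antipode_mult: "antipode H (h \<odot> l) = antipode H l \<odot> antipode H h"
proof -
  let ?I = "coeff_tensor id :: ('h, 'h dual) tensor" and ?J = "coeff_tensor (antipode H)"
  note H = unital.unital_algebra_axioms
  note H1 = unital_algebra_tensor[OF H unital_algebra_dual]
  note H2 = unital_algebra_tensor[OF H1 unital_algebra_dual]
  note assoc = unital_algebra.amult_assoc[OF H2]
  note evs = ev_coeff_tensor[OF finite_dim clinear_id(1)] ev_coeff_tensor[OF finite_dim antipode_linear]
  have I: "comult_last H ?I = leg12 H ?I \<odot>\<^bsub>coef2 H H\<^esub> leg13 H ?I"
    by (rule ev2_eqI) (simp add: ev_comult_last ev_legs H evs)
  have JI: "comult_last H ?J \<odot>\<^bsub>coef2 H H\<^esub> comult_last H ?I = \<one>\<^bsub>coef2 H H\<^esub>"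
    by (simp flip: comult_last_mult[OF H] add: coeff_inverse comult_last_one H)
  have "leg12 H ?I \<odot>\<^bsub>coef2 H H\<^esub> leg13 H ?I \<odot>\<^bsub>coef2 H H\<^esub> (leg13 H ?J \<odot>\<^bsub>coef2 H H\<^esub> leg12 H ?J)
    = leg12 H ?I \<odot>\<^bsub>coef2 H H\<^esub> ((leg13 H ?I \<odot>\<^bsub>coef2 H H\<^esub> leg13 H ?J) \<odot>\<^bsub>coef2 H H\<^esub> leg12 H ?J)"
    by (simp add: assoc)
  also have "\<dots> = \<one>\<^bsub>coef2 H H\<^esub>"
    by (simp flip: leg13_mult[OF H unital_algebra_dual] leg12_mult[OF H1]
        add: coeff_inverse leg13_one leg12_one unital_algebra.amult_one_left[OF H2])
  finally have "comult_last H ?J = leg13 H ?J \<odot>\<^bsub>coef2 H H\<^esub> leg12 H ?J"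
    using JI I assoc unital_algebra.amult_one_left[OF H2] unital_algebra.amult_one_right[OF H2] by metis
  then have "ev h (ev l (comult_last H ?J)) = ev h (ev l (leg13 H ?J \<odot>\<^bsub>coef2 H H\<^esub> leg12 H ?J))"
    by simp
  then show ?thesis by (simp add: ev_comult_last ev_legs H evs)
qed

lemma comult_sweedler: "comult H h = sweedler2 H (\<otimes>\<^sub>t) h"
  by (simp add: sweedler2_def tensor_lift_pure_id)

text \<open>The argument of \<open>antipode_mult\<close> with \<Delta> applied to the first factor
  in place of the dual coproduct in the second.\<close>

lemma comult_antipode: "comult H (antipode H h) = sweedler2 H (\<lambda>a b. antipode H b \<otimes>\<^sub>t antipode H a) h"
proof -
  let ?I = "coeff_tensor id :: ('h, 'h dual) tensor" and ?J = "coeff_tensor (antipode H)"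
  let ?l = "tensor_map (\<lambda>x. x \<otimes>\<^sub>t \<one>) id" and ?r = "tensor_map (\<lambda>x. \<one> \<otimes>\<^sub>t x) id"
  let ?D = "tensor_map (comult H) id" and ?K = "coef1 H (tensor_algebra H H)"
  note H = unital.unital_algebra_axioms
  note HH = unital_algebra_tensor[OF H H]
  note alg = unital_algebra_tensor[OF HH unital_algebra_dual]
  note assoc = unital_algebra.amult_assoc[OF alg]
  note evs = ev_coeff_tensor[OF finite_dim clinear_id(1)] ev_coeff_tensor[OF finite_dim antipode_linear]
    ev_tensor_map[OF pure_tensor_left] ev_tensor_map[OF pure_tensor_right] ev_tensor_map[OF comult_linear]
    ev_mult[OF HH] tensor_algebra_mult[OF H H] amult_one_left amult_one_right
  have m: "?l (s \<odot>\<^bsub>coef1 H H\<^esub> t) = ?l s \<odot>\<^bsub>?K\<^esub> ?l t" "?r (s \<odot>\<^bsub>coef1 H H\<^esub> t) = ?r s \<odot>\<^bsub>?K\<^esub> ?r t"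
    "?D (s \<odot>\<^bsub>coef1 H H\<^esub> t) = ?D s \<odot>\<^bsub>?K\<^esub> ?D t" for s t
    by (rule tensor_map_mult;
        simp add: H HH unital_algebra_dual pure_tensor_left pure_tensor_right comult_linear comult_mult
          tensor_algebra_mult[OF H H] amult_one_left)+
  have o: "?l \<one>\<^bsub>coef1 H H\<^esub> = \<one>\<^bsub>?K\<^esub>" "?r \<one>\<^bsub>coef1 H H\<^esub> = \<one>\<^bsub>?K\<^esub>" "?D \<one>\<^bsub>coef1 H H\<^esub> = \<one>\<^bsub>?K\<^esub>"
    by (simp_all add: tensor_algebra_one pure_tensor_left pure_tensor_right comult_linear comult_one)
  have I: "?D ?I = ?l ?I \<odot>\<^bsub>?K\<^esub> ?r ?I"
    by (rule ev_eqI[OF finite_dim]) (simp add: evs comult_sweedler)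
  have JI: "?D ?J \<odot>\<^bsub>?K\<^esub> ?D ?I = \<one>\<^bsub>?K\<^esub>"
    by (simp flip: m add: coeff_inverse o)
  have "?l ?I \<odot>\<^bsub>?K\<^esub> ?r ?I \<odot>\<^bsub>?K\<^esub> (?r ?J \<odot>\<^bsub>?K\<^esub> ?l ?J) = ?l ?I \<odot>\<^bsub>?K\<^esub> ((?r ?I \<odot>\<^bsub>?K\<^esub> ?r ?J) \<odot>\<^bsub>?K\<^esub> ?l ?J)"
    by (simp add: assoc)
  also have "\<dots> = \<one>\<^bsub>?K\<^esub>"
    by (simp flip: m add: coeff_inverse o unital_algebra.amult_one_left[OF alg])
  finally have "?D ?J = ?r ?J \<odot>\<^bsub>?K\<^esub> ?l ?J"
    using JI I assoc unital_algebra.amult_one_left[OF alg] unital_algebra.amult_one_right[OF alg] by metis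
  then have "ev h (?D ?J) = ev h (?r ?J \<odot>\<^bsub>?K\<^esub> ?l ?J)" by simp
  then show ?thesis by (simp add: evs)
qed

lemma sweedler2_antipode_arg:
  assumes f: "cbilinear f"
  shows "sweedler2 H f (antipode H h) = sweedler2 H (\<lambda>a b. f (antipode H b) (antipode H a)) h"
  using sweedler2_linear[OF clinear_tensor_lift[OF f], of H "\<lambda>a b. antipode H b \<otimes>\<^sub>t antipode H a" h]
  by (simp add: sweedler2_def[of H f] comult_antipode f)

text \<open>Let K be S conjugated by the involution. The adjoint of the antipode law is K(h_(2))
  h_(1) = \<epsilon>(h) 1, and applying S to it makes S K a right convolution inverse of S. The
  identity is a left one, so S K = id.\<close>

lemma antipode_star_antipode_star: "antipode H (astar H (antipode H (astar H h))) = h"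
proof -
  let ?K = "\<lambda>h. astar H (antipode H (astar H h))"
  let ?I = "coeff_tensor id :: ('h, 'h dual) tensor" and ?J = "coeff_tensor (antipode H)"
  let ?X = "coeff_tensor (\<lambda>h. antipode H (?K h)) :: ('h, 'h dual) tensor"
  note H = unital.unital_algebra_axioms
  note H1 = unital_algebra_tensor[OF H unital_algebra_dual]
  have X: "clinear (\<lambda>h. antipode H (?K h))"
    by (rule clinearI) (simp_all add: astar_add astar_scale clinear_simps[OF antipode_linear])
  have b: "cbilinear (\<lambda>a b. a \<odot> antipode H b)"
    by (rule cbilinear_compose(1)[OF unital.cbilinear_amult clinear_id(2) antipode_linear])
  have K: "sweedler2 H (\<lambda>a b. ?K b \<odot> a) h = counit H h *\<^sub>C \<one>" for h
  proof -
    have "sweedler2 H (\<lambda>a b. ?K b \<odot> a) h = sweedler2 H (\<lambda>a b. astar H (astar H a \<odot> antipode H (astar H b))) h"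
      by (simp add: astar_mult astar_astar)
    also have "\<dots> = astar H (sweedler2 H (\<lambda>a b. a \<odot> antipode H b) (astar H h))"
      unfolding sweedler2_star[OF b] by (rule sweedler2_hom) (simp_all add: astar_zero astar_add)
    finally show ?thesis by (simp add: antipode_right astar_scale astar_one counit_star)
  qed
  have "sweedler2 H (\<lambda>a b. antipode H a \<odot> antipode H (?K b)) h = counit H h *\<^sub>C \<one>" for h
    using sweedler2_linear[OF antipode_linear, of H "\<lambda>a b. ?K b \<odot> a" h] K[of h]
    by (simp add: antipode_mult clinear_simps[OF antipode_linear] antipode_one)
  then have "?J \<odot>\<^bsub>coef1 H H\<^esub> ?X = \<one>\<^bsub>coef1 H H\<^esub>"
    by (intro ev_eqI[OF finite_dim])
      (simp add: ev_mult[OF H] ev_one ev_coeff_tensor[OF finite_dim] antipode_linear X)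
  then have "?X = ?I"
    using coeff_inverse(1) unital_algebra.amult_assoc[OF H1] unital_algebra.amult_one_left[OF H1]
      unital_algebra.amult_one_right[OF H1] by metis
  then have "ev h ?X = ev h ?I" by simp
  then show ?thesis by (simp add: ev_coeff_tensor[OF finite_dim] X)
qed

lemma antipode_star_antipode: "antipode H (astar H (antipode H h)) = astar H h"
  using antipode_star_antipode_star[of "astar H h"] by (simp add: astar_astar)

lemma antipode_eq_iff: "antipode H h = antipode H l \<longleftrightarrow> h = l"
  by (metis antipode_star_antipode astar_astar)

text \<open>Involutivity comes from \<open>antipode_star_antipode\<close>, antimultiplicativity from
  the flip of the coproduct by S.\<close>

lemma unital_star_algebra_dual: "unital_star_algebra (dual_hopf H)"
proof (rule unital_star_algebraI)
  show "unital_algebra (dual_hopf H)" by (rule unital_algebra_dual)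
  fix \<phi> \<psi> :: "'h dual" and c
  show "astar (dual_hopf H) (astar (dual_hopf H) \<phi>) = \<phi>"
    by (rule dual_eqI) (simp add: dual_star_apply antipode_star_antipode astar_astar)
  show "astar (dual_hopf H) (\<phi> + \<psi>) = astar (dual_hopf H) \<phi> + astar (dual_hopf H) \<psi>"
    "astar (dual_hopf H) (c *\<^sub>C \<phi>) = cnj c *\<^sub>C astar (dual_hopf H) \<phi>"
    by (rule dual_eqI; simp add: dual_star_apply)+
  show "astar (dual_hopf H) (\<phi> \<odot>\<^bsub>dual_hopf H\<^esub> \<psi>) = astar (dual_hopf H) \<psi> \<odot>\<^bsub>dual_hopf H\<^esub> astar (dual_hopf H) \<phi>"
  proof (rule dual_eqI)
    fix h
    let ?s = "\<lambda>h. astar H (antipode H h)"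
    have b: "balanced_on UNIV (\<lambda>a b. cnj (dual_apply \<phi> (astar H a) * dual_apply \<psi> (astar H b)))"
      by (simp add: balanced_on_def astar_add astar_scale clinear_simps[OF clinear_dual_apply]
          scaleC_complex_def algebra_simps)
    \<comment> \<open>The conjugation outside and the involution inside cancel, so this form is
      bilinear and the coproduct rule for S applies.\<close>
    have b': "cbilinear (\<lambda>a b. cnj (dual_apply \<phi> (astar H a) * dual_apply \<psi> (astar H b)))"
      by (rule cbilinearI) (simp_all add: astar_add astar_scale clinear_simps[OF clinear_dual_apply]
          scaleC_complex_def algebra_simps)
    have "dual_apply (astar (dual_hopf H) (\<phi> \<odot>\<^bsub>dual_hopf H\<^esub> \<psi>)) h
      = cnj (sweedler2 H (\<lambda>a b. dual_apply \<phi> (astar H a) * dual_apply \<psi> (astar H b)) (antipode H h))"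
      by (simp add: dual_star_apply dual_mult_apply sweedler2_star cbilinear_dual_apply)
    also have "\<dots> = sweedler2 H (\<lambda>a b. cnj (dual_apply \<phi> (astar H a) * dual_apply \<psi> (astar H b))) (antipode H h)"
      by (rule sweedler2_hom[symmetric]) simp_all
    also have "\<dots> = sweedler2 H (\<lambda>a b. cnj (dual_apply \<phi> (?s b) * dual_apply \<psi> (?s a))) h"
      by (rule sweedler2_antipode_arg[OF b'])
    finally show "dual_apply (astar (dual_hopf H) (\<phi> \<odot>\<^bsub>dual_hopf H\<^esub> \<psi>)) h
      = dual_apply (astar (dual_hopf H) \<psi> \<odot>\<^bsub>dual_hopf H\<^esub> astar (dual_hopf H) \<phi>) h"
      by (simp add: dual_mult_apply dual_star_apply mult.commute)
  qed
qed

lemma unital_star_algebra_coef1: "unital_star_algebra A \<Longrightarrow> unital_star_algebra (coef1 H A)"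
  by (rule unital_star_algebra_tensor[OF _ unital_star_algebra_dual])

lemma ev_star:
  assumes A: "unital_star_algebra A"
  shows "ev h (astar (coef1 H A) t) = astar A (ev (astar H (antipode H h)) t)"
  by (induction t rule: tensor_induct)
    (simp_all add: tensor_algebra_star[OF A unital_star_algebra_dual] ev_pure dual_star_apply
      clinear_simps[OF clinear_ev] unital_star_algebra.astar_simps[OF A])

lemma unital_star_hom_comult_last:
  assumes A: "unital_star_algebra A"
  shows "unital_star_hom (coef1 H A) (coef2 H A) (comult_last H)"
proof -
  note u = unital_star_algebra_unital[OF A]
  have "comult_last H (astar (coef1 H A) t) = astar (coef2 H A) (comult_last H t)" for t
    by (rule ev2_eqI)
      (simp add: ev_comult_last ev_star A unital_star_algebra_coef1 antipode_mult astar_mult)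
  then show ?thesis
    by (simp add: unital_star_hom_def clinear_comult_last comult_last_mult comult_last_one u)
qed

lemma unital_star_hom_leg12: "unital_star_algebra A \<Longrightarrow> unital_star_hom A (coef1 H A) (leg12 H)"
  unfolding leg12_def[abs_def] by (rule unital_star_hom_left[OF _ unital_star_algebra_dual])

lemma unital_star_hom_leg13:
  "unital_star_algebra A \<Longrightarrow> unital_star_hom (coef1 H A) (coef2 H A) (leg13 H)"
  unfolding leg13_def
  by (rule unital_star_hom_tensor_map)
    (simp_all add: unital_star_algebra_dual unital_star_algebra_coef1 unital_star_hom_leg12 unital_star_hom_id)

end

section \<open>Eigenvectors, traces and inner products in finite dimension\<close>

definition poly_map :: "('v::complex_vector \<Rightarrow> 'v) \<Rightarrow> complex poly \<Rightarrow> 'v \<Rightarrow> 'v"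
  where "poly_map f p v = (\<Sum>i\<le>degree p. coeff p i *\<^sub>C (f ^^ i) v)"

lemma poly_map_eq: "degree p \<le> n \<Longrightarrow> poly_map f p v = (\<Sum>i\<le>n. coeff p i *\<^sub>C (f ^^ i) v)"
  unfolding poly_map_def by (intro sum.mono_neutral_left) (auto simp: coeff_eq_0)

lemma poly_map_factor:
  assumes f: "clinear f"
  shows "poly_map f ([:- c, 1:] * q) v = f (poly_map f q v) - c *\<^sub>C poly_map f q v"
proof -
  let ?n = "degree q"
  have p: "[:- c, 1:] * q = pCons 0 q - smult c q" by simp
  have "degree ([:- c, 1:] * q) \<le> Suc ?n"
    by (rule order_trans[OF degree_mult_le]) simp
  then have d: "degree (pCons 0 q - smult c q) \<le> Suc ?n" unfolding p .
  have "poly_map f ([:- c, 1:] * q) v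
    = (\<Sum>i\<le>Suc ?n. coeff (pCons 0 q) i *\<^sub>C (f ^^ i) v - (c * coeff q i) *\<^sub>C (f ^^ i) v)"
    unfolding p poly_map_eq[OF d] by (simp add: cvector.scale_left_diff_distrib del: sum.atMost_Suc)
  also have "\<dots> = (\<Sum>i\<le>Suc ?n. coeff (pCons 0 q) i *\<^sub>C (f ^^ i) v) - c *\<^sub>C (\<Sum>i\<le>Suc ?n. coeff q i *\<^sub>C (f ^^ i) v)"
    by (simp add: sum_subtractf cvector.scale_sum_right scaleC_scaleC del: sum.atMost_Suc)
  also have "(\<Sum>i\<le>Suc ?n. coeff q i *\<^sub>C (f ^^ i) v) = poly_map f q v"
    by (rule poly_map_eq[symmetric]) simp
  also have "(\<Sum>i\<le>Suc ?n. coeff (pCons 0 q) i *\<^sub>C (f ^^ i) v) = f (poly_map f q v)"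
    unfolding poly_map_def sum.atMost_Suc_shift by (simp add: clinear_simps[OF f])
  finally show ?thesis .
qed

lemma exists_annihilating_poly:
  assumes fd: "finite_dim TYPE('v::complex_vector)" and f: "clinear (f :: 'v \<Rightarrow> 'v)"
  shows "\<exists>p. p \<noteq> 0 \<and> poly_map f p v = 0"
proof -
  obtain b :: "'v set" where b: "finite b" "cspan b = UNIV" using fd unfolding finite_dim_def by blast
  define n where "n = card b"
  define g where "g i = (f ^^ i) v" for i
  show ?thesis
  \<comment> \<open>Linear dependence is a notion for sets, so a repetition among the n + 1 iterates
    is treated apart; there a difference of two monomials annihilates v.\<close>
  proof (cases "inj_on g {..n}")
    case False
    then obtain i j where ij: "i \<le> n" "j \<le> n" "i \<noteq> j" "g i = g j" by (auto simp: inj_on_def)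
    define p :: "complex poly" where "p = monom 1 i - monom 1 j"
    have "coeff p i = 1" using ij by (simp add: p_def)
    then have "p \<noteq> 0" by auto
    moreover have "degree p \<le> max i j" unfolding p_def
      by (intro degree_diff_le) (auto simp: degree_monom_eq)
    then have "poly_map f p v = (\<Sum>k\<le>max i j. ((if i = k then 1 else 0) - (if j = k then 1 else 0)) *\<^sub>C g k)"
      by (simp add: poly_map_eq p_def g_def)
    then have "poly_map f p v = (\<Sum>k\<le>max i j. (if i = k then g k else 0) - (if j = k then g k else 0))"
      by (simp add: cvector.scale_left_diff_distrib if_distrib[of "\<lambda>c. c *\<^sub>C _"] scaleC_one cong: if_cong)
    then have "poly_map f p v = 0" using ij by (simp add: sum_subtractf)
    ultimately show ?thesis by blast
  next
    case True
    have "cvector.dependent (g ` {..n})"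
    proof (rule ccontr)
      assume "cvector.independent (g ` {..n})"
      then have "card (g ` {..n}) \<le> card b"
        using cvector.independent_span_bound[OF b(1)] b(2) by auto
      then show False using card_image[OF True] by (simp add: n_def)
    qed
    then obtain c where c: "(\<Sum>x\<in>g ` {..n}. c x *\<^sub>C x) = 0" "\<exists>x\<in>g ` {..n}. c x \<noteq> 0"
      unfolding cvector.dependent_finite[OF finite_imageI[OF finite_atMost]] by blast
    then obtain i where i: "i \<le> n" "c (g i) \<noteq> 0" by auto
    define p where "p = (\<Sum>k\<le>n. monom (c (g k)) k)"
    have co: "coeff p k = (if k \<le> n then c (g k) else 0)" for k
      by (simp add: p_def coeff_sum)
    then have "coeff p i \<noteq> 0" using i by simp
    then have "p \<noteq> 0" by auto
    moreover have "degree p \<le> n" by (rule degree_le) (simp add: co)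
    then have "poly_map f p v = (\<Sum>k\<le>n. c (g k) *\<^sub>C g k)"
      by (simp add: poly_map_eq co g_def)
    then have "poly_map f p v = 0"
      using c(1) by (simp add: sum.reindex[OF True])
    ultimately show ?thesis by blast
  qed
qed

text \<open>Take a polynomial p of least degree with p(f) v in U and a root c of it. With p = (x -
  c) q, the vector w = q(f) v is outside U by minimality.\<close>

lemma exists_eigenvector_mod:
  assumes fd: "finite_dim TYPE('v::complex_vector)" and f: "clinear (f :: 'v \<Rightarrow> 'v)"
    and U: "csubspace U" and v: "v \<notin> U"
  shows "\<exists>w c. w \<notin> U \<and> f w - c *\<^sub>C w \<in> U"
proof -
  let ?P = "\<lambda>n. \<exists>p. p \<noteq> 0 \<and> poly_map f p v \<in> U \<and> degree p = n"
  obtain p0 where "p0 \<noteq> 0" "poly_map f p0 v = 0" using exists_annihilating_poly[OF fd f] by blast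
  then have "?P (degree p0)" using cvector.subspace_0[OF U] by metis
  then have L: "?P (LEAST n. ?P n)" by (rule LeastI)
  then obtain p where p: "p \<noteq> 0" "poly_map f p v \<in> U" "degree p = (LEAST n. ?P n)" by blast
  have "degree p \<noteq> 0"
  proof
    assume d: "degree p = 0"
    then have c0: "coeff p 0 \<noteq> 0" using p(1) leading_coeff_0_iff[of p] by auto
    have "coeff p 0 *\<^sub>C v \<in> U" using p(2) d by (simp add: poly_map_def)
    then have "(1 / coeff p 0) *\<^sub>C (coeff p 0 *\<^sub>C v) \<in> U" by (rule cvector.subspace_scale[OF U])
    then show False using v c0 by (simp add: scaleC_scaleC scaleC_one)
  qed
  then obtain c where "poly p c = 0"
    using fundamental_theorem_of_algebra_alt[of p] p(1) by (metis degree_pCons_0)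
  then obtain q where q: "p = [:- c, 1:] * q" by (metis poly_eq_0_iff_dvd dvdE)
  then have "q \<noteq> 0" using p(1) by auto
  then have "degree p = Suc (degree q)" unfolding q by (subst degree_mult_eq) auto
  then have "degree q < (LEAST n. ?P n)" using p(3) by simp
  then have "poly_map f q v \<notin> U" using \<open>q \<noteq> 0\<close> not_less_Least[of "degree q" ?P] by blast
  moreover have "f (poly_map f q v) - c *\<^sub>C poly_map f q v \<in> U"
    using p(2) unfolding q poly_map_factor[OF f] .
  ultimately show ?thesis by blast
qed

text \<open>An eigenvector modulo the span of the eigenvectors can be corrected, by semisimplicity, to an eigenvector.\<close>

lemma eigenvectors_span:
  assumes fd: "finite_dim TYPE('v::complex_vector)" and f: "clinear (f :: 'v \<Rightarrow> 'v)"
    and ss: "\<And>c v. f (f v - c *\<^sub>C v) = c *\<^sub>C (f v - c *\<^sub>C v) \<Longrightarrow> f v = c *\<^sub>C v"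
  shows "cspan {v. \<exists>c. f v = c *\<^sub>C v} = UNIV"
proof (rule ccontr)
  define E where "E = {v. \<exists>c. f v = c *\<^sub>C v}"
  assume "cspan E \<noteq> UNIV"
  then obtain v where "v \<notin> cspan E" by blast
  then obtain w c where w: "w \<notin> cspan E" "f w - c *\<^sub>C w \<in> cspan E"
    using exists_eigenvector_mod[OF fd f cvector.subspace_span] by blast
  obtain t r where t: "finite t" "t \<subseteq> E" "f w - c *\<^sub>C w = (\<Sum>e\<in>t. r e *\<^sub>C e)"
    using w(2) unfolding cvector.span_explicit by auto
  have "\<forall>e\<in>E. \<exists>c. f e = c *\<^sub>C e" by (simp add: E_def)
  then obtain m where m: "\<And>e. e \<in> E \<Longrightarrow> f e = m e *\<^sub>C e" using bchoice[of E "\<lambda>e c. f e = c *\<^sub>C e"] by blast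
  \<comment> \<open>The summands of (f - c) w with eigenvalue other than c lie in the range of f - c
    on the span; z is their preimage, so f - c moves w - z to a sum of eigenvectors for c
    alone.\<close>
  define z where "z = (\<Sum>e\<in>{e\<in>t. m e \<noteq> c}. (r e / (m e - c)) *\<^sub>C e)"
  have "z \<in> cspan E" unfolding z_def
    using t(2) by (intro cvector.span_sum cvector.span_scale cvector.span_base) auto
  then have w': "w - z \<notin> cspan E" using w(1) cvector.span_add[of "w - z" E z] by auto
  have "f z - c *\<^sub>C z = (\<Sum>e\<in>{e\<in>t. m e \<noteq> c}. (r e / (m e - c)) *\<^sub>C (f e - c *\<^sub>C e))"
    unfolding z_def by (simp add: clinear_simps[OF f] cvector.scale_sum_right scaleC_scaleC
        cvector.scale_right_diff_distrib sum_subtractf mult.commute)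
  also have "\<dots> = (\<Sum>e\<in>{e\<in>t. m e \<noteq> c}. r e *\<^sub>C e)"
  proof (rule sum.cong)
    fix e assume "e \<in> {e\<in>t. m e \<noteq> c}"
    then have "f e = m e *\<^sub>C e" "m e \<noteq> c" using m t(2) by auto
    then show "(r e / (m e - c)) *\<^sub>C (f e - c *\<^sub>C e) = r e *\<^sub>C e"
      by (simp add: scaleC_scaleC cvector.scale_left_diff_distrib[symmetric])
  qed simp
  finally have "f (w - z) - c *\<^sub>C (w - z) = (\<Sum>e\<in>t. r e *\<^sub>C e) - (\<Sum>e\<in>{e\<in>t. m e \<noteq> c}. r e *\<^sub>C e)"
    using t(3) by (simp add: clinear_simps[OF f] cvector.scale_right_diff_distrib algebra_simps)
  also have "\<dots> = (\<Sum>e\<in>{e\<in>t. m e = c}. r e *\<^sub>C e)"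
  proof -
    have "t = {e\<in>t. m e \<noteq> c} \<union> {e\<in>t. m e = c}" by auto
    then have "(\<Sum>e\<in>t. r e *\<^sub>C e) = (\<Sum>e\<in>{e\<in>t. m e \<noteq> c}. r e *\<^sub>C e) + (\<Sum>e\<in>{e\<in>t. m e = c}. r e *\<^sub>C e)"
      using t(1) by (subst sum.union_disjoint[symmetric]) auto
    then show ?thesis by simp
  qed
  finally have *: "f (w - z) - c *\<^sub>C (w - z) = (\<Sum>e\<in>{e\<in>t. m e = c}. r e *\<^sub>C e)" .
  have "f (\<Sum>e\<in>{e\<in>t. m e = c}. r e *\<^sub>C e) = c *\<^sub>C (\<Sum>e\<in>{e\<in>t. m e = c}. r e *\<^sub>C e)"
    unfolding clinear_simps[OF f] cvector.scale_sum_right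
    using m t(2) by (intro sum.cong) (auto simp: scaleC_scaleC mult.commute)
  then have "f (f (w - z) - c *\<^sub>C (w - z)) = c *\<^sub>C (f (w - z) - c *\<^sub>C (w - z))" unfolding * .
  then have "f (w - z) = c *\<^sub>C (w - z)" by (rule ss)
  then have "w - z \<in> cspan E" by (intro cvector.span_base) (auto simp: E_def)
  with w' show False by blast
qed

section \<open>Traces and orthonormal bases\<close>

definition ctrace :: "('h::complex_vector \<Rightarrow> 'h) \<Rightarrow> complex"
  where "ctrace f = (\<Sum>b\<in>fbasis TYPE('h). fcoord b (f b))"

text \<open>Any resolution of the identity by functionals c_i and vectors v_i computes the trace:
  expand each basis vector in the v_i and resum. It is used with eigenvectors and with orthonormal
  bases.\<close>

lemma ctrace_expansion:
  assumes fd: "finite_dim TYPE('h::complex_vector)" and f: "clinear (f :: 'h \<Rightarrow> 'h)"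
    and c: "\<And>i. i \<in> I \<Longrightarrow> clinear (c i)" and ex: "\<And>x. (\<Sum>i\<in>I. c i x *\<^sub>C v i) = x"
  shows "ctrace f = (\<Sum>i\<in>I. c i (f (v i)))"
proof -
  have "fcoord b (f b) = (\<Sum>i\<in>I. c i b * fcoord b (f (v i)))" for b :: 'h
  proof -
    have "f b = (\<Sum>i\<in>I. c i b *\<^sub>C f (v i))"
      by (subst ex[of b, symmetric]) (simp add: clinear_simps[OF f])
    then show ?thesis by (simp add: clinear_simps[OF clinear_fcoord[OF fd]] scaleC_complex_def)
  qed
  then have "ctrace f = (\<Sum>i\<in>I. \<Sum>b\<in>fbasis TYPE('h). fcoord b (f (v i)) * c i b)"
    unfolding ctrace_def by (subst sum.swap) (simp add: mult.commute)
  also have "\<dots> = (\<Sum>i\<in>I. c i (\<Sum>b\<in>fbasis TYPE('h). fcoord b (f (v i)) *\<^sub>C b))"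
    by (intro sum.cong) (auto simp: clinear_simps[OF c] scaleC_complex_def)
  finally show ?thesis by (simp add: fcoord_expand[OF fd])
qed

lemma ctrace_commute:
  assumes fd: "finite_dim TYPE('h::complex_vector)" and f: "clinear f" and g: "clinear (g :: 'h \<Rightarrow> 'h)"
  shows "ctrace (\<lambda>x. f (g x)) = ctrace (\<lambda>x. g (f x))"
proof -
  have "fcoord b (f (g b)) = (\<Sum>c\<in>fbasis TYPE('h). fcoord c (g b) * fcoord b (f c))"
    if "clinear f" for f g :: "'h \<Rightarrow> 'h" and b
  proof -
    have "f (g b) = (\<Sum>c\<in>fbasis TYPE('h). fcoord c (g b) *\<^sub>C f c)"
      by (subst fcoord_expand[OF fd, of "g b", symmetric]) (simp add: clinear_simps[OF that])
    then show ?thesis by (simp add: clinear_simps[OF clinear_fcoord[OF fd]] scaleC_complex_def)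
  qed
  from this[OF f, of _ g] this[OF g, of _ f] show ?thesis
    unfolding ctrace_def by (simp only:) (subst sum.swap, simp add: mult.commute)
qed

text \<open>Used for two inner products on H: the trace form, and the weighted trace form for which
  S^2 is positive.\<close>

locale positive_form =
  fixes B :: "'h::complex_vector \<Rightarrow> 'h \<Rightarrow> complex"
  assumes linear: "clinear (B x)"
    and hermitian: "B y x = cnj (B x y)"
    and positive: "x \<noteq> 0 \<Longrightarrow> Re (B x x) > 0"
begin

lemma B_real: "B x x = of_real (Re (B x x))"
  using hermitian[of x x] by (simp add: complex_eq_iff)

lemma gram_schmidt:
  assumes "finite S"
  shows "\<exists>E. finite E \<and> (\<forall>e\<in>E. \<forall>e'\<in>E. B e e' = (if e = e' then 1 else 0)) \<and> S \<subseteq> cspan E"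
  using assms
proof (induction S)
  case empty
  show ?case by (intro exI[of _ "{}"]) simp
next
  case (insert x S)
  then obtain E where E: "finite E" "\<And>e e'. e \<in> E \<Longrightarrow> e' \<in> E \<Longrightarrow> B e e' = (if e = e' then 1 else 0)" "S \<subseteq> cspan E"
    by blast
  define y where "y = x - (\<Sum>e\<in>E. B e x *\<^sub>C e)"
  have sE: "(\<Sum>e\<in>E. B e x *\<^sub>C e) \<in> cspan E"
    by (intro cvector.span_sum cvector.span_scale cvector.span_base)
  show ?case
  proof (cases "y = 0")
    case True
    then have "x \<in> cspan E" using sE by (simp add: y_def)
    then show ?thesis using E by (intro exI[of _ E]) auto
  next
    case False
    define n where "n = Re (B y y)"
    have n: "n > 0" "B y y = of_real n" unfolding n_def by (rule positive[OF False]) (rule B_real)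
    define z where "z = (1 / of_real (sqrt n)) *\<^sub>C y"
    have orth: "B e y = 0" if "e \<in> E" for e
      unfolding y_def using E(1,2) that
      by (simp add: clinear_simps[OF linear] scaleC_complex_def if_distrib[of "(*) _"] cong: if_cong)
    have zE: "B e z = 0" "B z e = 0" if "e \<in> E" for e
      using orth[OF that] hermitian[of e z] by (simp_all add: z_def clinear_simps[OF linear] scaleC_complex_def)
    have "B z z = (1 / of_real (sqrt n)) * B z y"
      by (simp add: z_def clinear_simps[OF linear] scaleC_complex_def)
    also have "B z y = cnj (B y z)" by (rule hermitian)
    also have "B y z = (1 / of_real (sqrt n)) * of_real n"
      by (simp add: z_def clinear_simps[OF linear] scaleC_complex_def n(2))
    finally have "B z z = of_real n / (of_real (sqrt n) * of_real (sqrt n))" by simp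
    then have zz: "B z z = 1"
      using n(1) by (simp flip: of_real_mult)
    then have "z \<notin> E" using zE by auto
    have "z \<in> cspan (insert z E)" by (simp add: cvector.span_base)
    then have "of_real (sqrt n) *\<^sub>C z \<in> cspan (insert z E)" by (rule cvector.span_scale)
    then have "y \<in> cspan (insert z E)" using n(1) by (simp add: z_def scaleC_scaleC scaleC_one)
    then have "x \<in> cspan (insert z E)"
      using cvector.span_add[of y "insert z E" "\<Sum>e\<in>E. B e x *\<^sub>C e"] sE cvector.span_mono[of E "insert z E"]
      by (auto simp: y_def)
    then show ?thesis
      using E zz zE \<open>z \<notin> E\<close> cvector.span_mono[of E "insert z E"] by (intro exI[of _ "insert z E"]) auto
  qed
qed

lemma orthonormal_basis:
  assumes fd: "finite_dim TYPE('h)"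
  obtains E where "finite E" "\<And>e e'. e \<in> E \<Longrightarrow> e' \<in> E \<Longrightarrow> B e e' = (if e = e' then 1 else 0)"
    "\<And>x. (\<Sum>e\<in>E. B e x *\<^sub>C e) = x"
proof -
  obtain S :: "'h set" where S: "finite S" "cspan S = UNIV" using fd unfolding finite_dim_def by blast
  obtain E where E: "finite E" "\<And>e e'. e \<in> E \<Longrightarrow> e' \<in> E \<Longrightarrow> B e e' = (if e = e' then 1 else 0)" "S \<subseteq> cspan E"
    using gram_schmidt[OF S(1)] by blast
  have "cspan E = UNIV" using cvector.span_minimal[OF E(3)] S(2) by auto
  have "(\<Sum>e\<in>E. B e x *\<^sub>C e) = x" for x
  proof -
    have "x \<in> cspan E" using \<open>cspan E = UNIV\<close> by simp
    then show ?thesis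
    proof (induction rule: cvector.span_induct_alt)
      case base
      show ?case by (simp add: clinear_simps[OF linear])
    next
      case (step c y z)
      have "(\<Sum>e\<in>E. B e y *\<^sub>C e) = y"
        using E(1,2) step(1) by (simp add: if_distrib[of "\<lambda>c. c *\<^sub>C _"] scaleC_one cong: if_cong)
      then show ?case using step
        by (simp add: clinear_simps[OF linear] scaleC_add_left sum.distrib scaleC_complex_def
            scaleC_scaleC[symmetric] cvector.scale_sum_right[symmetric] del: cvector.scale_scale)
    qed
  qed
  then show thesis using that E by blast
qed

end

section \<open>The square of the antipode\<close>

text \<open>
  Let \<open>T = S\<^sup>2\<close>, let \<open>\<tau>\<close> be the trace of left multiplication, \<open>e\<close> the normalised two-sided integral and
  \<open>a = (id \<otimes> \<tau>)(\<Delta> e)\<close>. Then \<open>T(h) a = a h\<close>, and \<open>T\<close> is positive for the inner product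
  \<open>\<tau>(x\<^sup>* y a)\<close>. The functionals \<open>x \<mapsto> Tr(L\<^sub>x T)\<close> and \<open>x \<mapsto> Tr(R\<^sub>x T)\<close> are a left and a right
  integral, hence equal, and comparing how they commute gives \<open>T\<^sup>2 = id\<close>; positivity then
  leaves only \<open>T = id\<close>.
\<close>

context cstar_algebra
begin

lemma star_self_zero: "astar A x \<odot> x = 0 \<Longrightarrow> x = 0"
proof -
  assume x: "astar A x \<odot> x = 0"
  obtain n where n: "is_cstar_norm A n" using ex_cstar_norm by blast
  then have "(n x)\<^sup>2 = n 0" "n 0 = 0" using x unfolding is_cstar_norm_def by metis+
  then show ?thesis using n unfolding is_cstar_norm_def by simp
qed

lemma selfadjoint_eigenvalue_real:
  assumes r: "astar A r = r" and y: "r \<odot> y = c *\<^sub>C y" "y \<noteq> 0"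
  shows "cnj c = c"
proof -
  have "astar A (astar A y \<odot> (r \<odot> y)) = astar A y \<odot> (r \<odot> y)"
    by (simp add: astar_mult astar_astar r amult_assoc)
  then have "cnj c *\<^sub>C (astar A y \<odot> y) = c *\<^sub>C (astar A y \<odot> y)"
    by (simp add: y amult_scale_right astar_scale astar_mult astar_astar)
  then have "(cnj c - c) *\<^sub>C (astar A y \<odot> y) = 0" by (simp add: cvector.scale_left_diff_distrib)
  then show ?thesis using star_self_zero[of y] y(2) by auto
qed

text \<open>If y = (r - c) v is nonzero it is an eigenvector, so c is real and r - c is selfadjoint;
  then y* y = v* (r - c) y = 0, a contradiction.\<close>

lemma selfadjoint_semisimple:
  assumes r: "astar A r = r" and y: "r \<odot> (r \<odot> v - c *\<^sub>C v) = c *\<^sub>C (r \<odot> v - c *\<^sub>C v)"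
  shows "r \<odot> v = c *\<^sub>C v"
proof (rule ccontr)
  assume "r \<odot> v \<noteq> c *\<^sub>C v"
  then have c: "cnj c = c" using selfadjoint_eigenvalue_real[OF r y] by simp
  let ?y = "r \<odot> v - c *\<^sub>C v"
  have "astar A ?y \<odot> ?y = astar A v \<odot> (r \<odot> ?y - c *\<^sub>C ?y)"
    by (simp add: astar_diff astar_mult astar_scale r c unital.amult_simps amult_assoc)
  also have "\<dots> = 0" using y by (simp add: unital.amult_simps)
  finally show False using star_self_zero[of ?y] \<open>r \<odot> v \<noteq> c *\<^sub>C v\<close> by simp
qed

lemma real_imaginary_parts:
  obtains r s where "astar A r = r" "astar A s = s" "x = r + \<i> *\<^sub>C s"
proof
  let ?r = "(1/2) *\<^sub>C (x + astar A x)" and ?s = "(- \<i> / 2) *\<^sub>C (x - astar A x)"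
  show "astar A ?r = ?r" by (simp add: astar_simps add.commute)
  show "astar A ?s = ?s" by (simp add: astar_simps cvector.scale_right_diff_distrib)
  have "?r + \<i> *\<^sub>C ?s = ((1/2) *\<^sub>C x + (1/2) *\<^sub>C x)"
    by (simp add: scaleC_scaleC scaleC_add_right cvector.scale_right_diff_distrib)
  then show "x = ?r + \<i> *\<^sub>C ?s" by (simp add: scaleC_one flip: scaleC_add_left)
qed

end

section \<open>The trace of the regular representation and the two-sided integral\<close>

context cstar_hopf_algebra
begin

definition left_trace :: "'h \<Rightarrow> complex"
  where "left_trace x = ctrace (\<lambda>k. x \<odot> k)"

lemma clinear_ctrace_fun: "(\<And>k. clinear (\<lambda>x. f x k)) \<Longrightarrow> clinear (\<lambda>x. ctrace (f x :: 'h \<Rightarrow> 'h))"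
  unfolding ctrace_def by (rule clinear_sumI) (rule clinear_compose[OF clinear_fcoord[OF finite_dim]])

lemma clinear_left_trace: "clinear left_trace"
  unfolding left_trace_def[abs_def] by (rule clinear_ctrace_fun) (rule unital.clinear_amult_left)

lemma left_trace_commute: "left_trace (x \<odot> y) = left_trace (y \<odot> x)"
  unfolding left_trace_def amult_assoc
  by (rule ctrace_commute[OF finite_dim]) (rule unital.clinear_amult_right)+

text \<open>Left multiplication by r is diagonalisable, since \<open>selfadjoint_semisimple\<close>
  is the hypothesis of \<open>eigenvectors_span\<close>. The eigenvalues are real, and if all vanish
  then r annihilates a basis of H and so the unit. Positivity of the trace has its source
  here.\<close>

lemma left_trace_eigen:
  assumes r: "astar H r = r"
  obtains I c where "finite (I :: 'h set)" "left_trace r = (\<Sum>i\<in>I. of_real (c i))"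
    "left_trace (r \<odot> r) = (\<Sum>i\<in>I. of_real ((c i)\<^sup>2))" "(\<forall>i\<in>I. c i = 0) \<longrightarrow> r = 0"
proof -
  let ?E = "{v. \<exists>c. r \<odot> v = c *\<^sub>C v}"
  have "cspan ?E = UNIV"
    by (rule eigenvectors_span[OF finite_dim unital.clinear_amult_right])
      (rule selfadjoint_semisimple[OF r])
  moreover obtain I where I: "I \<subseteq> ?E" "cvector.independent I" "?E \<subseteq> cspan I"
    using cvector.maximal_independent_subset[of ?E] by blast
  ultimately have span: "cspan I = UNIV"
    using cvector.span_minimal[OF I(3) cvector.subspace_span] by blast
  have fin: "finite I"
    using cvector.independent_span_bound[OF fbasis(1)[OF finite_dim] I(2)] fbasis(3)[OF finite_dim] by auto
  define m where "m i = (SOME c. r \<odot> i = c *\<^sub>C i)" for i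
  have m: "r \<odot> i = m i *\<^sub>C i" if "i \<in> I" for i
  proof -
    have "\<exists>c. r \<odot> i = c *\<^sub>C i" using I(1) that by blast
    then show ?thesis unfolding m_def by (rule someI_ex)
  qed
  have nz: "i \<noteq> 0" if "i \<in> I" for i using I(2) that cvector.dependent_zero by blast
  have real: "m i = of_real (Re (m i))" if "i \<in> I" for i
    using selfadjoint_eigenvalue_real[OF r m[OF that] nz[OF that]] by (simp add: complex_eq_iff)
  define R where "R x i = cvector.representation I x i" for x i
  have Rlin: "clinear (\<lambda>x. R x i)" for i
    unfolding R_def using I(2) span
    by (intro clinearI) (simp_all add: cvector.representation_add cvector.representation_scale scaleC_complex_def)
  have Rex: "(\<Sum>i\<in>I. R x i *\<^sub>C i) = x" for x
    unfolding R_def using I span fin by (intro cvector.sum_representation_eq) auto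
  have Rb: "R i i = 1" if "i \<in> I" for i
    unfolding R_def using cvector.representation_basis[OF I(2) that] by simp
  note tr = ctrace_expansion[OF finite_dim _ Rlin Rex]
  have 1: "left_trace r = (\<Sum>i\<in>I. of_real (Re (m i)))"
    unfolding left_trace_def tr[OF unital.clinear_amult_right]
    by (intro sum.cong) (auto simp: m clinear_simps[OF Rlin] scaleC_complex_def Rb real[symmetric])
  have 2: "left_trace (r \<odot> r) = (\<Sum>i\<in>I. of_real ((Re (m i))\<^sup>2))"
    unfolding left_trace_def tr[OF unital.clinear_amult_right]
    by (intro sum.cong)
      (auto simp: amult_assoc m unital.amult_simps clinear_simps[OF Rlin] scaleC_complex_def Rb real[symmetric]
        power2_eq_square)
  have 3: "r = 0" if "\<forall>i\<in>I. Re (m i) = 0"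
  proof -
    have "r \<odot> i = 0" if "i \<in> I" for i
      using m[OF that] real[OF that] \<open>\<forall>i\<in>I. Re (m i) = 0\<close> that by simp
    then have "r \<odot> (\<Sum>i\<in>I. R \<one> i *\<^sub>C i) = 0" by (simp add: unital.amult_simps)
    then show ?thesis by (simp add: Rex amult_one_right)
  qed
  show thesis using that[OF fin 1 2] 3 by blast
qed

lemma left_trace_star: "left_trace (astar H x) = cnj (left_trace x)"
proof -
  obtain r s where rs: "astar H r = r" "astar H s = s" "x = r + \<i> *\<^sub>C s" by (rule real_imaginary_parts)
  have "cnj (left_trace r) = left_trace r" if r: "astar H r = r" for r
  proof -
    obtain I :: "'h set" and c :: "'h \<Rightarrow> real" where "left_trace r = (\<Sum>i\<in>I. of_real (c i))"
      by (rule left_trace_eigen[OF r]) blast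
    then show ?thesis by simp
  qed
  then show ?thesis
    using rs by (simp add: astar_simps clinear_simps[OF clinear_left_trace] scaleC_complex_def)
qed

text \<open>For x = r + i s with r and s selfadjoint, the mixed part of x* x is a commutator, on
  which the trace vanishes; what remains is the trace of r^2 + s^2, a sum of squared
  eigenvalues.\<close>

lemma positive_form_left_trace: "positive_form (\<lambda>x y. left_trace (astar H x \<odot> y))"
proof (rule positive_form.intro)
  show "clinear (\<lambda>y. left_trace (astar H x \<odot> y))" for x
    by (rule clinear_compose[OF clinear_left_trace unital.clinear_amult_right])
  show "left_trace (astar H y \<odot> x) = cnj (left_trace (astar H x \<odot> y))" for x y
    by (simp add: left_trace_star[symmetric] astar_mult astar_astar)
  show "Re (left_trace (astar H x \<odot> x)) > 0" if "x \<noteq> 0" for x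
  proof -
    obtain r s where rs: "astar H r = r" "astar H s = s" "x = r + \<i> *\<^sub>C s" by (rule real_imaginary_parts)
    have pos: "Re (left_trace (r \<odot> r)) \<ge> 0 \<and> (Re (left_trace (r \<odot> r)) = 0 \<longrightarrow> r = 0)" if r: "astar H r = r" for r
    proof -
      obtain I :: "'h set" and c where I: "finite I" "left_trace (r \<odot> r) = (\<Sum>i\<in>I. of_real ((c i)\<^sup>2))"
        "(\<forall>i\<in>I. c i = 0) \<longrightarrow> r = 0"
        by (rule left_trace_eigen[OF r]) blast
      have "Re (left_trace (r \<odot> r)) = (\<Sum>i\<in>I. (c i)\<^sup>2)" unfolding I(2) Re_sum by simp
      then show ?thesis using I(1,3) by (auto simp: sum_nonneg sum_nonneg_eq_0_iff)
    qed
    have "astar H x \<odot> x = r \<odot> r + s \<odot> s + \<i> *\<^sub>C (r \<odot> s - s \<odot> r)"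
      using rs by (simp add: astar_simps unital.amult_simps cvector.scale_right_diff_distrib scaleC_scaleC)
    then have "left_trace (astar H x \<odot> x) = left_trace (r \<odot> r) + left_trace (s \<odot> s)"
      by (simp add: clinear_simps[OF clinear_left_trace] left_trace_commute[of r s])
    then show ?thesis using pos[OF rs(1)] pos[OF rs(2)] \<open>x \<noteq> 0\<close> rs(3) by fastforce
  qed
qed

text \<open>The trace form represents the counit by a vector k, and nondegeneracy turns
  multiplicativity of \<epsilon> into h k = \<epsilon>(h) k. After scaling, e* e = e, so e is
  selfadjoint, and adjoints give the law for multiplication from the right.\<close>

lemma exists_integral:
  obtains e where "astar H e = e" "e \<odot> e = e" "counit H e = 1"
    "\<And>h. h \<odot> e = counit H h *\<^sub>C e" "\<And>h. e \<odot> h = counit H h *\<^sub>C e"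
proof -
  interpret form: positive_form "\<lambda>x y. left_trace (astar H x \<odot> y)" by (rule positive_form_left_trace)
  obtain E where E: "finite E" "\<And>x. (\<Sum>e\<in>E. left_trace (astar H e \<odot> x) *\<^sub>C e) = x"
    by (rule form.orthonormal_basis[OF finite_dim]) blast
  define k where "k = (\<Sum>b\<in>E. cnj (counit H b) *\<^sub>C b)"
  have k: "left_trace (astar H k \<odot> x) = counit H x" for x
  proof -
    have "left_trace (astar H k \<odot> x) = (\<Sum>b\<in>E. counit H b * left_trace (astar H b \<odot> x))"
      by (simp add: k_def astar_simps unital.amult_simps clinear_simps[OF clinear_left_trace] scaleC_complex_def)
    also have "\<dots> = counit H (\<Sum>b\<in>E. left_trace (astar H b \<odot> x) *\<^sub>C b)"
      by (simp add: clinear_simps[OF counit_linear] scaleC_complex_def mult.commute)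
    finally show ?thesis by (simp add: E(2))
  qed
  have nondeg: "u = w" if "\<And>x. left_trace (astar H u \<odot> x) = left_trace (astar H w \<odot> x)" for u w
  proof -
    have "left_trace (astar H (u - w) \<odot> (u - w)) = 0"
      using that[of "u - w"]
      by (simp add: astar_diff unital.amult_simps clinear_simps[OF clinear_left_trace] algebra_simps)
    then show ?thesis using form.positive[of "u - w"] by force
  qed
  have hk: "h \<odot> k = counit H h *\<^sub>C k" for h
  proof (rule nondeg)
    fix x
    have "left_trace (astar H (h \<odot> k) \<odot> x) = left_trace (astar H k \<odot> (astar H h \<odot> x))"
      by (simp add: astar_mult amult_assoc)
    then show "left_trace (astar H (h \<odot> k) \<odot> x) = left_trace (astar H (counit H h *\<^sub>C k) \<odot> x)"
      by (simp add: k counit_mult counit_star astar_scale unital.amult_simps clinear_simps[OF clinear_left_trace]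
          scaleC_complex_def)
  qed
  have "k \<noteq> 0" using k[of \<one>] by (auto simp: counit_one astar_zero unital.amult_simps clinear_simps[OF clinear_left_trace])
  then have ck: "counit H k \<noteq> 0" using form.positive[of k] k[of k] by force
  define e where "e = (1 / counit H k) *\<^sub>C k"
  have he: "h \<odot> e = counit H h *\<^sub>C e" for h
    by (simp add: e_def unital.amult_simps hk scaleC_scaleC mult.commute)
  have ce: "counit H e = 1" using ck by (simp add: e_def clinear_simps[OF counit_linear] scaleC_complex_def)
  have ee: "astar H e \<odot> e = e" by (simp add: he counit_star ce scaleC_one)
  then have se: "astar H e = e" by (metis astar_mult astar_astar)
  have "e \<odot> h = counit H h *\<^sub>C e" for h
    using arg_cong[OF he[of "astar H h"], of "astar H"]
    by (simp add: astar_mult astar_astar se counit_star astar_scale)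
  then show thesis using that[OF se _ ce he] ee se by simp
qed

text \<open>Both formulas split off a full coproduct. Next to \<Delta>(e) that factor reduces to a
  counit, and this is how elements are moved from one leg of \<Delta>(e) to the other.\<close>

lemma tensor_left_unit: "h \<otimes>\<^sub>t \<one> = sweedler2 H (\<lambda>a b. comult H a \<odot>\<^bsub>tensor_algebra H H\<^esub> (\<one> \<otimes>\<^sub>t antipode H b)) h"
  and tensor_right_unit: "\<one> \<otimes>\<^sub>t h = sweedler2 H (\<lambda>a b. (antipode H a \<otimes>\<^sub>t \<one>) \<odot>\<^bsub>tensor_algebra H H\<^esub> comult H b) h"
proof -
  note H = unital.unital_algebra_axioms
  note m = tensor_algebra_mult(1)[OF H H]
  note l = cbilinear_left[OF tensor_algebra_mult(2)[OF H H]] cbilinear_right[OF tensor_algebra_mult(2)[OF H H]]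
  have t1: "ctrilinear (\<lambda>c d b. c \<otimes>\<^sub>t (d \<odot> antipode H b))"
    and t2: "ctrilinear (\<lambda>a c d. (antipode H a \<odot> c) \<otimes>\<^sub>t d)"
    by (rule ctrilinearI; rule clinearI;
        simp add: pure_tensor_simps unital.amult_simps clinear_simps[OF antipode_linear])+
  have "sweedler2 H (\<lambda>a b. comult H a \<odot>\<^bsub>tensor_algebra H H\<^esub> (\<one> \<otimes>\<^sub>t antipode H b)) h
    = sweedler2 H (\<lambda>a b. sweedler2 H (\<lambda>c d. c \<otimes>\<^sub>t (d \<odot> antipode H b)) a) h"
    by (simp add: comult_sweedler sweedler2_linear[OF l(1), symmetric] m amult_one_right)
  also have "\<dots> = sweedler2 H (\<lambda>c k. sweedler2 H (\<lambda>d b. c \<otimes>\<^sub>t (d \<odot> antipode H b)) k) h"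
    by (rule sweedler2_coassoc[OF t1])
  also have "\<dots> = h \<otimes>\<^sub>t \<one>"
    by (simp add: sweedler2_antipode(2)[OF pure_tensor_right] sweedler2_counit(2)[OF pure_tensor_left])
  finally show "h \<otimes>\<^sub>t \<one> = sweedler2 H (\<lambda>a b. comult H a \<odot>\<^bsub>tensor_algebra H H\<^esub> (\<one> \<otimes>\<^sub>t antipode H b)) h" ..
  have "sweedler2 H (\<lambda>a b. (antipode H a \<otimes>\<^sub>t \<one>) \<odot>\<^bsub>tensor_algebra H H\<^esub> comult H b) h
    = sweedler2 H (\<lambda>a b. sweedler2 H (\<lambda>c d. (antipode H a \<odot> c) \<otimes>\<^sub>t d) b) h"
    by (simp add: comult_sweedler sweedler2_linear[OF l(2), symmetric] m amult_one_left)
  also have "\<dots> = sweedler2 H (\<lambda>k d. sweedler2 H (\<lambda>a c. (antipode H a \<odot> c) \<otimes>\<^sub>t d) k) h"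
    by (rule sweedler2_coassoc[OF t2, symmetric])
  also have "\<dots> = \<one> \<otimes>\<^sub>t h"
    by (simp add: sweedler2_antipode(1)[OF pure_tensor_left] sweedler2_counit(1)[OF pure_tensor_right])
  finally show "\<one> \<otimes>\<^sub>t h = sweedler2 H (\<lambda>a b. (antipode H a \<otimes>\<^sub>t \<one>) \<odot>\<^bsub>tensor_algebra H H\<^esub> comult H b) h" ..
qed

end

lemma slice_tensor_algebra:
  assumes A: "unital_algebra A" and B: "unital_algebra B" and f: "clinear f"
  shows "slice f (t \<odot>\<^bsub>tensor_algebra A B\<^esub> (a \<otimes>\<^sub>t \<one>\<^bsub>B\<^esub>)) = slice f t \<odot>\<^bsub>A\<^esub> a"
    and "slice f ((a \<otimes>\<^sub>t \<one>\<^bsub>B\<^esub>) \<odot>\<^bsub>tensor_algebra A B\<^esub> t) = a \<odot>\<^bsub>A\<^esub> slice f t"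
  by (induction t rule: tensor_induct;
      simp add: tensor_algebra_mult[OF A B] cbilinear_simps[OF tensor_algebra_mult(2)[OF A B]] f
        unital_algebra.amult_simps[OF A] clinear_simps[OF clinear_slice[OF f]]
        unital_algebra.amult_one_left[OF B] unital_algebra.amult_one_right[OF B])+

lemma slice_tracial:
  assumes A: "unital_algebra A" and B: "unital_algebra B" and f: "clinear f"
    and tr: "\<And>x y. f (x \<odot>\<^bsub>B\<^esub> y) = f (y \<odot>\<^bsub>B\<^esub> x)"
  shows "slice f (t \<odot>\<^bsub>tensor_algebra A B\<^esub> (\<one>\<^bsub>A\<^esub> \<otimes>\<^sub>t b)) = slice f ((\<one>\<^bsub>A\<^esub> \<otimes>\<^sub>t b) \<odot>\<^bsub>tensor_algebra A B\<^esub> t)"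
  by (induction t rule: tensor_induct)
    (simp_all add: tensor_algebra_mult[OF A B] cbilinear_simps[OF tensor_algebra_mult(2)[OF A B]] f
      clinear_simps[OF clinear_slice[OF f]] tr[of _ b]
      unital_algebra.amult_one_left[OF A] unital_algebra.amult_one_right[OF A])

lemma tensor_expansion:
  assumes c: "\<And>i. i \<in> I \<Longrightarrow> clinear (c i)" and ex: "\<And>x. (\<Sum>i\<in>I. c i x *\<^sub>C v i) = x"
  shows "(\<Sum>i\<in>I. slice (c i) t \<otimes>\<^sub>t v i) = t"
proof (induction t rule: tensor_induct)
  case (pure a b)
  have "(\<Sum>i\<in>I. slice (c i) (a \<otimes>\<^sub>t b) \<otimes>\<^sub>t v i) = a \<otimes>\<^sub>t (\<Sum>i\<in>I. c i b *\<^sub>C v i)"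
    using c by (simp add: pure_tensor_simps)
  then show ?case by (simp add: ex)
next
  case (add s t)
  then show ?case
    using c by (simp add: clinear_simps[OF clinear_slice] pure_tensor_simps sum.distrib)
qed

section \<open>An inner product for which the square of the antipode is positive\<close>

context cstar_hopf_algebra
begin

abbreviation antipode_sq :: "'h \<Rightarrow> 'h"
  where "antipode_sq h \<equiv> antipode H (antipode H h)"

lemma clinear_antipode_sq: "clinear antipode_sq"
  by (rule clinear_compose[OF antipode_linear antipode_linear])

lemma antipode_sq_mult: "antipode_sq (h \<odot> l) = antipode_sq h \<odot> antipode_sq l"
  by (simp add: antipode_mult)

lemma sweedler2_antipode_sq:
  assumes f: "cbilinear f"
  shows "sweedler2 H f (antipode_sq h) = sweedler2 H (\<lambda>a b. f (antipode_sq a) (antipode_sq b)) h"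
  by (simp add: sweedler2_antipode_arg f
      sweedler2_antipode_arg[OF cbilinear_compose(3)[OF cbilinear_compose(1)[OF f antipode_linear antipode_linear]]])

text \<open>The form is \<tau>(x* y a) with a = (id \<otimes> \<tau>)(\<Delta>(e)). From S^2(h) a =
  a h follows \<tau>(h* S^2(h) a) = \<tau>(h* a h), which is positive because a is a sum of terms x*
  x.\<close>

lemma antipode_sq_positive:
  obtains B where "positive_form B" "\<And>x y z. B (astar H x \<odot> y) z = B y (x \<odot> z)"
    "\<And>h. h \<noteq> 0 \<Longrightarrow> Re (B h (antipode_sq h)) > 0"
proof -
  let ?HH = "tensor_algebra H H"
  note H = unital.unital_algebra_axioms and Hs = unital_star_algebra_axioms
  interpret HH: unital_star_algebra ?HH by (rule unital_star_algebra_tensor[OF Hs Hs])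
  interpret form: positive_form "\<lambda>x y. left_trace (astar H x \<odot> y)" by (rule positive_form_left_trace)
  note m = tensor_algebra_mult[OF H H]
  note tl = clinear_left_trace left_trace_commute
  obtain e where e: "astar H e = e" "e \<odot> e = e" "counit H e = 1"
    "\<And>h. h \<odot> e = counit H h *\<^sub>C e" "\<And>h. e \<odot> h = counit H h *\<^sub>C e"
    by (rule exists_integral) blast
  define p where "p = comult H e"
  have p: "astar ?HH p = p" "p \<odot>\<^bsub>?HH\<^esub> p = p"
    by (simp_all add: p_def e flip: comult_star comult_mult)
  \<comment> \<open>An element passes from the first leg to the second as its image under S: insert
    \<open>tensor_left_unit\<close> and let the integral absorb the coproduct.\<close>
  have p_right: "p \<odot>\<^bsub>?HH\<^esub> (h \<otimes>\<^sub>t \<one>) = p \<odot>\<^bsub>?HH\<^esub> (\<one> \<otimes>\<^sub>t antipode H h)" for h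
  proof -
    have l: "clinear (\<lambda>h. p \<odot>\<^bsub>?HH\<^esub> (\<one> \<otimes>\<^sub>t antipode H h))"
      by (rule clinear_compose[OF HH.unital.clinear_amult_right clinear_compose[OF pure_tensor_right antipode_linear]])
    have "p \<odot>\<^bsub>?HH\<^esub> (h \<otimes>\<^sub>t \<one>)
      = sweedler2 H (\<lambda>a b. p \<odot>\<^bsub>?HH\<^esub> (comult H a \<odot>\<^bsub>?HH\<^esub> (\<one> \<otimes>\<^sub>t antipode H b))) h"
      by (subst tensor_left_unit) (rule sweedler2_linear[OF HH.unital.clinear_amult_right, symmetric])
    also have "\<dots> = sweedler2 H (\<lambda>a b. counit H a *\<^sub>C (p \<odot>\<^bsub>?HH\<^esub> (\<one> \<otimes>\<^sub>t antipode H b))) h"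
      by (simp add: p_def HH.amult_assoc[symmetric] comult_mult[symmetric] e clinear_simps[OF comult_linear]
          HH.unital.amult_simps)
    also have "\<dots> = p \<odot>\<^bsub>?HH\<^esub> (\<one> \<otimes>\<^sub>t antipode H h)" by (rule sweedler2_counit(1)[OF l])
    finally show ?thesis .
  qed
  have p_left: "(\<one> \<otimes>\<^sub>t h) \<odot>\<^bsub>?HH\<^esub> p = (antipode H h \<otimes>\<^sub>t \<one>) \<odot>\<^bsub>?HH\<^esub> p" for h
  proof -
    have l: "clinear (\<lambda>h. (antipode H h \<otimes>\<^sub>t \<one>) \<odot>\<^bsub>?HH\<^esub> p)"
      by (rule clinear_compose[OF HH.unital.clinear_amult_left clinear_compose[OF pure_tensor_left antipode_linear]])
    have "(\<one> \<otimes>\<^sub>t h) \<odot>\<^bsub>?HH\<^esub> p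
      = sweedler2 H (\<lambda>a b. ((antipode H a \<otimes>\<^sub>t \<one>) \<odot>\<^bsub>?HH\<^esub> comult H b) \<odot>\<^bsub>?HH\<^esub> p) h"
      by (subst tensor_right_unit) (rule sweedler2_linear[OF HH.unital.clinear_amult_left, symmetric])
    also have "\<dots> = sweedler2 H (\<lambda>a b. counit H b *\<^sub>C ((antipode H a \<otimes>\<^sub>t \<one>) \<odot>\<^bsub>?HH\<^esub> p)) h"
      by (simp add: p_def HH.amult_assoc comult_mult[symmetric] e clinear_simps[OF comult_linear]
          HH.unital.amult_simps)
    also have "\<dots> = (antipode H h \<otimes>\<^sub>t \<one>) \<odot>\<^bsub>?HH\<^esub> p" by (rule sweedler2_counit(2)[OF l])
    finally show ?thesis .
  qed
  \<comment> \<open>The map u \<otimes> v \<mapsto> S(u) v sends p to the unit and the product of p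
    with h \<otimes> 1 to S(h).\<close>
  have p_faithful: "h = 0" if "p \<odot>\<^bsub>?HH\<^esub> (h \<otimes>\<^sub>t \<one>) = 0" for h
  proof -
    let ?m = "\<lambda>u v. antipode H u \<odot> v"
    have b: "cbilinear ?m"
      by (rule cbilinear_compose(1)[OF unital.cbilinear_amult antipode_linear clinear_id(2)])
    have "tensor_lift ?m (t \<odot>\<^bsub>?HH\<^esub> (h \<otimes>\<^sub>t \<one>)) = antipode H h \<odot> tensor_lift ?m t" for t
      by (induction t rule: tensor_induct)
        (simp_all add: m b HH.unital.amult_simps clinear_simps[OF clinear_tensor_lift[OF b]] unital.amult_simps
          antipode_mult amult_one_right amult_assoc)
    moreover have "tensor_lift ?m p = \<one>"
      using antipode_left[of e] by (simp add: p_def sweedler2_def e scaleC_one)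
    ultimately have "antipode H h = 0"
      using that clinear_zero[OF clinear_tensor_lift[OF b]] by (metis amult_one_right)
    then show ?thesis using antipode_eq_iff[of h 0] by (simp add: clinear_zero[OF antipode_linear])
  qed
  define a where "a = slice left_trace p"
  \<comment> \<open>Send h to the second leg as S(h), cycle it through the trace, and bring it back
    to the first leg as S^2(h).\<close>
  have ah: "a \<odot> h = antipode_sq h \<odot> a" for h
    using slice_tensor_algebra[OF H H clinear_left_trace] slice_tracial[OF H H tl] p_left p_right
    unfolding a_def by metis
  obtain E where E: "finite E"
    "\<And>b b'. b \<in> E \<Longrightarrow> b' \<in> E \<Longrightarrow> left_trace (astar H b \<odot> b') = (if b = b' then 1 else 0)"
    "\<And>x. (\<Sum>b\<in>E. left_trace (astar H b \<odot> x) *\<^sub>C b) = x"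
    by (rule form.orthonormal_basis[OF finite_dim]) blast
  \<comment> \<open>Coefficients of p in an orthonormal basis of the trace form; p = p* p then turns
    a into a sum of terms x* x.\<close>
  define x where "x b = slice (\<lambda>y. left_trace (astar H b \<odot> y)) p" for b
  have px: "p = (\<Sum>b\<in>E. x b \<otimes>\<^sub>t b)"
    unfolding x_def using tensor_expansion[of E, OF _ E(3), of p] form.linear by simp
  have ax: "a = (\<Sum>b\<in>E. astar H (x b) \<odot> x b)"
  proof -
    have "p = astar ?HH p \<odot>\<^bsub>?HH\<^esub> p" using p by simp
    also have "\<dots> = (\<Sum>b\<in>E. \<Sum>b'\<in>E. (astar H (x b) \<odot> x b') \<otimes>\<^sub>t (astar H b \<odot> b'))"
      unfolding px by (simp add: HH.astar_sum HH.unital.amult_simps tensor_algebra_star[OF Hs Hs] m)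
        (rule sum.swap)
    finally have "a = (\<Sum>b\<in>E. \<Sum>b'\<in>E. left_trace (astar H b \<odot> b') *\<^sub>C (astar H (x b) \<odot> x b'))"
      unfolding a_def by (simp add: clinear_simps[OF clinear_slice[OF clinear_left_trace]] clinear_left_trace)
    also have "\<dots> = (\<Sum>b\<in>E. \<Sum>b'\<in>E. if b = b' then astar H (x b) \<odot> x b' else 0)"
      by (intro sum.cong) (auto simp: E(2) scaleC_one)
    finally show ?thesis using E(1) by simp
  qed
  have sa: "astar H a = a" by (simp add: ax astar_simps)
  have pos: "Re (left_trace (astar H k \<odot> (a \<odot> k))) > 0" if "k \<noteq> 0" for k
  proof -
    have "left_trace (astar H k \<odot> (a \<odot> k)) = (\<Sum>b\<in>E. left_trace (astar H (x b \<odot> k) \<odot> (x b \<odot> k)))"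
      by (simp add: ax unital.amult_simps clinear_simps[OF clinear_left_trace] astar_mult amult_assoc)
    moreover have "\<exists>b\<in>E. x b \<odot> k \<noteq> 0"
    proof (rule ccontr)
      assume "\<not> ?thesis"
      then have "p \<odot>\<^bsub>?HH\<^esub> (k \<otimes>\<^sub>t \<one>) = 0"
        unfolding px by (simp add: HH.unital.amult_simps m amult_one_right pure_tensor_simps)
      then show False using p_faithful \<open>k \<noteq> 0\<close> by blast
    qed
    moreover have "Re (left_trace (astar H z \<odot> z)) \<ge> 0" for z
      using form.positive[of z] by (cases "z = 0") (auto simp: unital.amult_simps clinear_zero[OF clinear_left_trace])
    ultimately show ?thesis
      using E(1) form.positive by (auto intro!: sum_pos2)
  qed
  let ?B = "\<lambda>x y. left_trace (astar H x \<odot> (y \<odot> a))"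
  show thesis
  proof (rule that[of ?B])
    show "positive_form ?B"
    proof (rule positive_form.intro)
      show "clinear (?B x)" for x
        by (rule clinear_compose[OF clinear_left_trace
              clinear_compose[OF unital.clinear_amult_right unital.clinear_amult_left]])
      show "?B y x = cnj (?B x y)" for x y
        using left_trace_commute[of a "astar H y \<odot> x"]
        by (simp add: left_trace_star[symmetric] astar_mult astar_astar sa amult_assoc)
      show "Re (?B x x) > 0" if "x \<noteq> 0" for x
      proof -
        have "astar H x \<noteq> 0" using that by (metis astar_astar astar_zero)
        from pos[OF this] show ?thesis
          using left_trace_commute[of "astar H x" "x \<odot> a"] by (simp add: astar_astar amult_assoc)
      qed
    qed
    show "?B (astar H x \<odot> y) z = ?B y (x \<odot> z)" for x y z
      by (simp add: astar_mult astar_astar amult_assoc)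
    show "Re (?B h (antipode_sq h)) > 0" if "h \<noteq> 0" for h
      using pos[OF that] by (simp add: ah)
  qed
qed

section \<open>Integrals from twisted traces, and the square of the antipode\<close>

definition left_integral :: "'h \<Rightarrow> complex"
  where "left_integral x = ctrace (\<lambda>k. x \<odot> antipode_sq k)"

definition right_integral :: "'h \<Rightarrow> complex"
  where "right_integral x = ctrace (\<lambda>k. antipode_sq k \<odot> x)"

lemma clinear_left_integral: "clinear left_integral"
  unfolding left_integral_def[abs_def] by (rule clinear_ctrace_fun) (rule unital.clinear_amult_left)

lemma clinear_right_integral: "clinear right_integral"
  unfolding right_integral_def[abs_def] by (rule clinear_ctrace_fun) (rule unital.clinear_amult_right)

text \<open>The first leg receives S^2(k_(2)) S(k_(1)) = S(k_(1) S(k_(2))), a copy of the counit. In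
  this form S^2(k) multiplies x before the coproduct is taken, as a trace over k requires.\<close>

lemma sweedler2_absorb:
  assumes G: "cbilinear G"
  shows "sweedler2 H (\<lambda>a b. G a (b \<odot> antipode_sq k)) x =
    sweedler2 H (\<lambda>k1 k2. sweedler2 H (\<lambda>a b. G (a \<odot> antipode H k1) b) (x \<odot> antipode_sq k2)) k"
proof -
  have G': "cbilinear (\<lambda>a b. G (a \<odot> antipode H k1) b)" for k1
    by (rule cbilinear_compose(1)[OF G unital.clinear_amult_left clinear_id(2)])
  have Gx: "cbilinear (\<lambda>c d. G (a \<odot> (c \<odot> antipode H k1)) (b \<odot> d))" for a b k1
    by (rule cbilinear_compose(1)[OF G clinear_compose[OF unital.clinear_amult_right unital.clinear_amult_left]
          unital.clinear_amult_right])
  have t: "ctrilinear (\<lambda>k1 c d. G (a \<odot> (antipode_sq c \<odot> antipode H k1)) (b \<odot> antipode_sq d))" for a b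
    by (rule ctrilinearI; rule clinearI;
        simp add: cbilinear_simps[OF G] unital.amult_simps clinear_simps[OF antipode_linear])
  have l: "clinear (\<lambda>z. G (a \<odot> antipode H z) (b \<odot> antipode_sq d))" for a b d
    by (rule clinearI) (simp_all add: cbilinear_simps[OF G] unital.amult_simps clinear_simps[OF antipode_linear])
  have l': "clinear (\<lambda>d. G a (b \<odot> antipode_sq d))" for a b
    by (rule clinearI) (simp_all add: cbilinear_simps[OF G] unital.amult_simps clinear_simps[OF antipode_linear])
  have "sweedler2 H (\<lambda>k1 k2. sweedler2 H (\<lambda>a b. G (a \<odot> antipode H k1) b) (x \<odot> antipode_sq k2)) k
    = sweedler2 H (\<lambda>k1 k2. sweedler2 H (\<lambda>a b. sweedler2 H
        (\<lambda>c d. G (a \<odot> (antipode_sq c \<odot> antipode H k1)) (b \<odot> antipode_sq d)) k2) x) k"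
    by (simp add: sweedler2_mult[OF G'] sweedler2_antipode_sq[OF Gx] amult_assoc)
  also have "\<dots> = sweedler2 H (\<lambda>a b. sweedler2 H (\<lambda>k1 k2. sweedler2 H
        (\<lambda>c d. G (a \<odot> (antipode_sq c \<odot> antipode H k1)) (b \<odot> antipode_sq d)) k2) k) x"
    by (rule sweedler2_swap)
  also have "\<dots> = sweedler2 H (\<lambda>a b. sweedler2 H (\<lambda>m d. sweedler2 H
        (\<lambda>k1 c. G (a \<odot> (antipode_sq c \<odot> antipode H k1)) (b \<odot> antipode_sq d)) m) k) x"
    by (simp only: sweedler2_coassoc[OF t])
  also have "\<dots> = sweedler2 H (\<lambda>a b. sweedler2 H (\<lambda>m d. sweedler2 H
        (\<lambda>k1 c. G (a \<odot> antipode H (k1 \<odot> antipode H c)) (b \<odot> antipode_sq d)) m) k) x"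
    by (simp only: antipode_mult)
  also have "\<dots> = sweedler2 H (\<lambda>a b. G a (b \<odot> antipode_sq k)) x"
    by (simp add: sweedler2_antipode(2)[OF l] sweedler2_counit(1)[OF l'] antipode_one amult_one_right)
  finally show ?thesis ..
qed

lemma left_integral_invariant: "sweedler2 H (\<lambda>a b. left_integral b *\<^sub>C a) x = left_integral x *\<^sub>C \<one>"
proof -
  let ?F = "fbasis TYPE('h)"
  note co = clinear_fcoord[OF finite_dim]
  \<comment> \<open>These are the coefficients of the coproduct: \<Delta>(y) is the sum of K c y
    \<otimes> c over the basis.\<close>
  define K where "K c y = sweedler2 H (\<lambda>u v. fcoord c v *\<^sub>C u) y" for c y :: 'h
  have bK: "cbilinear (\<lambda>u v. fcoord c v *\<^sub>C u)" for c :: 'h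
    by (rule cbilinear_slice[OF co])
  have Kl: "clinear (K c)" for c
    unfolding K_def[abs_def] by (rule clinear_sweedler2[OF bK])
  \<comment> \<open>Resumming c gives y_(1) S(y_(2)) weighted by the coordinate of y_(3) at d, which
    the antipode law collapses.\<close>
  have inner: "(\<Sum>c\<in>?F. K c y \<odot> antipode H (K d c)) = fcoord d y *\<^sub>C \<one>" for d y
  proof -
    have l1: "clinear (\<lambda>z. z \<odot> antipode H (K d c))" for c by (rule unital.clinear_amult_left)
    have l2: "clinear (\<lambda>v. u \<odot> antipode H (K d v))" for u
      by (rule clinear_compose[OF unital.clinear_amult_right clinear_compose[OF antipode_linear Kl]])
    have l3: "clinear (\<lambda>z. u \<odot> antipode H z)" for u
      by (rule clinear_compose[OF unital.clinear_amult_right antipode_linear])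
    have t: "ctrilinear (\<lambda>u p q. fcoord d q *\<^sub>C (u \<odot> antipode H p))"
      by (rule ctrilinearI; rule clinearI;
          simp add: clinear_simps[OF co] unital.amult_simps clinear_simps[OF antipode_linear]
            scaleC_add_left scaleC_add_right scaleC_complex_def mult.commute)
    have "(\<Sum>c\<in>?F. K c y \<odot> antipode H (K d c))
      = sweedler2 H (\<lambda>u v. \<Sum>c\<in>?F. fcoord c v *\<^sub>C (u \<odot> antipode H (K d c))) y"
      unfolding K_def[of _ y] by (simp add: sweedler2_sum sweedler2_linear[OF l1, symmetric] unital.amult_simps)
    also have "\<dots> = sweedler2 H (\<lambda>u v. u \<odot> antipode H (K d (\<Sum>c\<in>?F. fcoord c v *\<^sub>C c))) y"
      by (simp only: clinear_simps[OF l2])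
    also have "\<dots> = sweedler2 H (\<lambda>u v. sweedler2 H (\<lambda>p q. fcoord d q *\<^sub>C (u \<odot> antipode H p)) v) y"
      unfolding fcoord_expand[OF finite_dim] K_def
      by (simp only: sweedler2_linear[OF l3, symmetric] clinear_simps[OF l3])
    also have "\<dots> = sweedler2 H (\<lambda>m q. sweedler2 H (\<lambda>u p. fcoord d q *\<^sub>C (u \<odot> antipode H p)) m) y"
      by (rule sweedler2_coassoc[OF t, symmetric])
    also have "\<dots> = sweedler2 H (\<lambda>m q. counit H m *\<^sub>C (fcoord d q *\<^sub>C \<one>)) y"
      by (simp add: sweedler2_linear[OF clinear_scaleC] antipode_right mult.commute)
    also have "\<dots> = fcoord d y *\<^sub>C \<one>"
      by (rule sweedler2_counit(1)[OF clinear_compose[OF clinear_scaleC_left co]])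
    finally show ?thesis .
  qed
  have "sweedler2 H (\<lambda>a b. left_integral b *\<^sub>C a) x
    = (\<Sum>c\<in>?F. sweedler2 H (\<lambda>a b. fcoord c (b \<odot> antipode_sq c) *\<^sub>C a) x)"
    by (simp add: left_integral_def ctrace_def cvector.scale_sum_left sweedler2_sum)
  also have "\<dots> = (\<Sum>c\<in>?F. sweedler2 H (\<lambda>k1 k2. K c (x \<odot> antipode_sq k2) \<odot> antipode H k1) c)"
  proof (rule sum.cong)
    fix c :: 'h
    have l: "clinear (\<lambda>z. z \<odot> antipode H k1)" for k1 by (rule unital.clinear_amult_left)
    show "sweedler2 H (\<lambda>a b. fcoord c (b \<odot> antipode_sq c) *\<^sub>C a) x
      = sweedler2 H (\<lambda>k1 k2. K c (x \<odot> antipode_sq k2) \<odot> antipode H k1) c"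
      using sweedler2_absorb[OF bK[of c], of c x]
      by (simp add: K_def sweedler2_linear[OF l, symmetric] unital.amult_simps)
  qed simp
  also have "\<dots> = (\<Sum>c\<in>?F. \<Sum>d\<in>?F. K c (x \<odot> antipode_sq d) \<odot> antipode H (K d c))"
  proof (rule sum.cong)
    fix c :: 'h
    have l: "clinear (\<lambda>k2. K c (x \<odot> antipode_sq k2) \<odot> antipode H k1)" for k1
      by (rule clinear_compose[OF unital.clinear_amult_left clinear_compose[OF Kl
              clinear_compose[OF unital.clinear_amult_right clinear_antipode_sq]]])
    have l2: "clinear (\<lambda>k. z \<odot> antipode H k)" for z
      by (rule clinear_compose[OF unital.clinear_amult_right antipode_linear])
    have "sweedler2 H (\<lambda>k1 k2. K c (x \<odot> antipode_sq k2) \<odot> antipode H k1) c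
      = sweedler2 H (\<lambda>k1 k2. K c (x \<odot> antipode_sq (\<Sum>d\<in>?F. fcoord d k2 *\<^sub>C d)) \<odot> antipode H k1) c"
      by (simp only: fcoord_expand[OF finite_dim])
    also have "\<dots> = (\<Sum>d\<in>?F. sweedler2 H (\<lambda>k1 k2. fcoord d k2 *\<^sub>C (K c (x \<odot> antipode_sq d) \<odot> antipode H k1)) c)"
      by (simp only: clinear_simps[OF l] sweedler2_sum)
    also have "\<dots> = (\<Sum>d\<in>?F. K c (x \<odot> antipode_sq d) \<odot> antipode H (K d c))"
      unfolding K_def[of _ c] by (simp only: sweedler2_linear[OF l2, symmetric] clinear_simps[OF l2])
    finally show "sweedler2 H (\<lambda>k1 k2. K c (x \<odot> antipode_sq k2) \<odot> antipode H k1) c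
      = (\<Sum>d\<in>?F. K c (x \<odot> antipode_sq d) \<odot> antipode H (K d c))" .
  qed simp
  also have "\<dots> = (\<Sum>d\<in>?F. fcoord d (x \<odot> antipode_sq d) *\<^sub>C \<one>)"
    by (subst sum.swap) (simp only: inner)
  also have "\<dots> = left_integral x *\<^sub>C \<one>"
    by (simp add: left_integral_def ctrace_def cvector.scale_sum_left)
  finally show ?thesis .
qed

lemma left_integral_antipode: "left_integral (antipode H x) = right_integral x"
proof -
  have "left_integral (antipode H x) = ctrace (\<lambda>k. antipode H (antipode H k \<odot> x))"
    by (simp add: left_integral_def antipode_mult)
  also have "\<dots> = right_integral x"
    unfolding right_integral_def
    by (rule ctrace_commute[OF finite_dim antipode_linear, of "\<lambda>k. antipode H k \<odot> x"])
      (rule clinear_compose[OF unital.clinear_amult_left antipode_linear])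
  finally show ?thesis .
qed

lemma right_integral_invariant: "sweedler2 H (\<lambda>a b. right_integral a *\<^sub>C b) x = right_integral x *\<^sub>C \<one>"
proof -
  have b: "cbilinear (\<lambda>a b. left_integral b *\<^sub>C a)"
    by (rule cbilinear_slice[OF clinear_left_integral])
  have "antipode H (sweedler2 H (\<lambda>a b. right_integral a *\<^sub>C b) x)
    = sweedler2 H (\<lambda>a b. left_integral b *\<^sub>C a) (antipode H x)"
    by (simp add: sweedler2_antipode_arg[OF b] left_integral_antipode
        sweedler2_linear[OF antipode_linear, symmetric] clinear_simps[OF antipode_linear])
  also have "\<dots> = antipode H (right_integral x *\<^sub>C \<one>)"
    by (simp add: left_integral_invariant left_integral_antipode clinear_simps[OF antipode_linear] antipode_one)
  finally show ?thesis by (simp only: antipode_eq_iff)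
qed

text \<open>Cyclicity of the trace moves y past the operator k \<mapsto> x S^2(k), so the exchange
  of x and y costs one S^2.\<close>

lemma left_integral_commute: "left_integral (x \<odot> antipode_sq y) = left_integral (y \<odot> x)"
proof -
  have "left_integral (x \<odot> antipode_sq y) = ctrace (\<lambda>k. x \<odot> antipode_sq (y \<odot> k))"
    by (simp add: left_integral_def antipode_sq_mult amult_assoc)
  also have "\<dots> = ctrace (\<lambda>k. y \<odot> (x \<odot> antipode_sq k))"
    by (rule ctrace_commute[OF finite_dim, of "\<lambda>k. x \<odot> antipode_sq k" "\<lambda>k. y \<odot> k"])
      (rule unital.clinear_amult_right clinear_compose[OF unital.clinear_amult_right clinear_antipode_sq])+
  finally show ?thesis by (simp add: left_integral_def amult_assoc)
qed

lemma right_integral_commute: "right_integral (x \<odot> y) = right_integral (antipode_sq y \<odot> x)"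
proof -
  have "right_integral (x \<odot> y) = ctrace (\<lambda>k. (antipode_sq k \<odot> x) \<odot> y)"
    by (simp add: right_integral_def amult_assoc)
  also have "\<dots> = ctrace (\<lambda>k. antipode_sq (k \<odot> y) \<odot> x)"
    by (rule ctrace_commute[OF finite_dim, of "\<lambda>k. k \<odot> y" "\<lambda>k. antipode_sq k \<odot> x"])
      (rule unital.clinear_amult_left clinear_compose[OF unital.clinear_amult_left clinear_antipode_sq])+
  finally show ?thesis by (simp add: right_integral_def antipode_sq_mult amult_assoc)
qed

lemma antipode_antipode: "antipode H (antipode H h) = h"
proof -
  obtain B where B: "positive_form B" "\<And>x y z. B (astar H x \<odot> y) z = B y (x \<odot> z)"
    "\<And>h. h \<noteq> 0 \<Longrightarrow> Re (B h (antipode_sq h)) > 0"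
    by (rule antipode_sq_positive) blast
  interpret B: positive_form B by (rule B(1))
  obtain E where E: "finite E" "\<And>x. (\<Sum>e\<in>E. B e x *\<^sub>C e) = x"
    by (rule B.orthonormal_basis[OF finite_dim]) blast
  \<comment> \<open>By cyclicity this is the trace of k \<mapsto> y* S^2(y k); in an orthonormal
    basis of B it is a sum of terms B(y b, S^2(y b)), not all of which vanish.\<close>
  have faithful: "left_integral (y \<odot> astar H y) \<noteq> 0" if "y \<noteq> 0" for y
  proof -
    have "left_integral (y \<odot> astar H y) = ctrace (\<lambda>k. y \<odot> (astar H y \<odot> antipode_sq k))"
      by (simp add: left_integral_def amult_assoc)
    also have "\<dots> = ctrace (\<lambda>k. astar H y \<odot> antipode_sq (y \<odot> k))"
      by (rule ctrace_commute[OF finite_dim, of "\<lambda>k. y \<odot> k" "\<lambda>k. astar H y \<odot> antipode_sq k"])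
        (rule unital.clinear_amult_right clinear_compose[OF unital.clinear_amult_right clinear_antipode_sq])+
    also have "\<dots> = (\<Sum>b\<in>E. B b (astar H y \<odot> antipode_sq (y \<odot> b)))"
      by (rule ctrace_expansion[OF finite_dim _ B.linear E(2)])
        (rule clinear_compose[OF unital.clinear_amult_right
              clinear_compose[OF clinear_antipode_sq unital.clinear_amult_right]])
    also have "\<dots> = (\<Sum>b\<in>E. B (y \<odot> b) (antipode_sq (y \<odot> b)))"
      using B(2)[of "astar H y"] by (simp add: astar_astar)
    finally have *: "left_integral (y \<odot> astar H y) = (\<Sum>b\<in>E. B (y \<odot> b) (antipode_sq (y \<odot> b)))" .
    have "\<exists>b\<in>E. y \<odot> b \<noteq> 0"
    proof (rule ccontr)
      assume "\<not> ?thesis"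
      then have "y \<odot> (\<Sum>b\<in>E. B b \<one> *\<^sub>C b) = 0" by (simp add: unital.amult_simps)
      then show False using that by (simp add: E(2) amult_one_right)
    qed
    moreover have "Re (B z (antipode_sq z)) \<ge> 0" for z
      using B(3)[of z] B.linear by (cases "z = 0") (auto simp: clinear_zero[OF clinear_antipode_sq] clinear_zero)
    ultimately have "(\<Sum>b\<in>E. Re (B (y \<odot> b) (antipode_sq (y \<odot> b)))) > 0"
      using E(1) B(3) by (auto intro!: sum_pos2)
    then have "Re (left_integral (y \<odot> astar H y)) > 0" unfolding * by simp
    then show ?thesis by auto
  qed
  have "\<one> \<noteq> 0" using counit_one clinear_zero[OF counit_linear] by auto
  then have one: "left_integral \<one> \<noteq> 0" using faithful[of \<one>] by (simp add: astar_one amult_one_left)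
  \<comment> \<open>Evaluating right \<otimes> left on \<Delta>(x) by either invariance gives
    right(x) left(1) = left(x) right(1), and the two values at 1 agree because S(1) = 1.\<close>
  have "left_integral x = right_integral x" for x
  proof -
    have "sweedler2 H (\<lambda>a b. right_integral a *\<^sub>C left_integral b) x = right_integral x * left_integral \<one>"
      using arg_cong[OF right_integral_invariant[of x], of left_integral]
      by (simp add: sweedler2_linear[OF clinear_left_integral, symmetric]
          clinear_simps[OF clinear_left_integral] scaleC_complex_def)
    moreover have "sweedler2 H (\<lambda>a b. left_integral b *\<^sub>C right_integral a) x = left_integral x * right_integral \<one>"
      using arg_cong[OF left_integral_invariant[of x], of right_integral]
      by (simp add: sweedler2_linear[OF clinear_right_integral, symmetric]
          clinear_simps[OF clinear_right_integral] scaleC_complex_def)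
    ultimately have "right_integral x * left_integral \<one> = left_integral x * right_integral \<one>"
      by (simp add: scaleC_complex_def mult.commute)
    then show ?thesis using one left_integral_antipode[of \<one>] by (simp add: antipode_one)
  qed
  \<comment> \<open>Both commutation rules applied to the common integral: carrying y once around
    the product costs S^4, and faithfulness turns this into S^4 = id.\<close>
  then have com: "left_integral (y \<odot> x) = left_integral (antipode_sq (antipode_sq y) \<odot> x)" for x y
    using left_integral_commute[of x y] right_integral_commute[of x "antipode_sq y"] by metis
  have T2: "antipode_sq (antipode_sq y) = y" for y
  proof (rule ccontr)
    let ?z = "antipode_sq (antipode_sq y) - y"
    assume "antipode_sq (antipode_sq y) \<noteq> y"
    then have "left_integral (?z \<odot> astar H ?z) \<noteq> 0" using faithful[of ?z] by simp
    then show False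
      using com[of y "astar H ?z"] by (simp add: unital.amult_simps(5) clinear_diff[OF clinear_left_integral])
  qed
  show ?thesis
  proof (rule ccontr)
    \<comment> \<open>As S^4 = id, this vector lies in the eigenspace of S^2 for -1, on which S^2
      cannot be positive.\<close>
    let ?w = "antipode_sq h - h"
    assume "antipode_sq h \<noteq> h"
    then have w: "?w \<noteq> 0" by simp
    have "antipode_sq ?w = - ?w" by (simp add: clinear_diff[OF antipode_linear] T2)
    then have "Re (B ?w (antipode_sq ?w)) = - Re (B ?w ?w)"
      by (simp only: clinear_minus[OF B.linear] uminus_complex.sel)
    then show False using B(3)[OF w] B.positive[OF w] by simp
  qed
qed

end

section \<open>Contractivity\<close>

text \<open>The norm is a parameter, and not \<open>cstar_norm\<close>, because two C*-norms on one
  algebra are compared later.\<close>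

locale cstar_normed = unital_star_algebra A
  for A :: "('a::complex_vector, 'm) star_algebra_scheme" (structure) and n :: "'a \<Rightarrow> real" +
  assumes is_norm: "is_cstar_norm A n"
begin

lemma norm_nonneg: "n a \<ge> 0"
  and norm_zero_iff: "n a = 0 \<longleftrightarrow> a = 0"
  and norm_triangle: "n (a + b) \<le> n a + n b"
  and norm_scale: "n (z *\<^sub>C a) = cmod z * n a"
  and norm_mult: "n (a \<odot> b) \<le> n a * n b"
  and norm_star_self: "n (astar A a \<odot> a) = (n a)\<^sup>2"
  and norm_complete: "complete_wrt UNIV n"
  using is_norm unfolding is_cstar_norm_def by blast+

lemma norm_zero: "n 0 = 0"
  by (simp add: norm_zero_iff)

lemma norm_minus: "n (- a) = n a"
  using norm_scale[of "-1" a] by (simp add: scaleC_one)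

lemma norm_diff: "n (a - b) \<le> n a + n b"
  using norm_triangle[of a "- b"] by (simp add: norm_minus)

lemma norm_commute: "n (a - b) = n (b - a)"
  using norm_minus[of "a - b"] by simp

lemma norm_star: "n (astar A a) = n a"
proof -
  have le: "n a \<le> n (astar A a)" for a
  proof (cases "n a = 0")
    case True
    then show ?thesis by (simp add: norm_nonneg)
  next
    case False
    then have "n a > 0" using norm_nonneg[of a] by simp
    moreover have "n a * n a \<le> n (astar A a) * n a"
      using norm_star_self[of a] norm_mult[of "astar A a" a] by (simp add: power2_eq_square)
    ultimately show ?thesis by simp
  qed
  from le[of a] le[of "astar A a"] show ?thesis by (simp add: astar_astar)
qed

lemma norm_one_le: "n \<one> \<le> 1"
proof -
  have "n \<one> = (n \<one>)\<^sup>2" using norm_star_self[of \<one>] by (simp add: astar_one amult_one_left)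
  then show ?thesis by (auto simp: power2_eq_square)
qed

lemma norm_mult3: "n (a \<odot> b \<odot> c) \<le> n a * n b * n c"
  using norm_mult[of "a \<odot> b" c] mult_right_mono[OF norm_mult[of a b] norm_nonneg[of c]] by linarith

text \<open>Stands in for continuity: an equation for a limit is proved by bounding the norm of the
  defect by a multiple of the distance to the limit.\<close>

lemma limit_zero:
  assumes l: "e \<longlonglongrightarrow> 0" and b: "\<And>k::nat. n x \<le> c * e k"
  shows "x = 0"
proof -
  have "(\<lambda>k. c * e k) \<longlonglongrightarrow> c * 0" by (rule tendsto_mult_left[OF l])
  then have "n x \<le> 0" by (intro LIMSEQ_le_const[where X = "\<lambda>k. c * e k"]) (auto intro: b)
  then show ?thesis using norm_nonneg[of x] norm_zero_iff[of x] by simp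
qed

text \<open>\<open>1 - s\<close> will be the square root of \<open>1 - d\<^sup>2\<close>, all products being twisted by \<open>g\<close>.\<close>

lemma square_root_iteration:
  assumes g: "astar A g = g" and d: "astar A d = d" and q: "n d * n g < 1"
  obtains s where "astar A s = s" "2 *\<^sub>C s = d \<odot> g \<odot> d + s \<odot> g \<odot> s" "d \<odot> g \<odot> s = s \<odot> g \<odot> d"
proof -
  define e where "e = d \<odot> g \<odot> d"
  define q where "q = n d * n g"
  have q01: "0 \<le> q" "q < 1" using q by (simp_all add: q_def norm_nonneg)
  have e: "n e * n g \<le> q * q"
    using mult_right_mono[OF norm_mult3[of d g d] norm_nonneg[of g]] by (simp add: e_def q_def mult.assoc)
  \<comment> \<open>Fixed point iteration for 2 s = d g d + s g s, the equation that makes the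
    square of 1 - s equal to 1 - d^2 in the twisted product.\<close>
  define s where "s = rec_nat 0 (\<lambda>_ x. (1/2) *\<^sub>C (e + x \<odot> g \<odot> x))"
  have s0: "s 0 = 0" and sS: "s (Suc k) = (1/2) *\<^sub>C (e + s k \<odot> g \<odot> s k)" for k
    by (simp_all add: s_def)
  have ss: "astar A (s k) = s k" for k
    by (induction k) (simp_all add: s0 sS astar_simps e_def g d amult_assoc)
  have sd: "d \<odot> g \<odot> s k = s k \<odot> g \<odot> d" for k
  proof (induction k)
    case (Suc k)
    have "d \<odot> g \<odot> (s k \<odot> g \<odot> s k) = (d \<odot> g \<odot> s k) \<odot> g \<odot> s k" by (simp add: amult_assoc)
    also have "\<dots> = (s k \<odot> g \<odot> d) \<odot> g \<odot> s k" by (simp only: Suc)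
    also have "\<dots> = s k \<odot> g \<odot> (d \<odot> g \<odot> s k)" by (simp only: amult_assoc)
    also have "\<dots> = s k \<odot> g \<odot> s k \<odot> g \<odot> d" by (simp only: Suc) (simp add: amult_assoc)
    finally show ?case by (simp add: sS unital.amult_simps e_def amult_assoc)
  qed (simp add: s0 unital.amult_simps)
  \<comment> \<open>The ball of radius q in the norm weighted by that of g is invariant, since (q^2
    + q^2) / 2 = q^2 \<le> q; on it the iteration contracts by the factor q.\<close>
  have sb: "n (s k) * n g \<le> q" for k
  proof (induction k)
    case 0
    show ?case using q01 by (simp add: s0 norm_zero)
  next
    case (Suc k)
    have "n (s (Suc k)) \<le> (n e + n (s k \<odot> g \<odot> s k)) / 2"
      using norm_triangle[of e "s k \<odot> g \<odot> s k"] by (simp add: sS norm_scale)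
    also have "\<dots> \<le> (n e + n (s k) * n g * n (s k)) / 2" using norm_mult3[of "s k" g "s k"] by simp
    finally have "n (s (Suc k)) * n g \<le> (n e + n (s k) * n g * n (s k)) / 2 * n g"
      by (rule mult_right_mono) (rule norm_nonneg)
    also have "\<dots> = (n e * n g + (n (s k) * n g) * (n (s k) * n g)) / 2" by (simp add: field_simps)
    also have "\<dots> \<le> (q * q + q * q) / 2"
      using e mult_mono[OF Suc Suc q01(1)] by (simp add: norm_nonneg)
    also have "\<dots> \<le> q" using q01 mult_left_mono[of q 1 q] by simp
    finally show ?case .
  qed
  have step: "n (s (Suc (Suc k)) - s (Suc k)) \<le> q * n (s (Suc k) - s k)" for k
  proof -
    let ?x = "s (Suc k)" and ?y = "s k"
    have "s (Suc (Suc k)) - s (Suc k) = (1/2) *\<^sub>C (?x \<odot> g \<odot> ?x - ?y \<odot> g \<odot> ?y)"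
      by (simp add: sS[of "Suc k"] sS[of k] cvector.scale_right_diff_distrib scaleC_add_right)
    also have "?x \<odot> g \<odot> ?x - ?y \<odot> g \<odot> ?y = ?x \<odot> g \<odot> (?x - ?y) + (?x - ?y) \<odot> g \<odot> ?y"
      by (simp add: unital.amult_simps)
    finally have "n (s (Suc (Suc k)) - s (Suc k)) = n (?x \<odot> g \<odot> (?x - ?y) + (?x - ?y) \<odot> g \<odot> ?y) / 2"
      by (simp add: norm_scale)
    also have "\<dots> \<le> (n ?x * n g * n (?x - ?y) + n (?x - ?y) * n g * n ?y) / 2"
      using norm_triangle[of "?x \<odot> g \<odot> (?x - ?y)" "(?x - ?y) \<odot> g \<odot> ?y"]
        norm_mult3[of ?x g "?x - ?y"] norm_mult3[of "?x - ?y" g ?y] by simp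
    also have "\<dots> = ((n ?x * n g) * n (?x - ?y) + (n ?y * n g) * n (?x - ?y)) / 2" by (simp add: mult_ac)
    also have "\<dots> \<le> (q * n (?x - ?y) + q * n (?x - ?y)) / 2"
      using mult_right_mono[OF sb[of "Suc k"] norm_nonneg[of "?x - ?y"]]
        mult_right_mono[OF sb[of k] norm_nonneg[of "?x - ?y"]] by simp
    finally show ?thesis by simp
  qed
  define c where "c = n (s 1)"
  have c: "c \<ge> 0" by (simp add: c_def norm_nonneg)
  have inc: "n (s (Suc k) - s k) \<le> c * q ^ k" for k
  proof (induction k)
    case (Suc k)
    then show ?case using step[of k] mult_left_mono[OF Suc q01(1)] by (simp add: mult_ac)
  qed (simp add: s0 c_def)
  have tail: "n (s (j + m) - s j) * (1 - q) \<le> c * q ^ j * (1 - q ^ m)" for j m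
  proof (induction m)
    case (Suc m)
    have "n (s (j + Suc m) - s j) \<le> n (s (Suc (j + m)) - s (j + m)) + n (s (j + m) - s j)"
      using norm_triangle[of "s (Suc (j + m)) - s (j + m)" "s (j + m) - s j"] by simp
    also have "\<dots> \<le> c * q ^ (j + m) + n (s (j + m) - s j)" using inc[of "j + m"] by simp
    finally have "n (s (j + Suc m) - s j) * (1 - q) \<le> (c * q ^ (j + m) + n (s (j + m) - s j)) * (1 - q)"
      using q01 by (intro mult_right_mono) auto
    also have "\<dots> \<le> c * q ^ (j + m) * (1 - q) + c * q ^ j * (1 - q ^ m)"
      using Suc by (simp add: distrib_right)
    also have "\<dots> = c * q ^ j * (1 - q ^ Suc m)" by (simp add: power_add algebra_simps)
    finally show ?case .
  qed (simp add: norm_zero)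
  have tail': "n (s i - s j) \<le> c / (1 - q) * q ^ j" if "j \<le> i" for i j
  proof -
    have "n (s i - s j) * (1 - q) \<le> c * q ^ j * (1 - q ^ (i - j))" using tail[of j "i - j"] that by simp
    also have "\<dots> \<le> c * q ^ j * 1" using c q01 by (intro mult_left_mono) auto
    finally show ?thesis using q01 by (simp add: pos_le_divide_eq)
  qed
  have lim0: "(\<lambda>j. c / (1 - q) * q ^ j) \<longlonglongrightarrow> 0"
    using tendsto_mult_left[OF LIMSEQ_realpow_zero[OF q01], of "c / (1 - q)"] by simp
  have "\<exists>N. \<forall>i\<ge>N. \<forall>j\<ge>N. n (s i - s j) < r" if r: "r > 0" for r
  proof -
    obtain N where N: "\<And>j. j \<ge> N \<Longrightarrow> c / (1 - q) * q ^ j < r"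
      using order_tendstoD(2)[OF lim0 r] by (auto simp: eventually_sequentially)
    have "n (s i - s j) < r" if "i \<ge> N" "j \<ge> N" for i j
      using N[OF that(1)] N[OF that(2)] tail'[of i j] tail'[of j i] norm_commute[of "s i" "s j"]
      by (cases "i \<le> j") auto
    then show ?thesis by blast
  qed
  then obtain l where l: "(\<lambda>i. n (s i - l)) \<longlonglongrightarrow> 0"
    using norm_complete unfolding complete_wrt_def by blast
  have "astar A l - l = 0"
  proof (rule limit_zero[OF l])
    fix k
    have "astar A l - l = (s k - l) - astar A (s k - l)" by (simp add: astar_simps ss)
    then have "n (astar A l - l) = n ((s k - l) - astar A (s k - l))" by (simp only:)
    then show "n (astar A l - l) \<le> 2 * n (s k - l)"
      using norm_diff[of "s k - l" "astar A (s k - l)"] norm_star[of "s k - l"] by linarith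
  qed
  moreover have "d \<odot> g \<odot> l - l \<odot> g \<odot> d = 0"
  proof (rule limit_zero[OF l])
    fix k
    have "d \<odot> g \<odot> l - l \<odot> g \<odot> d = (s k - l) \<odot> g \<odot> d - d \<odot> g \<odot> (s k - l)"
      by (simp add: unital.amult_simps sd)
    then show "n (d \<odot> g \<odot> l - l \<odot> g \<odot> d) \<le> 2 * q * n (s k - l)"
      using norm_diff[of "(s k - l) \<odot> g \<odot> d" "d \<odot> g \<odot> (s k - l)"]
        norm_mult3[of "s k - l" g d] norm_mult3[of d g "s k - l"] by (simp add: q_def mult_ac)
  qed
  moreover have "2 *\<^sub>C l - (e + l \<odot> g \<odot> l) = 0"
  \<comment> \<open>The recursion ties two consecutive terms, so the bound uses the sum of their
    distances to the limit.\<close>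
  proof (rule limit_zero[OF l[THEN LIMSEQ_Suc, THEN tendsto_add, OF l, simplified]])
    fix k
    let ?x = "s k"
    have "2 *\<^sub>C s (Suc k) = e + ?x \<odot> g \<odot> ?x" by (simp add: sS scaleC_scaleC scaleC_one)
    then have "2 *\<^sub>C l - (e + l \<odot> g \<odot> l) = (?x \<odot> g \<odot> (?x - l) + (?x - l) \<odot> g \<odot> l) - 2 *\<^sub>C (s (Suc k) - l)"
      by (simp add: unital.amult_simps cvector.scale_right_diff_distrib algebra_simps)
    then have "n (2 *\<^sub>C l - (e + l \<odot> g \<odot> l))
      \<le> (n ?x * n g * n (?x - l) + n (?x - l) * n g * n l) + 2 * n (s (Suc k) - l)"
      using norm_diff[of "?x \<odot> g \<odot> (?x - l) + (?x - l) \<odot> g \<odot> l" "2 *\<^sub>C (s (Suc k) - l)"]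
        norm_triangle[of "?x \<odot> g \<odot> (?x - l)" "(?x - l) \<odot> g \<odot> l"]
        norm_mult3[of ?x g "?x - l"] norm_mult3[of "?x - l" g l] by (simp add: norm_scale)
    also have "n ?x * n g * n (?x - l) \<le> 1 * n (?x - l)"
      using sb[of k] q01 by (intro mult_right_mono norm_nonneg) simp
    also have "1 * n (?x - l) + n (?x - l) * n g * n l + 2 * n (s (Suc k) - l)
      \<le> (3 + n g * n l) * (n (s (Suc k) - l) + n (?x - l))"
      using norm_nonneg[of "s (Suc k) - l"] norm_nonneg[of "?x - l"]
        mult_nonneg_nonneg[OF mult_nonneg_nonneg[OF norm_nonneg[of g] norm_nonneg[of l]] norm_nonneg[of "s (Suc k) - l"]]
      by (simp add: algebra_simps)
    finally show "n (2 *\<^sub>C l - (e + l \<odot> g \<odot> l)) \<le> (3 + n g * n l) * (n (s (Suc k) - l) + n (s k - l))"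
      by simp
  qed
  ultimately show thesis by (intro that[of l]) (simp_all add: e_def)
qed

end

text \<open>
  For small selfadjoint \<open>d\<close> the element \<open>M d\<close> is the real part of the unitary
  \<open>M d + \<i> (1 - (M d)\<^sup>2)\<^sup>1\<^sup>/\<^sup>2\<close>, and unitaries have norm at most one.
\<close>

lemma compressed_hom_contractive:
  assumes "cstar_normed D n" and "cstar_normed C p"
    and M: "clinear M" "\<And>x y. M (x \<odot>\<^bsub>D\<^esub> g \<odot>\<^bsub>D\<^esub> y) = M x \<odot>\<^bsub>C\<^esub> M y" "\<And>x. M (astar D x) = astar C (M x)"
    and g: "astar D g = g" and d: "astar D d = d"
  shows "p (M d) \<le> n d * n g"
proof -
  interpret D: cstar_normed D n by fact
  interpret C: cstar_normed C p by fact
  have unit: "p (M d) \<le> 1" if d: "astar D d = d" and q: "n d * n g < 1" for d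
  proof -
    obtain s where s: "astar D s = s" "2 *\<^sub>C s = d \<odot>\<^bsub>D\<^esub> g \<odot>\<^bsub>D\<^esub> d + s \<odot>\<^bsub>D\<^esub> g \<odot>\<^bsub>D\<^esub> s"
      "d \<odot>\<^bsub>D\<^esub> g \<odot>\<^bsub>D\<^esub> s = s \<odot>\<^bsub>D\<^esub> g \<odot>\<^bsub>D\<^esub> d"
      by (rule D.square_root_iteration[OF g d q])
    \<comment> \<open>A unit of the twisted product would be an inverse of g, so 1 - s is formed
      only in C, after applying M.\<close>
    define b where "b = \<one>\<^bsub>C\<^esub> - M s"
    define u where "u = M d + \<i> *\<^sub>C b"
    have b: "astar C b = b" using s(1) M(3)[of s] by (simp add: b_def C.astar_simps)
    have md: "astar C (M d) = M d" using d M(3)[of d] by simp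
    have "2 *\<^sub>C M s = M d \<odot>\<^bsub>C\<^esub> M d + M s \<odot>\<^bsub>C\<^esub> M s"
      using arg_cong[OF s(2), of M] by (simp add: clinear_simps[OF M(1)] M(2))
    moreover have "2 *\<^sub>C M s = M s + M s"
      using scaleC_add_left[of 1 1 "M s"] by (simp add: scaleC_one)
    ultimately have bb: "M d \<odot>\<^bsub>C\<^esub> M d + b \<odot>\<^bsub>C\<^esub> b = \<one>\<^bsub>C\<^esub>"
      by (simp add: b_def C.unital.amult_simps C.amult_one_left C.amult_one_right algebra_simps)
    have "M d \<odot>\<^bsub>C\<^esub> M s = M s \<odot>\<^bsub>C\<^esub> M d" using arg_cong[OF s(3), of M] by (simp add: M(2))
    then have com: "M d \<odot>\<^bsub>C\<^esub> b = b \<odot>\<^bsub>C\<^esub> M d"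
      by (simp add: b_def C.unital.amult_simps C.amult_one_left C.amult_one_right)
    have us: "astar C u = M d - \<i> *\<^sub>C b" by (simp add: u_def C.astar_simps b md)
    have "astar C u \<odot>\<^bsub>C\<^esub> u = \<one>\<^bsub>C\<^esub>"
      unfolding us unfolding u_def using bb com
      by (simp add: C.unital.amult_simps scaleC_scaleC cvector.scale_right_diff_distrib)
    then have "(p u)\<^sup>2 \<le> 1" using C.norm_star_self[of u] C.norm_one_le by simp
    then have u1: "p u \<le> 1" using C.norm_nonneg[of u] by (simp add: power_le_one_iff)
    have "u + astar C u = (1 + 1) *\<^sub>C M d"
      unfolding us unfolding u_def scaleC_add_left by (simp add: scaleC_one)
    then have "M d = (1/2) *\<^sub>C (u + astar C u)" by (simp add: scaleC_scaleC scaleC_one)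
    then have "p (M d) = p (u + astar C u) / 2" by (simp add: C.norm_scale)
    then show ?thesis using C.norm_triangle[of u "astar C u"] u1 by (simp add: C.norm_star)
  qed
  show ?thesis
  proof (rule dense_ge)
    fix t assume t: "n d * n g < t"
    have "n d * n g \<ge> 0" by (simp add: D.norm_nonneg)
    with t have t0: "t > 0" by linarith
    have "p (M (of_real (1 / t) *\<^sub>C d)) \<le> 1"
      using t t0 by (intro unit) (simp_all add: D.astar_scale d D.norm_scale norm_divide field_simps)
    then show "p (M d) \<le> t"
      using t0 by (simp add: clinear_simps[OF M(1)] C.norm_scale norm_divide field_simps)
  qed
qed

text \<open>The compressed estimate with g = 1 is applied to the selfadjoint element d* d, and the
  C*-identity on both sides takes the square root.\<close>

lemma star_hom_contractive:
  assumes "cstar_normed D n" and "cstar_normed C p" and f: "unital_star_hom D C f"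
  shows "p (f d) \<le> n d"
proof -
  interpret D: cstar_normed D n by fact
  interpret C: cstar_normed C p by fact
  have "p (f (astar D d \<odot>\<^bsub>D\<^esub> d)) \<le> n (astar D d \<odot>\<^bsub>D\<^esub> d) * n \<one>\<^bsub>D\<^esub>"
    using unital_star_homD[OF f]
    by (intro compressed_hom_contractive[OF assms(1,2)])
      (simp_all add: D.astar_one D.amult_one_right D.astar_mult D.astar_astar)
  also have "\<dots> \<le> (n d)\<^sup>2"
    using mult_left_mono[OF D.norm_one_le, of "(n d)\<^sup>2"] by (simp add: D.norm_star_self)
  finally have "(p (f d))\<^sup>2 \<le> (n d)\<^sup>2"
    using unital_star_homD[OF f] by (simp add: C.norm_star_self)
  then show ?thesis using D.norm_nonneg by (simp add: power2_le_iff_abs_le C.norm_nonneg)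
qed

lemma (in cstar_algebra) cstar_normed: "cstar_normed A (cstar_norm A)"
proof
  show "is_cstar_norm A (cstar_norm A)"
    unfolding cstar_norm_def using ex_cstar_norm by (rule someI_ex)
qed

section \<open>Exterior tensor products of bimodules\<close>

lemma tensor_lift_on_cong:
  assumes S: "csubspace S" and t: "t \<in> tensor_carrier S" and fg: "\<And>a b. a \<in> S \<Longrightarrow> f a b = g a b"
  shows "tensor_lift_on S f t = tensor_lift_on S g t"
proof -
  have "fst ` set_mset (SOME p. abs_tensor p = t \<and> fst ` set_mset p \<subseteq> S) \<subseteq> S"
    using someI_ex[OF tensor_carrier_rep[OF S t]] by blast
  then show ?thesis unfolding tensor_lift_on_def
    by (intro arg_cong[of _ _ sum_mset] image_mset_cong) (auto simp: fg image_subset_iff)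
qed

text \<open>All four operations of \<open>ext_tensor\<close> have this shape. Balancedness takes the
  place of bilinearity so that the inner products, conjugate linear in one argument, are covered as
  well.\<close>

lemma double_lift:
  fixes f :: "'x::complex_vector \<Rightarrow> 'k::complex_vector \<Rightarrow> 'y::complex_vector \<Rightarrow> 'l::complex_vector \<Rightarrow> 'z::ab_group_add"
  assumes S: "csubspace S" and R: "csubspace R"
    and f: "\<And>y l. y \<in> R \<Longrightarrow> balanced_on S (\<lambda>x k. f x k y l)" "\<And>x k. x \<in> S \<Longrightarrow> balanced_on R (\<lambda>y l. f x k y l)"
  defines "L \<equiv> \<lambda>s t. tensor_lift_on S (\<lambda>x k. tensor_lift_on R (\<lambda>y l. f x k y l) t) s"
  shows "x \<in> S \<Longrightarrow> y \<in> R \<Longrightarrow> L (x \<otimes>\<^sub>t k) (y \<otimes>\<^sub>t l) = f x k y l"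
    and "s \<in> tensor_carrier S \<Longrightarrow> s' \<in> tensor_carrier S \<Longrightarrow> t \<in> tensor_carrier R \<Longrightarrow> L (s + s') t = L s t + L s' t"
    and "s \<in> tensor_carrier S \<Longrightarrow> t \<in> tensor_carrier R \<Longrightarrow> t' \<in> tensor_carrier R \<Longrightarrow> L s (t + t') = L s t + L s t'"
proof -
  have bal: "balanced_on S (\<lambda>x k. tensor_lift_on R (\<lambda>y l. f x k y l) t)" if t: "t \<in> tensor_carrier R" for t
    unfolding balanced_on_def tensor_lift_on_fun_add[symmetric]
    using f(1) by (auto intro!: tensor_lift_on_cong[OF R t] simp: balanced_on_def)
  show "L (x \<otimes>\<^sub>t k) (y \<otimes>\<^sub>t l) = f x k y l" if "x \<in> S" "y \<in> R"
    using that by (simp add: L_def S R bal tensor_carrier_pure f)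
  show "L (s + s') t = L s t + L s' t"
    if "s \<in> tensor_carrier S" "s' \<in> tensor_carrier S" "t \<in> tensor_carrier R"
    unfolding L_def by (rule tensor_lift_on_add[OF S bal]) (rule that)+
  show "L s (t + t') = L s t + L s t'"
    if "s \<in> tensor_carrier S" "t \<in> tensor_carrier R" "t' \<in> tensor_carrier R"
    unfolding L_def tensor_lift_on_fun_add[symmetric]
    by (rule tensor_lift_on_cong[OF S that(1)]) (rule tensor_lift_on_add[OF R f(2) that(2,3)])
qed

text \<open>A part of the bimodule axioms that consists of closure properties and identities. These
  pass to exterior tensor products by checking elementary tensors, and the calculus in Y \<otimes>
  H^0 and Y \<otimes> H^0 \<otimes> H^0 rests on them alone.\<close>

locale pre_bimodule =
  left: unital_star_algebra A + right: unital_star_algebra B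
  for A :: "('a::complex_vector, 'm) star_algebra_scheme"
    and B :: "('b::complex_vector, 'n) star_algebra_scheme"
    and X :: "('a, 'b, 'x::complex_vector) bimodule" +
  assumes subspace: "csubspace (bcarrier X)"
    and lact_closed: "x \<in> bcarrier X \<Longrightarrow> lact X a x \<in> bcarrier X"
    and lact_add_left: "x \<in> bcarrier X \<Longrightarrow> lact X (a + a') x = lact X a x + lact X a' x"
    and lact_add_right: "x \<in> bcarrier X \<Longrightarrow> y \<in> bcarrier X \<Longrightarrow> lact X a (x + y) = lact X a x + lact X a y"
    and lact_scale_left: "x \<in> bcarrier X \<Longrightarrow> lact X (z *\<^sub>C a) x = z *\<^sub>C lact X a x"
    and lact_scale_right: "x \<in> bcarrier X \<Longrightarrow> lact X a (z *\<^sub>C x) = z *\<^sub>C lact X a x"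
    and lact_mult: "x \<in> bcarrier X \<Longrightarrow> lact X (a \<odot>\<^bsub>A\<^esub> a') x = lact X a (lact X a' x)"
    and lact_one: "x \<in> bcarrier X \<Longrightarrow> lact X \<one>\<^bsub>A\<^esub> x = x"
    and ract_closed: "x \<in> bcarrier X \<Longrightarrow> ract X x b \<in> bcarrier X"
    and ract_add_left: "x \<in> bcarrier X \<Longrightarrow> y \<in> bcarrier X \<Longrightarrow> ract X (x + y) b = ract X x b + ract X y b"
    and ract_add_right: "x \<in> bcarrier X \<Longrightarrow> ract X x (b + b') = ract X x b + ract X x b'"
    and ract_scale_left: "x \<in> bcarrier X \<Longrightarrow> ract X (z *\<^sub>C x) b = z *\<^sub>C ract X x b"
    and ract_scale_right: "x \<in> bcarrier X \<Longrightarrow> ract X x (z *\<^sub>C b) = z *\<^sub>C ract X x b"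
    and ract_mult: "x \<in> bcarrier X \<Longrightarrow> ract X x (b \<odot>\<^bsub>B\<^esub> b') = ract X (ract X x b) b'"
    and ract_one: "x \<in> bcarrier X \<Longrightarrow> ract X x \<one>\<^bsub>B\<^esub> = x"
    and lact_ract: "x \<in> bcarrier X \<Longrightarrow> ract X (lact X a x) b = lact X a (ract X x b)"
    and lip_add: "x \<in> bcarrier X \<Longrightarrow> y \<in> bcarrier X \<Longrightarrow> w \<in> bcarrier X \<Longrightarrow>
      lip X (x + y) w = lip X x w + lip X y w"
    and lip_scale: "x \<in> bcarrier X \<Longrightarrow> y \<in> bcarrier X \<Longrightarrow> lip X (z *\<^sub>C x) y = z *\<^sub>C lip X x y"
    and lip_lact: "x \<in> bcarrier X \<Longrightarrow> y \<in> bcarrier X \<Longrightarrow> lip X (lact X a x) y = a \<odot>\<^bsub>A\<^esub> lip X x y"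
    and lip_star: "x \<in> bcarrier X \<Longrightarrow> y \<in> bcarrier X \<Longrightarrow> astar A (lip X x y) = lip X y x"
    and rip_add: "x \<in> bcarrier X \<Longrightarrow> y \<in> bcarrier X \<Longrightarrow> w \<in> bcarrier X \<Longrightarrow>
      rip X w (x + y) = rip X w x + rip X w y"
    and rip_scale: "x \<in> bcarrier X \<Longrightarrow> y \<in> bcarrier X \<Longrightarrow> rip X x (z *\<^sub>C y) = z *\<^sub>C rip X x y"
    and rip_ract: "x \<in> bcarrier X \<Longrightarrow> y \<in> bcarrier X \<Longrightarrow> rip X x (ract X y b) = rip X x y \<odot>\<^bsub>B\<^esub> b"
    and rip_star: "x \<in> bcarrier X \<Longrightarrow> y \<in> bcarrier X \<Longrightarrow> astar B (rip X x y) = rip X y x"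
    and rip_lact: "x \<in> bcarrier X \<Longrightarrow> y \<in> bcarrier X \<Longrightarrow>
      rip X (lact X a x) y = rip X x (lact X (astar A a) y)"
    and lip_ract: "x \<in> bcarrier X \<Longrightarrow> y \<in> bcarrier X \<Longrightarrow>
      lip X (ract X x b) y = lip X x (ract X y (astar B b))"

sublocale equivalence_bimodule \<subseteq> pre_bimodule
  by (rule pre_bimodule.intro)
    (intro left.unital_star_algebra_axioms right.unital_star_algebra_axioms pre_bimodule_axioms.intro;
      fact subspace lact_closed lact_add_left lact_add_right lact_scale_left lact_scale_right lact_mult lact_one
        ract_closed ract_add_left ract_add_right ract_scale_left ract_scale_right ract_mult ract_one lact_ract
        lip_add lip_scale lip_lact lip_star rip_add rip_scale rip_ract rip_star rip_lact lip_ract)+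

context pre_bimodule
begin

lemma add_closed: "x \<in> bcarrier X \<Longrightarrow> y \<in> bcarrier X \<Longrightarrow> x + y \<in> bcarrier X"
  and scale_closed: "x \<in> bcarrier X \<Longrightarrow> z *\<^sub>C x \<in> bcarrier X"
  and zero_closed: "0 \<in> bcarrier X"
  and sum_closed: "(\<And>i. i \<in> I \<Longrightarrow> g i \<in> bcarrier X) \<Longrightarrow> (\<Sum>i\<in>I. g i) \<in> bcarrier X"
  using subspace by (auto intro: cvector.subspace_add cvector.subspace_scale cvector.subspace_0
      cvector.subspace_sum)

lemma lip_add_right:
  "x \<in> bcarrier X \<Longrightarrow> y \<in> bcarrier X \<Longrightarrow> w \<in> bcarrier X \<Longrightarrow> lip X w (x + y) = lip X w x + lip X w y"
  by (metis add_closed left.astar_add lip_add lip_star)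

lemma lip_scale_right:
  "x \<in> bcarrier X \<Longrightarrow> y \<in> bcarrier X \<Longrightarrow> lip X x (z *\<^sub>C y) = cnj z *\<^sub>C lip X x y"
  by (metis left.astar_scale lip_scale lip_star scale_closed)

lemma rip_add_left:
  "x \<in> bcarrier X \<Longrightarrow> y \<in> bcarrier X \<Longrightarrow> w \<in> bcarrier X \<Longrightarrow> rip X (x + y) w = rip X x w + rip X y w"
  by (metis add_closed right.astar_add rip_add rip_star)

lemma rip_scale_left:
  "x \<in> bcarrier X \<Longrightarrow> y \<in> bcarrier X \<Longrightarrow> rip X (z *\<^sub>C x) y = cnj z *\<^sub>C rip X x y"
  by (metis right.astar_scale rip_scale rip_star scale_closed)

lemma lip_lact_right:
  "x \<in> bcarrier X \<Longrightarrow> y \<in> bcarrier X \<Longrightarrow> lip X x (lact X a y) = lip X x y \<odot>\<^bsub>A\<^esub> astar A a"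
  by (metis left.astar_mult lact_closed lip_lact lip_star)

lemma rip_ract_left:
  "x \<in> bcarrier X \<Longrightarrow> y \<in> bcarrier X \<Longrightarrow> rip X (ract X x b) y = astar B b \<odot>\<^bsub>B\<^esub> rip X x y"
  by (metis right.astar_mult ract_closed rip_ract rip_star)

lemma clinear_lact_left: "x \<in> bcarrier X \<Longrightarrow> clinear (\<lambda>a. lact X a x)"
  by (rule clinearI) (simp_all add: lact_add_left lact_scale_left)

lemma clinear_ract_right: "x \<in> bcarrier X \<Longrightarrow> clinear (ract X x)"
  by (rule clinearI) (simp_all add: ract_add_right ract_scale_right)

lemma rip_zero: "x \<in> bcarrier X \<Longrightarrow> rip X x 0 = 0"
  using rip_scale[of x 0 0] zero_closed by simp

lemma rip_sum:
  "x \<in> bcarrier X \<Longrightarrow> (\<And>i. i \<in> I \<Longrightarrow> g i \<in> bcarrier X) \<Longrightarrow> rip X x (\<Sum>i\<in>I. g i) = (\<Sum>i\<in>I. rip X x (g i))"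
  by (induction I rule: infinite_finite_induct) (simp_all add: rip_zero rip_add sum_closed)

end

lemma bcarrier_ext: "bcarrier (ext_tensor X K) = tensor_carrier (bcarrier X)"
  by (simp add: ext_tensor_def tensor_carrier_def)

locale ext_bimodule = pre_bimodule A B X + coef: unital_star_algebra K
  for A :: "('a::complex_vector, 'm) star_algebra_scheme"
    and B :: "('b::complex_vector, 'n) star_algebra_scheme"
    and X :: "('a, 'b, 'x::complex_vector) bimodule"
    and K :: "('k::complex_vector, 'o) star_algebra_scheme"
begin

lemma ext_lact_bal:
  "x \<in> bcarrier X \<Longrightarrow> balanced_on UNIV (\<lambda>a k. lact X a x \<otimes>\<^sub>t (k \<odot>\<^bsub>K\<^esub> l))"
  "balanced_on (bcarrier X) (\<lambda>x l. lact X a x \<otimes>\<^sub>t (k \<odot>\<^bsub>K\<^esub> l))"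
  by (auto simp: balanced_on_def lact_add_left lact_add_right lact_scale_left lact_scale_right
      pure_tensor_simps coef.unital.amult_simps)

lemma ext_ract_bal:
  "x \<in> bcarrier X \<Longrightarrow> balanced_on UNIV (\<lambda>b k. ract X x b \<otimes>\<^sub>t (l \<odot>\<^bsub>K\<^esub> k))"
  "balanced_on (bcarrier X) (\<lambda>x l. ract X x b \<otimes>\<^sub>t (l \<odot>\<^bsub>K\<^esub> k))"
  by (auto simp: balanced_on_def ract_add_left ract_add_right ract_scale_left ract_scale_right
      pure_tensor_simps coef.unital.amult_simps)

lemma ext_lip_bal:
  "y \<in> bcarrier X \<Longrightarrow> balanced_on (bcarrier X) (\<lambda>x k. lip X x y \<otimes>\<^sub>t (k \<odot>\<^bsub>K\<^esub> astar K l))"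
  "x \<in> bcarrier X \<Longrightarrow> balanced_on (bcarrier X) (\<lambda>y l. lip X x y \<otimes>\<^sub>t (k \<odot>\<^bsub>K\<^esub> astar K l))"
  by (auto simp: balanced_on_def lip_add lip_scale lip_add_right lip_scale_right coef.astar_simps
      pure_tensor_simps coef.unital.amult_simps)

lemma ext_rip_bal:
  "y \<in> bcarrier X \<Longrightarrow> balanced_on (bcarrier X) (\<lambda>x k. rip X x y \<otimes>\<^sub>t (astar K k \<odot>\<^bsub>K\<^esub> l))"
  "x \<in> bcarrier X \<Longrightarrow> balanced_on (bcarrier X) (\<lambda>y l. rip X x y \<otimes>\<^sub>t (astar K k \<odot>\<^bsub>K\<^esub> l))"
  by (auto simp: balanced_on_def rip_add rip_scale rip_add_left rip_scale_left coef.astar_simps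
      pure_tensor_simps coef.unital.amult_simps)

abbreviation E where "E \<equiv> ext_tensor X K"

abbreviation carrier :: "('x, 'k) tensor set" where "carrier \<equiv> tensor_carrier (bcarrier X)"

lemma ext_pure:
  "x \<in> bcarrier X \<Longrightarrow> lact E (a \<otimes>\<^sub>t k) (x \<otimes>\<^sub>t l) = lact X a x \<otimes>\<^sub>t (k \<odot>\<^bsub>K\<^esub> l)"
  "x \<in> bcarrier X \<Longrightarrow> ract E (x \<otimes>\<^sub>t l) (b \<otimes>\<^sub>t k) = ract X x b \<otimes>\<^sub>t (l \<odot>\<^bsub>K\<^esub> k)"
  "x \<in> bcarrier X \<Longrightarrow> y \<in> bcarrier X \<Longrightarrow> lip E (x \<otimes>\<^sub>t k) (y \<otimes>\<^sub>t l) = lip X x y \<otimes>\<^sub>t (k \<odot>\<^bsub>K\<^esub> astar K l)"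
  "x \<in> bcarrier X \<Longrightarrow> y \<in> bcarrier X \<Longrightarrow> rip E (x \<otimes>\<^sub>t k) (y \<otimes>\<^sub>t l) = rip X x y \<otimes>\<^sub>t (astar K k \<odot>\<^bsub>K\<^esub> l)"
  using double_lift(1)[OF csubspace_UNIV subspace ext_lact_bal] double_lift(1)[OF subspace csubspace_UNIV ext_ract_bal(2,1)]
    double_lift(1)[OF subspace subspace ext_lip_bal] double_lift(1)[OF subspace subspace ext_rip_bal]
  by (simp_all add: ext_tensor_def)

lemma ext_add:
  "t \<in> carrier \<Longrightarrow> lact E (s + s') t = lact E s t + lact E s' t"
  "t \<in> carrier \<Longrightarrow> t' \<in> carrier \<Longrightarrow> lact E s (t + t') = lact E s t + lact E s t'"
  "t \<in> carrier \<Longrightarrow> t' \<in> carrier \<Longrightarrow> ract E (t + t') r = ract E t r + ract E t' r"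
  "t \<in> carrier \<Longrightarrow> ract E t (r + r') = ract E t r + ract E t r'"
  using double_lift(2,3)[OF csubspace_UNIV subspace ext_lact_bal] double_lift(2,3)[OF subspace csubspace_UNIV ext_ract_bal(2,1)]
  by (simp_all add: ext_tensor_def)

lemma ext_ip_add:
  "t \<in> carrier \<Longrightarrow> t' \<in> carrier \<Longrightarrow> w \<in> carrier \<Longrightarrow> lip E (t + t') w = lip E t w + lip E t' w"
  "t \<in> carrier \<Longrightarrow> t' \<in> carrier \<Longrightarrow> w \<in> carrier \<Longrightarrow> lip E w (t + t') = lip E w t + lip E w t'"
  "t \<in> carrier \<Longrightarrow> t' \<in> carrier \<Longrightarrow> w \<in> carrier \<Longrightarrow> rip E (t + t') w = rip E t w + rip E t' w"
  "t \<in> carrier \<Longrightarrow> t' \<in> carrier \<Longrightarrow> w \<in> carrier \<Longrightarrow> rip E w (t + t') = rip E w t + rip E w t'"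
  using double_lift(2,3)[OF subspace subspace ext_lip_bal] double_lift(2,3)[OF subspace subspace ext_rip_bal]
  by (simp_all add: ext_tensor_def)

lemmas ext_induct [consumes 1, case_names pure add] = tensor_carrier_induct[OF subspace]

lemma ext_closed:
  assumes t: "t \<in> carrier"
  shows "lact E s t \<in> carrier" "ract E t r \<in> carrier"
proof -
  show "lact E s t \<in> carrier"
  proof (induction s rule: tensor_induct)
    case (pure a k)
    from t show ?case
      by (induction rule: ext_induct) (simp_all add: ext_pure ext_add tensor_carrier_pure lact_closed tensor_carrier_add)
  qed (simp add: ext_add t tensor_carrier_add)
  show "ract E t r \<in> carrier"
  proof (induction r rule: tensor_induct)
    case (pure a k)
    from t show ?case
      by (induction rule: ext_induct) (simp_all add: ext_pure ext_add tensor_carrier_pure ract_closed tensor_carrier_add)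
  qed (simp add: ext_add t tensor_carrier_add)
qed

lemmas ext_simps = ext_pure ext_add ext_ip_add ext_closed tensor_carrier_pure tensor_carrier_add

lemma ext_pre_bimodule: "pre_bimodule (tensor_algebra A K) (tensor_algebra B K) E"
proof -
  note AK = unital_star_algebra_tensor[OF left.unital_star_algebra_axioms coef.unital_star_algebra_axioms]
  note BK = unital_star_algebra_tensor[OF right.unital_star_algebra_axioms coef.unital_star_algebra_axioms]
  interpret AK: unital_star_algebra "tensor_algebra A K" by (rule AK)
  interpret BK: unital_star_algebra "tensor_algebra B K" by (rule BK)
  note mult = tensor_algebra_mult(1)[OF left.unital.unital_algebra_axioms coef.unital.unital_algebra_axioms]
    tensor_algebra_mult(1)[OF right.unital.unital_algebra_axioms coef.unital.unital_algebra_axioms]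
    AK.unital.amult_simps BK.unital.amult_simps
    tensor_algebra_star[OF left.unital_star_algebra_axioms coef.unital_star_algebra_axioms]
    tensor_algebra_star[OF right.unital_star_algebra_axioms coef.unital_star_algebra_axioms]
    coef.astar_mult coef.astar_astar coef.amult_assoc coef.amult_one_left coef.amult_one_right
  note cl = lact_closed ract_closed
  show ?thesis
  proof (intro pre_bimodule.intro AK BK pre_bimodule_axioms.intro; unfold bcarrier_ext)
    show "csubspace carrier" by (rule csubspace_tensor_carrier)
    fix t :: "('x, 'k) tensor" assume t: "t \<in> carrier"
    show "lact E s t \<in> carrier" "ract E t r \<in> carrier" for s r by (rule ext_closed[OF t])+
    show "lact E (s + s') t = lact E s t + lact E s' t" "ract E t (r + r') = ract E t r + ract E t r'" for s s' r r'
      by (simp_all add: ext_add t)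
    show "lact E (z *\<^sub>C s) t = z *\<^sub>C lact E s t" for z s
    proof (induction s rule: tensor_induct)
      case (pure a k)
      from t show ?case
        by (induction rule: ext_induct)
          (simp_all add: ext_simps scaleC_add_right lact_scale_left flip: pure_tensor_scale_left)
    qed (simp add: ext_add t scaleC_add_right)
    show "lact E s (z *\<^sub>C t) = z *\<^sub>C lact E s t" for z s
    proof (induction s rule: tensor_induct)
      case (pure a k)
      from t show ?case
        by (induction rule: ext_induct)
          (simp_all add: ext_simps scaleC_add_right scale_closed lact_scale_right tensor_carrier_scale
            flip: pure_tensor_scale_left)
    qed (simp add: ext_add t scaleC_add_right tensor_carrier_scale)
    show "ract E t (z *\<^sub>C s) = z *\<^sub>C ract E t s" for z s
    proof (induction s rule: tensor_induct)
      case (pure a k)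
      from t show ?case
        by (induction rule: ext_induct)
          (simp_all add: ext_simps scaleC_add_right ract_scale_right flip: pure_tensor_scale_left)
    qed (simp add: ext_add t scaleC_add_right)
    show "ract E (z *\<^sub>C t) s = z *\<^sub>C ract E t s" for z s
    proof (induction s rule: tensor_induct)
      case (pure a k)
      from t show ?case
        by (induction rule: ext_induct)
          (simp_all add: ext_simps scaleC_add_right scale_closed ract_scale_left tensor_carrier_scale
            flip: pure_tensor_scale_left)
    qed (simp add: ext_add t scaleC_add_right tensor_carrier_scale)
    show "lact E (s \<odot>\<^bsub>tensor_algebra A K\<^esub> s') t = lact E s (lact E s' t)" for s s'
    proof (induction s rule: tensor_induct)
      case p: (pure a k)
      show ?case
      proof (induction s' rule: tensor_induct)
        case (pure a' k')
        from t show ?case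
          by (induction rule: ext_induct) (simp_all add: ext_simps mult cl lact_mult)
      qed (simp add: ext_add t mult ext_closed)
    qed (simp add: ext_add t mult ext_closed)
    show "ract E t (s \<odot>\<^bsub>tensor_algebra B K\<^esub> s') = ract E (ract E t s) s'" for s s'
    proof (induction s rule: tensor_induct)
      case p: (pure a k)
      show ?case
      proof (induction s' rule: tensor_induct)
        case (pure a' k')
        from t show ?case
          by (induction rule: ext_induct) (simp_all add: ext_simps mult cl ract_mult)
      qed (simp add: ext_add t mult ext_closed)
    qed (simp add: ext_add t mult ext_closed)
    show "lact E \<one>\<^bsub>tensor_algebra A K\<^esub> t = t"
      using t by (induction rule: ext_induct) (simp_all add: ext_simps mult tensor_algebra_one lact_one)
    show "ract E t \<one>\<^bsub>tensor_algebra B K\<^esub> = t"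
      using t by (induction rule: ext_induct) (simp_all add: ext_simps mult tensor_algebra_one ract_one)
    show "ract E (lact E s t) r = lact E s (ract E t r)" for s r
    proof (induction s rule: tensor_induct)
      case p: (pure a k)
      show ?case
      proof (induction r rule: tensor_induct)
        case (pure a' k')
        from t show ?case
          by (induction rule: ext_induct) (simp_all add: ext_simps mult cl lact_ract)
      qed (simp add: ext_add t mult ext_closed)
    qed (simp add: ext_add t mult ext_closed)
    fix w :: "('x, 'k) tensor" assume w: "w \<in> carrier"
    show "lact E s (t + w) = lact E s t + lact E s w" "ract E (t + w) r = ract E t r + ract E w r" for s r
      by (simp_all add: ext_add t w)
    show "lip E (t + w) t' = lip E t t' + lip E w t'" "rip E t' (t + w) = rip E t' t + rip E t' w"
      if "t' \<in> carrier" for t'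
      by (simp_all add: ext_ip_add t w that)
    show "lip E (z *\<^sub>C t) w = z *\<^sub>C lip E t w" for z
      using t
    proof (induction rule: ext_induct)
      case p: (pure x k)
      from w p show ?case
        by (induction rule: ext_induct)
          (simp_all add: ext_simps scaleC_add_right scale_closed lip_scale flip: pure_tensor_scale_left)
    qed (use w in \<open>simp add: ext_simps scaleC_add_right tensor_carrier_scale\<close>)
    show "rip E t (z *\<^sub>C w) = z *\<^sub>C rip E t w" for z
      using t
    proof (induction rule: ext_induct)
      case p: (pure x k)
      from w p show ?case
        by (induction rule: ext_induct)
          (simp_all add: ext_simps scaleC_add_right scale_closed rip_scale tensor_carrier_scale
            flip: pure_tensor_scale_left)
    qed (use w in \<open>simp add: ext_simps scaleC_add_right tensor_carrier_scale\<close>)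
    show "lip E (lact E s t) w = s \<odot>\<^bsub>tensor_algebra A K\<^esub> lip E t w" for s
    proof (induction s rule: tensor_induct)
      case (pure a k')
      from t show ?case
      proof (induction rule: ext_induct)
        case p: (pure x k)
        from w p show ?case
          by (induction rule: ext_induct) (simp_all add: ext_simps mult cl lip_lact)
      qed (use w in \<open>simp add: ext_simps mult\<close>)
    qed (use t w in \<open>simp add: ext_simps mult\<close>)
    show "rip E t (ract E w s) = rip E t w \<odot>\<^bsub>tensor_algebra B K\<^esub> s" for s
    proof (induction s rule: tensor_induct)
      case (pure a k')
      from t show ?case
      proof (induction rule: ext_induct)
        case p: (pure x k)
        from w p show ?case
          by (induction rule: ext_induct) (simp_all add: ext_simps mult cl rip_ract)
      qed (use w in \<open>simp add: ext_simps mult\<close>)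
    qed (use t w in \<open>simp add: ext_simps mult\<close>)
    show "astar (tensor_algebra A K) (lip E t w) = lip E w t"
      using t
    proof (induction rule: ext_induct)
      case p: (pure x k)
      from w p show ?case
        by (induction rule: ext_induct) (simp_all add: ext_simps mult cl lip_star)
    qed (use w in \<open>simp add: ext_simps mult\<close>)
    show "astar (tensor_algebra B K) (rip E t w) = rip E w t"
      using t
    proof (induction rule: ext_induct)
      case p: (pure x k)
      from w p show ?case
        by (induction rule: ext_induct) (simp_all add: ext_simps mult cl rip_star)
    qed (use w in \<open>simp add: ext_simps mult\<close>)
    show "rip E (lact E s t) w = rip E t (lact E (astar (tensor_algebra A K) s) w)" for s
    proof (induction s rule: tensor_induct)
      case (pure a k')
      from t show ?case
      proof (induction rule: ext_induct)
        case p: (pure x k)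
        from w p show ?case
          by (induction rule: ext_induct) (simp_all add: ext_simps mult cl rip_lact)
      qed (use w in \<open>simp add: ext_simps mult\<close>)
    qed (use t w in \<open>simp add: ext_simps mult\<close>)
    show "lip E (ract E t s) w = lip E t (ract E w (astar (tensor_algebra B K) s))" for s
    proof (induction s rule: tensor_induct)
      case (pure a k')
      from t show ?case
      proof (induction rule: ext_induct)
        case p: (pure x k)
        from w p show ?case
          by (induction rule: ext_induct) (simp_all add: ext_simps mult cl lip_ract)
      qed (use w in \<open>simp add: ext_simps mult\<close>)
    qed (use t w in \<open>simp add: ext_simps mult\<close>)
  qed
qed

end

text \<open>Z sits in Y with restricted operations. Tensoring with H^0 preserves this, so identities
  for the coaction can be computed in Y \<otimes> H^0, where the unitaries act, and read back over A
  and B.\<close>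

locale bimodule_inclusion = sub: pre_bimodule A B Z + pre_bimodule C D Y
  for A :: "('a::complex_vector, 'm) star_algebra_scheme"
    and B :: "('b::complex_vector, 'n) star_algebra_scheme"
    and Z :: "('a, 'b, 'x::complex_vector) bimodule"
    and C :: "('c::complex_vector, 'm1) star_algebra_scheme"
    and D :: "('d::complex_vector, 'n1) star_algebra_scheme"
    and Y :: "('c, 'd, 'x) bimodule" +
  fixes i :: "'a \<Rightarrow> 'c" and j :: "'b \<Rightarrow> 'd"
  assumes i_linear: "clinear i" and j_linear: "clinear j"
    and sub_carrier: "x \<in> bcarrier Z \<Longrightarrow> x \<in> bcarrier Y"
    and sub_lact: "x \<in> bcarrier Z \<Longrightarrow> lact Z a x = lact Y (i a) x"
    and sub_ract: "x \<in> bcarrier Z \<Longrightarrow> ract Z x b = ract Y x (j b)"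
    and sub_lip: "x \<in> bcarrier Z \<Longrightarrow> y \<in> bcarrier Z \<Longrightarrow> i (lip Z x y) = lip Y x y"
    and sub_rip: "x \<in> bcarrier Z \<Longrightarrow> y \<in> bcarrier Z \<Longrightarrow> j (rip Z x y) = rip Y x y"

lemma bimodule_inclusion_ext:
  assumes "bimodule_inclusion A B Z C D Y i j" and K: "unital_star_algebra K"
  shows "bimodule_inclusion (tensor_algebra A K) (tensor_algebra B K) (ext_tensor Z K)
    (tensor_algebra C K) (tensor_algebra D K) (ext_tensor Y K) (tensor_map i id) (tensor_map j id)"
proof -
  interpret bimodule_inclusion A B Z C D Y i j by fact
  interpret K: unital_star_algebra K by fact
  interpret EZ: ext_bimodule A B Z K ..
  interpret EY: ext_bimodule C D Y K ..
  have car: "t \<in> EY.carrier" if "t \<in> EZ.carrier" for t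
    using that by (induction rule: EZ.ext_induct) (simp_all add: tensor_carrier_pure tensor_carrier_add sub_carrier)
  note tm = clinear_tensor_map[OF i_linear clinear_id(1)] clinear_tensor_map[OF j_linear clinear_id(1)]
  note s = EZ.ext_simps EY.ext_simps i_linear j_linear clinear_simps[OF tm(1)] clinear_simps[OF tm(2)]
    sub_carrier sub_lact sub_ract sub_lip sub_rip car sub.lact_closed sub.ract_closed
  show ?thesis
  proof (intro bimodule_inclusion.intro EZ.ext_pre_bimodule EY.ext_pre_bimodule
      bimodule_inclusion_axioms.intro tm; (unfold bcarrier_ext)?)
    fix t assume t: "t \<in> EZ.carrier"
    show "t \<in> EY.carrier" by (rule car[OF t])
    show "lact EZ.E r t = lact EY.E (tensor_map i id r) t" for r
    proof (induction r rule: tensor_induct)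
      case (pure a k)
      from t show ?case by (induction rule: EZ.ext_induct) (simp_all add: s)
    qed (simp only: EZ.ext_add(1)[OF t] EY.ext_add(1)[OF car[OF t]] clinear_add[OF tm(1)])
    show "ract EZ.E t r = ract EY.E t (tensor_map j id r)" for r
    proof (induction r rule: tensor_induct)
      case (pure a k)
      from t show ?case by (induction rule: EZ.ext_induct) (simp_all add: s)
    qed (simp only: EZ.ext_add(4)[OF t] EY.ext_add(4)[OF car[OF t]] clinear_add[OF tm(2)])
    fix w assume w: "w \<in> EZ.carrier"
    show "tensor_map i id (lip EZ.E t w) = lip EY.E t w"
      using t
    proof (induction rule: EZ.ext_induct)
      case p: (pure x k)
      from w p show ?case by (induction rule: EZ.ext_induct) (simp_all add: s)
    next
      case (add r r')
      note cars = add(1,2) car[OF add(1)] car[OF add(2)]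
      from add(3,4) show ?case
        by (simp only: EZ.ext_ip_add(1)[OF cars(1) cars(2) w] EY.ext_ip_add(1)[OF cars(3) cars(4) car[OF w]]
            clinear_add[OF tm(1)])
    qed
    show "tensor_map j id (rip EZ.E t w) = rip EY.E t w"
      using t
    proof (induction rule: EZ.ext_induct)
      case p: (pure x k)
      from w p show ?case by (induction rule: EZ.ext_induct) (simp_all add: s)
    next
      case (add r r')
      note cars = add(1,2) car[OF add(1)] car[OF add(2)]
      from add(3,4) show ?case
        by (simp only: EZ.ext_ip_add(3)[OF cars(1) cars(2) w] EY.ext_ip_add(3)[OF cars(3) cars(4) car[OF w]]
            clinear_add[OF tm(2)])
    qed
  qed
qed

section \<open>Coefficients of the bimodule operations, and slices by functionals\<close>

context cstar_hopf_algebra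
begin

lemma ext_bimodule_dual:
  assumes "pre_bimodule A B Y"
  shows "ext_bimodule A B Y (dual_hopf H)"
proof -
  interpret pre_bimodule A B Y by fact
  interpret D: unital_star_algebra "dual_hopf H" by (rule unital_star_algebra_dual)
  show ?thesis ..
qed

lemma ev_lact:
  assumes "pre_bimodule A B Y" and t: "t \<in> tensor_carrier (bcarrier Y)"
  shows "ev h (lact (ext1 H Y) s t) = sweedler2 H (\<lambda>a b. lact Y (ev a s) (ev b t)) h"
proof -
  interpret ext_bimodule A B Y "dual_hopf H" by (rule ext_bimodule_dual) fact
  note evc = ev_in_carrier[OF subspace]
  show ?thesis
  proof (induction s rule: tensor_induct)
    case (pure a k)
    from t show ?case
    proof (induction rule: ext_induct)
      case p: (pure x l)
      have "sweedler2 H (\<lambda>p q. lact Y (dual_apply k p *\<^sub>C a) (dual_apply l q *\<^sub>C x)) h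
        = sweedler2 H (\<lambda>p q. (dual_apply k p * dual_apply l q) *\<^sub>C lact Y a x) h"
        using p by (simp add: lact_scale_left lact_scale_right scale_closed lact_closed mult.commute)
      also have "\<dots> = dual_apply (k \<odot>\<^bsub>dual_hopf H\<^esub> l) h *\<^sub>C lact Y a x"
        unfolding dual_mult_apply by (rule sweedler2_linear[OF clinear_scaleC_left])
      finally show ?case using p by (simp add: ext_pure ev_pure)
    next
      case (add r r')
      then show ?case
        by (simp add: ext_add clinear_simps[OF clinear_ev] sweedler2_add lact_add_right[OF evc evc])
    qed
  next
    case (add r r')
    then show ?case
      using t by (simp add: ext_add clinear_simps[OF clinear_ev] sweedler2_add lact_add_left[OF evc])
  qed
qed

lemma ev_ract:
  assumes "pre_bimodule A B Y" and t: "t \<in> tensor_carrier (bcarrier Y)"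
  shows "ev h (ract (ext1 H Y) t s) = sweedler2 H (\<lambda>a b. ract Y (ev a t) (ev b s)) h"
proof -
  interpret ext_bimodule A B Y "dual_hopf H" by (rule ext_bimodule_dual) fact
  note evc = ev_in_carrier[OF subspace]
  show ?thesis
  proof (induction s rule: tensor_induct)
    case (pure a k)
    from t show ?case
    proof (induction rule: ext_induct)
      case p: (pure x l)
      have "sweedler2 H (\<lambda>p q. ract Y (dual_apply l p *\<^sub>C x) (dual_apply k q *\<^sub>C a)) h
        = sweedler2 H (\<lambda>p q. (dual_apply l p * dual_apply k q) *\<^sub>C ract Y x a) h"
        using p by (simp add: ract_scale_left ract_scale_right scale_closed ract_closed mult.commute)
      also have "\<dots> = dual_apply (l \<odot>\<^bsub>dual_hopf H\<^esub> k) h *\<^sub>C ract Y x a"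
        unfolding dual_mult_apply by (rule sweedler2_linear[OF clinear_scaleC_left])
      finally show ?case using p by (simp add: ext_pure ev_pure)
    next
      case (add r r')
      then show ?case
        by (simp add: ext_add clinear_simps[OF clinear_ev] sweedler2_add ract_add_left[OF evc evc])
    qed
  next
    case (add r r')
    then show ?case
      using t by (simp add: ext_add clinear_simps[OF clinear_ev] sweedler2_add ract_add_right[OF evc])
  qed
qed

lemma comult_last_closed:
  assumes "csubspace S" "t \<in> tensor_carrier S"
  shows "comult_last H t \<in> tensor_carrier (tensor_carrier S)"
  by (intro tensor_carrier_evI[OF finite_dim]) (simp add: ev_comult_last ev_in_carrier assms)

lemma leg13_closed:
  assumes "csubspace S" "t \<in> tensor_carrier S"
  shows "leg13 H t \<in> tensor_carrier (tensor_carrier S)"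
  using assms
  by (induction rule: tensor_carrier_induct)
    (simp_all add: leg13_pure leg12_def tensor_carrier_pure tensor_carrier_add clinear_simps[OF clinear_leg13])

lemma comult_last_lact:
  assumes Y: "pre_bimodule A B Y" and t: "t \<in> tensor_carrier (bcarrier Y)"
  shows "comult_last H (lact (ext1 H Y) s t) = lact (ext2 H Y) (comult_last H s) (comult_last H t)"
proof (rule ev2_eqI)
  fix h l
  interpret ext_bimodule A B Y "dual_hopf H" by (rule ext_bimodule_dual[OF Y])
  note evc = ev_in_carrier[OF subspace]
  have ct: "comult_last H t \<in> tensor_carrier (bcarrier (ext1 H Y))"
    by (simp add: bcarrier_ext comult_last_closed[OF subspace t])
  have ect: "ev d (comult_last H t) \<in> tensor_carrier (bcarrier Y)" for d
    using ev_in_carrier[OF csubspace_tensor_carrier comult_last_closed[OF subspace t]] .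
  have b: "cbilinear (\<lambda>a b. lact Y (ev a s) (ev b t))"
    by (rule cbilinearI)
      (simp_all add: clinear_simps[OF clinear_ev_arg] lact_add_left lact_add_right lact_scale_left lact_scale_right
        evc[OF t])
  have "ev h (ev l (lact (ext2 H Y) (comult_last H s) (comult_last H t)))
      = sweedler2 H (\<lambda>c d. sweedler2 H (\<lambda>a b. lact Y (ev (a \<odot> c) s) (ev (b \<odot> d) t)) h) l"
    by (simp add: ev_lact[OF ext_pre_bimodule ct] sweedler2_linear[OF clinear_ev, symmetric] ev_lact[OF Y ect]
        ev_comult_last)
  also have "\<dots> = sweedler2 H (\<lambda>a b. sweedler2 H (\<lambda>c d. lact Y (ev (a \<odot> c) s) (ev (b \<odot> d) t)) l) h"
    by (rule sweedler2_swap)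
  finally show "ev h (ev l (comult_last H (lact (ext1 H Y) s t)))
      = ev h (ev l (lact (ext2 H Y) (comult_last H s) (comult_last H t)))"
    by (simp add: ev_comult_last ev_lact[OF Y t] sweedler2_mult[OF b])
qed

lemma comult_last_ract:
  assumes Y: "pre_bimodule A B Y" and t: "t \<in> tensor_carrier (bcarrier Y)"
  shows "comult_last H (ract (ext1 H Y) t s) = ract (ext2 H Y) (comult_last H t) (comult_last H s)"
proof (rule ev2_eqI)
  fix h l
  interpret ext_bimodule A B Y "dual_hopf H" by (rule ext_bimodule_dual[OF Y])
  note evc = ev_in_carrier[OF subspace]
  have ct: "comult_last H t \<in> tensor_carrier (bcarrier (ext1 H Y))"
    by (simp add: bcarrier_ext comult_last_closed[OF subspace t])
  have ect: "ev d (comult_last H t) \<in> tensor_carrier (bcarrier Y)" for d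
    using ev_in_carrier[OF csubspace_tensor_carrier comult_last_closed[OF subspace t]] .
  have b: "cbilinear (\<lambda>a b. ract Y (ev a t) (ev b s))"
    by (rule cbilinearI)
      (simp_all add: clinear_simps[OF clinear_ev_arg] ract_add_left ract_add_right ract_scale_left ract_scale_right
        evc[OF t])
  have "ev h (ev l (ract (ext2 H Y) (comult_last H t) (comult_last H s)))
      = sweedler2 H (\<lambda>c d. sweedler2 H (\<lambda>a b. ract Y (ev (a \<odot> c) t) (ev (b \<odot> d) s)) h) l"
    by (simp add: ev_ract[OF ext_pre_bimodule ct] sweedler2_linear[OF clinear_ev, symmetric] ev_ract[OF Y ect]
        ev_comult_last)
  also have "\<dots> = sweedler2 H (\<lambda>a b. sweedler2 H (\<lambda>c d. ract Y (ev (a \<odot> c) t) (ev (b \<odot> d) s)) l) h"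
    by (rule sweedler2_swap)
  finally show "ev h (ev l (comult_last H (ract (ext1 H Y) t s)))
      = ev h (ev l (ract (ext2 H Y) (comult_last H t) (comult_last H s)))"
    by (simp add: ev_comult_last ev_ract[OF Y t] sweedler2_mult[OF b])
qed

lemma leg13_bimodule:
  assumes Y: "pre_bimodule A B Y" and t: "t \<in> tensor_carrier (bcarrier Y)"
  shows "leg13 H (lact (ext1 H Y) s t) = lact (ext2 H Y) (leg13 H s) (leg13 H t)"
    and "leg13 H (ract (ext1 H Y) t r) = ract (ext2 H Y) (leg13 H t) (leg13 H r)"
proof -
  interpret ext_bimodule A B Y "dual_hopf H" by (rule ext_bimodule_dual[OF Y])
  interpret E2: ext_bimodule "coef1 H A" "coef1 H B" "ext1 H Y" "dual_hopf H"
    by (rule ext_bimodule_dual[OF ext_pre_bimodule])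
  note l = leg13_pure leg12_def ext_simps E2.ext_simps clinear_simps[OF clinear_leg13] bcarrier_ext
    coef.amult_one_left lact_closed ract_closed leg13_closed[OF subspace]
  show "leg13 H (lact (ext1 H Y) s t) = lact (ext2 H Y) (leg13 H s) (leg13 H t)"
  proof (induction s rule: tensor_induct)
    case (pure a k)
    from t show ?case by (induction rule: ext_induct) (simp_all add: l)
  qed (use t in \<open>simp add: l\<close>)
  show "leg13 H (ract (ext1 H Y) t r) = ract (ext2 H Y) (leg13 H t) (leg13 H r)"
  proof (induction r rule: tensor_induct)
    case (pure a k)
    from t show ?case by (induction rule: ext_induct) (simp_all add: l)
  qed (use t in \<open>simp add: l\<close>)
qed

text \<open>The coproduct of H^0 is dual to the product of H, so slicing a product splits \<psi>.
  This makes the dual action compatible with products.\<close>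

lemma slice_mult_dual:
  assumes A: "unital_algebra A"
  shows "slice (dual_apply \<psi>) (s \<odot>\<^bsub>tensor_algebra A H\<^esub> t) =
    sweedler2 (dual_hopf H) (\<lambda>\<psi>1 \<psi>2. slice (dual_apply \<psi>1) s \<odot>\<^bsub>A\<^esub> slice (dual_apply \<psi>2) t) \<psi>"
proof -
  note H = unital.unital_algebra_axioms
  note m = tensor_algebra_mult[OF A H] cbilinear_simps[OF tensor_algebra_mult(2)[OF A H]]
    clinear_simps[OF clinear_slice[OF clinear_dual_apply]] unital_algebra.amult_simps[OF A] sweedler2_add
  show ?thesis
  proof (induction s rule: tensor_induct)
    case (pure a k)
    show ?case
    proof (induction t rule: tensor_induct)
      case p: (pure b l)
      have "sweedler2 (dual_hopf H) (\<lambda>\<psi>1 \<psi>2. (dual_apply \<psi>1 k * dual_apply \<psi>2 l) *\<^sub>C (a \<odot>\<^bsub>A\<^esub> b)) \<psi>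
        = dual_pairing2 (comult (dual_hopf H) \<psi>) k l *\<^sub>C (a \<odot>\<^bsub>A\<^esub> b)"
        unfolding dual_pairing2_def sweedler2_def[symmetric] by (rule sweedler2_linear[OF clinear_scaleC_left])
      then show ?case
        by (simp add: m(1) clinear_dual_apply unital_algebra.amult_simps[OF A] dual_pairing2_eq dual_comult mult.commute)
    qed (simp add: m)
  qed (simp add: m)
qed

text \<open>The coproduct of H^0 is given by a definite description; this evaluates it in the dual
  basis.\<close>

lemma sweedler2_dual:
  assumes f: "cbilinear f"
  shows "sweedler2 (dual_hopf H) f \<psi> =
    (\<Sum>j\<in>fbasis TYPE('h). \<Sum>i\<in>fbasis TYPE('h). dual_apply \<psi> (i \<odot> j) *\<^sub>C f (dbasis i) (dbasis j))"
proof -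
  let ?F = "fbasis TYPE('h)"
  have c: "comult (dual_hopf H) \<psi> = (\<Sum>j\<in>?F. ev j (comult (dual_hopf H) \<psi>) \<otimes>\<^sub>t dbasis j)"
    using coeff_tensor_ev[OF finite_dim, of "comult (dual_hopf H) \<psi>"] by (simp add: coeff_tensor_def)
  have e: "ev j (comult (dual_hopf H) \<psi>) = (\<Sum>i\<in>?F. dual_apply \<psi> (i \<odot> j) *\<^sub>C dbasis i)" for j
    using dual_expand[OF finite_dim, of "ev j (comult (dual_hopf H) \<psi>)"] by (simp add: dual_comult)
  show ?thesis
    unfolding sweedler2_def
    by (subst c) (simp add: clinear_simps[OF clinear_tensor_lift[OF f]] f e cbilinear_simps[OF f])
qed

lemma clinear_sweedler2_dual: "cbilinear f \<Longrightarrow> clinear (sweedler2 (dual_hopf H) f)"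
  using clinear_compose[OF clinear_tensor_lift clinear_dual_comult] unfolding sweedler2_def by blast

end

section \<open>Twisted crossed products\<close>

lemma sweedler3_hom:
  assumes "F 0 = 0" "\<And>x y. F (x + y) = F x + F y"
  shows "sweedler3 H (\<lambda>a b c. F (f a b c)) h = F (sweedler3 H f h)"
  unfolding sweedler3_def by (simp only: sweedler2_hom[of F, OF assms])

lemma sweedler4_hom:
  assumes "F 0 = 0" "\<And>x y. F (x + y) = F x + F y"
  shows "sweedler4 H (\<lambda>a b c d. F (f a b c d)) h = F (sweedler4 H f h)"
  unfolding sweedler4_def by (simp only: sweedler2_hom[of F, OF assms] sweedler3_hom[of F, OF assms])

lemma clinear_sweedler3_fun: "(\<And>a b c. clinear (\<lambda>x. f x a b c)) \<Longrightarrow> clinear (\<lambda>x. sweedler3 H (f x) h)"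
  unfolding sweedler3_def by (intro clinear_sweedler2_fun)

lemma clinear_sweedler4_fun: "(\<And>a b c d. clinear (\<lambda>x. f x a b c d)) \<Longrightarrow> clinear (\<lambda>x. sweedler4 H (f x) h)"
  unfolding sweedler4_def by (intro clinear_sweedler2_fun clinear_sweedler3_fun)

lemma (in cstar_hopf_algebra) clinear_sweedler3:
  assumes "\<And>b c. clinear (\<lambda>a. f a b c)" "\<And>a c. clinear (\<lambda>b. f a b c)" "\<And>a b. clinear (f a b)"
  shows "clinear (sweedler3 H f)"
proof -
  have "cbilinear (\<lambda>k c. sweedler2 H (\<lambda>a b. f a b c) k)"
    using assms clinear_sweedler2[of "\<lambda>a b. f a b c" for c] clinear_sweedler2_fun[of "\<lambda>c a b. f a b c" H]
    by (auto simp: cbilinear_def)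
  then show ?thesis unfolding sweedler3_def[abs_def] by (rule clinear_sweedler2)
qed

lemma (in cstar_hopf_algebra) clinear_sweedler4:
  assumes "\<And>b c d. clinear (\<lambda>a. f a b c d)" "\<And>a c d. clinear (\<lambda>b. f a b c d)"
    "\<And>a b d. clinear (\<lambda>c. f a b c d)" "\<And>a b c. clinear (f a b c)"
  shows "clinear (sweedler4 H f)"
proof -
  have "cbilinear (\<lambda>k d. sweedler3 H (\<lambda>a b c. f a b c d) k)"
    using assms clinear_sweedler3[of "\<lambda>a b c. f a b c d" for d] clinear_sweedler3_fun[of "\<lambda>d a b c. f a b c d" H]
    by (auto simp: cbilinear_def)
  then show ?thesis unfolding sweedler4_def[abs_def] by (rule clinear_sweedler2)
qed

text \<open>The dual coaction id \<otimes> \<Delta>, defined on the vector space A \<otimes> H. That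
  it respects the product and the involution of the crossed product is
  \<open>unital_star_hom_coact\<close>.\<close>

definition coact :: "'h::complex_vector hopf_algebra \<Rightarrow> ('a::complex_vector, 'h) tensor \<Rightarrow> (('a, 'h) tensor, 'h) tensor"
  where "coact H t = tensor_assoc (tensor_map id (comult H) t)"

context cstar_hopf_algebra
begin

lemma clinear_coact: "clinear (coact H)"
  unfolding coact_def[abs_def]
  by (rule clinear_compose[OF clinear_tensor_assoc clinear_tensor_map]) (simp_all add: comult_linear)

lemma coact_pure: "coact H (a \<otimes>\<^sub>t h) = sweedler2 H (\<lambda>p q. (a \<otimes>\<^sub>t p) \<otimes>\<^sub>t q) h"
proof -
  have l: "clinear (\<lambda>t. tensor_assoc (a \<otimes>\<^sub>t t))"
    by (rule clinear_compose[OF clinear_tensor_assoc pure_tensor_right])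
  show ?thesis
    using sweedler2_linear[OF l, of H "(\<otimes>\<^sub>t)" h] by (simp add: coact_def comult_linear comult_sweedler)
qed

lemma cbilinear_assoc: "cbilinear (\<lambda>p q. (a \<otimes>\<^sub>t p) \<otimes>\<^sub>t q)"
  by (rule cbilinearI) (simp_all add: pure_tensor_simps)

text \<open>The involution here is that of the tensor product algebra and not that of the crossed
  product; \<open>crossed_star\<close> expresses the latter through the former.\<close>

lemma coact_star:
  assumes A: "unital_star_algebra A"
  shows "coact H (astar (tensor_algebra A H) t) = astar (tensor_algebra (tensor_algebra A H) H) (coact H t)"
proof (induction t rule: tensor_induct)
  note Hs = unital_star_algebra_axioms
  note AH = unital_star_algebra_tensor[OF A Hs]
  note AHH = unital_star_algebra_tensor[OF AH Hs]
  {
    case (pure a h)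
    have "sweedler2 H (\<lambda>p q. (astar A a \<otimes>\<^sub>t astar H p) \<otimes>\<^sub>t astar H q) h
      = sweedler2 H (\<lambda>p q. astar (tensor_algebra (tensor_algebra A H) H) ((a \<otimes>\<^sub>t p) \<otimes>\<^sub>t q)) h"
      by (simp add: tensor_algebra_star[OF AH Hs] tensor_algebra_star[OF A Hs])
    also have "\<dots> = astar (tensor_algebra (tensor_algebra A H) H) (sweedler2 H (\<lambda>p q. (a \<otimes>\<^sub>t p) \<otimes>\<^sub>t q) h)"
      by (rule sweedler2_hom) (simp_all add: unital_star_algebra.astar_simps[OF AHH])
    finally show ?case
      by (simp add: tensor_algebra_star[OF A Hs] coact_pure sweedler2_star[OF cbilinear_assoc])
  next
    case (add s t)
    then show ?case
      by (simp add: unital_star_algebra.astar_simps[OF AHH] unital_star_algebra.astar_simps[OF AH]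
          clinear_simps[OF clinear_coact])
  }
qed

lemma coact_counit: "tensor_map (slice (counit H)) id (coact H t) = t" (is "?R (coact H t) = t")
proof (rule tensor_eqI[of "\<lambda>t. ?R (coact H t)"])
  have R: "clinear ?R" by (rule clinear_tensor_map) (simp_all add: clinear_slice counit_linear)
  show "clinear (\<lambda>t. ?R (coact H t))" by (rule clinear_compose[OF R clinear_coact])
  show "?R (coact H (a \<otimes>\<^sub>t h)) = a \<otimes>\<^sub>t h" for a :: 'a and h
    unfolding coact_pure sweedler2_linear[OF R, symmetric]
    using sweedler2_counit(1)[OF pure_tensor_right[of a], of h]
    by (simp add: clinear_slice counit_linear pure_tensor_simps)
qed simp

text \<open>Apply \<epsilon> to the middle leg. Coinvariant elements therefore belong to the
  coefficient algebra, which is how membership in A and B is detected below.\<close>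

lemma coinvariant:
  assumes "coact H t = t \<otimes>\<^sub>t \<one>"
  shows "t = slice (counit H) t \<otimes>\<^sub>t \<one>"
  using coact_counit[of t] by (simp add: assms clinear_slice counit_linear)

end

text \<open>That the crossed product is a C*-algebra, and with it the associativity of the twisted
  product, is supplied by the hypothesis of an equivalence bimodule over it.\<close>

locale twisted_crossed_product =
  twisted_coaction H A \<rho> u + crossed: cstar_algebra "crossed_product H A \<rho> u"
  for H :: "'h::complex_vector hopf_algebra"
    and A :: "('a::complex_vector, 'm) star_algebra_scheme"
    and \<rho> :: "'a \<Rightarrow> ('a, 'h dual) tensor"
    and u :: "(('a, 'h dual) tensor, 'h dual) tensor"
begin

abbreviation C where "C \<equiv> crossed_product H A \<rho> u"

lemma rho_hom: "unital_star_hom A (coef1 H A) \<rho>"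
  and rho_counit: "ev \<one>\<^bsub>H\<^esub> (\<rho> a) = a"
  using weak by (auto simp: weak_coaction_def hopf.dual_counit[abs_def])

lemmas rho = unital_star_homD[OF rho_hom]

lemma cbilinear_act: "cbilinear (act \<rho>)"
  unfolding act_def[abs_def]
  by (rule cbilinearI) (simp_all add: clinear_simps[OF clinear_ev_arg] clinear_simps[OF rho(1)] clinear_simps[OF clinear_ev])

lemma cbilinear_hat: "cbilinear (hat u)"
  unfolding hat_def[abs_def]
  by (rule cbilinearI) (simp_all add: clinear_simps[OF clinear_ev_arg] clinear_simps[OF clinear_ev])

lemma act_one: "act \<rho> h \<one>\<^bsub>A\<^esub> = counit H h *\<^sub>C \<one>\<^bsub>A\<^esub>"
  by (simp add: act_def rho(2) hopf.ev_one)

lemma one_act: "act \<rho> \<one>\<^bsub>H\<^esub> x = x"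
  by (simp add: act_def rho_counit)

text \<open>Conjugating S by the involution gives the inverse of S; \<open>antipode_antipode\<close>
  identifies this inverse with S.\<close>

lemma act_star: "act \<rho> (astar H h) (astar A x) = astar A (act \<rho> (antipode H h) x)"
proof -
  have "antipode H (astar H (antipode H (astar H h))) = antipode H (antipode H h)"
    by (simp only: hopf.antipode_star_antipode_star hopf.antipode_antipode)
  then have "astar H (antipode H (astar H h)) = antipode H h" by (simp only: hopf.antipode_eq_iff)
  then show ?thesis by (simp add: act_def rho(4) hopf.ev_star[OF alg.unital_star_algebra_axioms])
qed

lemmas linear_simps = pure_tensor_simps alg.unital.amult_simps hopf.unital.amult_simps
  cbilinear_simps[OF cbilinear_act] cbilinear_simps[OF cbilinear_hat] clinear_simps[OF hopf.antipode_linear]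

definition embed :: "'a \<Rightarrow> ('a, 'h) tensor"
  where "embed a = a \<otimes>\<^sub>t \<one>\<^bsub>H\<^esub>"

definition gen :: "'h \<Rightarrow> ('a, 'h) tensor"
  where "gen h = \<one>\<^bsub>A\<^esub> \<otimes>\<^sub>t h"

lemma crossed_mult:
  "(x \<otimes>\<^sub>t h) \<odot>\<^bsub>C\<^esub> (y \<otimes>\<^sub>t l) = sweedler3 H (\<lambda>h1 h2 h3. sweedler2 H (\<lambda>l1 l2.
    (x \<odot>\<^bsub>A\<^esub> act \<rho> h1 y \<odot>\<^bsub>A\<^esub> hat u h2 l1) \<otimes>\<^sub>t (h3 \<odot>\<^bsub>H\<^esub> l2)) l) h"
proof -
  let ?g = "\<lambda>x y h1 h2 h3 l1 l2. (x \<odot>\<^bsub>A\<^esub> act \<rho> h1 y \<odot>\<^bsub>A\<^esub> hat u h2 l1) \<otimes>\<^sub>t (h3 \<odot>\<^bsub>H\<^esub> l2)"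
  have l: "clinear (\<lambda>x. ?g x y h1 h2 h3 l1 l2)" "clinear (\<lambda>y. ?g x y h1 h2 h3 l1 l2)"
    "clinear (\<lambda>h1. ?g x y h1 h2 h3 l1 l2)" "clinear (\<lambda>h2. ?g x y h1 h2 h3 l1 l2)"
    "clinear (\<lambda>h3. ?g x y h1 h2 h3 l1 l2)" "cbilinear (?g x y h1 h2 h3)" for x y h1 h2 h3 l1 l2
    by (rule clinearI cbilinearI; simp add: linear_simps)+
  note l1 = clinear_sweedler2_fun[OF l(1)] clinear_sweedler2_fun[OF l(2)] clinear_sweedler2_fun[OF l(3)]
    clinear_sweedler2_fun[OF l(4)] clinear_sweedler2_fun[OF l(5)] hopf.clinear_sweedler2[OF l(6)]
  have 1: "cbilinear (\<lambda>y l. sweedler3 H (\<lambda>h1 h2 h3. sweedler2 H (?g x y h1 h2 h3) l) h)" for x h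
    unfolding cbilinear_def by (intro conjI allI clinear_sweedler3_fun l1)
  have 2: "cbilinear (\<lambda>x h. sweedler3 H (\<lambda>h1 h2 h3. sweedler2 H (?g x y h1 h2 h3) l) h)" for y l
    unfolding cbilinear_def by (intro conjI allI clinear_sweedler3_fun hopf.clinear_sweedler3 l1)
  note 3 = cbilinear_left[OF cbilinear_tensor_lift_outer[OF 1 2]]
  have "cbilinear (\<lambda>x h. tensor_lift (\<lambda>y l. sweedler3 H (\<lambda>h1 h2 h3. sweedler2 H (?g x y h1 h2 h3) l) h) t)" for t
    using 2 by (auto simp: cbilinear_def intro!: clinear_tensor_lift_fun)
  from tensor_lift_pure[OF this] tensor_lift_pure[OF 1] show ?thesis
    by (simp only: crossed_product_def star_algebra.simps)
qed

lemma crossed_one: "\<one>\<^bsub>C\<^esub> = \<one>\<^bsub>A\<^esub> \<otimes>\<^sub>t \<one>\<^bsub>H\<^esub>"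
  by (simp add: crossed_product_def)

lemma embed_one: "embed \<one>\<^bsub>A\<^esub> = \<one>\<^bsub>C\<^esub>" and gen_one: "gen \<one>\<^bsub>H\<^esub> = \<one>\<^bsub>C\<^esub>"
  by (simp_all add: embed_def gen_def crossed_one)

lemma clinear_embed: "clinear embed" and clinear_gen: "clinear gen"
  by (simp_all add: embed_def[abs_def] gen_def[abs_def] pure_tensor_left pure_tensor_right)

lemma embed_mult_pure: "embed a \<odot>\<^bsub>C\<^esub> (b \<otimes>\<^sub>t h) = (a \<odot>\<^bsub>A\<^esub> b) \<otimes>\<^sub>t h"
proof -
  let ?g = "\<lambda>h1 h2 h3 l1 l2. (a \<odot>\<^bsub>A\<^esub> act \<rho> h1 b \<odot>\<^bsub>A\<^esub> hat u h2 l1) \<otimes>\<^sub>t (h3 \<odot>\<^bsub>H\<^esub> l2)"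
  have g: "clinear (\<lambda>h1. ?g h1 h2 h3 l1 l2)" "clinear (\<lambda>h2. ?g h1 h2 h3 l1 l2)"
    "clinear (\<lambda>h3. ?g h1 h2 h3 l1 l2)" for h1 h2 h3 l1 l2
    by (rule clinearI; simp add: linear_simps)+
  have 1: "cbilinear (\<lambda>k h3. sweedler2 H (\<lambda>h1 h2. sweedler2 H (?g h1 h2 h3) h) k)"
    unfolding cbilinear_def
  proof safe
    show "clinear (sweedler2 H (\<lambda>h1 h2. sweedler2 H (?g h1 h2 h3) h))" for h3
      by (rule hopf.clinear_sweedler2) (simp add: cbilinear_def clinear_sweedler2_fun g)
    show "clinear (\<lambda>h3. sweedler2 H (\<lambda>h1 h2. sweedler2 H (?g h1 h2 h3) h) k)" for k
      by (intro clinear_sweedler2_fun g)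
  qed
  have 2: "cbilinear (\<lambda>h1 h2. sweedler2 H (?g h1 h2 h3) h)" for h3
    by (simp add: cbilinear_def clinear_sweedler2_fun g)
  have "embed a \<odot>\<^bsub>C\<^esub> (b \<otimes>\<^sub>t h) = sweedler2 H (?g \<one>\<^bsub>H\<^esub> \<one>\<^bsub>H\<^esub> \<one>\<^bsub>H\<^esub>) h"
    unfolding embed_def crossed_mult sweedler3_def
    by (simp only: hopf.sweedler2_one[OF 1] hopf.sweedler2_one[OF 2])
  then show ?thesis
    using hopf.sweedler2_counit(1)[OF pure_tensor_right[of "a \<odot>\<^bsub>A\<^esub> b"], of h]
    by (simp add: one_act normalized_left linear_simps alg.amult_one_right hopf.amult_one_left)
qed

lemma embed_mult: "embed (a \<odot>\<^bsub>A\<^esub> b) = embed a \<odot>\<^bsub>C\<^esub> embed b"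
  using embed_mult_pure[of a b "\<one>\<^bsub>H\<^esub>"] by (simp add: embed_def)

lemma embed_gen: "embed a \<odot>\<^bsub>C\<^esub> gen h = a \<otimes>\<^sub>t h"
  unfolding gen_def embed_mult_pure by (simp add: alg.amult_one_right)

text \<open>Normalisation of u removes the cocycle and leaves the covariance relation. With
  \<open>gen_mult\<close> and the embedding of A it determines the product of C, which is spanned by
  the products of \<open>embed a\<close> with \<open>gen h\<close>.\<close>

lemma gen_embed: "gen h \<odot>\<^bsub>C\<^esub> embed a = sweedler2 H (\<lambda>h1 h2. embed (act \<rho> h1 a) \<odot>\<^bsub>C\<^esub> gen h2) h"
proof -
  have l: "clinear (\<lambda>h1. act \<rho> h1 a \<otimes>\<^sub>t h3)" for h3 by (rule clinearI) (simp_all add: linear_simps)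
  have b: "cbilinear (\<lambda>l1 l2. (act \<rho> h1 a \<odot>\<^bsub>A\<^esub> hat u h2 l1) \<otimes>\<^sub>t (h3 \<odot>\<^bsub>H\<^esub> l2))" for h1 h2 h3
    by (rule cbilinearI) (simp_all add: linear_simps)
  have "gen h \<odot>\<^bsub>C\<^esub> embed a = sweedler2 H (\<lambda>k h3. sweedler2 H (\<lambda>h1 h2. counit H h2 *\<^sub>C (act \<rho> h1 a \<otimes>\<^sub>t h3)) k) h"
    unfolding gen_def embed_def crossed_mult sweedler3_def
    by (simp add: hopf.sweedler2_one[OF b] normalized_right linear_simps alg.amult_one_right alg.amult_one_left
        hopf.amult_one_right)
  then show ?thesis by (simp add: hopf.sweedler2_counit(2)[OF l] embed_gen)
qed

lemma gen_mult:
  "gen h \<odot>\<^bsub>C\<^esub> gen l = sweedler2 H (\<lambda>h1 h2. sweedler2 H (\<lambda>l1 l2. embed (hat u h1 l1) \<odot>\<^bsub>C\<^esub> gen (h2 \<odot>\<^bsub>H\<^esub> l2)) l) h"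
proof -
  have l: "clinear (\<lambda>h2. sweedler2 H (\<lambda>l1 l2. hat u h2 l1 \<otimes>\<^sub>t (h3 \<odot>\<^bsub>H\<^esub> l2)) l)" for h3
    by (rule clinear_sweedler2_fun) (rule clinearI; simp add: linear_simps)
  have "gen h \<odot>\<^bsub>C\<^esub> gen l = sweedler2 H (\<lambda>k h3. sweedler2 H (\<lambda>h1 h2. counit H h1 *\<^sub>C
      sweedler2 H (\<lambda>l1 l2. hat u h2 l1 \<otimes>\<^sub>t (h3 \<odot>\<^bsub>H\<^esub> l2)) l) k) h"
    unfolding gen_def crossed_mult sweedler3_def
    by (simp add: act_one linear_simps alg.amult_one_right alg.amult_one_left sweedler2_linear[OF clinear_scaleC])
  then show ?thesis by (simp add: hopf.sweedler2_counit(1)[OF l] embed_gen)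
qed

text \<open>The involution is rewritten as the tensor involution of an expression that is linear in
  x and h, so that the linear Sweedler rules apply to it.\<close>

lemma crossed_star:
  "astar C (x \<otimes>\<^sub>t h) = astar (tensor_algebra A H) (sweedler4 H (\<lambda>h1 h2 h3 h4.
    (act \<rho> (antipode H h3) x \<odot>\<^bsub>A\<^esub> hat u (antipode H h2) h1) \<otimes>\<^sub>t h4) h)"
proof -
  let ?AH = "tensor_algebra A H"
  note As = alg.unital_star_algebra_axioms and Hs = hopf.unital_star_algebra_axioms
  interpret AH: unital_star_algebra ?AH by (rule unital_star_algebra_tensor[OF As Hs])
  let ?g = "\<lambda>x h1 h2 h3 h4. (act \<rho> (antipode H h3) x \<odot>\<^bsub>A\<^esub> hat u (antipode H h2) h1) \<otimes>\<^sub>t h4"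
  have eq: "sweedler4 H (\<lambda>h1 h2 h3 h4. (astar A (hat u (antipode H h2) h1) \<odot>\<^bsub>A\<^esub>
      act \<rho> (astar H h3) (astar A x)) \<otimes>\<^sub>t astar H h4) h = astar ?AH (sweedler4 H (?g x) h)" for x h
  proof -
    have "sweedler4 H (\<lambda>h1 h2 h3 h4. (astar A (hat u (antipode H h2) h1) \<odot>\<^bsub>A\<^esub>
      act \<rho> (astar H h3) (astar A x)) \<otimes>\<^sub>t astar H h4) h
      = sweedler4 H (\<lambda>h1 h2 h3 h4. astar ?AH (?g x h1 h2 h3 h4)) h"
      by (simp add: act_star tensor_algebra_star[OF As Hs] alg.astar_mult)
    also have "\<dots> = astar ?AH (sweedler4 H (?g x) h)"
      by (rule sweedler4_hom) (simp_all add: AH.astar_simps)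
    finally show ?thesis .
  qed
  have "clinear (\<lambda>x. ?g x h1 h2 h3 h4)" for h1 h2 h3 h4 by (rule clinearI) (simp_all add: linear_simps)
  note 1 = clinear_sweedler4_fun[OF this]
  have 2: "clinear (sweedler4 H (?g x))" for x
    by (rule hopf.clinear_sweedler4; rule clinearI; simp add: linear_simps)
  have bal: "balanced_on UNIV (\<lambda>x h. astar ?AH (sweedler4 H (?g x) h))"
    by (simp add: balanced_on_def clinear_simps[OF 1] clinear_simps[OF 2] AH.astar_simps)
  show ?thesis
    by (simp only: crossed_product_def star_algebra.simps eq tensor_lift_on_pure[OF csubspace_UNIV bal UNIV_I])
qed

text \<open>The adjoint of the coefficient in the adjoint of a generator: (1 \<rtimes> h)* is
  \<open>star_twist\<close>(h_(1))* \<rtimes> h_(2)*.\<close>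

definition star_twist :: "'h \<Rightarrow> 'a"
  where "star_twist = sweedler2 H (\<lambda>h1 h2. hat u (antipode H h2) h1)"

lemma star_twist_bilinear: "cbilinear (\<lambda>h1 h2. hat u (antipode H h2) h1)"
  by (rule cbilinearI) (simp_all add: linear_simps)

lemma clinear_star_twist: "clinear star_twist"
  unfolding star_twist_def by (rule hopf.clinear_sweedler2[OF star_twist_bilinear])

lemma gen_star: "astar C (gen h) = astar (tensor_algebra A H) (sweedler2 H (\<lambda>k l. star_twist k \<otimes>\<^sub>t l) h)"
proof -
  have l: "clinear (\<lambda>m. star_twist m \<otimes>\<^sub>t l)" for l
    by (rule clinear_compose[OF pure_tensor_left clinear_star_twist])
  have "sweedler4 H (\<lambda>h1 h2 h3 h4. (act \<rho> (antipode H h3) \<one>\<^bsub>A\<^esub> \<odot>\<^bsub>A\<^esub> hat u (antipode H h2) h1) \<otimes>\<^sub>t h4) h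
    = sweedler2 H (\<lambda>k l. sweedler2 H (\<lambda>m h3. counit H h3 *\<^sub>C (star_twist m \<otimes>\<^sub>t l)) k) h"
    unfolding sweedler4_def sweedler3_def star_twist_def
    by (simp add: act_one hopf.counit_antipode linear_simps alg.amult_one_left sweedler2_linear[OF clinear_scaleC]
        sweedler2_linear[OF pure_tensor_left])
  then show ?thesis
    unfolding gen_def crossed_star by (simp add: hopf.sweedler2_counit(2)[OF l])
qed

lemma embed_star: "astar C (embed a) = embed (astar A a)"
proof -
  note As = alg.unital_star_algebra_axioms and Hs = hopf.unital_star_algebra_axioms
  let ?g = "\<lambda>h1 h2 h3 h4. (act \<rho> (antipode H h3) a \<odot>\<^bsub>A\<^esub> hat u (antipode H h2) h1) \<otimes>\<^sub>t h4"
  have g: "clinear (\<lambda>h1. ?g h1 h2 h3 h4)" "clinear (\<lambda>h2. ?g h1 h2 h3 h4)"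
    "clinear (\<lambda>h3. ?g h1 h2 h3 h4)" "clinear (\<lambda>h4. ?g h1 h2 h3 h4)" for h1 h2 h3 h4
    by (rule clinearI; simp add: linear_simps)+
  have b1: "cbilinear (\<lambda>h1 h2. ?g h1 h2 h3 h4)" for h3 h4
    unfolding cbilinear_def by (intro conjI allI g)
  have b2: "cbilinear (\<lambda>k h3. sweedler2 H (\<lambda>h1 h2. ?g h1 h2 h3 h4) k)" for h4
    unfolding cbilinear_def by (intro conjI allI hopf.clinear_sweedler2[OF b1] clinear_sweedler2_fun[OF g(3)])
  have b3: "cbilinear (\<lambda>k h4. sweedler3 H (\<lambda>h1 h2 h3. ?g h1 h2 h3 h4) k)"
    unfolding cbilinear_def by (intro conjI allI hopf.clinear_sweedler3[OF g(1-3)] clinear_sweedler3_fun[OF g(4)])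
  have "sweedler4 H ?g \<one>\<^bsub>H\<^esub> = ?g \<one>\<^bsub>H\<^esub> \<one>\<^bsub>H\<^esub> \<one>\<^bsub>H\<^esub> \<one>\<^bsub>H\<^esub>"
    unfolding sweedler4_def hopf.sweedler2_one[OF b3]
    by (simp only: sweedler3_def hopf.sweedler2_one[OF b2] hopf.sweedler2_one[OF b1])
  then show ?thesis
    by (simp add: embed_def crossed_star hopf.antipode_one one_act normalized_left hopf.counit_one scaleC_one
        alg.amult_one_right tensor_algebra_star[OF As Hs] hopf.astar_one)
qed

lemma unital_star_hom_embed: "unital_star_hom A C embed"
  by (simp add: unital_star_hom_def clinear_embed embed_one embed_mult embed_star)

end

section \<open>The dual action of H^0\<close>

definition dual_act :: "'h::complex_vector hopf_algebra \<Rightarrow> 'h dual \<Rightarrow> ('a::complex_vector, 'h) tensor \<Rightarrow> ('a, 'h) tensor"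
  where "dual_act H \<psi> t = slice (dual_apply \<psi>) (coact H t)"

context cstar_hopf_algebra
begin

lemma clinear_dual_act: "clinear (dual_act H \<psi>)"
  unfolding dual_act_def[abs_def]
  by (rule clinear_compose[OF clinear_slice[OF clinear_dual_apply] clinear_coact])

lemma dual_act_add: "dual_act H (\<phi> + \<psi>) t = dual_act H \<phi> t + dual_act H \<psi> t"
  and dual_act_scale: "dual_act H (c *\<^sub>C \<psi>) t = c *\<^sub>C dual_act H \<psi> t"
  unfolding dual_act_def slice_fun_add[symmetric] slice_fun_scale[symmetric]
  by (simp_all flip: dual_apply_simps)

lemma dual_act_pure: "dual_act H \<psi> (a \<otimes>\<^sub>t h) = sweedler2 H (\<lambda>p q. dual_apply \<psi> q *\<^sub>C (a \<otimes>\<^sub>t p)) h"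
  by (simp add: dual_act_def coact_pure sweedler2_linear[OF clinear_slice[OF clinear_dual_apply], symmetric]
      clinear_dual_apply)

lemma dual_act_one: "dual_act H \<one>\<^bsub>dual_hopf H\<^esub> t = t"
  by (rule tensor_eqI[of _ "\<lambda>t. t"])
    (simp_all add: clinear_dual_act dual_act_pure dual_one_apply sweedler2_counit(2)[OF pure_tensor_right])

lemma dual_act_mult: "dual_act H (\<phi> \<odot>\<^bsub>dual_hopf H\<^esub> \<psi>) t = dual_act H \<phi> (dual_act H \<psi> t)"
proof (rule tensor_eqI[of _ "\<lambda>t. dual_act H \<phi> (dual_act H \<psi> t)"])
  show "clinear (\<lambda>t. dual_act H \<phi> (dual_act H \<psi> t))"
    by (rule clinear_compose[OF clinear_dual_act clinear_dual_act])
  fix a :: 'a and h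
  have t: "ctrilinear (\<lambda>r s q. (dual_apply \<phi> s * dual_apply \<psi> q) *\<^sub>C (a \<otimes>\<^sub>t r))"
    by (rule ctrilinearI; rule clinearI; simp add: pure_tensor_simps clinear_simps[OF clinear_dual_apply]
        scaleC_add_right scaleC_add_left distrib_left distrib_right scaleC_complex_def mult_ac)
  have "dual_act H \<phi> (dual_act H \<psi> (a \<otimes>\<^sub>t h)) = sweedler2 H (\<lambda>p q. sweedler2 H
      (\<lambda>r s. (dual_apply \<phi> s * dual_apply \<psi> q) *\<^sub>C (a \<otimes>\<^sub>t r)) p) h"
    unfolding dual_act_pure[of \<psi>]
    by (simp add: sweedler2_linear[OF clinear_dual_act, symmetric] clinear_simps[OF clinear_dual_act] dual_act_pure
        sweedler2_scale[symmetric] mult.commute)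
  also have "\<dots> = sweedler2 H (\<lambda>r k. sweedler2 H (\<lambda>s q. (dual_apply \<phi> s * dual_apply \<psi> q) *\<^sub>C (a \<otimes>\<^sub>t r)) k) h"
    by (rule sweedler2_coassoc[OF t])
  also have "\<dots> = dual_act H (\<phi> \<odot>\<^bsub>dual_hopf H\<^esub> \<psi>) (a \<otimes>\<^sub>t h)"
    unfolding dual_act_pure by (simp add: dual_mult_apply sweedler2_linear[OF clinear_scaleC_left])
  finally show "dual_act H (\<phi> \<odot>\<^bsub>dual_hopf H\<^esub> \<psi>) (a \<otimes>\<^sub>t h) = dual_act H \<phi> (dual_act H \<psi> (a \<otimes>\<^sub>t h))" ..
qed (rule clinear_dual_act)

text \<open>Testing with the dual basis recovers the whole coaction, so invariance under H^0 is
  coinvariance under H.\<close>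

lemma dual_act_invariant:
  assumes "\<And>\<psi>. dual_act H \<psi> t = dual_apply \<psi> \<one> *\<^sub>C t"
  shows "t = slice (counit H) t \<otimes>\<^sub>t \<one>"
proof (rule coinvariant)
  have "slice (fcoord b) (coact H t) = fcoord b \<one> *\<^sub>C t" for b :: 'h
    using assms[of "dbasis b"] by (simp add: dual_act_def dbasis_apply[OF finite_dim])
  then have "coact H t = (\<Sum>b\<in>fbasis TYPE('h). (fcoord b \<one> *\<^sub>C t) \<otimes>\<^sub>t b)"
    using tensor_expand[OF finite_dim, of "coact H t"] by simp
  also have "\<dots> = t \<otimes>\<^sub>t (\<Sum>b\<in>fbasis TYPE('h). fcoord b \<one> *\<^sub>C b)"
    by (simp add: pure_tensor_simps)
  finally show "coact H t = t \<otimes>\<^sub>t \<one>" by (simp add: fcoord_expand[OF finite_dim])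
qed

text \<open>Since S^2 = id, applying S to the adjoint of \<psi> gives the functional whose value at
  k is the conjugate of \<psi> at the adjoint of k.\<close>

lemma slice_star:
  assumes A: "unital_star_algebra A"
  shows "slice (dual_apply \<psi>) (astar (tensor_algebra A H) t) =
    astar A (slice (dual_apply (antipode (dual_hopf H) (astar (dual_hopf H) \<psi>))) t)"
proof -
  define \<psi>' where "\<psi>' = antipode (dual_hopf H) (astar (dual_hopf H) \<psi>)"
  have "dual_apply \<psi>' k = cnj (dual_apply \<psi> (astar H k))" for k
    by (simp add: \<psi>'_def dual_antipode_apply dual_star_apply antipode_antipode)
  then show ?thesis
    unfolding \<psi>'_def[symmetric]
    by (induction t rule: tensor_induct)
      (simp_all add: tensor_algebra_star[OF A unital_star_algebra_axioms] slice_pure[OF clinear_dual_apply]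
        unital_star_algebra.astar_simps[OF A] clinear_simps[OF clinear_slice[OF clinear_dual_apply]])
qed

end

section \<open>The element V and its relations\<close>

context twisted_crossed_product
begin

sublocale C1: unital_star_algebra "coef1 H C"
  by (rule hopf.unital_star_algebra_coef1[OF crossed.unital_star_algebra_axioms])

sublocale C2: unital_star_algebra "coef2 H C"
  by (rule hopf.unital_star_algebra_coef1[OF C1.unital_star_algebra_axioms])

sublocale CH: unital_star_algebra "tensor_algebra C H"
  by (rule unital_star_algebra_tensor[OF crossed.unital_star_algebra_axioms hopf.unital_star_algebra_axioms])

definition V :: "(('a, 'h) tensor, 'h dual) tensor"
  where "V = coeff_tensor gen"

abbreviation embed1 where "embed1 \<equiv> tensor_map embed (id :: 'h dual \<Rightarrow> 'h dual)"
abbreviation embed2 where "embed2 \<equiv> tensor_map embed1 (id :: 'h dual \<Rightarrow> 'h dual)"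

lemma unital_star_hom_embed1: "unital_star_hom (coef1 H A) (coef1 H C) embed1"
  by (rule unital_star_hom_tensor_map)
    (simp_all add: alg.unital_star_algebra_axioms crossed.unital_star_algebra_axioms
      hopf.unital_star_algebra_dual unital_star_hom_embed unital_star_hom_id)

lemma unital_star_hom_embed2: "unital_star_hom (coef2 H A) (coef2 H C) embed2"
  by (rule unital_star_hom_tensor_map)
    (simp_all add: hopf.unital_star_algebra_coef1 alg.unital_star_algebra_axioms C1.unital_star_algebra_axioms
      hopf.unital_star_algebra_dual unital_star_hom_embed1 unital_star_hom_id)

lemma ev_V: "ev h V = gen h"
  unfolding V_def by (rule ev_coeff_tensor[OF hopf.finite_dim clinear_gen])

lemma ev_embed1: "ev h (embed1 t) = embed (ev h t)"
  by (rule ev_tensor_map[OF clinear_embed])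

lemma ev_embed2: "ev h (embed2 t) = embed1 (ev h t)"
  by (rule ev_tensor_map[OF clinear_tensor_map[OF clinear_embed clinear_id(1)]])

lemma V_embed: "V \<odot>\<^bsub>coef1 H C\<^esub> leg12 H (embed a) = embed1 (\<rho> a) \<odot>\<^bsub>coef1 H C\<^esub> V"
  by (rule ev_eqI[OF hopf.finite_dim])
    (simp add: hopf.ev_leg12_mult[OF crossed.unital.unital_algebra_axioms]
      hopf.ev_mult[OF crossed.unital.unital_algebra_axioms, of _ "embed1 (\<rho> a)"] ev_V gen_embed ev_embed1 act_def)

lemma V_V: "leg12 H V \<odot>\<^bsub>coef2 H C\<^esub> leg13 H V = embed2 u \<odot>\<^bsub>coef2 H C\<^esub> comult_last H V"
proof (rule hopf.ev2_eqI)
  fix h l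
  note C = crossed.unital.unital_algebra_axioms
  have "ev h (ev l (embed2 u \<odot>\<^bsub>coef2 H C\<^esub> comult_last H V))
    = sweedler2 H (\<lambda>l1 l2. sweedler2 H (\<lambda>h1 h2. embed (hat u h1 l1) \<odot>\<^bsub>C\<^esub> gen (h2 \<odot>\<^bsub>H\<^esub> l2)) h) l"
    by (simp add: hopf.ev_mult[OF C1.unital.unital_algebra_axioms] sweedler2_linear[OF clinear_ev, symmetric]
        hopf.ev_mult[OF C] ev_embed1 ev_embed2 hopf.ev_comult_last ev_V hat_def)
  also have "\<dots> = gen h \<odot>\<^bsub>C\<^esub> gen l"
    unfolding gen_mult by (rule sweedler2_swap)
  finally show "ev h (ev l (leg12 H V \<odot>\<^bsub>coef2 H C\<^esub> leg13 H V))
    = ev h (ev l (embed2 u \<odot>\<^bsub>coef2 H C\<^esub> comult_last H V))"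
    by (simp add: hopf.ev_legs[OF C] ev_V)
qed

lemma crossed_induct:
  assumes "\<And>a h. P (embed a \<odot>\<^bsub>C\<^esub> gen h)" "\<And>s t. P s \<Longrightarrow> P t \<Longrightarrow> P (s + t)"
  shows "P c"
  by (rule tensor_induct) (use assms in \<open>auto simp: embed_gen\<close>)

lemmas CH_mult = tensor_algebra_mult(1)[OF crossed.unital.unital_algebra_axioms hopf.unital.unital_algebra_axioms]

lemmas crossed_linear_simps = pure_tensor_simps crossed.unital.amult_simps hopf.unital.amult_simps
  clinear_simps[OF clinear_embed] clinear_simps[OF clinear_gen]
  cbilinear_simps[OF cbilinear_act] cbilinear_simps[OF cbilinear_hat]

section \<open>The dual coaction as a homomorphism\<close>

lemma coact_gen: "coact H (gen h) = sweedler2 H (\<lambda>p q. gen p \<otimes>\<^sub>t q) h"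
  by (simp add: gen_def hopf.coact_pure)

lemma coact_embed: "coact H (embed a) = embed a \<otimes>\<^sub>t \<one>\<^bsub>H\<^esub>"
  by (simp add: embed_def hopf.coact_pure hopf.sweedler2_one[OF hopf.cbilinear_assoc])

lemma coact_embed_left: "coact H (embed a \<odot>\<^bsub>C\<^esub> c) = (embed a \<otimes>\<^sub>t \<one>\<^bsub>H\<^esub>) \<odot>\<^bsub>tensor_algebra C H\<^esub> coact H c"
proof (induction c rule: tensor_induct)
  case (pure b h)
  show ?case
    by (simp add: embed_mult_pure hopf.coact_pure CH_mult hopf.amult_one_left
        sweedler2_linear[OF CH.unital.clinear_amult_right, symmetric])
qed (simp add: clinear_simps[OF hopf.clinear_coact] crossed.unital.amult_simps CH.unital.amult_simps)

lemma coact_embed_right: "coact H (c \<odot>\<^bsub>C\<^esub> embed b) = coact H c \<odot>\<^bsub>tensor_algebra C H\<^esub> (embed b \<otimes>\<^sub>t \<one>\<^bsub>H\<^esub>)"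
proof (induction c rule: crossed_induct)
  case (1 a h)
  have t: "ctrilinear (\<lambda>h1 p q. (embed (act \<rho> h1 b) \<odot>\<^bsub>C\<^esub> gen p) \<otimes>\<^sub>t q)"
    by (rule ctrilinearI; rule clinearI; simp add: crossed_linear_simps)
  have "coact H (gen h \<odot>\<^bsub>C\<^esub> embed b)
    = sweedler2 H (\<lambda>h1 k. sweedler2 H (\<lambda>p q. (embed (act \<rho> h1 b) \<odot>\<^bsub>C\<^esub> gen p) \<otimes>\<^sub>t q) k) h"
    unfolding gen_embed
    by (simp add: sweedler2_linear[OF hopf.clinear_coact, symmetric] coact_embed_left coact_gen
        sweedler2_linear[OF CH.unital.clinear_amult_right, symmetric] CH_mult hopf.amult_one_left)
  also have "\<dots> = sweedler2 H (\<lambda>m q. sweedler2 H (\<lambda>h1 p. (embed (act \<rho> h1 b) \<odot>\<^bsub>C\<^esub> gen p) \<otimes>\<^sub>t q) m) h"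
    by (rule hopf.sweedler2_coassoc[OF t, symmetric])
  also have "\<dots> = coact H (gen h) \<odot>\<^bsub>tensor_algebra C H\<^esub> (embed b \<otimes>\<^sub>t \<one>\<^bsub>H\<^esub>)"
    by (simp add: coact_gen sweedler2_linear[OF CH.unital.clinear_amult_left, symmetric] CH_mult
        hopf.amult_one_right gen_embed sweedler2_linear[OF pure_tensor_left])
  finally show ?case by (simp add: crossed.amult_assoc CH.amult_assoc coact_embed_left)
qed (simp add: clinear_simps[OF hopf.clinear_coact] crossed.unital.amult_simps CH.unital.amult_simps)

text \<open>In the product of \<open>gen h\<close> and \<open>gen l\<close> the cocycle takes the
  first Sweedler legs and the generator the last ones, which \<open>coact\<close> splits again.
  Coassociativity in h and in l, with exchanges of the two sums, moves this splitting
  outside.\<close>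

lemma coact_gen_right: "coact H (c \<odot>\<^bsub>C\<^esub> gen l) = coact H c \<odot>\<^bsub>tensor_algebra C H\<^esub> coact H (gen l)"
proof (induction c rule: crossed_induct)
  case (1 a h)
  let ?Z = "\<lambda>h1 l1 p p' q q'. (embed (hat u h1 l1) \<odot>\<^bsub>C\<^esub> gen (p \<odot>\<^bsub>H\<^esub> p')) \<otimes>\<^sub>t (q \<odot>\<^bsub>H\<^esub> q')"
  have z: "clinear (\<lambda>h1. ?Z h1 l1 p p' q q')" "clinear (\<lambda>l1. ?Z h1 l1 p p' q q')"
    "clinear (\<lambda>p. ?Z h1 l1 p p' q q')" "clinear (\<lambda>p'. ?Z h1 l1 p p' q q')"
    "clinear (\<lambda>q. ?Z h1 l1 p p' q q')" "clinear (\<lambda>q'. ?Z h1 l1 p p' q q')" for h1 l1 p p' q q'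
    by (rule clinearI; simp add: crossed_linear_simps)+
  have tl: "ctrilinear (\<lambda>l1 p' q'. ?Z h1 l1 p p' q q')" for h1 p q
    by (rule ctrilinearI) (rule z)+
  have th: "ctrilinear (\<lambda>h1 p q. sweedler2 H (\<lambda>l1 k'. sweedler2 H (\<lambda>p' q'. ?Z h1 l1 p p' q q') k') l)"
    by (rule ctrilinearI; intro clinear_sweedler2_fun z)
  have bpq: "cbilinear (\<lambda>p q. gen p \<otimes>\<^sub>t q)"
    by (rule cbilinearI) (simp_all add: crossed_linear_simps)
  have "coact H (gen h \<odot>\<^bsub>C\<^esub> gen l)
    = sweedler2 H (\<lambda>h1 k. sweedler2 H (\<lambda>l1 k'. sweedler2 H (\<lambda>p q. sweedler2 H (\<lambda>p' q'. ?Z h1 l1 p p' q q') k') k) l) h"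
    unfolding gen_mult
    by (simp add: sweedler2_linear[OF hopf.clinear_coact, symmetric] coact_embed_left coact_gen
        hopf.sweedler2_mult[OF bpq]
        sweedler2_linear[OF CH.unital.clinear_amult_right, symmetric] CH_mult hopf.amult_one_left)
  also have "\<dots> = sweedler2 H (\<lambda>h1 k. sweedler2 H (\<lambda>p q. sweedler2 H (\<lambda>l1 k'. sweedler2 H (\<lambda>p' q'. ?Z h1 l1 p p' q q') k') l) k) h"
    by (subst sweedler2_swap) (rule HOL.refl)
  also have "\<dots> = sweedler2 H (\<lambda>m q. sweedler2 H (\<lambda>h1 p. sweedler2 H (\<lambda>l1 k'. sweedler2 H (\<lambda>p' q'. ?Z h1 l1 p p' q q') k') l) m) h"
    by (rule hopf.sweedler2_coassoc[OF th, symmetric])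
  also have "\<dots> = sweedler2 H (\<lambda>m q. sweedler2 H (\<lambda>h1 p. sweedler2 H (\<lambda>m' q'. sweedler2 H (\<lambda>l1 p'. ?Z h1 l1 p p' q q') m') l) m) h"
    by (simp only: hopf.sweedler2_coassoc[OF tl])
  also have "\<dots> = sweedler2 H (\<lambda>m q. sweedler2 H (\<lambda>m' q'. sweedler2 H (\<lambda>h1 p. sweedler2 H (\<lambda>l1 p'. ?Z h1 l1 p p' q q') m') m) l) h"
    by (subst sweedler2_swap) (rule HOL.refl)
  also have "\<dots> = sweedler2 H (\<lambda>m q. sweedler2 H (\<lambda>m' q'. (gen m \<odot>\<^bsub>C\<^esub> gen m') \<otimes>\<^sub>t (q \<odot>\<^bsub>H\<^esub> q')) l) h"
    unfolding gen_mult by (simp add: sweedler2_linear[OF pure_tensor_left, symmetric])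
  also have "\<dots> = coact H (gen h) \<odot>\<^bsub>tensor_algebra C H\<^esub> coact H (gen l)"
    by (simp add: coact_gen sweedler2_linear[OF CH.unital.clinear_amult_left, symmetric] CH_mult
        sweedler2_linear[OF CH.unital.clinear_amult_right, symmetric]) (rule sweedler2_swap)
  finally show ?case by (simp add: crossed.amult_assoc CH.amult_assoc coact_embed_left)
qed (simp add: clinear_simps[OF hopf.clinear_coact] crossed.unital.amult_simps CH.unital.amult_simps)

lemma coact_mult: "coact H (c \<odot>\<^bsub>C\<^esub> d) = coact H c \<odot>\<^bsub>tensor_algebra C H\<^esub> coact H d"
proof (induction d rule: crossed_induct)
  case (1 a h)
  have "coact H (c \<odot>\<^bsub>C\<^esub> (embed a \<odot>\<^bsub>C\<^esub> gen h)) = coact H ((c \<odot>\<^bsub>C\<^esub> embed a) \<odot>\<^bsub>C\<^esub> gen h)"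
    by (simp add: crossed.amult_assoc)
  then show ?case by (simp add: coact_gen_right coact_embed_right coact_embed CH.amult_assoc)
qed (simp add: clinear_simps[OF hopf.clinear_coact] crossed.unital.amult_simps CH.unital.amult_simps)

text \<open>\<open>star_twist\<close> takes the first leg and \<Delta> acts on the last, so
  coassociativity regroups them; this is done under the tensor involution, where everything is
  linear.\<close>

lemma coact_gen_star: "coact H (astar C (gen h)) = astar (tensor_algebra C H) (coact H (gen h))"
proof -
  note As = alg.unital_star_algebra_axioms and Hs = hopf.unital_star_algebra_axioms
  note AH = unital_star_algebra_tensor[OF As Hs]
  let ?AHH = "tensor_algebra (tensor_algebra A H) H"
  interpret AHH: unital_star_algebra ?AHH by (rule unital_star_algebra_tensor[OF AH Hs])
  have t: "ctrilinear (\<lambda>k p q. (star_twist k \<otimes>\<^sub>t p) \<otimes>\<^sub>t q)"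
    by (rule ctrilinearI; rule clinearI; simp add: pure_tensor_simps clinear_simps[OF clinear_star_twist])
  have "coact H (sweedler2 H (\<lambda>k l. star_twist k \<otimes>\<^sub>t l) h)
    = sweedler2 H (\<lambda>k l. sweedler2 H (\<lambda>p q. (star_twist k \<otimes>\<^sub>t p) \<otimes>\<^sub>t q) l) h"
    by (simp add: sweedler2_linear[OF hopf.clinear_coact, symmetric] hopf.coact_pure)
  also have "\<dots> = sweedler2 H (\<lambda>m q. sweedler2 H (\<lambda>k p. (star_twist k \<otimes>\<^sub>t p) \<otimes>\<^sub>t q) m) h"
    by (rule hopf.sweedler2_coassoc[OF t, symmetric])
  also have "\<dots> = sweedler2 H (\<lambda>m q. sweedler2 H (\<lambda>k p. star_twist k \<otimes>\<^sub>t p) m \<otimes>\<^sub>t q) h"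
    by (simp add: sweedler2_linear[OF pure_tensor_left])
  finally have "coact H (astar C (gen h))
    = astar ?AHH (sweedler2 H (\<lambda>m q. sweedler2 H (\<lambda>k p. star_twist k \<otimes>\<^sub>t p) m \<otimes>\<^sub>t q) h)"
    by (simp add: gen_star hopf.coact_star[OF As])
  also have "\<dots> = sweedler2 H (\<lambda>m q. astar ?AHH (sweedler2 H (\<lambda>k p. star_twist k \<otimes>\<^sub>t p) m \<otimes>\<^sub>t q)) h"
    by (rule sweedler2_hom[symmetric]) (simp_all add: AHH.astar_simps)
  also have "\<dots> = sweedler2 H (\<lambda>m q. astar (tensor_algebra C H) (gen m \<otimes>\<^sub>t q)) h"
    by (simp add: tensor_algebra_star[OF AH Hs] gen_star[symmetric]
        tensor_algebra_star[OF crossed.unital_star_algebra_axioms Hs])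
  also have "\<dots> = astar (tensor_algebra C H) (coact H (gen h))"
    unfolding coact_gen by (rule sweedler2_hom) (simp_all add: CH.astar_simps)
  finally show ?thesis .
qed

lemma unital_star_hom_coact: "unital_star_hom C (tensor_algebra C H) (coact H)"
proof -
  have "coact H (astar C c) = astar (tensor_algebra C H) (coact H c)" for c
  proof (induction c rule: crossed_induct)
    case (1 a h)
    show ?case
      by (simp add: crossed.astar_mult embed_star coact_mult coact_gen_star coact_embed CH.astar_mult
          tensor_algebra_star[OF crossed.unital_star_algebra_axioms hopf.unital_star_algebra_axioms] hopf.astar_one)
  qed (simp add: clinear_simps[OF hopf.clinear_coact] crossed.astar_add CH.astar_add)
  then show ?thesis
    using coact_embed[of "\<one>\<^bsub>A\<^esub>"]
    by (simp add: unital_star_hom_def hopf.clinear_coact coact_mult embed_one tensor_algebra_one)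
qed

text \<open>The left side is the coefficient at h of the adjoint of V. The right side is written
  with the adjoint of u so that \<open>V_isometry\<close> can use the unitarity of u.\<close>

lemma gen_star_antipode:
  "astar C (gen (astar H (antipode H h))) = sweedler2 H (\<lambda>a b.
    embed (sweedler2 H (\<lambda>p q. hat (astar (coef2 H A) u) (antipode H p) q) b) \<odot>\<^bsub>C\<^esub> gen (antipode H a)) h"
proof -
  note As = alg.unital_star_algebra_axioms and Hs = hopf.unital_star_algebra_axioms
  interpret AH: unital_star_algebra "tensor_algebra A H" by (rule unital_star_algebra_tensor[OF As Hs])
  have b: "cbilinear (\<lambda>k l. star_twist k \<otimes>\<^sub>t l)"
    by (rule cbilinearI) (simp_all add: pure_tensor_simps clinear_simps[OF clinear_star_twist])
  have bs: "balanced_on UNIV (\<lambda>k l. star_twist (astar H k) \<otimes>\<^sub>t astar H l)"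
    by (simp add: balanced_on_def hopf.astar_simps pure_tensor_simps clinear_simps[OF clinear_star_twist])
  have hat_star: "hat (astar (coef2 H A) u) k l = astar A (hat u (astar H (antipode H k)) (astar H (antipode H l)))" for k l
    by (simp add: hat_def hopf.ev_star[OF hopf.unital_star_algebra_coef1[OF As]] hopf.ev_star[OF As])
  have tw: "astar A (star_twist (astar H (antipode H b)))
    = sweedler2 H (\<lambda>p q. hat (astar (coef2 H A) u) (antipode H p) q) b" for b
  proof -
    let ?f = "\<lambda>h1 h2. astar A (hat u (antipode H (astar H h2)) (astar H h1))"
    have "astar A (star_twist (astar H (antipode H b))) = sweedler2 H ?f (antipode H b)"
      unfolding star_twist_def hopf.sweedler2_star[OF star_twist_bilinear]
      by (rule sweedler2_hom[symmetric]) (simp_all add: alg.astar_simps)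
    also have "\<dots> = sweedler2 H (\<lambda>p q. ?f (antipode H q) (antipode H p)) b"
      by (rule hopf.sweedler2_antipode_arg, rule cbilinearI)
        (simp_all add: hopf.astar_simps alg.astar_simps linear_simps)
    finally show ?thesis
      by (simp add: hat_star hopf.antipode_star_antipode hopf.antipode_antipode)
  qed
  have "astar C (gen (astar H (antipode H h)))
    = astar (tensor_algebra A H) (sweedler2 H (\<lambda>k l. star_twist (astar H k) \<otimes>\<^sub>t astar H l) (antipode H h))"
    by (simp add: gen_star hopf.sweedler2_star[OF b])
  also have "\<dots> = sweedler2 H (\<lambda>k l. astar (tensor_algebra A H) (star_twist (astar H k) \<otimes>\<^sub>t astar H l)) (antipode H h)"
    by (rule sweedler2_hom[symmetric]) (simp_all add: AH.astar_simps)
  also have "\<dots> = sweedler2 H (\<lambda>k l. embed (astar A (star_twist (astar H k))) \<odot>\<^bsub>C\<^esub> gen l) (antipode H h)"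
    by (simp add: embed_gen tensor_algebra_star[OF As Hs] hopf.astar_astar)
  also have "\<dots> = sweedler2 H (\<lambda>a b. embed (astar A (star_twist (astar H (antipode H b)))) \<odot>\<^bsub>C\<^esub> gen (antipode H a)) h"
    by (rule hopf.sweedler2_antipode_arg, rule cbilinearI)
      (simp_all add: crossed_linear_simps alg.astar_simps hopf.astar_simps clinear_simps[OF clinear_star_twist])
  finally show ?thesis by (simp only: tw)
qed

text \<open>Unitarity of u gives u* V_12 V_13 = (id \<otimes> \<Delta>^0)(V). Its coefficients at
  S(h_(1)) and h_(2) sum on the one hand to the coefficient of V* V at h, by
  \<open>gen_star_antipode\<close> and coassociativity, and on the other hand to 1 \<rtimes>
  S(h_(1)) h_(2), which is \<epsilon>(h) 1.\<close>

lemma V_isometry: "astar (coef1 H C) V \<odot>\<^bsub>coef1 H C\<^esub> V = \<one>\<^bsub>coef1 H C\<^esub>"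
proof (rule ev_eqI[OF hopf.finite_dim])
  fix h
  note Cu = crossed.unital.unital_algebra_axioms
  let ?us = "astar (coef2 H A) u"
  let ?T = "\<lambda>c q d z. embed (hat ?us c q) \<odot>\<^bsub>C\<^esub> (gen d \<odot>\<^bsub>C\<^esub> gen z)"
  have bh: "cbilinear (hat ?us)"
    unfolding hat_def[abs_def]
    by (rule cbilinearI) (simp_all add: clinear_simps[OF clinear_ev_arg] clinear_simps[OF clinear_ev])
  note ls = crossed_linear_simps cbilinear_simps[OF bh] clinear_simps[OF hopf.antipode_linear]
  have u1: "embed2 ?us \<odot>\<^bsub>coef2 H C\<^esub> (leg12 H V \<odot>\<^bsub>coef2 H C\<^esub> leg13 H V) = comult_last H V"
  proof -
    have "?us \<odot>\<^bsub>coef2 H A\<^esub> u = \<one>\<^bsub>coef2 H A\<^esub>" using unitary by (simp add: aunitary_def)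
    then have "embed2 ?us \<odot>\<^bsub>coef2 H C\<^esub> embed2 u = \<one>\<^bsub>coef2 H C\<^esub>"
      using unital_star_homD(2,3)[OF unital_star_hom_embed2] by metis
    then show ?thesis by (simp add: V_V C2.amult_assoc[symmetric] C2.amult_one_left)
  qed
  have Tsum: "sweedler2 H (\<lambda>c d. sweedler2 H (\<lambda>q z. ?T c q d z) l) k = gen (k \<odot>\<^bsub>H\<^esub> l)" for k l
  proof -
    have "ev k (ev l (embed2 ?us \<odot>\<^bsub>coef2 H C\<^esub> (leg12 H V \<odot>\<^bsub>coef2 H C\<^esub> leg13 H V)))
      = sweedler2 H (\<lambda>q z. sweedler2 H (\<lambda>c d. ?T c q d z) k) l"
      by (simp add: hopf.ev_mult[OF C1.unital.unital_algebra_axioms, of _ "embed2 ?us"] sweedler2_linear[OF clinear_ev, symmetric]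
          hopf.ev_mult[OF Cu, of _ "embed1 _"] ev_embed2 ev_embed1 hopf.ev_legs[OF Cu] ev_V hat_def)
    then show ?thesis
      unfolding u1 by (subst sweedler2_swap) (simp add: hopf.ev_comult_last ev_V)
  qed
  have t1: "ctrilinear (\<lambda>a b z. embed (sweedler2 H (\<lambda>p q. hat ?us (antipode H p) q) b) \<odot>\<^bsub>C\<^esub> (gen (antipode H a) \<odot>\<^bsub>C\<^esub> gen z))"
  proof -
    have "cbilinear (\<lambda>p q. hat ?us (antipode H p) q)" by (rule cbilinearI) (simp_all add: ls)
    note clinear_simps[OF hopf.clinear_sweedler2[OF this]]
    then show ?thesis by (intro ctrilinearI; intro clinearI; simp add: ls)
  qed
  have t2: "ctrilinear (\<lambda>p q z. ?T (antipode H p) q (antipode H a) z)" for a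
    by (rule ctrilinearI; rule clinearI; simp add: ls)
  have t3: "ctrilinear (\<lambda>a p k. sweedler2 H (\<lambda>q z. ?T (antipode H p) q (antipode H a) z) k)"
  proof (rule ctrilinearI)
    show "clinear (\<lambda>a. sweedler2 H (\<lambda>q z. ?T (antipode H p) q (antipode H a) z) k)" for p k
      by (rule clinear_sweedler2_fun; rule clinearI; simp add: ls)
    show "clinear (\<lambda>p. sweedler2 H (\<lambda>q z. ?T (antipode H p) q (antipode H a) z) k)" for a k
      by (rule clinear_sweedler2_fun; rule clinearI; simp add: ls)
    show "clinear (\<lambda>k. sweedler2 H (\<lambda>q z. ?T (antipode H p) q (antipode H a) z) k)" for a p
      by (rule hopf.clinear_sweedler2) (rule cbilinearI; simp add: ls)
  qed
  have b: "cbilinear (\<lambda>c d. sweedler2 H (\<lambda>q z. ?T c q d z) k)" for k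
    unfolding cbilinear_def by (intro conjI allI clinear_sweedler2_fun; rule clinearI; simp add: ls)
  have "ev h (astar (coef1 H C) V \<odot>\<^bsub>coef1 H C\<^esub> V)
    = sweedler2 H (\<lambda>m z. sweedler2 H (\<lambda>a b. embed (sweedler2 H (\<lambda>p q. hat ?us (antipode H p) q) b)
        \<odot>\<^bsub>C\<^esub> (gen (antipode H a) \<odot>\<^bsub>C\<^esub> gen z)) m) h"
    by (simp add: hopf.ev_mult[OF Cu] hopf.ev_star[OF crossed.unital_star_algebra_axioms] ev_V gen_star_antipode
        sweedler2_linear[OF crossed.unital.clinear_amult_left, symmetric] crossed.amult_assoc)
  also have "\<dots> = sweedler2 H (\<lambda>a k. sweedler2 H (\<lambda>b z. embed (sweedler2 H (\<lambda>p q. hat ?us (antipode H p) q) b)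
        \<odot>\<^bsub>C\<^esub> (gen (antipode H a) \<odot>\<^bsub>C\<^esub> gen z)) k) h"
    by (rule hopf.sweedler2_coassoc[OF t1])
  also have "\<dots> = sweedler2 H (\<lambda>a k. sweedler2 H (\<lambda>b z. sweedler2 H (\<lambda>p q. ?T (antipode H p) q (antipode H a) z) b) k) h"
    by (simp add: sweedler2_linear[OF clinear_embed, symmetric]
        sweedler2_linear[OF crossed.unital.clinear_amult_left, symmetric])
  also have "\<dots> = sweedler2 H (\<lambda>a k. sweedler2 H (\<lambda>p k'. sweedler2 H (\<lambda>q z. ?T (antipode H p) q (antipode H a) z) k') k) h"
    by (simp only: hopf.sweedler2_coassoc[OF t2])
  also have "\<dots> = sweedler2 H (\<lambda>g k'. sweedler2 H (\<lambda>a p. sweedler2 H (\<lambda>q z. ?T (antipode H p) q (antipode H a) z) k') g) h"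
    by (rule hopf.sweedler2_coassoc[OF t3, symmetric])
  also have "\<dots> = sweedler2 H (\<lambda>g k'. sweedler2 H (\<lambda>c d. sweedler2 H (\<lambda>q z. ?T c q d z) k') (antipode H g)) h"
    by (simp only: hopf.sweedler2_antipode_arg[OF b])
  also have "\<dots> = ev h \<one>\<^bsub>coef1 H C\<^esub>"
    by (simp add: Tsum hopf.sweedler2_antipode(1)[OF clinear_gen] gen_one hopf.ev_one)
  finally show "ev h (astar (coef1 H C) V \<odot>\<^bsub>coef1 H C\<^esub> V) = ev h \<one>\<^bsub>coef1 H C\<^esub>" .
qed

end

section \<open>Unitarity of V and the dual action on it\<close>

context twisted_crossed_product
begin

lemma coact_V_star:
  "coact H (ev h (astar (coef1 H C) V)) = sweedler2 H (\<lambda>p q. ev q (astar (coef1 H C) V) \<otimes>\<^sub>t antipode H p) h"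
proof -
  have b: "cbilinear (\<lambda>p q. gen p \<otimes>\<^sub>t q)"
    by (rule cbilinearI) (simp_all add: crossed_linear_simps)
  have "coact H (ev h (astar (coef1 H C) V))
    = astar (tensor_algebra C H) (sweedler2 H (\<lambda>a b. gen (astar H a) \<otimes>\<^sub>t astar H b) (antipode H h))"
    by (simp add: hopf.ev_star[OF crossed.unital_star_algebra_axioms] ev_V coact_gen_star coact_gen
        hopf.sweedler2_star[OF b])
  also have "\<dots> = sweedler2 H (\<lambda>a b. astar (tensor_algebra C H) (gen (astar H a) \<otimes>\<^sub>t astar H b)) (antipode H h)"
    by (rule sweedler2_hom[symmetric]) (simp_all add: CH.astar_simps)
  also have "\<dots> = sweedler2 H (\<lambda>a b. astar C (gen (astar H a)) \<otimes>\<^sub>t b) (antipode H h)"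
    by (simp add: tensor_algebra_star[OF crossed.unital_star_algebra_axioms hopf.unital_star_algebra_axioms]
        hopf.astar_astar)
  also have "\<dots> = sweedler2 H (\<lambda>p q. astar C (gen (astar H (antipode H q))) \<otimes>\<^sub>t antipode H p) h"
    by (rule hopf.sweedler2_antipode_arg, rule cbilinearI)
      (simp_all add: crossed_linear_simps hopf.astar_simps crossed.astar_simps)
  finally show ?thesis
    by (simp add: hopf.ev_star[OF crossed.unital_star_algebra_axioms] ev_V)
qed

text \<open>The coefficients of \<open>V V\<^sup>*\<close> are coinvariant, hence lie in \<open>A\<close>; and \<open>A\<close>-coefficients can be cancelled from \<open>V\<close>.\<close>

lemma V_coisometry: "V \<odot>\<^bsub>coef1 H C\<^esub> astar (coef1 H C) V = \<one>\<^bsub>coef1 H C\<^esub>"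
proof -
  note Cu = crossed.unital.unital_algebra_axioms
  let ?W = "astar (coef1 H C) V"
  define g where "g = V \<odot>\<^bsub>coef1 H C\<^esub> ?W - \<one>\<^bsub>coef1 H C\<^esub>"
  have inv: "coact H (ev h (V \<odot>\<^bsub>coef1 H C\<^esub> ?W)) = ev h (V \<odot>\<^bsub>coef1 H C\<^esub> ?W) \<otimes>\<^sub>t \<one>\<^bsub>H\<^esub>" for h
  proof -
    let ?G = "\<lambda>p q r s. (gen p \<odot>\<^bsub>C\<^esub> ev s ?W) \<otimes>\<^sub>t (q \<odot>\<^bsub>H\<^esub> antipode H r)"
    note ls = crossed_linear_simps clinear_simps[OF hopf.antipode_linear] clinear_simps[OF clinear_ev_arg]
    have G: "clinear (\<lambda>p. ?G p q r s)" "clinear (\<lambda>q. ?G p q r s)" "clinear (\<lambda>r. ?G p q r s)" "clinear (\<lambda>s. ?G p q r s)"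
      for p q r s
      by (rule clinearI; simp add: ls)+
    have brs: "cbilinear (\<lambda>r s. ?G p q r s)" for p q
      unfolding cbilinear_def by (intro conjI allI G)
    have t1: "ctrilinear (\<lambda>p q b. sweedler2 H (?G p q) b)"
      by (rule ctrilinearI) (rule clinear_sweedler2_fun[OF G(1)] clinear_sweedler2_fun[OF G(2)] hopf.clinear_sweedler2[OF brs])+
    have t2: "ctrilinear (?G p)" for p by (rule ctrilinearI) (rule G)+
    have l: "clinear (\<lambda>s. (gen p \<odot>\<^bsub>C\<^esub> ev s ?W) \<otimes>\<^sub>t \<one>\<^bsub>H\<^esub>)" for p
      by (rule clinearI) (simp_all add: ls)
    have "coact H (ev h (V \<odot>\<^bsub>coef1 H C\<^esub> ?W))
      = sweedler2 H (\<lambda>a b. sweedler2 H (\<lambda>p q. sweedler2 H (?G p q) b) a) h"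
      by (simp add: hopf.ev_mult[OF Cu] ev_V sweedler2_linear[OF hopf.clinear_coact, symmetric] coact_mult
          coact_gen coact_V_star sweedler2_linear[OF CH.unital.clinear_amult_left, symmetric]
          sweedler2_linear[OF CH.unital.clinear_amult_right, symmetric] CH_mult)
        (subst sweedler2_swap, rule HOL.refl)
    also have "\<dots> = sweedler2 H (\<lambda>p k. sweedler2 H (\<lambda>q b. sweedler2 H (?G p q) b) k) h"
      by (rule hopf.sweedler2_coassoc[OF t1])
    also have "\<dots> = sweedler2 H (\<lambda>p k. sweedler2 H (\<lambda>m s. sweedler2 H (\<lambda>q r. ?G p q r s) m) k) h"
      by (simp only: hopf.sweedler2_coassoc[OF t2])
    also have "\<dots> = sweedler2 H (\<lambda>p k. (gen p \<odot>\<^bsub>C\<^esub> ev k ?W) \<otimes>\<^sub>t \<one>\<^bsub>H\<^esub>) h"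
      by (simp add: hopf.sweedler2_antipode(2)[OF pure_tensor_right] hopf.sweedler2_counit(1)[OF l])
    also have "\<dots> = ev h (V \<odot>\<^bsub>coef1 H C\<^esub> ?W) \<otimes>\<^sub>t \<one>\<^bsub>H\<^esub>"
      by (simp add: hopf.ev_mult[OF Cu] ev_V sweedler2_linear[OF pure_tensor_left])
    finally show ?thesis .
  qed
  have "coact H (ev h g) = ev h g \<otimes>\<^sub>t \<one>\<^bsub>H\<^esub>" for h
    using inv[of h] coact_embed[of "\<one>\<^bsub>A\<^esub>"]
    by (simp add: g_def clinear_simps[OF clinear_ev] clinear_simps[OF hopf.clinear_coact] pure_tensor_simps
        hopf.ev_one embed_one)
  then have ge: "ev h g = embed (slice (counit H) (ev h g))" for h
    using hopf.coinvariant unfolding embed_def by blast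
  have lg: "clinear (\<lambda>h. slice (counit H) (ev h g))"
    by (rule clinear_compose[OF clinear_slice[OF hopf.counit_linear] clinear_ev_arg])
  have "g \<odot>\<^bsub>coef1 H C\<^esub> V = 0"
    by (simp add: g_def C1.unital.amult_simps C1.amult_assoc V_isometry C1.amult_one_left C1.amult_one_right)
  then have "ev h (g \<odot>\<^bsub>coef1 H C\<^esub> V) = 0" for h by (simp add: clinear_zero[OF clinear_ev])
  then have "sweedler2 H (\<lambda>a b. embed (slice (counit H) (ev a g)) \<odot>\<^bsub>C\<^esub> gen b) h = 0" for h
    by (simp add: hopf.ev_mult[OF Cu] ev_V flip: ge)
  \<comment> \<open>Applying \<epsilon> to the H-factor removes \<open>gen b\<close> and leaves the
    coefficient itself.\<close>
  then have "slice (counit H) (sweedler2 H (\<lambda>a b. slice (counit H) (ev a g) \<otimes>\<^sub>t b) h) = 0" for h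
    by (simp add: embed_gen clinear_zero[OF clinear_slice[OF hopf.counit_linear]])
  then have "slice (counit H) (ev h g) = 0" for h
    using hopf.sweedler2_counit(2)[OF lg, of h]
    by (simp add: sweedler2_linear[OF clinear_slice[OF hopf.counit_linear], symmetric] hopf.counit_linear)
  then have "ev h g = 0" for h
    using ge[of h] by (simp add: clinear_zero[OF clinear_embed])
  then have "g = 0" by (intro ev_eqI[OF hopf.finite_dim]) (simp add: clinear_zero[OF clinear_ev])
  then show ?thesis by (simp add: g_def)
qed

text \<open>The model for \<open>transport_V\<close>, where \<theta>(\<psi>) takes the place of
  \<psi>. It holds because \<open>gen h\<close> goes to the sum of \<psi>(h_(2)) \<open>gen\<close>
  h_(1).\<close>

lemma dual_act_V: "tensor_map (dual_act H \<psi>) id V = V \<odot>\<^bsub>coef1 H C\<^esub> (\<one>\<^bsub>C\<^esub> \<otimes>\<^sub>t \<psi>)"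
  by (rule ev_eqI[OF hopf.finite_dim])
    (simp add: ev_tensor_map hopf.clinear_dual_act ev_V hopf.ev_mult[OF crossed.unital.unital_algebra_axioms]
      ev_pure gen_def hopf.dual_act_pure crossed.unital.amult_simps crossed.amult_one_right)

lemma dual_act_product:
  "dual_act H \<psi> (c \<odot>\<^bsub>C\<^esub> d) = sweedler2 (dual_hopf H) (\<lambda>\<psi>1 \<psi>2. dual_act H \<psi>1 c \<odot>\<^bsub>C\<^esub> dual_act H \<psi>2 d) \<psi>"
  unfolding dual_act_def coact_mult by (rule hopf.slice_mult_dual[OF crossed.unital.unital_algebra_axioms])

lemma dual_act_star:
  "dual_act H \<psi> (astar C c) = astar C (dual_act H (antipode (dual_hopf H) (astar (dual_hopf H) \<psi>)) c)"
  unfolding dual_act_def unital_star_homD(4)[OF unital_star_hom_coact]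
  by (rule hopf.slice_star[OF crossed.unital_star_algebra_axioms])

lemma dual_act_embed_left: "dual_act H \<psi> (embed a \<odot>\<^bsub>C\<^esub> c) = embed a \<odot>\<^bsub>C\<^esub> dual_act H \<psi> c"
  unfolding dual_act_def coact_embed_left
  by (rule slice_tensor_algebra(2)[OF crossed.unital.unital_algebra_axioms hopf.unital.unital_algebra_axioms clinear_dual_apply])

lemma dual_act_embed_right: "dual_act H \<psi> (c \<odot>\<^bsub>C\<^esub> embed a) = dual_act H \<psi> c \<odot>\<^bsub>C\<^esub> embed a"
  unfolding dual_act_def coact_embed_right
  by (rule slice_tensor_algebra(1)[OF crossed.unital.unital_algebra_axioms hopf.unital.unital_algebra_axioms clinear_dual_apply])

lemma dual_act_embed: "dual_act H \<psi> (embed a) = dual_apply \<psi> \<one>\<^bsub>H\<^esub> *\<^sub>C embed a"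
  by (simp add: dual_act_def coact_embed clinear_dual_apply)

lemma slice_embed: "slice (counit H) (embed a) = a"
  by (simp add: embed_def hopf.counit_linear hopf.counit_one scaleC_one)

lemma embed_inject: "embed a = embed b \<longleftrightarrow> a = b"
  by (metis slice_embed)

lemma coefficient_algebra_embed: "coefficient_algebra H = range embed"
  by (simp add: coefficient_algebra_def embed_def[abs_def])

text \<open>The values on the elements \<open>gen h\<close>, followed by the counit, determine
  \<psi>. This serves the injectivity of \<theta>.\<close>

lemma dual_act_faithful:
  assumes "\<one>\<^bsub>A\<^esub> \<noteq> 0" and "\<And>c :: ('a, 'h) tensor. dual_act H \<psi> c = 0"
  shows "\<psi> = 0"
proof (rule dual_eqI)
  fix h
  have "0 = slice (counit H) (dual_act H \<psi> (gen h))"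
    using assms(2) by (simp add: clinear_zero[OF clinear_slice[OF hopf.counit_linear]])
  also have "\<dots> = sweedler2 H (\<lambda>p q. counit H p *\<^sub>C (dual_apply \<psi> q *\<^sub>C \<one>\<^bsub>A\<^esub>)) h"
    by (simp add: gen_def hopf.dual_act_pure sweedler2_linear[OF clinear_slice[OF hopf.counit_linear], symmetric]
        clinear_simps[OF clinear_slice[OF hopf.counit_linear]] hopf.counit_linear mult.commute)
  also have "\<dots> = dual_apply \<psi> h *\<^sub>C \<one>\<^bsub>A\<^esub>"
    by (rule hopf.sweedler2_counit(1)[OF clinear_compose[OF clinear_scaleC_left clinear_dual_apply]])
  finally show "dual_apply \<psi> h = dual_apply 0 h" using assms(1) by simp
qed

lemma V_star_embed: "leg12 H (embed a) \<odot>\<^bsub>coef1 H C\<^esub> astar (coef1 H C) V = astar (coef1 H C) V \<odot>\<^bsub>coef1 H C\<^esub> embed1 (\<rho> a)"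
proof -
  have "astar (coef1 H C) (V \<odot>\<^bsub>coef1 H C\<^esub> leg12 H (embed (astar A a)))
    = astar (coef1 H C) (embed1 (\<rho> (astar A a)) \<odot>\<^bsub>coef1 H C\<^esub> V)"
    by (simp only: V_embed)
  then show ?thesis
    using unital_star_homD(4)[OF hopf.unital_star_hom_leg12[OF crossed.unital_star_algebra_axioms], of "embed (astar A a)"]
      unital_star_homD(4)[OF unital_star_hom_embed1, of "\<rho> (astar A a)"] rho(4)[of "astar A a"]
    by (simp add: C1.astar_mult embed_star[symmetric] crossed.astar_astar alg.astar_astar C1.astar_astar)
qed

lemma rho_V: "embed1 (\<rho> a) = V \<odot>\<^bsub>coef1 H C\<^esub> (leg12 H (embed a) \<odot>\<^bsub>coef1 H C\<^esub> astar (coef1 H C) V)"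
  by (simp add: C1.amult_assoc[symmetric] V_embed) (simp add: C1.amult_assoc V_coisometry C1.amult_one_right)

end

section \<open>Coalgebra laws of the dual\<close>

context cstar_hopf_algebra
begin

text \<open>H^0 is not made an instance of \<open>cstar_hopf_algebra\<close>, whose axioms include a
  C*-norm. Its coalgebra laws are derived instead from the algebra laws of H, starting with this
  evaluation.\<close>

lemma dual_sweedler2_eval:
  "sweedler2 (dual_hopf H) (\<lambda>a b. dual_apply a h * dual_apply b l) \<psi> = dual_apply \<psi> (h \<odot> l)"
  using dual_pairing2_eq[of "comult (dual_hopf H) \<psi>" h l]
  by (simp add: dual_pairing2_def sweedler2_def dual_comult)

lemma dual_sweedler2_counit:
  assumes f: "clinear f"
  shows "sweedler2 (dual_hopf H) (\<lambda>a b. dual_apply a \<one> *\<^sub>C f b) \<psi> = f \<psi>"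
    and "sweedler2 (dual_hopf H) (\<lambda>a b. dual_apply b \<one> *\<^sub>C f a) \<psi> = f \<psi>"
proof -
  have "sweedler2 (dual_hopf H) (\<lambda>a b. dual_apply a \<one> *\<^sub>C b) \<psi> = \<psi>"
    "sweedler2 (dual_hopf H) (\<lambda>a b. dual_apply b \<one> *\<^sub>C a) \<psi> = \<psi>"
    using dual_sweedler2_eval[of \<one> _ \<psi>] dual_sweedler2_eval[of _ \<one> \<psi>]
    by (auto intro!: dual_eqI simp: sweedler2_linear[OF clinear_eval, symmetric] mult.commute
        amult_one_left amult_one_right)
  then show "sweedler2 (dual_hopf H) (\<lambda>a b. dual_apply a \<one> *\<^sub>C f b) \<psi> = f \<psi>"
    "sweedler2 (dual_hopf H) (\<lambda>a b. dual_apply b \<one> *\<^sub>C f a) \<psi> = f \<psi>"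
    by (simp_all flip: clinear_simps(2)[OF f] add: sweedler2_linear[OF f])
qed

text \<open>In the dual basis both sides have the coefficients \<psi>(p q j), so coassociativity of
  H^0 is associativity of H.\<close>

lemma dual_sweedler2_coassoc:
  assumes f: "ctrilinear f"
  shows "sweedler2 (dual_hopf H) (\<lambda>k c. sweedler2 (dual_hopf H) (\<lambda>a b. f a b c) k) \<psi> =
    sweedler2 (dual_hopf H) (\<lambda>a k. sweedler2 (dual_hopf H) (f a) k) \<psi>"
proof -
  let ?F = "fbasis TYPE('h)"
  note b = ctrilinear_bilinear[OF f]
  have c1: "clinear (\<lambda>a. f a b c)" and c3: "clinear (\<lambda>c. f a b c)" for a b c
    using f by (simp_all add: ctrilinear_def cbilinear_def)
  have b2: "cbilinear (\<lambda>k c. sweedler2 (dual_hopf H) (\<lambda>a b. f a b c) k)"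
    unfolding cbilinear_def by (intro conjI allI clinear_sweedler2_dual[OF b(2)] clinear_sweedler2_fun c3)
  have b3: "cbilinear (\<lambda>a k. sweedler2 (dual_hopf H) (f a) k)"
    unfolding cbilinear_def by (intro conjI allI clinear_sweedler2_dual[OF b(1)] clinear_sweedler2_fun c1)
  have expand: "(\<Sum>i\<in>?F. fcoord i x * g i) = g x" if "clinear g" for g :: "'h \<Rightarrow> complex" and x
    using arg_cong[OF fcoord_expand[OF finite_dim, of x], of g] by (simp add: clinear_simps[OF that] scaleC_complex_def)
  have l: "clinear (\<lambda>i. dual_apply \<psi> (i \<odot> j))" "clinear (\<lambda>j. dual_apply \<psi> (i \<odot> j))" for i j
    by (rule clinear_compose[OF clinear_dual_apply unital.clinear_amult_left])
      (rule clinear_compose[OF clinear_dual_apply unital.clinear_amult_right])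
  let ?s = "\<lambda>r. (\<Sum>j\<in>?F. \<Sum>q\<in>?F. \<Sum>p\<in>?F. r p q j *\<^sub>C f (dbasis p) (dbasis q) (dbasis j))"
  have "sweedler2 (dual_hopf H) (\<lambda>k c. sweedler2 (dual_hopf H) (\<lambda>a b. f a b c) k) \<psi>
    = (\<Sum>j\<in>?F. \<Sum>i\<in>?F. \<Sum>q\<in>?F. \<Sum>p\<in>?F. (fcoord i (p \<odot> q) * dual_apply \<psi> (i \<odot> j)) *\<^sub>C f (dbasis p) (dbasis q) (dbasis j))"
    unfolding sweedler2_dual[OF b2]
    by (simp add: sweedler2_dual[OF b(2)] dbasis_apply[OF finite_dim]
        cvector.scale_sum_right mult.commute)
  also have "\<dots> = (\<Sum>j\<in>?F. \<Sum>q\<in>?F. \<Sum>i\<in>?F. \<Sum>p\<in>?F. (fcoord i (p \<odot> q) * dual_apply \<psi> (i \<odot> j)) *\<^sub>C f (dbasis p) (dbasis q) (dbasis j))"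
    by (intro sum.cong HOL.refl sum.swap)
  also have "\<dots> = (\<Sum>j\<in>?F. \<Sum>q\<in>?F. \<Sum>p\<in>?F. \<Sum>i\<in>?F. (fcoord i (p \<odot> q) * dual_apply \<psi> (i \<odot> j)) *\<^sub>C f (dbasis p) (dbasis q) (dbasis j))"
    by (intro sum.cong HOL.refl sum.swap)
  also have "\<dots> = ?s (\<lambda>p q j. dual_apply \<psi> (p \<odot> q \<odot> j))"
    by (simp only: cvector.scale_sum_left[symmetric] expand[OF l(1)])
  finally have L: "sweedler2 (dual_hopf H) (\<lambda>k c. sweedler2 (dual_hopf H) (\<lambda>a b. f a b c) k) \<psi>
    = ?s (\<lambda>p q j. dual_apply \<psi> (p \<odot> q \<odot> j))" .
  have "sweedler2 (dual_hopf H) (\<lambda>a k. sweedler2 (dual_hopf H) (f a) k) \<psi>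
    = (\<Sum>i\<in>?F. \<Sum>p\<in>?F. \<Sum>j\<in>?F. \<Sum>q\<in>?F. (fcoord i (q \<odot> j) * dual_apply \<psi> (p \<odot> i)) *\<^sub>C f (dbasis p) (dbasis q) (dbasis j))"
    unfolding sweedler2_dual[OF b3]
    by (simp add: sweedler2_dual[OF b(1)] dbasis_apply[OF finite_dim]
        cvector.scale_sum_right mult.commute)
  also have "\<dots> = (\<Sum>p\<in>?F. \<Sum>i\<in>?F. \<Sum>j\<in>?F. \<Sum>q\<in>?F. (fcoord i (q \<odot> j) * dual_apply \<psi> (p \<odot> i)) *\<^sub>C f (dbasis p) (dbasis q) (dbasis j))"
    by (rule sum.swap)
  also have "\<dots> = (\<Sum>p\<in>?F. \<Sum>j\<in>?F. \<Sum>i\<in>?F. \<Sum>q\<in>?F. (fcoord i (q \<odot> j) * dual_apply \<psi> (p \<odot> i)) *\<^sub>C f (dbasis p) (dbasis q) (dbasis j))"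
    by (intro sum.cong HOL.refl sum.swap)
  also have "\<dots> = (\<Sum>p\<in>?F. \<Sum>j\<in>?F. \<Sum>q\<in>?F. \<Sum>i\<in>?F. (fcoord i (q \<odot> j) * dual_apply \<psi> (p \<odot> i)) *\<^sub>C f (dbasis p) (dbasis q) (dbasis j))"
    by (intro sum.cong HOL.refl sum.swap)
  also have "\<dots> = (\<Sum>p\<in>?F. \<Sum>j\<in>?F. \<Sum>q\<in>?F. dual_apply \<psi> (p \<odot> q \<odot> j) *\<^sub>C f (dbasis p) (dbasis q) (dbasis j))"
    by (simp only: cvector.scale_sum_left[symmetric] expand[OF l(2)] amult_assoc)
  also have "\<dots> = (\<Sum>j\<in>?F. \<Sum>p\<in>?F. \<Sum>q\<in>?F. dual_apply \<psi> (p \<odot> q \<odot> j) *\<^sub>C f (dbasis p) (dbasis q) (dbasis j))"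
    by (rule sum.swap)
  also have "\<dots> = ?s (\<lambda>p q j. dual_apply \<psi> (p \<odot> q \<odot> j))"
    by (intro sum.cong HOL.refl sum.swap)
  finally show ?thesis using L by simp
qed

text \<open>P and Q are a left and a right convolution inverse of one map. It is applied twice to
  the automorphism, once for the antipode and once for the involution.\<close>

lemma dual_convolution_inverse_unique:
  assumes lin: "clinear P" "clinear \<theta>" "clinear Q"
    and l: "\<And>\<psi>. sweedler2 (dual_hopf H) (\<lambda>a b. P a \<odot>\<^bsub>dual_hopf H\<^esub> \<theta> b) \<psi> = dual_apply \<psi> \<one> *\<^sub>C \<one>\<^bsub>dual_hopf H\<^esub>"
    and r: "\<And>\<psi>. sweedler2 (dual_hopf H) (\<lambda>a b. \<theta> a \<odot>\<^bsub>dual_hopf H\<^esub> Q b) \<psi> = dual_apply \<psi> \<one> *\<^sub>C \<one>\<^bsub>dual_hopf H\<^esub>"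
  shows "P \<psi> = Q \<psi>"
proof -
  interpret D: unital_star_algebra "dual_hopf H" by (rule unital_star_algebra_dual)
  let ?D = "dual_hopf H"
  have t: "ctrilinear (\<lambda>a b c. P a \<odot>\<^bsub>?D\<^esub> (\<theta> b \<odot>\<^bsub>?D\<^esub> Q c))"
    by (rule ctrilinearI; rule clinearI; simp add: clinear_simps[OF lin(1)] clinear_simps[OF lin(2)]
        clinear_simps[OF lin(3)] D.unital.amult_simps)
  have "P \<psi> = sweedler2 ?D (\<lambda>a k. dual_apply k \<one> *\<^sub>C P a) \<psi>"
    by (rule dual_sweedler2_counit(2)[OF lin(1), symmetric])
  also have "\<dots> = sweedler2 ?D (\<lambda>a k. P a \<odot>\<^bsub>?D\<^esub> sweedler2 ?D (\<lambda>b c. \<theta> b \<odot>\<^bsub>?D\<^esub> Q c) k) \<psi>"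
    by (simp add: r D.unital.amult_simps D.amult_one_right)
  also have "\<dots> = sweedler2 ?D (\<lambda>a k. sweedler2 ?D (\<lambda>b c. P a \<odot>\<^bsub>?D\<^esub> (\<theta> b \<odot>\<^bsub>?D\<^esub> Q c)) k) \<psi>"
    by (simp only: sweedler2_linear[OF D.unital.clinear_amult_right])
  also have "\<dots> = sweedler2 ?D (\<lambda>k c. sweedler2 ?D (\<lambda>a b. P a \<odot>\<^bsub>?D\<^esub> (\<theta> b \<odot>\<^bsub>?D\<^esub> Q c)) k) \<psi>"
    by (rule dual_sweedler2_coassoc[OF t, symmetric])
  also have "\<dots> = sweedler2 ?D (\<lambda>k c. sweedler2 ?D (\<lambda>a b. P a \<odot>\<^bsub>?D\<^esub> \<theta> b) k \<odot>\<^bsub>?D\<^esub> Q c) \<psi>"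
    by (simp only: D.amult_assoc[symmetric] sweedler2_linear[OF D.unital.clinear_amult_left])
  also have "\<dots> = Q \<psi>"
    by (simp add: l D.unital.amult_simps D.amult_one_left dual_sweedler2_counit(1)[OF lin(3)])
  finally show ?thesis .
qed

lemma dual_antipode_law:
  "sweedler2 (dual_hopf H) (\<lambda>a b. a \<odot>\<^bsub>dual_hopf H\<^esub> antipode (dual_hopf H) b) \<psi> = dual_apply \<psi> \<one> *\<^sub>C \<one>\<^bsub>dual_hopf H\<^esub>"
  "sweedler2 (dual_hopf H) (\<lambda>a b. antipode (dual_hopf H) a \<odot>\<^bsub>dual_hopf H\<^esub> b) \<psi> = dual_apply \<psi> \<one> *\<^sub>C \<one>\<^bsub>dual_hopf H\<^esub>"
proof -
  have *: "sweedler2 H (\<lambda>h l. dual_apply \<psi> (h \<odot> antipode H l)) k = dual_apply \<psi> \<one> * counit H k"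
    "sweedler2 H (\<lambda>h l. dual_apply \<psi> (antipode H h \<odot> l)) k = dual_apply \<psi> \<one> * counit H k" for k
    by (simp_all add: sweedler2_antipode[OF clinear_dual_apply] scaleC_complex_def mult.commute)
  show "sweedler2 (dual_hopf H) (\<lambda>a b. a \<odot>\<^bsub>dual_hopf H\<^esub> antipode (dual_hopf H) b) \<psi> = dual_apply \<psi> \<one> *\<^sub>C \<one>\<^bsub>dual_hopf H\<^esub>"
    by (rule dual_eqI, simp add: sweedler2_linear[OF clinear_eval, symmetric] dual_mult_apply dual_antipode_apply
        dual_one_apply, subst sweedler2_swap, simp add: dual_sweedler2_eval *)
  show "sweedler2 (dual_hopf H) (\<lambda>a b. antipode (dual_hopf H) a \<odot>\<^bsub>dual_hopf H\<^esub> b) \<psi> = dual_apply \<psi> \<one> *\<^sub>C \<one>\<^bsub>dual_hopf H\<^esub>"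
    by (rule dual_eqI, simp add: sweedler2_linear[OF clinear_eval, symmetric] dual_mult_apply dual_antipode_apply
        dual_one_apply, subst sweedler2_swap, simp add: dual_sweedler2_eval *)
qed

lemma clinear_dual_antipode: "clinear (antipode (dual_hopf H))"
  by (rule clinearI; rule dual_eqI; simp add: dual_antipode_apply)

lemma dual_antipode_antipode: "antipode (dual_hopf H) (antipode (dual_hopf H) \<psi>) = \<psi>"
  by (rule dual_eqI) (simp add: dual_antipode_apply antipode_antipode)

lemma dual_antipode_star: "antipode (dual_hopf H) (astar (dual_hopf H) (antipode (dual_hopf H) \<phi>)) = astar (dual_hopf H) \<phi>"
proof (rule dual_eqI)
  fix k
  have "antipode H (astar H k) = astar H (antipode H k)"
    using antipode_star_antipode[of "antipode H k"] by (simp add: antipode_antipode)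
  then show "dual_apply (antipode (dual_hopf H) (astar (dual_hopf H) (antipode (dual_hopf H) \<phi>))) k
    = dual_apply (astar (dual_hopf H) \<phi>) k"
    by (simp add: dual_antipode_apply dual_star_apply antipode_antipode)
qed

lemma finite_dim_dual: "finite_dim TYPE('h dual)"
  unfolding finite_dim_def
proof (intro exI conjI)
  show "finite (dbasis ` fbasis TYPE('h))" using fbasis(1)[OF finite_dim] by simp
  have "\<phi> \<in> cspan (dbasis ` fbasis TYPE('h))" for \<phi> :: "'h dual"
    by (subst dual_expand[OF finite_dim, symmetric]) (intro cvector.span_sum cvector.span_scale cvector.span_base imageI)
  then show "cspan (dbasis ` fbasis TYPE('h)) = UNIV" by blast
qed

end

lemma finite_dim_inj_imp_surj:
  assumes fd: "finite_dim TYPE('v::complex_vector)" and f: "clinear (f :: 'v \<Rightarrow> 'v)" "inj f"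
  shows "surj f"
proof -
  interpret finite_dimensional_vector_space "scaleC :: complex \<Rightarrow> 'v \<Rightarrow> 'v" "fbasis TYPE('v)"
    using fbasis[OF fd] by unfold_locales
  show ?thesis by (rule linear_inj_imp_surj[OF f])
qed

section \<open>Transport of the dual action through the bimodule\<close>

text \<open>The frames can be finite because the inner products over X span A and B algebraically.
  Their members lie in X, so that inner products with elements of X fall into A and B, over which
  the dual actions are linear.\<close>

locale crossed_morita_frame =
  L: twisted_crossed_product H A \<rho> u + R: twisted_crossed_product H B \<sigma> v +
  inclusions_strongly_morita_equivalent "crossed_product H A \<rho> u" "coefficient_algebra H"
    "crossed_product H B \<sigma> v" "coefficient_algebra H" Y X
  for H :: "'h::complex_vector hopf_algebra"
    and A :: "('a::complex_vector, 'm) star_algebra_scheme"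
    and \<rho> :: "'a \<Rightarrow> ('a, 'h dual) tensor"
    and u :: "(('a, 'h dual) tensor, 'h dual) tensor"
    and B :: "('b::complex_vector, 'n) star_algebra_scheme"
    and \<sigma> :: "'b \<Rightarrow> ('b, 'h dual) tensor"
    and v :: "(('b, 'h dual) tensor, 'h dual) tensor"
    and Y :: "(('a, 'h) tensor, ('b, 'h) tensor, 'y::complex_vector) bimodule"
    and X :: "'y set" +
  fixes I :: "'i set" and fx fy :: "'i \<Rightarrow> 'y" and J :: "'j set" and gx gy :: "'j \<Rightarrow> 'y"
  assumes frame_X: "i \<in> I \<Longrightarrow> fx i \<in> X" "i \<in> I \<Longrightarrow> fy i \<in> X" "j \<in> J \<Longrightarrow> gx j \<in> X" "j \<in> J \<Longrightarrow> gy j \<in> X"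
    and left_frame: "(\<Sum>i\<in>I. lip Y (fx i) (fy i)) = \<one>\<^bsub>crossed_product H A \<rho> u\<^esub>"
    and right_frame: "(\<Sum>j\<in>J. rip Y (gx j) (gy j)) = \<one>\<^bsub>crossed_product H B \<sigma> v\<^esub>"
    and trivial_commutant: "relative_commutant (crossed_product H A \<rho> u) (coefficient_algebra H) \<subseteq>
      range (\<lambda>z. z *\<^sub>C \<one>\<^bsub>crossed_product H A \<rho> u\<^esub>)"
begin

abbreviation C where "C \<equiv> crossed_product H A \<rho> u"
abbreviation D where "D \<equiv> crossed_product H B \<sigma> v"
abbreviation K where "K \<equiv> dual_hopf H"

sublocale K: unital_star_algebra K by (rule L.hopf.unital_star_algebra_dual)

lemma XY: "x \<in> X \<Longrightarrow> x \<in> bcarrier Y"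
  using X_subset by blast

lemmas frame_Y = frame_X[THEN XY]

lemma lip_X: "x \<in> X \<Longrightarrow> y \<in> X \<Longrightarrow> \<exists>a. lip Y x y = L.embed a"
  using cvector.span_base[of "lip Y x y" "{lip Y x y |x y. x \<in> X \<and> y \<in> X}"]
  unfolding X_lip_span L.coefficient_algebra_embed by auto

lemma rip_X: "x \<in> X \<Longrightarrow> y \<in> X \<Longrightarrow> \<exists>b. rip Y x y = R.embed b"
  using cvector.span_base[of "rip Y x y" "{rip Y x y |x y. x \<in> X \<and> y \<in> X}"]
  unfolding X_rip_span R.coefficient_algebra_embed by auto

lemma lact_X: "x \<in> X \<Longrightarrow> lact Y (L.embed a) x \<in> X"
  by (rule X_lact) (simp_all add: L.coefficient_algebra_embed)

lemma ract_X: "x \<in> X \<Longrightarrow> ract Y x (R.embed b) \<in> X"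
  by (rule X_ract) (simp_all add: R.coefficient_algebra_embed)

lemma frame_expand:
  assumes "y \<in> bcarrier Y"
  shows "(\<Sum>i\<in>I. ract Y (fx i) (rip Y (fy i) y)) = y"
proof -
  have "(\<Sum>i\<in>I. ract Y (fx i) (rip Y (fy i) y)) = (\<Sum>i\<in>I. lact Y (lip Y (fx i) (fy i)) y)"
    using assms by (intro sum.cong) (auto simp: imprimitivity frame_Y)
  also have "\<dots> = lact Y (\<Sum>i\<in>I. lip Y (fx i) (fy i)) y"
    by (rule clinear_sum[OF clinear_lact_left[OF assms], symmetric])
  finally show ?thesis by (simp add: left_frame lact_one assms)
qed

text \<open>The left frame recovers from the matrix coefficients over X first the action on X and
  then the element of C. All laws for \<open>transport\<close> are read off from coefficients in
  this way.\<close>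

lemma left_eqI:
  assumes "\<And>x y. x \<in> X \<Longrightarrow> y \<in> X \<Longrightarrow> rip Y y (lact Y c x) = rip Y y (lact Y c' x)"
  shows "c = c'"
proof -
  have x: "lact Y c x = lact Y c' x" if "x \<in> X" for x
  proof -
    have "(\<Sum>i\<in>I. ract Y (fx i) (rip Y (fy i) (lact Y c x))) = (\<Sum>i\<in>I. ract Y (fx i) (rip Y (fy i) (lact Y c' x)))"
      by (intro sum.cong HOL.refl) (simp add: assms[OF that] frame_X)
    then show ?thesis by (simp add: frame_expand lact_closed XY that)
  qed
  have "c = (\<Sum>i\<in>I. lip Y (lact Y c (fx i)) (fy i))" for c
  proof -
    have "c = c \<odot>\<^bsub>C\<^esub> (\<Sum>i\<in>I. lip Y (fx i) (fy i))" by (simp add: left_frame L.crossed.amult_one_right)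
    also have "\<dots> = (\<Sum>i\<in>I. lip Y (lact Y c (fx i)) (fy i))"
      unfolding L.crossed.unital.amult_simps by (intro sum.cong) (auto simp: lip_lact frame_Y)
    finally show ?thesis .
  qed
  moreover have "(\<Sum>i\<in>I. lip Y (lact Y c (fx i)) (fy i)) = (\<Sum>i\<in>I. lip Y (lact Y c' (fx i)) (fy i))"
    by (intro sum.cong) (auto simp: x frame_X)
  ultimately show ?thesis by metis
qed

text \<open>Forced by \<open>transport_char\<close>: write c between two copies of the resolution of
  the unit by the left frame, and let \<psi> act on the coefficients of c.\<close>

definition transport :: "'h dual \<Rightarrow> ('a, 'h) tensor \<Rightarrow> ('a, 'h) tensor"
  where "transport \<psi> c = (\<Sum>i\<in>I. \<Sum>j\<in>I.
    lip Y (ract Y (fx j) (dual_act H \<psi> (rip Y (fy j) (lact Y c (fx i))))) (fy i))"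

text \<open>The inner products of x and y with the frame lie in B, and the dual action on D is
  linear over B on both sides, so the frame sums can be drawn inside it and resummed.\<close>

lemma transport_char:
  assumes x: "x \<in> X" and y: "y \<in> X"
  shows "rip Y y (lact Y (transport \<psi> c) x) = dual_act H \<psi> (rip Y y (lact Y c x))"
proof -
  let ?E = "dual_act H \<psi> :: ('b, 'h) tensor \<Rightarrow> _"
  note xY = XY[OF x] and yY = XY[OF y]
  have E: "?E (rip Y y z) \<odot>\<^bsub>D\<^esub> rip Y (fy i) x = ?E (rip Y y (ract Y z (rip Y (fy i) x)))"
    if iz: "i \<in> I" "z \<in> bcarrier Y" for i z
  proof -
    obtain b where "rip Y (fy i) x = R.embed b" using rip_X[OF frame_X(2)[OF iz(1)] x] by blast
    then show ?thesis by (simp add: rip_ract yY iz R.dual_act_embed_right)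
  qed
  have E': "rip Y y (ract Y (fx j) (?E (rip Y (fy j) z))) = ?E (rip Y y (ract Y (fx j) (rip Y (fy j) z)))"
    if jz: "j \<in> I" "z \<in> bcarrier Y" for j z
  proof -
    obtain b where "rip Y y (fx j) = R.embed b" using rip_X[OF y frame_X(1)[OF jz(1)]] by blast
    then show ?thesis by (simp add: rip_ract yY frame_Y jz R.dual_act_embed_left)
  qed
  have "lact Y (transport \<psi> c) x = (\<Sum>i\<in>I. \<Sum>j\<in>I.
      ract Y (ract Y (fx j) (?E (rip Y (fy j) (lact Y c (fx i))))) (rip Y (fy i) x))"
    unfolding transport_def clinear_sum[OF clinear_lact_left[OF xY]]
    by (intro sum.cong) (auto simp: imprimitivity ract_closed frame_Y xY)
  then have "rip Y y (lact Y (transport \<psi> c) x) = (\<Sum>i\<in>I. \<Sum>j\<in>I.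
      rip Y y (ract Y (fx j) (?E (rip Y (fy j) (lact Y c (fx i))))) \<odot>\<^bsub>D\<^esub> rip Y (fy i) x)"
    by (simp add: rip_sum sum_closed ract_closed frame_Y yY rip_ract)
  also have "\<dots> = (\<Sum>i\<in>I. (\<Sum>j\<in>I. ?E (rip Y y (ract Y (fx j) (rip Y (fy j) (lact Y c (fx i)))))) \<odot>\<^bsub>D\<^esub> rip Y (fy i) x)"
    by (simp add: E' lact_closed frame_Y R.crossed.unital.amult_simps)
  also have "\<dots> = (\<Sum>i\<in>I. ?E (rip Y y (lact Y c (fx i))) \<odot>\<^bsub>D\<^esub> rip Y (fy i) x)"
    by (intro sum.cong HOL.refl)
      (simp add: clinear_sum[OF L.hopf.clinear_dual_act, symmetric] rip_sum[symmetric] yY ract_closed frame_Y frame_expand lact_closed)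
  also have "\<dots> = (\<Sum>i\<in>I. ?E (rip Y y (lact Y c (ract Y (fx i) (rip Y (fy i) x)))))"
    by (intro sum.cong HOL.refl) (simp add: E lact_closed frame_Y lact_ract)
  also have "\<dots> = ?E (rip Y y (\<Sum>i\<in>I. lact Y c (ract Y (fx i) (rip Y (fy i) x))))"
    by (simp add: clinear_sum[OF L.hopf.clinear_dual_act] rip_sum yY lact_closed ract_closed frame_Y)
  also have "(\<Sum>i\<in>I. lact Y c (ract Y (fx i) (rip Y (fy i) x))) = (\<Sum>i\<in>I. lact Y (c \<odot>\<^bsub>C\<^esub> lip Y (fx i) (fy i)) x)"
    by (intro sum.cong HOL.refl) (simp add: lact_mult xY imprimitivity frame_Y)
  also have "\<dots> = lact Y c x"
    by (simp add: clinear_sum[OF clinear_lact_left[OF xY], symmetric] L.crossed.unital.amult_simps(12)[symmetric]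
        left_frame L.crossed.amult_one_right)
  finally show ?thesis .
qed

lemma rip_lact_right: "x \<in> bcarrier Y \<Longrightarrow> y \<in> bcarrier Y \<Longrightarrow> rip Y y (lact Y c x) = rip Y (lact Y (astar C c) y) x"
  using rip_lact[of y x "astar C c"] by (simp add: L.crossed.astar_astar)

lemma clinear_transport: "clinear (transport \<psi>)"
  by (rule clinearI; rule left_eqI)
    (simp_all add: transport_char lact_add_left lact_scale_left rip_add rip_scale XY lact_closed scale_closed
      clinear_simps[OF L.hopf.clinear_dual_act])

lemma transport_add: "transport (\<phi> + \<psi>) c = transport \<phi> c + transport \<psi> c"
  and transport_scale: "transport (z *\<^sub>C \<psi>) c = z *\<^sub>C transport \<psi> c"
  by (rule left_eqI, simp add: transport_char lact_add_left lact_scale_left rip_add rip_scale XY lact_closed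
      L.hopf.dual_act_add L.hopf.dual_act_scale)+

lemma transport_embed_left: "transport \<psi> (L.embed a \<odot>\<^bsub>C\<^esub> c) = L.embed a \<odot>\<^bsub>C\<^esub> transport \<psi> c"
  by (rule left_eqI)
    (simp add: transport_char lact_mult XY rip_lact_right[of "lact Y _ _"] lact_closed L.embed_star lact_X)

lemma transport_embed_right: "transport \<psi> (c \<odot>\<^bsub>C\<^esub> L.embed a) = transport \<psi> c \<odot>\<^bsub>C\<^esub> L.embed a"
  by (rule left_eqI) (simp add: transport_char lact_mult XY lact_X)

lemma transport_one: "transport \<one>\<^bsub>K\<^esub> c = c"
  by (rule left_eqI) (simp add: transport_char L.hopf.dual_act_one)

lemma transport_compose: "transport (\<phi> \<odot>\<^bsub>K\<^esub> \<psi>) c = transport \<phi> (transport \<psi> c)"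
  by (rule left_eqI) (simp add: transport_char L.hopf.dual_act_mult)

lemma transport_unit: "transport \<psi> \<one>\<^bsub>C\<^esub> = dual_apply \<psi> \<one>\<^bsub>H\<^esub> *\<^sub>C \<one>\<^bsub>C\<^esub>"
proof (rule left_eqI)
  fix x y assume xy: "x \<in> X" "y \<in> X"
  obtain b where "rip Y y x = R.embed b" using rip_X xy by blast
  then show "rip Y y (lact Y (transport \<psi> \<one>\<^bsub>C\<^esub>) x) = rip Y y (lact Y (dual_apply \<psi> \<one>\<^bsub>H\<^esub> *\<^sub>C \<one>\<^bsub>C\<^esub>) x)"
    using xy by (simp add: transport_char lact_one lact_scale_left rip_scale XY R.dual_act_embed)
qed

lemma transport_star: "transport \<psi> (astar C c) = astar C (transport (antipode K (astar K \<psi>)) c)"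
proof (rule left_eqI)
  fix x y assume xy: "x \<in> X" "y \<in> X"
  have swap: "rip Y y (lact Y (astar C c) x) = astar D (rip Y x (lact Y c y))" for c
    using xy by (simp add: rip_star XY lact_closed rip_lact_right L.crossed.astar_astar)
  show "rip Y y (lact Y (transport \<psi> (astar C c)) x) = rip Y y (lact Y (astar C (transport (antipode K (astar K \<psi>)) c)) x)"
    unfolding swap using xy by (simp add: transport_char swap R.dual_act_star)
qed

text \<open>Inserting the frame between two factors turns a coefficient of a product in C into a sum
  of products of coefficients in D, where \<open>dual_act_product\<close> applies.\<close>

lemma transport_product:
  "transport \<psi> (c \<odot>\<^bsub>C\<^esub> c') = sweedler2 K (\<lambda>\<psi>1 \<psi>2. transport \<psi>1 c \<odot>\<^bsub>C\<^esub> transport \<psi>2 c') \<psi>"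
proof (rule left_eqI)
  fix x y assume xy: "x \<in> X" "y \<in> X"
  note xY = XY[OF xy(1)] and yY = XY[OF xy(2)]
  have insert: "rip Y y (lact Y (d \<odot>\<^bsub>C\<^esub> d') x) = (\<Sum>i\<in>I. rip Y y (lact Y d (fx i)) \<odot>\<^bsub>D\<^esub> rip Y (fy i) (lact Y d' x))"
    for d d'
  proof -
    have "rip Y y (lact Y (d \<odot>\<^bsub>C\<^esub> d') x) = rip Y y (lact Y d (\<Sum>i\<in>I. ract Y (fx i) (rip Y (fy i) (lact Y d' x))))"
      by (simp add: frame_expand lact_closed xY lact_mult)
    also have "\<dots> = rip Y (lact Y (astar C d) y) (\<Sum>i\<in>I. ract Y (fx i) (rip Y (fy i) (lact Y d' x)))"
      by (rule rip_lact_right) (simp_all add: sum_closed ract_closed frame_Y yY)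
    also have "\<dots> = (\<Sum>i\<in>I. rip Y (lact Y (astar C d) y) (fx i) \<odot>\<^bsub>D\<^esub> rip Y (fy i) (lact Y d' x))"
      by (simp add: rip_sum lact_closed ract_closed frame_Y yY rip_ract)
    finally show ?thesis by (simp add: rip_lact_right[symmetric] frame_Y yY)
  qed
  have l: "clinear (\<lambda>c. rip Y y (lact Y c x))"
    by (rule clinearI) (simp_all add: lact_add_left lact_scale_left rip_add rip_scale lact_closed xY yY)
  have "rip Y y (lact Y (sweedler2 K (\<lambda>\<psi>1 \<psi>2. transport \<psi>1 c \<odot>\<^bsub>C\<^esub> transport \<psi>2 c') \<psi>) x)
    = (\<Sum>i\<in>I. sweedler2 K (\<lambda>\<psi>1 \<psi>2. dual_act H \<psi>1 (rip Y y (lact Y c (fx i))) \<odot>\<^bsub>D\<^esub>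
        dual_act H \<psi>2 (rip Y (fy i) (lact Y c' x))) \<psi>)"
    by (simp add: sweedler2_linear[OF l, symmetric] insert sweedler2_sum transport_char xy frame_X)
  also have "\<dots> = dual_act H \<psi> (rip Y y (lact Y (c \<odot>\<^bsub>C\<^esub> c') x))"
    by (simp add: insert R.dual_act_product clinear_sum[OF L.hopf.clinear_dual_act])
  finally show "rip Y y (lact Y (transport \<psi> (c \<odot>\<^bsub>C\<^esub> c')) x)
    = rip Y y (lact Y (sweedler2 K (\<lambda>\<psi>1 \<psi>2. transport \<psi>1 c \<odot>\<^bsub>C\<^esub> transport \<psi>2 c') \<psi>) x)"
    by (simp add: transport_char xy)
qed

lemma transport_faithful:
  assumes one: "\<one>\<^bsub>C\<^esub> \<noteq> 0" and z: "\<And>c. transport \<psi> c = 0"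
  shows "\<psi> = 0"
proof (rule R.dual_act_faithful)
  \<comment> \<open>A zero unit in B would make Y zero, and the left frame would then give a zero
    unit in C.\<close>
  show "\<one>\<^bsub>B\<^esub> \<noteq> 0"
  proof
    assume "\<one>\<^bsub>B\<^esub> = 0"
    then have D1: "\<one>\<^bsub>D\<^esub> = 0" by (simp add: R.crossed_one pure_tensor_simps)
    have Y0: "y = 0" if "y \<in> bcarrier Y" for y
      using ract_one[OF that] clinear_zero[OF clinear_ract_right[OF that]] by (simp add: D1)
    then have "lip Y (fx i) (fy i) = 0" if "i \<in> I" for i
      using Y0[OF frame_Y(1)[OF that]] Y0[OF frame_Y(2)[OF that]] lip_scale[of 0 0 0] zero_closed by simp
    then show False using left_frame one by simp
  qed
  \<comment> \<open>The right frame writes y as a sum of elements of C acting on elements of X, to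
    which \<open>transport_char\<close> applies.\<close>
  have E0: "dual_act H \<psi> (rip Y x y) = 0" if x: "x \<in> X" and y: "y \<in> bcarrier Y" for x y
  proof -
    have "y = ract Y y (\<Sum>j\<in>J. rip Y (gx j) (gy j))" by (simp add: right_frame ract_one y)
    also have "\<dots> = (\<Sum>j\<in>J. ract Y y (rip Y (gx j) (gy j)))" by (rule clinear_sum[OF clinear_ract_right[OF y]])
    also have "\<dots> = (\<Sum>j\<in>J. lact Y (lip Y y (gx j)) (gy j))"
      by (intro sum.cong) (auto simp: imprimitivity y frame_Y)
    finally have "rip Y x y = (\<Sum>j\<in>J. rip Y x (lact Y (lip Y y (gx j)) (gy j)))"
      using rip_sum[OF XY[OF x], of J "\<lambda>j. lact Y (lip Y y (gx j)) (gy j)"] by (simp add: lact_closed frame_Y)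
    moreover have "dual_act H \<psi> (rip Y x (lact Y (lip Y y (gx j)) (gy j))) = 0" if "j \<in> J" for j
      using transport_char[OF frame_X(4)[OF that] x, of \<psi> "lip Y y (gx j)"] z that
        clinear_zero[OF clinear_lact_left[OF frame_Y(4)[OF that]]] rip_zero[OF XY[OF x]]
      by simp
    ultimately show ?thesis by (simp add: clinear_sum[OF L.hopf.clinear_dual_act])
  qed
  \<comment> \<open>The spanning hypothesis has the element of X on the right, while
    \<open>E0\<close> has it on the left; the involution exchanges the two.\<close>
  define S where "S = {d :: ('b, 'h) tensor. dual_act H \<psi> (astar D d) = 0}"
  have "csubspace S"
    unfolding S_def
    by (rule cvector.subspaceI)
      (simp_all add: R.crossed.astar_simps clinear_simps[OF L.hopf.clinear_dual_act])
  moreover have "{rip Y y x |y x. y \<in> bcarrier Y \<and> x \<in> X} \<subseteq> S"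
    unfolding S_def by (auto simp: rip_star XY E0)
  ultimately have "S = UNIV"
    using cvector.span_minimal[of "{rip Y y x |y x. y \<in> bcarrier Y \<and> x \<in> X}" S] YX_rip_span by auto
  then have "dual_act H \<psi> (astar D d) = 0" for d :: "('b, 'h) tensor" by (auto simp: S_def)
  then show "dual_act H \<psi> d = 0" for d :: "('b, 'h) tensor"
    using R.crossed.astar_astar[of d] by metis
qed

end

lemma tensor_map_right_mult:
  assumes A: "unital_algebra A" and A': "unital_algebra A'" and K: "unital_algebra K" and f: "clinear f"
  shows "tensor_map f id (s \<odot>\<^bsub>tensor_algebra A K\<^esub> (\<one>\<^bsub>A\<^esub> \<otimes>\<^sub>t k)) = tensor_map f id s \<odot>\<^bsub>tensor_algebra A' K\<^esub> (\<one>\<^bsub>A'\<^esub> \<otimes>\<^sub>t k)"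
  by (induction s rule: tensor_induct)
    (simp_all add: f tensor_algebra_mult[OF A K] tensor_algebra_mult[OF A' K] clinear_simps[OF clinear_tensor_map]
      cbilinear_simps[OF tensor_algebra_mult(2)[OF A K]] cbilinear_simps[OF tensor_algebra_mult(2)[OF A' K]]
      unital_algebra.amult_one_right[OF A] unital_algebra.amult_one_right[OF A'])

lemma tensor_map_sweedler_product:
  assumes A: "unital_algebra A" and K: "unital_algebra K" and f: "\<And>\<psi>. clinear (f \<psi>)"
    and prod: "\<And>c c'. f \<psi> (c \<odot>\<^bsub>A\<^esub> c') = sweedler2 H (\<lambda>\<psi>1 \<psi>2. f \<psi>1 c \<odot>\<^bsub>A\<^esub> f \<psi>2 c') \<psi>"
  shows "tensor_map (f \<psi>) id (s \<odot>\<^bsub>tensor_algebra A K\<^esub> t) =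
    sweedler2 H (\<lambda>\<psi>1 \<psi>2. tensor_map (f \<psi>1) id s \<odot>\<^bsub>tensor_algebra A K\<^esub> tensor_map (f \<psi>2) id t) \<psi>"
proof -
  note m = tensor_algebra_mult[OF A K] cbilinear_simps[OF tensor_algebra_mult(2)[OF A K]]
    clinear_simps[OF clinear_tensor_map] f sweedler2_add
  show ?thesis
  proof (induction s rule: tensor_induct)
    case (pure a k)
    show ?case
    proof (induction t rule: tensor_induct)
      case p: (pure b l)
      show ?case by (simp add: m(1) f prod sweedler2_linear[OF pure_tensor_left])
    qed (simp add: m)
  qed (simp add: m)
qed

lemma exists_linear_functional:
  assumes "e \<noteq> (0 :: 'v::complex_vector)"
  shows "\<exists>\<tau> :: 'v \<Rightarrow> complex. clinear \<tau> \<and> \<tau> e = 1"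
proof -
  interpret vector_space_pair "scaleC :: complex \<Rightarrow> 'v \<Rightarrow> 'v" "scaleC :: complex \<Rightarrow> complex \<Rightarrow> complex"
    by unfold_locales
  have "cvector.independent {e}" using assms by simp
  from linear_independent_extend[OF this, of "\<lambda>_. 1"] show ?thesis by blast
qed

section \<open>The automorphism given by the transported action\<close>

context crossed_morita_frame
begin

abbreviation V where "V \<equiv> L.V"

abbreviation transport1 where "transport1 \<psi> \<equiv> tensor_map (transport \<psi>) (id :: 'h dual \<Rightarrow> 'h dual)"

abbreviation transport2 where "transport2 \<psi> \<equiv> tensor_map (transport1 \<psi>) (id :: 'h dual \<Rightarrow> 'h dual)"

lemmas unital_C = L.crossed.unital.unital_algebra_axioms
lemmas unital_K = K.unital.unital_algebra_axioms
lemmas unital_C1 = L.C1.unital.unital_algebra_axioms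

lemma clinear_transport1: "clinear (transport1 \<psi>)"
  by (rule clinear_tensor_map) (simp_all add: clinear_transport)

lemma transport1_embed1: "transport1 \<psi> (L.embed1 s \<odot>\<^bsub>coef1 H C\<^esub> t) = L.embed1 s \<odot>\<^bsub>coef1 H C\<^esub> transport1 \<psi> t"
  by (rule ev_eqI[OF L.hopf.finite_dim])
    (simp add: ev_tensor_map clinear_transport L.hopf.ev_mult[OF unital_C] L.ev_embed1
      sweedler2_linear[OF clinear_transport, symmetric] transport_embed_left)

lemma transport1_leg12:
  "transport1 \<psi> (t \<odot>\<^bsub>coef1 H C\<^esub> leg12 H (L.embed a)) = transport1 \<psi> t \<odot>\<^bsub>coef1 H C\<^esub> leg12 H (L.embed a)"
  by (rule ev_eqI[OF L.hopf.finite_dim])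
    (simp add: ev_tensor_map clinear_transport L.hopf.ev_leg12_mult[OF unital_C] transport_embed_right)

lemma transport1_scalar:
  "transport1 \<psi> (s \<odot>\<^bsub>coef1 H C\<^esub> (\<one>\<^bsub>C\<^esub> \<otimes>\<^sub>t \<phi>)) = transport1 \<psi> s \<odot>\<^bsub>coef1 H C\<^esub> (\<one>\<^bsub>C\<^esub> \<otimes>\<^sub>t \<phi>)"
  by (rule tensor_map_right_mult[OF unital_C unital_C unital_K clinear_transport])

lemma transport1_star:
  "transport1 \<psi> (astar (coef1 H C) t) = astar (coef1 H C) (transport1 (antipode K (astar K \<psi>)) t)"
proof (induction t rule: tensor_induct)
  case (pure c k)
  show ?case
    by (simp add: tensor_algebra_star[OF L.crossed.unital_star_algebra_axioms K.unital_star_algebra_axioms]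
        clinear_transport transport_star)
next
  case (add s t)
  then show ?case by (simp only: L.C1.astar_add clinear_add[OF clinear_transport1])
qed

lemma transport1_product:
  "transport1 \<psi> (s \<odot>\<^bsub>coef1 H C\<^esub> t) = sweedler2 K (\<lambda>a b. transport1 a s \<odot>\<^bsub>coef1 H C\<^esub> transport1 b t) \<psi>"
  by (rule tensor_map_sweedler_product[OF unital_C unital_K clinear_transport transport_product])

lemma transport2_product:
  "transport2 \<psi> (s \<odot>\<^bsub>coef2 H C\<^esub> t) = sweedler2 K (\<lambda>a b. transport2 a s \<odot>\<^bsub>coef2 H C\<^esub> transport2 b t) \<psi>"
  by (rule tensor_map_sweedler_product[OF unital_C1 unital_K clinear_transport1 transport1_product])

lemma transport2_embed2: "transport2 \<psi> (L.embed2 s \<odot>\<^bsub>coef2 H C\<^esub> t) = L.embed2 s \<odot>\<^bsub>coef2 H C\<^esub> transport2 \<psi> t"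
  by (rule ev_eqI[OF L.hopf.finite_dim])
    (simp add: ev_tensor_map clinear_transport1 L.hopf.ev_mult[OF unital_C1] L.ev_embed2
      sweedler2_linear[OF clinear_transport1, symmetric] transport1_embed1)

lemma transport2_leg12: "transport2 \<psi> (leg12 H t) = leg12 H (transport1 \<psi> t)"
  by (simp add: leg12_def clinear_transport1)

lemma transport2_leg13: "transport2 \<psi> (leg13 H t) = leg13 H (transport1 \<psi> t)"
  unfolding leg13_def
  by (simp add: tensor_map_compose clinear_transport clinear_transport1 clinear_leg12)
    (simp add: leg12_def clinear_transport)

lemma transport2_comult_last: "transport2 \<psi> (comult_last H t) = comult_last H (transport1 \<psi> t)"
  by (rule L.hopf.ev2_eqI) (simp add: ev_tensor_map clinear_transport clinear_transport1 L.hopf.ev_comult_last)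

lemma V_cancel: "V \<odot>\<^bsub>coef1 H C\<^esub> s = V \<odot>\<^bsub>coef1 H C\<^esub> t \<Longrightarrow> s = t"
  by (metis L.C1.amult_assoc L.C1.amult_one_left L.V_isometry)

text \<open>The action is linear over A, so its value on V has the same commutation relation with a
  and \<rho>(a) as V itself; in the product with the adjoint of V the two occurrences of \<rho>(a)
  meet and disappear.\<close>

lemma V_star_transport_commutes:
  "leg12 H (L.embed a) \<odot>\<^bsub>coef1 H C\<^esub> (astar (coef1 H C) V \<odot>\<^bsub>coef1 H C\<^esub> transport1 \<psi> V) =
    astar (coef1 H C) V \<odot>\<^bsub>coef1 H C\<^esub> transport1 \<psi> V \<odot>\<^bsub>coef1 H C\<^esub> leg12 H (L.embed a)"
proof -
  have "astar (coef1 H C) V \<odot>\<^bsub>coef1 H C\<^esub> transport1 \<psi> V \<odot>\<^bsub>coef1 H C\<^esub> leg12 H (L.embed a)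
    = astar (coef1 H C) V \<odot>\<^bsub>coef1 H C\<^esub> transport1 \<psi> (L.embed1 (\<rho> a) \<odot>\<^bsub>coef1 H C\<^esub> V)"
    by (simp add: L.C1.amult_assoc transport1_leg12[symmetric] L.V_embed)
  also have "\<dots> = (astar (coef1 H C) V \<odot>\<^bsub>coef1 H C\<^esub> L.embed1 (\<rho> a)) \<odot>\<^bsub>coef1 H C\<^esub> transport1 \<psi> V"
    by (simp add: transport1_embed1 L.C1.amult_assoc)
  finally show ?thesis by (simp add: L.V_star_embed[symmetric] L.C1.amult_assoc)
qed

lemma transport_V:
  assumes one: "\<one>\<^bsub>C\<^esub> \<noteq> 0"
  obtains \<theta> where "clinear \<theta>" "\<And>\<psi>. transport1 \<psi> V = V \<odot>\<^bsub>coef1 H C\<^esub> (\<one>\<^bsub>C\<^esub> \<otimes>\<^sub>t \<theta> \<psi>)"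
proof -
  define t where "t \<psi> = astar (coef1 H C) V \<odot>\<^bsub>coef1 H C\<^esub> transport1 \<psi> V" for \<psi>
  have tl: "clinear t"
  proof (rule clinearI)
    have "transport (\<phi> + \<psi>) = (\<lambda>c. transport \<phi> c + transport \<psi> c)" for \<phi> \<psi>
      by (rule ext) (rule transport_add)
    then show "t (\<phi> + \<psi>) = t \<phi> + t \<psi>" for \<phi> \<psi>
      by (simp add: t_def tensor_map_fun_left L.C1.unital.amult_simps)
    have "transport (z *\<^sub>C \<psi>) = (\<lambda>c. z *\<^sub>C transport \<psi> c)" for z \<psi>
      by (rule ext) (rule transport_scale)
    then show "t (z *\<^sub>C \<psi>) = z *\<^sub>C t \<psi>" for z \<psi>
      by (simp add: t_def tensor_map_fun_left L.C1.unital.amult_simps)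
  qed
  have scalar: "\<exists>z. ev h (t \<psi>) = z *\<^sub>C \<one>\<^bsub>C\<^esub>" for h \<psi>
  proof -
    have "L.embed a \<odot>\<^bsub>C\<^esub> ev h (t \<psi>) = ev h (t \<psi>) \<odot>\<^bsub>C\<^esub> L.embed a" for a
      using arg_cong[OF V_star_transport_commutes[of a \<psi>], of "ev h"]
      by (simp add: L.hopf.ev_leg12_mult[OF unital_C] t_def)
    then have "ev h (t \<psi>) \<in> relative_commutant C (coefficient_algebra H)"
      by (auto simp: relative_commutant_def L.coefficient_algebra_embed)
    then show ?thesis using trivial_commutant by blast
  qed
  \<comment> \<open>A functional with value 1 at the unit reads z off from z 1.\<close>
  obtain \<tau> :: "('a, 'h) tensor \<Rightarrow> complex" where \<tau>: "clinear \<tau>" "\<tau> \<one>\<^bsub>C\<^esub> = 1"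
    using exists_linear_functional[OF one] by blast
  define \<theta> where "\<theta> \<psi> = Abs_dual (\<lambda>h. \<tau> (ev h (t \<psi>)))" for \<psi>
  have app: "dual_apply (\<theta> \<psi>) h = \<tau> (ev h (t \<psi>))" for \<psi> h
    unfolding \<theta>_def by (simp add: dual_apply_Abs clinear_compose[OF \<tau>(1) clinear_ev_arg])
  have "t \<psi> = \<one>\<^bsub>C\<^esub> \<otimes>\<^sub>t \<theta> \<psi>" for \<psi>
  proof (rule ev_eqI[OF L.hopf.finite_dim])
    fix h
    show "ev h (t \<psi>) = ev h (\<one>\<^bsub>C\<^esub> \<otimes>\<^sub>t \<theta> \<psi>)"
      using scalar[of h \<psi>] by (auto simp: ev_pure app clinear_simps[OF \<tau>(1)] \<tau>(2) scaleC_complex_def)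
  qed
  then have "transport1 \<psi> V = V \<odot>\<^bsub>coef1 H C\<^esub> (\<one>\<^bsub>C\<^esub> \<otimes>\<^sub>t \<theta> \<psi>)" for \<psi>
    by (metis t_def L.C1.amult_assoc L.C1.amult_one_left L.V_coisometry)
  moreover have "clinear \<theta>"
    by (rule clinearI; rule dual_eqI)
      (simp_all add: app clinear_simps[OF tl] clinear_simps[OF clinear_ev] clinear_simps[OF \<tau>(1)] scaleC_complex_def)
  ultimately show thesis using that by blast
qed

lemma exists_automorphism_nontrivial:
  assumes one: "\<one>\<^bsub>C\<^esub> \<noteq> 0"
  shows "\<exists>\<theta>. cstar_hopf_automorphism K \<theta> \<and> (\<forall>\<psi>. transport1 \<psi> V = V \<odot>\<^bsub>coef1 H C\<^esub> (\<one>\<^bsub>C\<^esub> \<otimes>\<^sub>t \<theta> \<psi>))"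
proof -
  obtain \<theta> where \<theta>: "clinear \<theta>" "\<And>\<psi>. transport1 \<psi> V = V \<odot>\<^bsub>coef1 H C\<^esub> (\<one>\<^bsub>C\<^esub> \<otimes>\<^sub>t \<theta> \<psi>)"
    by (rule transport_V[OF one]) blast
  let ?J = "\<lambda>\<phi>. \<one>\<^bsub>C\<^esub> \<otimes>\<^sub>t \<phi> :: (('a, 'h) tensor, 'h dual) tensor"
  let ?V = "astar (coef1 H C) V"
  note st = tensor_algebra_star[OF L.crossed.unital_star_algebra_axioms K.unital_star_algebra_axioms]
  note mu = tensor_algebra_mult[OF unital_C unital_K]
  have Jinj: "\<phi> = \<psi>" if "?J \<phi> = ?J \<psi>" for \<phi> \<psi>
  proof (rule dual_eqI)
    fix h
    have "ev h (?J \<phi>) = ev h (?J \<psi>)" using that by simp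
    then show "dual_apply \<phi> h = dual_apply \<psi> h" using one by (simp add: ev_pure)
  qed
  have Jm: "?J \<phi> \<odot>\<^bsub>coef1 H C\<^esub> ?J \<psi> = ?J (\<phi> \<odot>\<^bsub>K\<^esub> \<psi>)" for \<phi> \<psi>
    by (simp add: mu L.crossed.amult_one_left)
  have J1: "?J \<one>\<^bsub>K\<^esub> = \<one>\<^bsub>coef1 H C\<^esub>" by (simp add: tensor_algebra_one)
  \<comment> \<open>Composition of actions multiplies the constants on the right of V, and V can be
    cancelled.\<close>
  have mult: "\<theta> (\<phi> \<odot>\<^bsub>K\<^esub> \<psi>) = \<theta> \<phi> \<odot>\<^bsub>K\<^esub> \<theta> \<psi>" for \<phi> \<psi>
  proof (rule Jinj, rule V_cancel)
    have "transport1 (\<phi> \<odot>\<^bsub>K\<^esub> \<psi>) V = transport1 \<phi> (transport1 \<psi> V)"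
      by (simp add: tensor_map_compose clinear_transport transport_compose[abs_def] id_def)
    then show "V \<odot>\<^bsub>coef1 H C\<^esub> ?J (\<theta> (\<phi> \<odot>\<^bsub>K\<^esub> \<psi>)) = V \<odot>\<^bsub>coef1 H C\<^esub> ?J (\<theta> \<phi> \<odot>\<^bsub>K\<^esub> \<theta> \<psi>)"
      by (simp add: \<theta>(2)[symmetric] Jm[symmetric] L.C1.amult_assoc[symmetric] transport1_scalar[symmetric])
  qed
  have unit: "\<theta> \<one>\<^bsub>K\<^esub> = \<one>\<^bsub>K\<^esub>"
  proof (rule Jinj, rule V_cancel)
    have "transport1 \<one>\<^bsub>K\<^esub> V = V"
      by (simp add: transport_one[abs_def] flip: id_def)
    then show "V \<odot>\<^bsub>coef1 H C\<^esub> ?J (\<theta> \<one>\<^bsub>K\<^esub>) = V \<odot>\<^bsub>coef1 H C\<^esub> ?J \<one>\<^bsub>K\<^esub>"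
      by (simp add: \<theta>(2)[symmetric] J1 L.C1.amult_one_right)
  qed
  \<comment> \<open>Evaluate at 1: there V has the coefficient 1, on which the action is
    multiplication by the counit of H^0.\<close>
  have counit: "dual_apply (\<theta> \<psi>) \<one>\<^bsub>H\<^esub> = dual_apply \<psi> \<one>\<^bsub>H\<^esub>" for \<psi>
  proof -
    have "ev \<one>\<^bsub>H\<^esub> (V \<odot>\<^bsub>coef1 H C\<^esub> ?J (\<theta> \<psi>)) = dual_apply (\<theta> \<psi>) \<one>\<^bsub>H\<^esub> *\<^sub>C \<one>\<^bsub>C\<^esub>"
    proof -
      have "cbilinear (\<lambda>a b. ev a V \<odot>\<^bsub>C\<^esub> ev b (?J (\<theta> \<psi>)))"
        by (rule cbilinear_compose(1)[OF L.crossed.unital.cbilinear_amult clinear_ev_arg clinear_ev_arg])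
      from L.hopf.sweedler2_one[OF this] show ?thesis
        by (simp add: L.hopf.ev_mult[OF unital_C] L.ev_V L.gen_one ev_pure L.crossed.unital.amult_simps
            L.crossed.amult_one_right)
    qed
    moreover have "ev \<one>\<^bsub>H\<^esub> (transport1 \<psi> V) = dual_apply \<psi> \<one>\<^bsub>H\<^esub> *\<^sub>C \<one>\<^bsub>C\<^esub>"
      by (simp add: ev_tensor_map clinear_transport L.ev_V L.gen_one transport_unit)
    ultimately show ?thesis using one \<theta>(2)[of \<psi>] by simp
  qed
  \<comment> \<open>The action on V_12 V_13 is computed in two ways: leg by leg, which splits
    \<psi>, and on u (id \<otimes> \<Delta>^0)(V), which puts the coproduct of H^0 on
    \<theta>(\<psi>).\<close>
  have comult_eval: "dual_apply (\<theta> \<psi>) (h \<odot>\<^bsub>H\<^esub> l) = sweedler2 K (\<lambda>a b. dual_apply (\<theta> a) h * dual_apply (\<theta> b) l) \<psi>" for \<psi> h l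
  proof -
    let ?V12 = "leg12 H V" and ?V13 = "leg13 H V"
    have com: "leg12 H (?J \<phi>) \<odot>\<^bsub>coef2 H C\<^esub> leg13 H s = leg13 H s \<odot>\<^bsub>coef2 H C\<^esub> leg12 H (?J \<phi>)" for \<phi> s
      by (rule L.hopf.ev2_eqI) (simp add: L.hopf.ev_legs[OF unital_C] ev_pure L.crossed.unital.amult_simps
          L.crossed.amult_one_left L.crossed.amult_one_right)
    have VV: "leg12 H (V \<odot>\<^bsub>coef1 H C\<^esub> ?J \<phi>) \<odot>\<^bsub>coef2 H C\<^esub> leg13 H (V \<odot>\<^bsub>coef1 H C\<^esub> ?J \<phi>')
      = (?V12 \<odot>\<^bsub>coef2 H C\<^esub> ?V13) \<odot>\<^bsub>coef2 H C\<^esub> (leg12 H (?J \<phi>) \<odot>\<^bsub>coef2 H C\<^esub> leg13 H (?J \<phi>'))" for \<phi> \<phi>'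
    proof -
      have "leg12 H (V \<odot>\<^bsub>coef1 H C\<^esub> ?J \<phi>) \<odot>\<^bsub>coef2 H C\<^esub> leg13 H (V \<odot>\<^bsub>coef1 H C\<^esub> ?J \<phi>')
        = ?V12 \<odot>\<^bsub>coef2 H C\<^esub> ((leg12 H (?J \<phi>) \<odot>\<^bsub>coef2 H C\<^esub> ?V13) \<odot>\<^bsub>coef2 H C\<^esub> leg13 H (?J \<phi>'))"
        by (simp add: L.hopf.leg12_mult[OF unital_C1] L.hopf.leg13_mult[OF unital_C unital_K] L.C2.amult_assoc)
      then show ?thesis by (simp only: com L.C2.amult_assoc)
    qed
    have "(?V12 \<odot>\<^bsub>coef2 H C\<^esub> ?V13) \<odot>\<^bsub>coef2 H C\<^esub> sweedler2 K (\<lambda>a b. leg12 H (?J (\<theta> a)) \<odot>\<^bsub>coef2 H C\<^esub> leg13 H (?J (\<theta> b))) \<psi>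
      = transport2 \<psi> (?V12 \<odot>\<^bsub>coef2 H C\<^esub> ?V13)"
      by (simp add: transport2_product transport2_leg12 transport2_leg13 \<theta>(2) VV
          sweedler2_linear[OF L.C2.unital.clinear_amult_right])
    also have "\<dots> = (?V12 \<odot>\<^bsub>coef2 H C\<^esub> ?V13) \<odot>\<^bsub>coef2 H C\<^esub> comult_last H (?J (\<theta> \<psi>))"
      by (simp add: L.V_V transport2_embed2 transport2_comult_last \<theta>(2) L.hopf.comult_last_mult[OF unital_C] L.C2.amult_assoc)
    finally have "(leg13 H ?V \<odot>\<^bsub>coef2 H C\<^esub> leg12 H ?V) \<odot>\<^bsub>coef2 H C\<^esub> ((?V12 \<odot>\<^bsub>coef2 H C\<^esub> ?V13) \<odot>\<^bsub>coef2 H C\<^esub>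
        sweedler2 K (\<lambda>a b. leg12 H (?J (\<theta> a)) \<odot>\<^bsub>coef2 H C\<^esub> leg13 H (?J (\<theta> b))) \<psi>)
      = (leg13 H ?V \<odot>\<^bsub>coef2 H C\<^esub> leg12 H ?V) \<odot>\<^bsub>coef2 H C\<^esub> ((?V12 \<odot>\<^bsub>coef2 H C\<^esub> ?V13) \<odot>\<^bsub>coef2 H C\<^esub> comult_last H (?J (\<theta> \<psi>)))"
      by simp
    \<comment> \<open>The legs of the adjoint of V in reverse order form a left inverse of V_12
      V_13.\<close>
    moreover have "(leg13 H ?V \<odot>\<^bsub>coef2 H C\<^esub> leg12 H ?V) \<odot>\<^bsub>coef2 H C\<^esub> ((?V12 \<odot>\<^bsub>coef2 H C\<^esub> ?V13) \<odot>\<^bsub>coef2 H C\<^esub> x) = x" for x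
    proof -
      have "(leg13 H ?V \<odot>\<^bsub>coef2 H C\<^esub> leg12 H ?V) \<odot>\<^bsub>coef2 H C\<^esub> ((?V12 \<odot>\<^bsub>coef2 H C\<^esub> ?V13) \<odot>\<^bsub>coef2 H C\<^esub> x)
        = leg13 H ?V \<odot>\<^bsub>coef2 H C\<^esub> (leg12 H (?V \<odot>\<^bsub>coef1 H C\<^esub> V) \<odot>\<^bsub>coef2 H C\<^esub> (?V13 \<odot>\<^bsub>coef2 H C\<^esub> x))"
        by (simp add: L.hopf.leg12_mult[OF unital_C1] L.C2.amult_assoc)
      also have "\<dots> = leg13 H (?V \<odot>\<^bsub>coef1 H C\<^esub> V) \<odot>\<^bsub>coef2 H C\<^esub> x"
        by (simp only: L.V_isometry L.hopf.leg12_one L.C2.amult_one_left)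
          (simp only: L.V_isometry[symmetric] L.hopf.leg13_mult[OF unital_C unital_K] L.C2.amult_assoc)
      finally show ?thesis by (simp add: L.V_isometry L.hopf.leg13_one L.C2.amult_one_left)
    qed
    ultimately have "sweedler2 K (\<lambda>a b. leg12 H (?J (\<theta> a)) \<odot>\<^bsub>coef2 H C\<^esub> leg13 H (?J (\<theta> b))) \<psi> = comult_last H (?J (\<theta> \<psi>))"
      by simp
    from arg_cong[OF this, of "\<lambda>s. ev h (ev l s)"]
    have "sweedler2 K (\<lambda>a b. (dual_apply (\<theta> a) h * dual_apply (\<theta> b) l) *\<^sub>C \<one>\<^bsub>C\<^esub>) \<psi> = dual_apply (\<theta> \<psi>) (h \<odot>\<^bsub>H\<^esub> l) *\<^sub>C \<one>\<^bsub>C\<^esub>"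
      by (simp add: sweedler2_linear[OF clinear_ev, symmetric] L.hopf.ev_legs[OF unital_C] ev_pure L.hopf.ev_comult_last
          L.crossed.unital.amult_simps L.crossed.amult_one_left mult.commute)
    then show ?thesis using one by (simp add: sweedler2_linear[OF clinear_scaleC_left])
  qed
  have comult: "comult K (\<theta> \<psi>) = tensor_map \<theta> \<theta> (comult K \<psi>)" for \<psi>
  proof (rule L.hopf.dual_tensor_eqI)
    fix h l
    have b: "cbilinear (\<lambda>a b. dual_apply (\<theta> a) h * dual_apply (\<theta> b) l)"
      by (rule cbilinear_compose(1)[OF clinear_complex_mult];
          rule clinear_compose[OF clinear_eval \<theta>(1)])
    have "dual_apply (ev l (tensor_map \<theta> \<theta> t)) h = tensor_lift (\<lambda>a b. dual_apply (\<theta> a) h * dual_apply (\<theta> b) l) t" for t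
      by (rule tensor_eqI[of "\<lambda>t. dual_apply (ev l (tensor_map \<theta> \<theta> t)) h"])
        (simp_all add: clinear_compose[OF clinear_eval clinear_compose[OF clinear_ev clinear_tensor_map[OF \<theta>(1) \<theta>(1)]]]
          clinear_tensor_lift b \<theta>(1) ev_pure mult.commute)
    then show "dual_apply (ev l (comult K (\<theta> \<psi>))) h = dual_apply (ev l (tensor_map \<theta> \<theta> (comult K \<psi>))) h"
      by (simp add: L.hopf.dual_comult comult_eval sweedler2_def)
  qed
  have right_inv: "sweedler2 K (\<lambda>a b. \<theta> a \<odot>\<^bsub>K\<^esub> \<theta> (antipode K b)) \<psi> = dual_apply \<psi> \<one>\<^bsub>H\<^esub> *\<^sub>C \<one>\<^bsub>K\<^esub>" for \<psi>
    by (simp add: mult[symmetric] sweedler2_linear[OF \<theta>(1)] L.hopf.dual_antipode_law clinear_simps[OF \<theta>(1)] unit)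
  have lin_right: "clinear (\<lambda>\<psi>. \<theta> (antipode K \<psi>))"
    by (rule clinear_compose[OF \<theta>(1) L.hopf.clinear_dual_antipode])
  \<comment> \<open>Since \<theta> respects product and coproduct, S \<theta> is a left and \<theta>
    S a right convolution inverse of \<theta>.\<close>
  have antipode: "antipode K (\<theta> \<psi>) = \<theta> (antipode K \<psi>)" for \<psi>
  proof (rule L.hopf.dual_convolution_inverse_unique[OF _ \<theta>(1) lin_right _ right_inv])
    show "clinear (\<lambda>\<psi>. antipode K (\<theta> \<psi>))"
      by (rule clinear_compose[OF L.hopf.clinear_dual_antipode \<theta>(1)])
    have b: "cbilinear (\<lambda>a b. antipode K a \<odot>\<^bsub>K\<^esub> b)"
      by (rule cbilinear_compose(1)[OF K.unital.cbilinear_amult L.hopf.clinear_dual_antipode clinear_id(2)])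
    have b': "cbilinear (\<lambda>a b. antipode K (\<theta> a) \<odot>\<^bsub>K\<^esub> \<theta> b)"
      by (rule cbilinear_compose(1)[OF b \<theta>(1) \<theta>(1)])
    have "tensor_lift (\<lambda>a b. antipode K a \<odot>\<^bsub>K\<^esub> b) (tensor_map \<theta> \<theta> t) = tensor_lift (\<lambda>a b. antipode K (\<theta> a) \<odot>\<^bsub>K\<^esub> \<theta> b) t" for t
      by (rule tensor_eqI[of "\<lambda>t. tensor_lift (\<lambda>a b. antipode K a \<odot>\<^bsub>K\<^esub> b) (tensor_map \<theta> \<theta> t)"])
        (simp_all add: clinear_compose[OF clinear_tensor_lift[OF b] clinear_tensor_map[OF \<theta>(1) \<theta>(1)]]
          clinear_tensor_lift b b' \<theta>(1))
    then show "sweedler2 K (\<lambda>a b. antipode K (\<theta> a) \<odot>\<^bsub>K\<^esub> \<theta> b) \<psi> = dual_apply \<psi> \<one>\<^bsub>H\<^esub> *\<^sub>C \<one>\<^bsub>K\<^esub>" for \<psi>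
      using L.hopf.dual_antipode_law(2)[of "\<theta> \<psi>"] by (simp add: sweedler2_def comult counit)
  qed
  \<comment> \<open>Acting on V* V = 1 makes the map on the left another left convolution inverse of
    \<theta>, so it agrees with the right inverse \<theta> S.\<close>
  have star_eq: "astar K (\<theta> (antipode K (astar K \<psi>))) = \<theta> (antipode K \<psi>)" for \<psi>
  proof (rule L.hopf.dual_convolution_inverse_unique[OF _ \<theta>(1) lin_right _ right_inv])
    show "clinear (\<lambda>\<psi>. astar K (\<theta> (antipode K (astar K \<psi>))))"
      by (rule clinearI) (simp_all add: K.astar_simps clinear_simps[OF \<theta>(1)] clinear_simps[OF L.hopf.clinear_dual_antipode])
    fix \<psi>
    have "transport1 \<psi> (?V \<odot>\<^bsub>coef1 H C\<^esub> V)
      = sweedler2 K (\<lambda>a b. ?J (astar K (\<theta> (antipode K (astar K a)))) \<odot>\<^bsub>coef1 H C\<^esub> (?V \<odot>\<^bsub>coef1 H C\<^esub> (V \<odot>\<^bsub>coef1 H C\<^esub> ?J (\<theta> b)))) \<psi>"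
      by (simp add: transport1_product transport1_star \<theta>(2) L.C1.astar_mult st L.crossed.astar_one L.C1.amult_assoc)
    also have "\<dots> = sweedler2 K (\<lambda>a b. ?J (astar K (\<theta> (antipode K (astar K a))) \<odot>\<^bsub>K\<^esub> \<theta> b)) \<psi>"
      by (simp add: L.C1.amult_assoc[symmetric] L.V_isometry L.C1.amult_one_left Jm[symmetric])
    also have "\<dots> = ?J (sweedler2 K (\<lambda>a b. astar K (\<theta> (antipode K (astar K a))) \<odot>\<^bsub>K\<^esub> \<theta> b) \<psi>)"
      by (rule sweedler2_linear[OF pure_tensor_right])
    finally show "sweedler2 K (\<lambda>a b. astar K (\<theta> (antipode K (astar K a))) \<odot>\<^bsub>K\<^esub> \<theta> b) \<psi> = dual_apply \<psi> \<one>\<^bsub>H\<^esub> *\<^sub>C \<one>\<^bsub>K\<^esub>"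
      by (intro Jinj) (simp add: L.V_isometry tensor_algebra_one clinear_transport transport_unit pure_tensor_simps)
  qed
  have star: "\<theta> (astar K \<phi>) = astar K (\<theta> \<phi>)" for \<phi>
  proof -
    have "astar K (\<theta> (astar K \<phi>)) = \<theta> \<phi>"
      using star_eq[of "antipode K \<phi>"] by (simp add: L.hopf.dual_antipode_antipode L.hopf.dual_antipode_star)
    then show ?thesis by (metis K.astar_astar)
  qed
  \<comment> \<open>If \<theta> kills a functional, its action kills V, hence every
    \<open>gen h\<close>, hence C by linearity over A; \<open>transport_faithful\<close> then
    applies.\<close>
  have inj: "inj \<theta>"
  proof (rule injI)
    fix \<phi> \<psi> assume "\<theta> \<phi> = \<theta> \<psi>"
    then have "\<theta> (\<phi> - \<psi>) = 0" by (simp add: clinear_diff[OF \<theta>(1)])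
    then have V0: "transport1 (\<phi> - \<psi>) V = 0"
      by (simp add: \<theta>(2) pure_tensor_simps L.C1.unital.amult_simps)
    have "transport (\<phi> - \<psi>) (L.gen h) = 0" for h
      using arg_cong[OF V0, of "ev h"] by (simp add: ev_tensor_map clinear_transport L.ev_V clinear_zero[OF clinear_ev])
    then have "transport (\<phi> - \<psi>) c = 0" for c
      by (induction c rule: L.crossed_induct)
        (simp_all add: transport_embed_left L.crossed.unital.amult_simps clinear_simps[OF clinear_transport])
    then have "\<phi> - \<psi> = 0" by (rule transport_faithful[OF one])
    then show "\<phi> = \<psi>" by simp
  qed
  then have "bij \<theta>"
    using finite_dim_inj_imp_surj[OF L.hopf.finite_dim_dual \<theta>(1)] by (simp add: bij_def)
  then have "cstar_hopf_automorphism K \<theta>"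
    by (simp add: cstar_hopf_automorphism_def unital_star_hom_def \<theta>(1) unit mult star comult antipode
        L.hopf.dual_counit counit)
  then show ?thesis using \<theta>(2) by blast
qed

text \<open>If 1 = 0 in C, then C is the zero space, the constants 1 \<otimes> \<theta>(\<psi>)
  carry no information, and the identity serves.\<close>

lemma exists_automorphism:
  "\<exists>\<theta>. cstar_hopf_automorphism K \<theta> \<and> (\<forall>\<psi>. transport1 \<psi> V = V \<odot>\<^bsub>coef1 H C\<^esub> (\<one>\<^bsub>C\<^esub> \<otimes>\<^sub>t \<theta> \<psi>))"
proof (cases "\<one>\<^bsub>C\<^esub> = 0")
  case True
  have "\<one>\<^bsub>coef1 H C\<^esub> = 0" by (simp add: tensor_algebra_one True pure_tensor_simps)
  then have "t = 0" for t :: "(('a, 'h) tensor, 'h dual) tensor"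
    using L.C1.amult_one_left[of t] by (simp add: L.C1.unital.amult_simps)
  moreover have "cstar_hopf_automorphism K id"
    by (simp add: cstar_hopf_automorphism_def unital_star_hom_id)
  ultimately show ?thesis by metis
qed (rule exists_automorphism_nontrivial)

end

section \<open>Twisting a coaction by an automorphism\<close>

locale automorphism_twist = twisted_crossed_product H A \<rho> u
  for H :: "'h::complex_vector hopf_algebra"
    and A :: "('a::complex_vector, 'm) star_algebra_scheme"
    and \<rho> :: "'a \<Rightarrow> ('a, 'h dual) tensor"
    and u :: "(('a, 'h dual) tensor, 'h dual) tensor" +
  fixes \<theta> :: "'h dual \<Rightarrow> 'h dual"
  assumes automorphism: "cstar_hopf_automorphism (dual_hopf H) \<theta>"
begin

abbreviation K where "K \<equiv> dual_hopf H"

abbreviation map1 :: "('z::complex_vector, 'h dual) tensor \<Rightarrow> ('z, 'h dual) tensor"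
  where "map1 \<equiv> tensor_map id \<theta>"

abbreviation map2 :: "(('z::complex_vector, 'h dual) tensor, 'h dual) tensor \<Rightarrow> (('z, 'h dual) tensor, 'h dual) tensor"
  where "map2 \<equiv> tensor_map map1 \<theta>"

lemma theta_hom: "unital_star_hom K K \<theta>"
  and theta_comult: "comult K (\<theta> \<phi>) = tensor_map \<theta> \<theta> (comult K \<phi>)"
  and theta_counit: "dual_apply (\<theta> \<phi>) \<one>\<^bsub>H\<^esub> = dual_apply \<phi> \<one>\<^bsub>H\<^esub>"
  using automorphism by (auto simp: cstar_hopf_automorphism_def hopf.dual_counit)

lemmas theta = unital_star_homD[OF theta_hom]

lemma hom_map:
  assumes "unital_star_algebra B" "unital_star_hom B B f"
  shows "unital_star_hom (coef1 H B) (coef1 H B) (tensor_map f \<theta>)"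
  by (rule unital_star_hom_tensor_map) (intro assms theta_hom hopf.unital_star_algebra_dual)+

lemma clinear_map: "clinear f \<Longrightarrow> clinear (tensor_map f \<theta>)"
  by (rule clinear_tensor_map[OF _ theta(1)])

lemma map_leg12: "clinear f \<Longrightarrow> tensor_map f \<theta> (leg12 H t) = leg12 H (f t)"
  by (simp add: leg12_def theta)

lemma map_leg13: "map2 (leg13 H t) = leg13 H (map1 t)"
  unfolding leg13_def
  by (simp add: tensor_map_compose theta(1) clinear_map clinear_leg12 map_leg12)

lemma tensor_assoc_map:
  "clinear f \<Longrightarrow> tensor_assoc (f a \<otimes>\<^sub>t tensor_map \<theta> \<theta> s) = tensor_map (tensor_map f \<theta>) \<theta> (tensor_assoc (a \<otimes>\<^sub>t s))"
  by (rule tensor_eqI[of "\<lambda>s. tensor_assoc (f a \<otimes>\<^sub>t tensor_map \<theta> \<theta> s)"])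
    (simp_all add: theta(1) clinear_compose[OF clinear_tensor_assoc clinear_compose[OF pure_tensor_right clinear_map]]
      clinear_compose[OF clinear_map clinear_compose[OF clinear_tensor_assoc pure_tensor_right]] clinear_map)

lemma comult_last_map:
  assumes f: "clinear f"
  shows "comult_last H (tensor_map f \<theta> t) = tensor_map (tensor_map f \<theta>) \<theta> (comult_last H t)"
proof (rule tensor_eqI[of "\<lambda>t. comult_last H (tensor_map f \<theta> t)"])
  show "clinear (\<lambda>t. comult_last H (tensor_map f \<theta> t))"
    by (rule clinear_compose[OF hopf.clinear_comult_last clinear_map[OF f]])
  show "clinear (\<lambda>t. tensor_map (tensor_map f \<theta>) \<theta> (comult_last H t))"
    by (rule clinear_compose[OF clinear_map[OF clinear_map[OF f]] hopf.clinear_comult_last])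
qed (simp add: comult_last_def f theta(1) theta_comult hopf.clinear_dual_comult tensor_assoc_map)

lemma map_fun: "clinear f \<Longrightarrow> tensor_map (\<lambda>a. map1 (f a)) id (map1 t) = map2 (tensor_map f id t)"
  by (simp add: tensor_map_compose theta(1) clinear_map clinear_compose[OF clinear_map])

text \<open>The algebraic axioms are images of the original ones under extensions of \<theta>, which
  are homomorphisms commuting with the dual coproduct. The normalisations survive because \<theta>
  preserves evaluation at 1, the counit of H^0.\<close>

lemma twisted_coaction_map: "twisted_coaction H A (map1 \<circ> \<rho>) (map2 u)"
proof (intro twisted_coaction.intro twisted_coaction_axioms.intro)
  note m1 = unital_star_homD[OF hom_map[OF alg.unital_star_algebra_axioms unital_star_hom_id]]
  note A1 = hopf.unital_star_algebra_coef1[OF alg.unital_star_algebra_axioms]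
  note hom1 = hom_map[OF alg.unital_star_algebra_axioms unital_star_hom_id]
  note hom2 = hom_map[OF A1 hom1]
  note hom3 = hom_map[OF hopf.unital_star_algebra_coef1[OF A1] hom2]
  note m2 = unital_star_homD[OF hom2] and m3 = unital_star_homD[OF hom3]
  show "cstar_hopf_algebra H" "cstar_algebra A" by unfold_locales
  have "slice (counit K) (map1 t) = ev \<one>\<^bsub>H\<^esub> t" for t :: "('a, 'h dual) tensor"
    by (simp add: slice_tensor_map theta(1) hopf.dual_counit[abs_def] clinear_eval theta_counit)
  then show "weak_coaction H A (map1 \<circ> \<rho>)"
    using unital_star_hom_compose[OF rho_hom hom1] by (simp add: weak_coaction_def comp_def rho_counit)
  show "aunitary (coef2 H A) (map2 u)"
    using unitary by (simp add: aunitary_def m2(2) flip: m2(3,4))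
  show "tensor_map (map1 \<circ> \<rho>) id ((map1 \<circ> \<rho>) a) =
      map2 u \<odot>\<^bsub>coef2 H A\<^esub> comult_last H ((map1 \<circ> \<rho>) a) \<odot>\<^bsub>coef2 H A\<^esub> astar (coef2 H A) (map2 u)" for a
    by (simp add: comp_def map_fun rho(1) twisted_coassoc m2 comult_last_map)
  have c: "tensor_map (comult_last H) id (map2 u) = tensor_map map2 \<theta> (tensor_map (comult_last H) id u)"
    by (simp add: tensor_map_compose theta(1) clinear_map hopf.clinear_comult_last comult_last_map)
  have r: "tensor_map (tensor_map (map1 \<circ> \<rho>) id) id (map2 u) = tensor_map map2 \<theta> (tensor_map (tensor_map \<rho> id) id u)"
    by (simp add: tensor_map_compose comp_def theta(1) clinear_map rho(1) clinear_tensor_map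
        clinear_compose[OF clinear_map rho(1)] clinear_compose[OF clinear_tensor_map[OF rho(1)]] map_fun)
  show "(map2 u \<otimes>\<^sub>t \<one>\<^bsub>K\<^esub>) \<odot>\<^bsub>coef3 H A\<^esub> tensor_map (comult_last H) id (map2 u) =
      tensor_map (tensor_map (map1 \<circ> \<rho>) id) id (map2 u) \<odot>\<^bsub>coef3 H A\<^esub> comult_last H (map2 u)"
    using arg_cong[OF cocycle, of "tensor_map map2 \<theta>"]
    by (simp add: c r comult_last_map[OF clinear_map] m3 theta clinear_map)
  have ev1: "ev \<one>\<^bsub>H\<^esub> (tensor_map f \<theta> t) = f (ev \<one>\<^bsub>H\<^esub> t)" if "clinear f" for f and t :: "('z::complex_vector, 'h dual) tensor"
    by (simp add: that slice_tensor_map theta(1) clinear_eval theta_counit)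
  have u1: "ev \<one>\<^bsub>H\<^esub> u = leg12 H \<one>\<^bsub>A\<^esub>"
    by (rule ev_eqI[OF hopf.finite_dim]) (simp add: hopf.ev_leg12 normalized_right[unfolded hat_def])
  show "hat (map2 u) h \<one>\<^bsub>H\<^esub> = counit H h *\<^sub>C \<one>\<^bsub>A\<^esub>" for h
    unfolding hat_def by (simp add: ev1 clinear_map u1 map_leg12 hopf.ev_leg12)
  \<comment> \<open>The left normalisation concerns the middle leg of u, so the evaluation at 1 has
    to be taken past the last leg.\<close>
  have u2: "tensor_map (ev \<one>\<^bsub>H\<^esub>) id u = leg12 H \<one>\<^bsub>A\<^esub>"
    by (rule ev_eqI[OF hopf.finite_dim])
      (simp add: ev_tensor_map clinear_ev hopf.ev_leg12 normalized_left[unfolded hat_def])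
  have "hat (map2 u) \<one>\<^bsub>H\<^esub> h = ev h (tensor_map (ev \<one>\<^bsub>H\<^esub>) id (map2 u))" for h
    by (simp add: hat_def ev_tensor_map clinear_ev)
  moreover have "tensor_map (ev \<one>\<^bsub>H\<^esub>) id (map2 u) = map1 (tensor_map (ev \<one>\<^bsub>H\<^esub>) id u)"
    by (simp add: tensor_map_compose theta(1) clinear_map clinear_ev ev1)
  ultimately show "hat (map2 u) \<one>\<^bsub>H\<^esub> h = counit H h *\<^sub>C \<one>\<^bsub>A\<^esub>" for h
    by (simp add: u2 map_leg12 hopf.ev_leg12)
qed

definition W :: "(('a, 'h) tensor, 'h dual) tensor"
  where "W = map1 V"

lemma hom_map1: "unital_star_hom (coef1 H C) (coef1 H C) map1"
  by (rule hom_map[OF crossed.unital_star_algebra_axioms unital_star_hom_id])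

lemma hom_map2: "unital_star_hom (coef2 H C) (coef2 H C) map2"
  by (rule hom_map[OF C1.unital_star_algebra_axioms hom_map1])

lemmas map1 = unital_star_homD[OF hom_map1]
lemmas map2 = unital_star_homD[OF hom_map2]

lemma W_isometry: "astar (coef1 H C) W \<odot>\<^bsub>coef1 H C\<^esub> W = \<one>\<^bsub>coef1 H C\<^esub>"
  and W_coisometry: "W \<odot>\<^bsub>coef1 H C\<^esub> astar (coef1 H C) W = \<one>\<^bsub>coef1 H C\<^esub>"
  unfolding W_def by (simp_all add: V_isometry V_coisometry map1(2) flip: map1(3,4))

lemma map1_embed1: "map1 (embed1 t) = embed1 (map1 t)"
  by (simp add: tensor_map_compose theta(1) clinear_embed)

lemma map2_embed2: "map2 (embed2 t) = embed2 (map2 t)"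
  by (simp add: tensor_map_compose theta(1) clinear_embed clinear_map clinear_tensor_map)

lemma W_embed: "W \<odot>\<^bsub>coef1 H C\<^esub> leg12 H (embed a) = embed1 (map1 (\<rho> a)) \<odot>\<^bsub>coef1 H C\<^esub> W"
  using arg_cong[OF V_embed[of a], of map1] by (simp add: map1(3) map_leg12 map1_embed1 W_def)

lemma W_W: "leg12 H W \<odot>\<^bsub>coef2 H C\<^esub> leg13 H W = embed2 (map2 u) \<odot>\<^bsub>coef2 H C\<^esub> comult_last H W"
  using arg_cong[OF V_V, of map2]
  by (simp add: map2(3) map_leg12 map_leg13 map2_embed2 comult_last_map W_def clinear_map theta(1))

lemma W_counit: "ev \<one>\<^bsub>H\<^esub> W = \<one>\<^bsub>C\<^esub>"
  by (simp add: W_def slice_tensor_map theta(1) clinear_eval theta_counit ev_V gen_one)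

text \<open>The constant is the one that the transported action puts on V; this is the reason for
  twisting by \<theta>.\<close>

lemma dual_act_W: "tensor_map (dual_act H \<psi>) id W = W \<odot>\<^bsub>coef1 H C\<^esub> (\<one>\<^bsub>C\<^esub> \<otimes>\<^sub>t \<theta> \<psi>)"
proof -
  have "tensor_map (dual_act H \<psi>) id W = map1 (tensor_map (dual_act H \<psi>) id V)"
    by (simp add: W_def tensor_map_compose theta(1) hopf.clinear_dual_act)
  then show ?thesis by (simp add: dual_act_V map1(3) theta(1) W_def)
qed

text \<open>The rule for the dual action on adjoints brings in S, and with it the cancellation
  against the constant of V.\<close>

lemma dual_act_W_star:
  "tensor_map (dual_act H \<psi>) id (astar (coef1 H C) W) = (\<one>\<^bsub>C\<^esub> \<otimes>\<^sub>t \<theta> (antipode K \<psi>)) \<odot>\<^bsub>coef1 H C\<^esub> astar (coef1 H C) W"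
proof -
  note st = tensor_algebra_star[OF crossed.unital_star_algebra_axioms hopf.unital_star_algebra_dual]
  note cl = clinear_tensor_map[OF hopf.clinear_dual_act clinear_id(1)]
  have star: "tensor_map (dual_act H \<psi>) id (astar (coef1 H C) t)
    = astar (coef1 H C) (tensor_map (dual_act H (antipode K (astar K \<psi>))) id t)" for t
  proof (induction t rule: tensor_induct)
    case (pure c k)
    show ?case by (simp add: st hopf.clinear_dual_act dual_act_star)
  next
    case (add s t)
    then show ?case by (simp only: C1.astar_add clinear_add[OF cl])
  qed
  have "astar K (antipode K (astar K \<psi>)) = antipode K \<psi>"
    using hopf.dual_antipode_star[of "astar K \<psi>"]
    by (metis hopf.dual_antipode_antipode unital_star_algebra.astar_astar[OF hopf.unital_star_algebra_dual])
  then show ?thesis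
    unfolding star dual_act_W C1.astar_mult by (simp add: st crossed.astar_one flip: theta(4))
qed

end

section \<open>The bimodule over the coefficient algebras\<close>

lemma complete_wrt_cong:
  fixes S :: "'z::complex_vector set"
  assumes "csubspace S" "\<And>x. x \<in> S \<Longrightarrow> n x = p x"
  shows "complete_wrt S n \<longleftrightarrow> complete_wrt S p"
proof -
  have eq: "n (x - y) = p (x - y)" if "x \<in> S" "y \<in> S" for x y
    using assms cvector.subspace_diff[OF assms(1) that] by blast
  have "complete_wrt S r" if r: "complete_wrt S q" and e: "\<And>x y. x \<in> S \<Longrightarrow> y \<in> S \<Longrightarrow> q (x - y) = r (x - y)" for q r
    unfolding complete_wrt_def
  proof (intro allI impI)
    fix f :: "nat \<Rightarrow> 'z"
    assume f: "range f \<subseteq> S" and c: "\<forall>e>0. \<exists>N. \<forall>i\<ge>N. \<forall>j\<ge>N. r (f i - f j) < e"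
    then have "\<exists>l\<in>S. (\<lambda>i. q (f i - l)) \<longlonglongrightarrow> 0"
      using r e unfolding complete_wrt_def by (simp add: subset_eq)
    then show "\<exists>l\<in>S. (\<lambda>i. r (f i - l)) \<longlonglongrightarrow> 0"
      using f e by (auto simp: subset_eq)
  qed
  from this[of n p] this[of p n] eq show ?thesis by metis
qed

lemma (in cstar_algebra) cstar_dense_total:
  assumes "\<And>a. a \<in> S"
  shows "cstar_dense A S"
proof -
  interpret cstar_normed A "cstar_norm A" by (rule cstar_normed)
  show ?thesis
    unfolding cstar_dense_def
  proof (intro allI impI)
    fix a and e :: real assume "e > 0"
    then have "cstar_norm A (a - a) < e" by (simp add: norm_zero)
    then show "\<exists>s\<in>S. cstar_norm A (a - s) < e" using assms by blast
  qed
qed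

text \<open>Closedness of the range makes the norm of C, pulled back along f, a second complete
  C*-norm on A; two such norms agree because the identity is contractive in both directions.\<close>

lemma injective_hom_isometric:
  assumes A: "cstar_normed A n" and C: "cstar_normed C p" and f: "unital_star_hom A C f" "inj f"
    and closed: "\<And>a c. (\<lambda>i::nat. p (f (a i) - c)) \<longlonglongrightarrow> 0 \<Longrightarrow> c \<in> range f"
  shows "p (f a) = n a"
proof -
  interpret A: cstar_normed A n by fact
  interpret C: cstar_normed C p by fact
  note f' = unital_star_homD[OF f(1)]
  have "complete_wrt UNIV (\<lambda>a. p (f a))"
    unfolding complete_wrt_def
  proof (intro allI impI)
    fix g :: "nat \<Rightarrow> _"
    assume "\<forall>e>0. \<exists>N. \<forall>i\<ge>N. \<forall>j\<ge>N. p (f (g i - g j)) < e"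
    then obtain c where c: "(\<lambda>i. p (f (g i) - c)) \<longlonglongrightarrow> 0"
      using C.norm_complete unfolding complete_wrt_def by (auto simp: clinear_diff[OF f'(1)] dest!: spec[of _ "\<lambda>i. f (g i)"])
    then obtain l where "c = f l" using closed by blast
    with c show "\<exists>l\<in>UNIV. (\<lambda>i. p (f (g i - l))) \<longlonglongrightarrow> 0" by (auto simp: clinear_diff[OF f'(1)])
  qed
  moreover have "f a = 0 \<longleftrightarrow> a = 0" for a
    using injD[OF f(2), of a 0] by (auto simp: clinear_zero[OF f'(1)])
  ultimately have "is_cstar_norm A (\<lambda>a. p (f a))"
    unfolding is_cstar_norm_def
    by (simp add: C.norm_nonneg C.norm_zero_iff clinear_simps[OF f'(1)] C.norm_triangle C.norm_scale
        f'(3,4) C.norm_mult C.norm_star_self)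
  then have A': "cstar_normed A (\<lambda>a. p (f a))" by unfold_locales
  show ?thesis
    using star_hom_contractive[OF A A' unital_star_hom_id, of a] star_hom_contractive[OF A' A unital_star_hom_id, of a]
    by simp
qed

context equivalence_bimodule
begin

text \<open>By imprimitivity, a \<mapsto> <x, a x>_B takes the product of A twisted by the left
  inner product of x with itself to the product of B, which is the situation of
  \<open>compressed_hom_contractive\<close>.\<close>

lemma norm_rip_lact:
  assumes x: "x \<in> bcarrier X" and a: "astar A a = a"
  shows "cstar_norm B (rip X x (lact X a x)) \<le> cstar_norm A a * cstar_norm A (lip X x x)"
proof (rule compressed_hom_contractive[OF left.cstar_normed right.cstar_normed])
  show "clinear (\<lambda>a. rip X x (lact X a x))"
    by (rule clinearI) (simp_all add: x lact_add_left lact_scale_left rip_add rip_scale lact_closed)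
  show "rip X x (lact X (b \<odot>\<^bsub>A\<^esub> lip X x x \<odot>\<^bsub>A\<^esub> c) x) = rip X x (lact X b x) \<odot>\<^bsub>B\<^esub> rip X x (lact X c x)" for b c
    by (simp add: x lact_mult lact_closed imprimitivity lact_ract[symmetric] rip_ract)
  show "rip X x (lact X (astar A b) x) = astar B (rip X x (lact X b x))" for b
    using x by (simp add: rip_star lact_closed rip_lact)
qed (simp_all add: x lip_star a)

lemma norm_lip_ract:
  assumes x: "x \<in> bcarrier X" and b: "astar B b = b"
  shows "cstar_norm A (lip X (ract X x b) x) \<le> cstar_norm B b * cstar_norm B (rip X x x)"
proof (rule compressed_hom_contractive[OF right.cstar_normed left.cstar_normed])
  show "clinear (\<lambda>b. lip X (ract X x b) x)"
    by (rule clinearI) (simp_all add: x ract_add_right ract_scale_right lip_add lip_scale ract_closed)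
  show "lip X (ract X x (b \<odot>\<^bsub>B\<^esub> rip X x x \<odot>\<^bsub>B\<^esub> c)) x = lip X (ract X x b) x \<odot>\<^bsub>A\<^esub> lip X (ract X x c) x" for b c
    by (simp add: x ract_mult ract_closed lip_lact[symmetric] imprimitivity lact_ract[symmetric])
  show "lip X (ract X x (astar B b)) x = astar A (lip X (ract X x b) x)" for b
    using x by (simp add: lip_star ract_closed lip_ract right.astar_astar)
qed (simp_all add: x rip_star b)

lemma norm_lip_rip:
  assumes x: "x \<in> bcarrier X"
  shows "cstar_norm A (lip X x x) = cstar_norm B (rip X x x)"
proof (rule antisym)
  interpret nA: cstar_normed A "cstar_norm A" by (rule left.cstar_normed)
  interpret nB: cstar_normed B "cstar_norm B" by (rule right.cstar_normed)
  show "cstar_norm A (lip X x x) \<le> cstar_norm B (rip X x x)"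
    using norm_lip_ract[OF x right.astar_one] mult_right_mono[OF nB.norm_one_le nB.norm_nonneg[of "rip X x x"]]
    by (simp add: ract_one x)
  show "cstar_norm B (rip X x x) \<le> cstar_norm A (lip X x x)"
    using norm_rip_lact[OF x left.astar_one] mult_right_mono[OF nA.norm_one_le nA.norm_nonneg[of "lip X x x"]]
    by (simp add: lact_one x)
qed

end

context twisted_crossed_product
begin

text \<open>The coaction takes e to e \<otimes> 1 and therefore b to the inverse of e \<otimes> 1,
  which is b \<otimes> 1; so b is coinvariant and lies in A.\<close>

lemma inverse_embed:
  assumes "b \<odot>\<^bsub>C\<^esub> embed e = \<one>\<^bsub>C\<^esub>" "embed e \<odot>\<^bsub>C\<^esub> b = \<one>\<^bsub>C\<^esub>"
  shows "b \<in> range embed"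
proof -
  note h = unital_star_homD[OF unital_star_hom_coact]
  note l = unital_star_homD[OF unital_star_hom_left[OF crossed.unital_star_algebra_axioms hopf.unital_star_algebra_axioms]]
  have "coact H b = coact H b \<odot>\<^bsub>tensor_algebra C H\<^esub> (coact H (embed e) \<odot>\<^bsub>tensor_algebra C H\<^esub> (b \<otimes>\<^sub>t \<one>\<^bsub>H\<^esub>))"
    by (simp add: coact_embed CH.amult_one_right assms(2) l(2) flip: l(3))
  also have "\<dots> = coact H (b \<odot>\<^bsub>C\<^esub> embed e) \<odot>\<^bsub>tensor_algebra C H\<^esub> (b \<otimes>\<^sub>t \<one>\<^bsub>H\<^esub>)"
    by (simp add: h(3) CH.amult_assoc)
  also have "\<dots> = b \<otimes>\<^sub>t \<one>\<^bsub>H\<^esub>"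
    by (simp add: assms(1) h(2) CH.amult_one_left)
  finally have "b = embed (slice (counit H) b)"
    using hopf.coinvariant unfolding embed_def by blast
  then show ?thesis by blast
qed

text \<open>By \<open>inverse_embed\<close> the spectrum does not grow on passing to the coefficient
  algebra, so positivity descends from C to A.\<close>

lemma apositive_embed:
  assumes "apositive C (embed a)"
  shows "apositive A a"
proof -
  have "aspectrum A a \<subseteq> aspectrum C (embed a)"
  proof
    fix z assume z: "z \<in> aspectrum A a"
    let ?e = "z *\<^sub>C \<one>\<^bsub>A\<^esub> - a"
    have e: "z *\<^sub>C \<one>\<^bsub>C\<^esub> - embed a = embed ?e" by (simp add: clinear_simps[OF clinear_embed] embed_one)
    show "z \<in> aspectrum C (embed a)"
    proof (rule ccontr)
      assume "z \<notin> aspectrum C (embed a)"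
      then obtain b where b: "b \<odot>\<^bsub>C\<^esub> embed ?e = \<one>\<^bsub>C\<^esub>" "embed ?e \<odot>\<^bsub>C\<^esub> b = \<one>\<^bsub>C\<^esub>"
        by (auto simp: aspectrum_def e)
      then obtain b' where "b = embed b'" using inverse_embed by blast
      with b have "b' \<odot>\<^bsub>A\<^esub> ?e = \<one>\<^bsub>A\<^esub>" "?e \<odot>\<^bsub>A\<^esub> b' = \<one>\<^bsub>A\<^esub>"
        by (simp_all only: embed_mult[symmetric] embed_one[symmetric] embed_inject)
      with z show False by (auto simp: aspectrum_def)
    qed
  qed
  then show ?thesis
    using assms by (auto simp: apositive_def embed_star embed_inject)
qed

end

section \<open>X as an equivalence bimodule over A and B\<close>

context crossed_morita_frame
begin

lemma embed_slice_lip: "x \<in> X \<Longrightarrow> y \<in> X \<Longrightarrow> L.embed (slice (counit H) (lip Y x y)) = lip Y x y"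
  and embed_slice_rip: "x \<in> X \<Longrightarrow> y \<in> X \<Longrightarrow> R.embed (slice (counit H) (rip Y x y)) = rip Y x y"
  using lip_X[of x y] rip_X[of x y] by (auto simp: L.slice_embed R.slice_embed)

text \<open>Inner products of elements of X lie in the embedded coefficient algebras, where
  \<open>slice (counit H)\<close> inverts the embedding.\<close>

definition coefficient_bimodule :: "('a, 'b, 'y) bimodule"
  where "coefficient_bimodule = \<lparr>bcarrier = X,
    lact = (\<lambda>a x. lact Y (L.embed a) x), ract = (\<lambda>x b. ract Y x (R.embed b)),
    lip = (\<lambda>x y. slice (counit H) (lip Y x y)), rip = (\<lambda>x y. slice (counit H) (rip Y x y))\<rparr>"

abbreviation Z where "Z \<equiv> coefficient_bimodule"

lemma Z_simps [simp]:
  "bcarrier Z = X" "lact Z a x = lact Y (L.embed a) x" "ract Z x b = ract Y x (R.embed b)"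
  "lip Z x y = slice (counit H) (lip Y x y)" "rip Z x y = slice (counit H) (rip Y x y)"
  by (simp_all add: coefficient_bimodule_def)

lemma X_add: "x \<in> X \<Longrightarrow> y \<in> X \<Longrightarrow> x + y \<in> X"
  and X_scale: "x \<in> X \<Longrightarrow> z *\<^sub>C x \<in> X"
  and X_sum: "(\<And>i. i \<in> P \<Longrightarrow> g i \<in> X) \<Longrightarrow> (\<Sum>i\<in>P. g i) \<in> X"
  using X_subspace by (auto intro: cvector.subspace_add cvector.subspace_scale cvector.subspace_sum)

lemma pre_bimodule_Z: "pre_bimodule A B Z"
proof (intro pre_bimodule.intro pre_bimodule_axioms.intro L.alg.unital_star_algebra_axioms R.alg.unital_star_algebra_axioms)
  note cl = clinear_simps[OF L.clinear_embed] clinear_simps[OF R.clinear_embed]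
    clinear_simps[OF clinear_slice[OF L.hopf.counit_linear]]
  note em = L.embed_inject[symmetric] R.embed_inject[symmetric]
    L.embed_mult R.embed_mult L.embed_star[symmetric] R.embed_star[symmetric] embed_slice_lip embed_slice_rip
  note ax = XY X_add X_scale lact_X ract_X lact_add_left lact_add_right lact_scale_left lact_scale_right lact_mult
    ract_add_left ract_add_right ract_scale_left ract_scale_right ract_mult lact_ract lip_add lip_scale rip_add rip_scale
  show "csubspace (bcarrier Z)" by (simp add: X_subspace)
  show "lact Z \<one>\<^bsub>A\<^esub> x = x" "ract Z x \<one>\<^bsub>B\<^esub> = x" if "x \<in> bcarrier Z" for x
    using that by (simp_all add: L.embed_one R.embed_one lact_one ract_one XY)
  show "lip Z (lact Z a x) y = a \<odot>\<^bsub>A\<^esub> lip Z x y" if "x \<in> bcarrier Z" "y \<in> bcarrier Z" for a x y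
    using that by (simp add: em ax lip_lact[symmetric])
  show "rip Z x (ract Z y b) = rip Z x y \<odot>\<^bsub>B\<^esub> b" if "x \<in> bcarrier Z" "y \<in> bcarrier Z" for b x y
    using that by (simp add: em ax rip_ract[symmetric])
  show "astar A (lip Z x y) = lip Z y x" "astar B (rip Z x y) = rip Z y x" if "x \<in> bcarrier Z" "y \<in> bcarrier Z" for x y
    using that by (simp_all add: em ax lip_star rip_star)
  show "rip Z (lact Z a x) y = rip Z x (lact Z (astar A a) y)" if "x \<in> bcarrier Z" "y \<in> bcarrier Z" for a x y
    using that by (simp add: ax rip_lact L.embed_star)
  show "lip Z (ract Z x b) y = lip Z x (ract Z y (astar B b))" if "x \<in> bcarrier Z" "y \<in> bcarrier Z" for b x y
    using that by (simp add: ax lip_ract R.embed_star)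
  show "lact Z (a \<odot>\<^bsub>A\<^esub> a') x = lact Z a (lact Z a' x)" if "x \<in> bcarrier Z" for a a' x
    using that by (simp add: ax L.embed_mult)
  show "ract Z x (b \<odot>\<^bsub>B\<^esub> b') = ract Z (ract Z x b) b'" if "x \<in> bcarrier Z" for b b' x
    using that by (simp add: ax R.embed_mult)
qed (simp_all add: XY X_add X_scale lact_X ract_X lact_add_left lact_add_right lact_scale_left lact_scale_right
    ract_add_left ract_add_right ract_scale_left ract_scale_right lact_ract lip_add lip_scale rip_add rip_scale
    clinear_simps[OF L.clinear_embed] clinear_simps[OF R.clinear_embed] clinear_simps[OF clinear_slice[OF L.hopf.counit_linear]])

lemma bimodule_inclusion_Z: "bimodule_inclusion A B Z C D Y L.embed R.embed"
  by (intro bimodule_inclusion.intro bimodule_inclusion_axioms.intro pre_bimodule_Z pre_bimodule_axioms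
      L.clinear_embed R.clinear_embed)
    (simp_all add: XY embed_slice_lip embed_slice_rip)

interpretation nC: cstar_normed C "cstar_norm C" by (rule L.crossed.cstar_normed)
interpretation nD: cstar_normed D "cstar_norm D" by (rule R.crossed.cstar_normed)

text \<open>A norm limit c of elements of A maps X into X, because X is closed; writing c by the
  frame as a sum of inner products of c X with X shows that c lies in A. It supplies the closed
  range for \<open>injective_hom_isometric\<close>.\<close>

lemma embed_closed_left:
  assumes lim: "(\<lambda>i::nat. cstar_norm C (L.embed (a i) - c)) \<longlonglongrightarrow> 0"
  shows "c \<in> range L.embed"
proof -
  have cx: "lact Y c x \<in> X" if x: "x \<in> X" for x
  proof (rule X_closed[of "\<lambda>i. lact Y (L.embed (a i)) x"])
    note xY = XY[OF x]
    show "range (\<lambda>i. lact Y (L.embed (a i)) x) \<subseteq> X" using x lact_X by blast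
    show "lact Y c x \<in> bcarrier Y" by (rule lact_closed[OF xY])
    let ?s = "sqrt (cstar_norm C (lip Y x x))"
    have "sqrt (cstar_norm D (rip Y (lact Y (L.embed (a i)) x - lact Y c x) (lact Y (L.embed (a i)) x - lact Y c x)))
      \<le> cstar_norm C (L.embed (a i) - c) * ?s" for i
    proof -
      let ?e = "L.embed (a i) - c"
      have "rip Y (lact Y ?e x) (lact Y ?e x) = rip Y x (lact Y (astar C ?e \<odot>\<^bsub>C\<^esub> ?e) x)"
        by (simp only: rip_lact lact_mult lact_closed xY)
      then have "cstar_norm D (rip Y (lact Y ?e x) (lact Y ?e x)) \<le> (cstar_norm C ?e)\<^sup>2 * cstar_norm C (lip Y x x)"
        using norm_rip_lact[OF xY, of "astar C ?e \<odot>\<^bsub>C\<^esub> ?e"]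
        by (simp add: L.crossed.astar_mult L.crossed.astar_astar nC.norm_star_self)
      then have "sqrt (cstar_norm D (rip Y (lact Y ?e x) (lact Y ?e x))) \<le> sqrt ((cstar_norm C ?e)\<^sup>2 * cstar_norm C (lip Y x x))"
        by simp
      then show ?thesis
        by (simp add: clinear_diff[OF clinear_lact_left[OF xY]] real_sqrt_mult nC.norm_nonneg)
    qed
    then show "(\<lambda>i. sqrt (cstar_norm D (rip Y (lact Y (L.embed (a i)) x - lact Y c x) (lact Y (L.embed (a i)) x - lact Y c x)))) \<longlonglongrightarrow> 0"
      by (intro tendsto_sandwich[OF _ _ tendsto_const tendsto_mult_left_zero[OF lim]])
        (auto intro!: always_eventually nD.norm_nonneg)
  qed
  have "c = c \<odot>\<^bsub>C\<^esub> (\<Sum>i\<in>I. lip Y (fx i) (fy i))" by (simp add: left_frame L.crossed.amult_one_right)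
  also have "\<dots> = (\<Sum>i\<in>I. lip Y (lact Y c (fx i)) (fy i))"
    unfolding L.crossed.unital.amult_simps by (intro sum.cong) (auto simp: lip_lact frame_Y)
  also have "\<dots> = L.embed (\<Sum>i\<in>I. slice (counit H) (lip Y (lact Y c (fx i)) (fy i)))"
    by (simp add: clinear_simps[OF L.clinear_embed] embed_slice_lip cx frame_X)
  finally show ?thesis by blast
qed

lemma embed_closed_right:
  assumes lim: "(\<lambda>i::nat. cstar_norm D (R.embed (b i) - d)) \<longlonglongrightarrow> 0"
  shows "d \<in> range R.embed"
proof -
  have xd: "ract Y x d \<in> X" if x: "x \<in> X" for x
  proof (rule X_closed[of "\<lambda>i. ract Y x (R.embed (b i))"])
    note xY = XY[OF x]
    show "range (\<lambda>i. ract Y x (R.embed (b i))) \<subseteq> X" using x ract_X by blast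
    show "ract Y x d \<in> bcarrier Y" by (rule ract_closed[OF xY])
    let ?s = "sqrt (cstar_norm D (rip Y x x))"
    have "sqrt (cstar_norm D (rip Y (ract Y x (R.embed (b i)) - ract Y x d) (ract Y x (R.embed (b i)) - ract Y x d)))
      \<le> cstar_norm D (R.embed (b i) - d) * ?s" for i
    proof -
      let ?e = "R.embed (b i) - d"
      have "rip Y (ract Y x ?e) (ract Y x ?e) = astar D ?e \<odot>\<^bsub>D\<^esub> rip Y x x \<odot>\<^bsub>D\<^esub> ?e"
        by (simp only: rip_ract rip_ract_left ract_closed xY)
      then have "cstar_norm D (rip Y (ract Y x ?e) (ract Y x ?e)) \<le> (cstar_norm D ?e)\<^sup>2 * cstar_norm D (rip Y x x)"
        using nD.norm_mult3[of "astar D ?e" "rip Y x x" ?e] by (simp add: nD.norm_star power2_eq_square mult_ac)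
      then have "sqrt (cstar_norm D (rip Y (ract Y x ?e) (ract Y x ?e))) \<le> sqrt ((cstar_norm D ?e)\<^sup>2 * cstar_norm D (rip Y x x))"
        by simp
      then show ?thesis
        by (simp add: clinear_diff[OF clinear_ract_right[OF xY]] real_sqrt_mult nD.norm_nonneg)
    qed
    then show "(\<lambda>i. sqrt (cstar_norm D (rip Y (ract Y x (R.embed (b i)) - ract Y x d) (ract Y x (R.embed (b i)) - ract Y x d)))) \<longlonglongrightarrow> 0"
      by (intro tendsto_sandwich[OF _ _ tendsto_const tendsto_mult_left_zero[OF lim]])
        (auto intro!: always_eventually nD.norm_nonneg)
  qed
  have "d = (\<Sum>j\<in>J. rip Y (gx j) (gy j)) \<odot>\<^bsub>D\<^esub> d" by (simp add: right_frame R.crossed.amult_one_left)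
  also have "\<dots> = (\<Sum>j\<in>J. rip Y (gx j) (ract Y (gy j) d))"
    unfolding R.crossed.unital.amult_simps by (intro sum.cong) (auto simp: rip_ract frame_Y)
  also have "\<dots> = R.embed (\<Sum>j\<in>J. slice (counit H) (rip Y (gx j) (ract Y (gy j) d)))"
    by (simp add: clinear_simps[OF R.clinear_embed] embed_slice_rip xd frame_X)
  finally show ?thesis by blast
qed

lemma norm_embed_left: "cstar_norm C (L.embed a) = cstar_norm A a"
  by (rule injective_hom_isometric[OF L.alg.cstar_normed L.crossed.cstar_normed L.unital_star_hom_embed])
    (auto intro: injI embed_closed_left simp: L.embed_inject)

lemma norm_embed_right: "cstar_norm D (R.embed b) = cstar_norm B b"
  by (rule injective_hom_isometric[OF R.alg.cstar_normed R.crossed.cstar_normed R.unital_star_hom_embed])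
    (auto intro: injI embed_closed_right simp: R.embed_inject)

lemma norm_Z:
  assumes x: "x \<in> X"
  shows "cstar_norm A (lip Z x x) = cstar_norm D (rip Y x x)" "cstar_norm B (rip Z x x) = cstar_norm D (rip Y x x)"
  using x by (simp_all add: norm_embed_left[symmetric] norm_embed_right[symmetric] embed_slice_lip embed_slice_rip
      norm_lip_rip XY)

lemma complete_X: "complete_wrt X (\<lambda>x. sqrt (cstar_norm D (rip Y x x)))"
  unfolding complete_wrt_def
proof (intro allI impI)
  fix f :: "nat \<Rightarrow> 'y"
  assume f: "range f \<subseteq> X" and c: "\<forall>e>0. \<exists>N. \<forall>i\<ge>N. \<forall>j\<ge>N. sqrt (cstar_norm D (rip Y (f i - f j) (f i - f j))) < e"
  obtain l where l: "l \<in> bcarrier Y" "(\<lambda>i. sqrt (cstar_norm D (rip Y (f i - l) (f i - l)))) \<longlonglongrightarrow> 0"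
    using rip_complete f c X_subset unfolding complete_wrt_def by blast
  then show "\<exists>l\<in>X. (\<lambda>i. sqrt (cstar_norm D (rip Y (f i - l) (f i - l)))) \<longlonglongrightarrow> 0"
    using X_closed[OF f l] by blast
qed

lemma lip_Z_span: "a \<in> cspan {lip Z x y |x y. x \<in> bcarrier Z \<and> y \<in> bcarrier Z}"
proof -
  let ?T = "{lip Z x y |x y. x \<in> bcarrier Z \<and> y \<in> bcarrier Z}"
  let ?S = "{c. slice (counit H) c \<in> cspan ?T}"
  note cl = clinear_simps[OF clinear_slice[OF L.hopf.counit_linear]]
  have "csubspace ?S"
    by (rule cvector.subspaceI) (auto simp: cl cvector.span_zero cvector.span_add cvector.span_scale)
  moreover have "{lip Y x y |x y. x \<in> X \<and> y \<in> X} \<subseteq> ?S" by (auto intro: cvector.span_base)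
  ultimately have "coefficient_algebra H \<subseteq> ?S" unfolding X_lip_span[symmetric] by (rule cvector.span_minimal[rotated])
  then have "L.embed a \<in> ?S" by (auto simp: L.coefficient_algebra_embed)
  then show ?thesis by (simp only: mem_Collect_eq L.slice_embed)
qed

lemma rip_Z_span: "b \<in> cspan {rip Z x y |x y. x \<in> bcarrier Z \<and> y \<in> bcarrier Z}"
proof -
  let ?T = "{rip Z x y |x y. x \<in> bcarrier Z \<and> y \<in> bcarrier Z}"
  let ?S = "{c. slice (counit H) c \<in> cspan ?T}"
  note cl = clinear_simps[OF clinear_slice[OF L.hopf.counit_linear]]
  have "csubspace ?S"
    by (rule cvector.subspaceI) (auto simp: cl cvector.span_zero cvector.span_add cvector.span_scale)
  moreover have "{rip Y x y |x y. x \<in> X \<and> y \<in> X} \<subseteq> ?S" by (auto intro: cvector.span_base)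
  ultimately have "coefficient_algebra H \<subseteq> ?S" unfolding X_rip_span[symmetric] by (rule cvector.span_minimal[rotated])
  then have "R.embed b \<in> ?S" by (auto simp: R.coefficient_algebra_embed)
  then show ?thesis by (simp only: mem_Collect_eq R.slice_embed)
qed

lemma equivalence_bimodule_Z: "equivalence_bimodule A B Z"
proof -
  interpret Z: pre_bimodule A B Z by (rule pre_bimodule_Z)
  show ?thesis
  proof (intro equivalence_bimodule.intro equivalence_bimodule_axioms.intro L.alg.cstar_algebra_axioms R.alg.cstar_algebra_axioms)
    show "apositive A (lip Z x x)" "apositive B (rip Z x x)" if "x \<in> bcarrier Z" for x
      using that lip_positive[of x] rip_positive[of x]
      by (auto intro!: L.apositive_embed R.apositive_embed simp: embed_slice_lip embed_slice_rip XY)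
    show "x = 0" if "x \<in> bcarrier Z" "lip Z x x = 0" for x
      using that lip_definite[of x] embed_slice_lip[of x x] by (simp add: XY clinear_zero[OF L.clinear_embed])
    show "x = 0" if "x \<in> bcarrier Z" "rip Z x x = 0" for x
      using that rip_definite[of x] embed_slice_rip[of x x] by (simp add: XY clinear_zero[OF R.clinear_embed])
    show "cstar_dense A (cspan {lip Z x y |x y. x \<in> bcarrier Z \<and> y \<in> bcarrier Z})"
      by (rule L.alg.cstar_dense_total[OF lip_Z_span])
    show "cstar_dense B (cspan {rip Z x y |x y. x \<in> bcarrier Z \<and> y \<in> bcarrier Z})"
      by (rule R.alg.cstar_dense_total[OF rip_Z_span])
    show "complete_wrt (bcarrier Z) (\<lambda>x. sqrt (cstar_norm A (lip Z x x)))"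
      "complete_wrt (bcarrier Z) (\<lambda>x. sqrt (cstar_norm B (rip Z x x)))"
      unfolding Z_simps(1) by (rule iffD2[OF complete_wrt_cong[OF X_subspace] complete_X]; simp only: norm_Z)+
    show "lact Z (lip Z x y) w = ract Z x (rip Z y w)" if "x \<in> bcarrier Z" "y \<in> bcarrier Z" "w \<in> bcarrier Z" for x y w
      using that by (simp add: embed_slice_lip embed_slice_rip imprimitivity XY)
  qed (fact Z.subspace Z.lact_closed Z.lact_add_left Z.lact_add_right Z.lact_scale_left Z.lact_scale_right Z.lact_mult Z.lact_one
        Z.ract_closed Z.ract_add_left Z.ract_add_right Z.ract_scale_left Z.ract_scale_right Z.ract_mult Z.ract_one Z.lact_ract
        Z.lip_add Z.lip_scale Z.lip_lact Z.lip_star Z.rip_add Z.rip_scale Z.rip_ract Z.rip_star Z.rip_lact Z.lip_ract)+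
qed

end

section \<open>The coaction on the bimodule\<close>

context cstar_hopf_algebra
begin

lemma sweedler2_expand:
  assumes f: "cbilinear f"
  shows "sweedler2 H f h = (\<Sum>b\<in>fbasis TYPE('h). f (slice (fcoord b) (comult H h)) b)"
  unfolding sweedler2_def
  by (subst tensor_expand[OF finite_dim, symmetric]) (simp add: clinear_simps[OF clinear_tensor_lift[OF f]] f)

lemma leg12_bimodule:
  assumes "pre_bimodule A B Y" and x: "x \<in> bcarrier Y"
  shows "leg12 H (lact Y a x) = lact (ext1 H Y) (leg12 H a) (leg12 H x)"
    and "leg12 H (ract Y x b) = ract (ext1 H Y) (leg12 H x) (leg12 H b)"
    and "y \<in> bcarrier Y \<Longrightarrow> lip (ext1 H Y) (leg12 H x) (leg12 H y) = leg12 H (lip Y x y)"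
    and "y \<in> bcarrier Y \<Longrightarrow> rip (ext1 H Y) (leg12 H x) (leg12 H y) = leg12 H (rip Y x y)"
proof -
  interpret E: ext_bimodule A B Y "dual_hopf H" by (rule ext_bimodule_dual) fact
  show "leg12 H (lact Y a x) = lact (ext1 H Y) (leg12 H a) (leg12 H x)"
    "leg12 H (ract Y x b) = ract (ext1 H Y) (leg12 H x) (leg12 H b)"
    "y \<in> bcarrier Y \<Longrightarrow> lip (ext1 H Y) (leg12 H x) (leg12 H y) = leg12 H (lip Y x y)"
    "y \<in> bcarrier Y \<Longrightarrow> rip (ext1 H Y) (leg12 H x) (leg12 H y) = leg12 H (rip Y x y)"
    using x by (simp_all add: leg12_def E.ext_pure E.coef.amult_one_left E.coef.astar_one)
qed

lemma comult_last_leg12: "comult_last H (leg12 H x) = leg13 H (leg12 H x)"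
  by (rule ev2_eqI) (simp add: ev_comult_last ev_leg12 ev_leg13 counit_mult clinear_simps[OF clinear_leg12]
      clinear_simps[OF clinear_ev] mult.commute)

end

locale crossed_morita_automorphism = crossed_morita_frame H A \<rho> u B \<sigma> v Y X I fx fy J gx gy
  for H :: "'h::complex_vector hopf_algebra"
    and A :: "('a::complex_vector, 'm) star_algebra_scheme"
    and \<rho> :: "'a \<Rightarrow> ('a, 'h dual) tensor"
    and u :: "(('a, 'h dual) tensor, 'h dual) tensor"
    and B :: "('b::complex_vector, 'n) star_algebra_scheme"
    and \<sigma> :: "'b \<Rightarrow> ('b, 'h dual) tensor"
    and v :: "(('b, 'h dual) tensor, 'h dual) tensor"
    and Y :: "(('a, 'h) tensor, ('b, 'h) tensor, 'y::complex_vector) bimodule"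
    and X :: "'y set" and I :: "'i set" and fx fy :: "'i \<Rightarrow> 'y" and J :: "'j set" and gx gy :: "'j \<Rightarrow> 'y" +
  fixes \<theta> :: "'h dual \<Rightarrow> 'h dual"
  assumes automorphism: "cstar_hopf_automorphism (dual_hopf H) \<theta>"
    and transport_automorphism:
      "transport1 \<psi> V = V \<odot>\<^bsub>coef1 H (crossed_product H A \<rho> u)\<^esub> (\<one>\<^bsub>crossed_product H A \<rho> u\<^esub> \<otimes>\<^sub>t \<theta> \<psi>)"
begin

sublocale T: automorphism_twist H B \<sigma> v \<theta>
  by (intro automorphism_twist.intro automorphism_twist_axioms.intro R.twisted_crossed_product_axioms automorphism)

abbreviation W where "W \<equiv> T.W"
abbreviation star1 where "star1 \<equiv> astar (coef1 H D)"
abbreviation star2 where "star2 \<equiv> astar (coef2 H D)"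

interpretation E1: ext_bimodule C D Y K
  by (rule L.hopf.ext_bimodule_dual[OF pre_bimodule_axioms])

interpretation P1: pre_bimodule "coef1 H C" "coef1 H D" "ext1 H Y"
  by (rule E1.ext_pre_bimodule)

interpretation E2: ext_bimodule "coef1 H C" "coef1 H D" "ext1 H Y" K
  by (rule L.hopf.ext_bimodule_dual[OF P1.pre_bimodule_axioms])

interpretation P2: pre_bimodule "coef2 H C" "coef2 H D" "ext2 H Y"
  by (rule E2.ext_pre_bimodule)

interpretation S1: bimodule_inclusion "coef1 H A" "coef1 H B" "ext1 H Z" "coef1 H C" "coef1 H D" "ext1 H Y" L.embed1 R.embed1
  by (rule bimodule_inclusion_ext[OF bimodule_inclusion_Z K.unital_star_algebra_axioms])

interpretation S2: bimodule_inclusion "coef2 H A" "coef2 H B" "ext2 H Z" "coef2 H C" "coef2 H D" "ext2 H Y" L.embed2 R.embed2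
  by (rule bimodule_inclusion_ext[OF S1.bimodule_inclusion_axioms K.unital_star_algebra_axioms])

lemmas unital_D = R.crossed.unital.unital_algebra_axioms
lemmas leg12_Y = L.hopf.leg12_bimodule[OF pre_bimodule_axioms]

lemma leg12_closed: "x \<in> bcarrier Y \<Longrightarrow> leg12 H x \<in> bcarrier (ext1 H Y)"
  by (simp add: bcarrier_ext leg12_def tensor_carrier_pure)

definition \<nu> :: "'y \<Rightarrow> ('y, 'h dual) tensor"
  where "\<nu> x = lact (ext1 H Y) V (ract (ext1 H Y) (leg12 H x) (star1 W))"

lemma \<nu>_Y: "x \<in> bcarrier Y \<Longrightarrow> \<nu> x \<in> bcarrier (ext1 H Y)"
  unfolding \<nu>_def by (intro P1.lact_closed P1.ract_closed leg12_closed)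

lemma ev_\<nu>:
  assumes x: "x \<in> bcarrier Y"
  shows "ev h (\<nu> x) = sweedler2 H (\<lambda>a b. ract Y (lact Y (ev a V) x) (ev b (star1 W))) h"
proof -
  have c: "clinear (\<lambda>b. ract Y x (ev b (star1 W)))"
    by (rule clinear_compose[OF clinear_ract_right[OF x] clinear_ev_arg])
  have "ev b (ract (ext1 H Y) (leg12 H x) (star1 W)) = ract Y x (ev b (star1 W))" for b
    using leg12_closed[OF x] x
    by (simp add: bcarrier_ext L.hopf.ev_ract[OF pre_bimodule_axioms] L.hopf.ev_leg12 ract_scale_left
        L.hopf.sweedler2_counit(1)[OF c])
  then show ?thesis
    using P1.ract_closed[OF leg12_closed[OF x]] x unfolding \<nu>_def
    by (simp add: bcarrier_ext L.hopf.ev_lact[OF pre_bimodule_axioms] lact_ract)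
qed

lemma bilinear_\<nu>:
  assumes x: "x \<in> bcarrier Y"
  shows "cbilinear (\<lambda>a b. ract Y (lact Y (ev a V) x) (ev b (star1 W)))"
  by (rule cbilinearI)
    (simp_all add: x clinear_simps[OF clinear_ev_arg] lact_add_left lact_scale_left ract_add_left ract_scale_left
      ract_add_right ract_scale_right lact_closed)

text \<open>Pairing with z turns a question on the coefficients of \<nu>(x) into one on an element
  of D \<otimes> H^0, where the dual action is available.\<close>

lemma rip_\<nu>:
  assumes x: "x \<in> bcarrier Y" and z: "z \<in> bcarrier Y"
  shows "rip Y z (ev h (\<nu> x)) = ev h (tensor_map (\<lambda>c. rip Y z (lact Y c x)) id V \<odot>\<^bsub>coef1 H D\<^esub> star1 W)"
proof -
  have l: "clinear (\<lambda>c. rip Y z (lact Y c x))"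
    by (rule clinearI) (simp_all add: x z lact_add_left lact_scale_left rip_add rip_scale lact_closed)
  have b: "cbilinear (\<lambda>p q. rip Y z (lact Y (ev p V) x) \<odot>\<^bsub>D\<^esub> ev q (star1 W))"
    by (rule cbilinear_compose(1)[OF R.crossed.unital.cbilinear_amult clinear_compose[OF l clinear_ev_arg] clinear_ev_arg])
  have "rip Y z (ev h (\<nu> x)) = sweedler2 H (\<lambda>p q. rip Y z (lact Y (ev p V) x) \<odot>\<^bsub>D\<^esub> ev q (star1 W)) h"
    by (simp add: ev_\<nu>[OF x] L.hopf.sweedler2_expand[OF bilinear_\<nu>[OF x]] L.hopf.sweedler2_expand[OF b]
        rip_sum z x lact_closed ract_closed rip_ract)
  then show ?thesis by (simp add: L.hopf.ev_mult[OF unital_D] ev_tensor_map l)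
qed

text \<open>The inner products of the coefficients of \<open>\<nu> x\<close> with elements of \<open>X\<close> are invariant under the dual action, hence lie in \<open>B\<close>.\<close>

lemma ev_\<nu>_closed:
  assumes x: "x \<in> X"
  shows "ev h (\<nu> x) \<in> X"
proof -
  note xY = XY[OF x]
  have y: "ev h (\<nu> x) \<in> bcarrier Y"
    using \<nu>_Y[OF xY] by (simp add: bcarrier_ext ev_in_carrier[OF subspace])
  have "\<exists>b. rip Y z (ev h (\<nu> x)) = R.embed b" if z: "z \<in> X" for z
  proof -
    define r where "r c = rip Y z (lact Y c x)" for c
    have rl: "clinear r"
      unfolding r_def[abs_def]
      by (rule clinearI) (simp_all add: xY XY[OF z] lact_add_left lact_scale_left rip_add rip_scale lact_closed)
    define t where "t = tensor_map r id V"
    \<comment> \<open>By \<open>transport_char\<close> the dual action on the paired tensor is the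
      pairing of the transported action, which multiplies V by a constant.\<close>
    have r: "tensor_map (dual_act H \<psi>) id t = t \<odot>\<^bsub>coef1 H D\<^esub> (\<one>\<^bsub>D\<^esub> \<otimes>\<^sub>t \<theta> \<psi>)" for \<psi>
    proof -
      have "tensor_map (dual_act H \<psi>) id t = tensor_map (\<lambda>c. r (transport \<psi> c)) id V"
        unfolding t_def by (simp add: tensor_map_compose rl L.hopf.clinear_dual_act)
          (simp add: r_def transport_char[OF x z] id_def)
      also have "\<dots> = tensor_map r id (transport1 \<psi> V)"
        by (simp add: tensor_map_compose rl clinear_transport id_def)
      finally show ?thesis
        unfolding transport_automorphism t_def by (simp add: tensor_map_right_mult[OF unital_C unital_D unital_K rl])
    qed
    define F where "F \<phi> = t \<odot>\<^bsub>coef1 H D\<^esub> ((\<one>\<^bsub>D\<^esub> \<otimes>\<^sub>t \<theta> \<phi>) \<odot>\<^bsub>coef1 H D\<^esub> star1 W)" for \<phi>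
    have F: "clinear F"
      unfolding F_def by (rule clinearI) (simp_all add: clinear_simps[OF T.theta(1)] pure_tensor_simps R.C1.unital.amult_simps)
    have "tensor_map (dual_act H \<psi>1) id t \<odot>\<^bsub>coef1 H D\<^esub> tensor_map (dual_act H \<psi>2) id (star1 W)
        = F (\<psi>1 \<odot>\<^bsub>K\<^esub> antipode K \<psi>2)" for \<psi>1 \<psi>2
    proof -
      have "(\<one>\<^bsub>D\<^esub> \<otimes>\<^sub>t \<theta> (\<psi>1 \<odot>\<^bsub>K\<^esub> antipode K \<psi>2)) = (\<one>\<^bsub>D\<^esub> \<otimes>\<^sub>t \<theta> \<psi>1) \<odot>\<^bsub>coef1 H D\<^esub> (\<one>\<^bsub>D\<^esub> \<otimes>\<^sub>t \<theta> (antipode K \<psi>2))"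
        by (simp add: tensor_algebra_mult[OF unital_D unital_K] R.crossed.amult_one_left T.theta)
      then show ?thesis by (simp add: r T.dual_act_W_star F_def R.C1.amult_assoc)
    qed
    \<comment> \<open>The constants from t and from the adjoint of W meet as \<theta>(\<psi>_1
      S(\<psi>_2)), and the antipode law of H^0 reduces their sum to the counit.\<close>
    then have inv: "tensor_map (dual_act H \<psi>) id (t \<odot>\<^bsub>coef1 H D\<^esub> star1 W) = dual_apply \<psi> \<one>\<^bsub>H\<^esub> *\<^sub>C (t \<odot>\<^bsub>coef1 H D\<^esub> star1 W)" for \<psi>
    proof -
      have one: "F \<one>\<^bsub>K\<^esub> = t \<odot>\<^bsub>coef1 H D\<^esub> star1 W"
        unfolding F_def by (simp add: T.theta tensor_algebra_one[symmetric] R.C1.amult_one_left)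
      show ?thesis
        unfolding tensor_map_sweedler_product[of D K "dual_act H" \<psi>, OF unital_D unital_K L.hopf.clinear_dual_act R.dual_act_product]
        by (simp add: \<open>\<And>\<psi>1 \<psi>2. _ = F (\<psi>1 \<odot>\<^bsub>K\<^esub> antipode K \<psi>2)\<close> sweedler2_linear[OF F] L.hopf.dual_antipode_law
            clinear_simps[OF F] one)
    qed
    have "dual_act H \<psi> (rip Y z (ev h (\<nu> x))) = dual_apply \<psi> \<one>\<^bsub>H\<^esub> *\<^sub>C rip Y z (ev h (\<nu> x))" for \<psi>
      using arg_cong[OF inv[of \<psi>], of "ev h"]
      by (simp add: rip_\<nu> xY XY[OF z] t_def r_def[abs_def] ev_tensor_map L.hopf.clinear_dual_act clinear_simps[OF clinear_ev])
    then show ?thesis using L.hopf.dual_act_invariant unfolding R.embed_def by blast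
  qed
  \<comment> \<open>The frame expands an element of Y by its inner products with X; if these lie in
    B, every summand lies in X.\<close>
  then have "ract Y (fx i) (rip Y (fy i) (ev h (\<nu> x))) \<in> X" if "i \<in> I" for i
    using frame_X(1,2)[OF that] ract_X by metis
  then show ?thesis by (subst frame_expand[OF y, symmetric]) (rule X_sum)
qed

lemma \<nu>_closed: "x \<in> X \<Longrightarrow> \<nu> x \<in> bcarrier (ext1 H Z)"
  by (simp add: bcarrier_ext tensor_carrier_evI[OF L.hopf.finite_dim] ev_\<nu>_closed)

lemma embed1_inject: "L.embed1 s = L.embed1 t \<Longrightarrow> s = t" "R.embed1 s' = R.embed1 t' \<Longrightarrow> s' = t'"
proof -
  show "s = t" if "L.embed1 s = L.embed1 t"
    by (rule ev_eqI[OF L.hopf.finite_dim]) (metis that L.ev_embed1 L.embed_inject)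
  show "s' = t'" if "R.embed1 s' = R.embed1 t'"
    by (rule ev_eqI[OF L.hopf.finite_dim]) (metis that R.ev_embed1 R.embed_inject)
qed

lemma W_star_embed:
  "leg12 H (R.embed b) \<odot>\<^bsub>coef1 H D\<^esub> star1 W = star1 W \<odot>\<^bsub>coef1 H D\<^esub> R.embed1 (T.map1 (\<sigma> b))"
proof -
  have "star1 W \<odot>\<^bsub>coef1 H D\<^esub> (W \<odot>\<^bsub>coef1 H D\<^esub> leg12 H (R.embed b)) \<odot>\<^bsub>coef1 H D\<^esub> star1 W
    = leg12 H (R.embed b) \<odot>\<^bsub>coef1 H D\<^esub> star1 W"
    by (simp add: R.C1.amult_assoc[symmetric] T.W_isometry R.C1.amult_one_left)
  then show ?thesis
    by (simp add: T.W_embed R.C1.amult_assoc T.W_coisometry R.C1.amult_one_right)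
qed

text \<open>V and the adjoint of W act on the first two legs only, so \<nu> \<otimes> id multiplies
  by them in legs 1 and 2, with its argument placed in legs 1 and 3.\<close>

lemma map_\<nu>:
  assumes "t \<in> tensor_carrier X"
  shows "tensor_map_on X \<nu> id t = lact (ext2 H Y) (leg12 H V) (ract (ext2 H Y) (leg13 H t) (leg12 H (star1 W)))"
proof -
  have bal: "balanced_on X (\<lambda>x k. \<nu> x \<otimes>\<^sub>t id k)"
    by (auto simp: balanced_on_def pure_tensor_simps \<nu>_def clinear_simps[OF clinear_leg12] P1.ract_add_left
        P1.ract_scale_left P1.lact_add_right P1.lact_scale_right leg12_closed P1.ract_closed XY)
  have l13: "leg13 H t \<in> bcarrier (ext2 H Y)" if "t \<in> tensor_carrier X" for t :: "('y, 'h dual) tensor"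
    using that X_subset unfolding bcarrier_ext
    by (intro L.hopf.leg13_closed[OF subspace]) (auto simp: tensor_carrier_def intro: cvector.span_mono[THEN subsetD, rotated])
  from X_subspace assms show ?thesis
  proof (induction rule: tensor_carrier_induct)
    case (pure x k)
    have 1: "leg12 H x \<in> tensor_carrier (bcarrier Y)" "ract (ext1 H Y) (leg12 H x) (star1 W) \<in> tensor_carrier (bcarrier Y)"
      using leg12_closed[OF XY[OF pure]] P1.ract_closed[OF leg12_closed[OF XY[OF pure]]] by (simp_all add: bcarrier_ext)
    have "lact (ext2 H Y) (V \<otimes>\<^sub>t \<one>\<^bsub>K\<^esub>) (ract (ext2 H Y) (leg12 H x \<otimes>\<^sub>t k) (star1 W \<otimes>\<^sub>t \<one>\<^bsub>K\<^esub>)) = \<nu> x \<otimes>\<^sub>t k"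
      using 1 by (simp add: E2.ext_pure bcarrier_ext \<nu>_def K.amult_one_left K.amult_one_right)
    then show ?case
      using tensor_lift_on_pure[OF X_subspace bal pure] by (simp add: tensor_map_on_def leg13_pure leg12_def[of H V] leg12_def[of H "star1 W"])
  next
    case (add s t)
    then show ?case
      using tensor_lift_on_add[OF X_subspace bal add(1,2)]
      by (simp add: tensor_map_on_def clinear_simps[OF clinear_leg13]
          P2.ract_add_left P2.lact_add_right P2.ract_closed l13)
  qed
qed

lemma coactions_strongly_morita_equivalent_\<nu>:
  "coactions_strongly_morita_equivalent H A \<rho> u B (T.map1 \<circ> \<sigma>) (T.map2 v) Z \<nu>"
proof (intro coactions_strongly_morita_equivalent.intro coactions_strongly_morita_equivalent_axioms.intro
    L.twisted_coaction_axioms T.twisted_coaction_map equivalence_bimodule_Z)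
  note cl = leg12_closed P1.ract_closed P1.lact_closed XY
  fix x assume x: "x \<in> bcarrier Z"
  then have xX: "x \<in> X" and xY: "x \<in> bcarrier Y" by (simp_all add: XY)
  show "\<nu> x \<in> bcarrier (ext1 H Z)" by (rule \<nu>_closed[OF xX])
  show "\<nu> (z *\<^sub>C x) = z *\<^sub>C \<nu> x" for z
    by (simp add: \<nu>_def clinear_simps[OF clinear_leg12] P1.ract_scale_left P1.lact_scale_right cl xY)
  show "\<nu> (lact Z a x) = lact (ext1 H Z) (\<rho> a) (\<nu> x)" for a
  proof -
    have "\<nu> (lact Z a x) = lact (ext1 H Y) (V \<odot>\<^bsub>coef1 H C\<^esub> leg12 H (L.embed a)) (ract (ext1 H Y) (leg12 H x) (star1 W))"
      by (simp add: \<nu>_def leg12_Y xY P1.lact_ract P1.lact_mult cl)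
    also have "\<dots> = lact (ext1 H Y) (L.embed1 (\<rho> a)) (\<nu> x)"
      by (simp add: L.V_embed \<nu>_def P1.lact_mult cl xY)
    finally show ?thesis by (simp add: S1.sub_lact \<nu>_closed xX)
  qed
  show "\<nu> (ract Z x b) = ract (ext1 H Z) (\<nu> x) ((T.map1 \<circ> \<sigma>) b)" for b
  proof -
    have "\<nu> (ract Z x b) = lact (ext1 H Y) V (ract (ext1 H Y) (leg12 H x) (leg12 H (R.embed b) \<odot>\<^bsub>coef1 H D\<^esub> star1 W))"
      by (simp add: \<nu>_def leg12_Y xY P1.ract_mult cl)
    also have "\<dots> = ract (ext1 H Y) (\<nu> x) (R.embed1 (T.map1 (\<sigma> b)))"
      by (simp add: W_star_embed \<nu>_def P1.ract_mult P1.lact_ract cl xY)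
    finally show ?thesis by (simp add: S1.sub_ract \<nu>_closed xX)
  qed
  show "slice (counit K) (\<nu> x) = x"
    using ev_\<nu>[OF xY, of "\<one>\<^bsub>H\<^esub>", unfolded L.hopf.sweedler2_one[OF bilinear_\<nu>[OF xY]]] xY
    by (simp add: L.hopf.dual_counit[abs_def] L.ev_V L.gen_one lact_one
        L.hopf.ev_star[OF R.crossed.unital_star_algebra_axioms] L.hopf.antipode_one L.hopf.astar_one T.W_counit
        R.crossed.astar_one ract_one)
  \<comment> \<open>In leg notation the left side is V_12 V_13 x W_13* W_12*. The relations for V
    and W turn the outer products into u times the coproduct of V and the coproduct of W* times the
    adjoint of the twisted v; the coproducts then recombine to that of \<nu>(x).\<close>
  show "tensor_map_on (bcarrier Z) \<nu> id (\<nu> x) =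
      ract (ext2 H Z) (lact (ext2 H Z) u (comult_last H (\<nu> x))) (astar (coef2 H B) (T.map2 v))"
  proof -
    note h12 = unital_star_homD[OF L.hopf.unital_star_hom_leg12[OF R.C1.unital_star_algebra_axioms]]
    note h13 = unital_star_homD[OF L.hopf.unital_star_hom_leg13[OF R.crossed.unital_star_algebra_axioms]]
    note hc = unital_star_homD[OF L.hopf.unital_star_hom_comult_last[OF R.crossed.unital_star_algebra_axioms]]
    let ?x = "leg13 H (leg12 H x)"
    have x2: "?x \<in> bcarrier (ext2 H Y)"
      using leg12_closed[OF xY] by (simp add: bcarrier_ext L.hopf.leg13_closed[OF subspace])
    have nX: "\<nu> x \<in> tensor_carrier X" using \<nu>_closed[OF xX] by (simp add: bcarrier_ext)
    have c2: "comult_last H (\<nu> x) \<in> bcarrier (ext2 H Z)"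
      by (simp add: bcarrier_ext L.hopf.comult_last_closed[OF X_subspace nX])
    have t1: "leg12 H x \<in> tensor_carrier (bcarrier Y)" "ract (ext1 H Y) (leg12 H x) (star1 W) \<in> tensor_carrier (bcarrier Y)"
      using leg12_closed[OF xY] P1.ract_closed[OF leg12_closed[OF xY]] by (simp_all add: bcarrier_ext)
    have "tensor_map_on (bcarrier Z) \<nu> id (\<nu> x) = lact (ext2 H Y) (leg12 H V) (ract (ext2 H Y)
        (lact (ext2 H Y) (leg13 H V) (ract (ext2 H Y) ?x (leg13 H (star1 W)))) (leg12 H (star1 W)))"
      unfolding Z_simps(1) map_\<nu>[OF nX] using t1 by (simp add: \<nu>_def[of x] L.hopf.leg13_bimodule[OF pre_bimodule_axioms])
    also have "\<dots> = lact (ext2 H Y) (leg12 H V \<odot>\<^bsub>coef2 H C\<^esub> leg13 H V)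
        (ract (ext2 H Y) ?x (star2 (leg12 H W \<odot>\<^bsub>coef2 H D\<^esub> leg13 H W)))"
      by (simp add: P2.lact_mult P2.ract_mult P2.lact_ract P2.ract_closed x2 h12(4) h13(4) R.C2.astar_mult)
    also have "\<dots> = lact (ext2 H Y) (L.embed2 u \<odot>\<^bsub>coef2 H C\<^esub> comult_last H V)
        (ract (ext2 H Y) ?x (comult_last H (star1 W) \<odot>\<^bsub>coef2 H D\<^esub> star2 (R.embed2 (T.map2 v))))"
      by (simp add: L.V_V T.W_W R.C2.astar_mult hc(4))
    also have "\<dots> = ract (ext2 H Y) (lact (ext2 H Y) (L.embed2 u) (comult_last H (\<nu> x))) (star2 (R.embed2 (T.map2 v)))"
      using t1 by (simp add: \<nu>_def[of x] L.hopf.comult_last_lact[OF pre_bimodule_axioms]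
          L.hopf.comult_last_ract[OF pre_bimodule_axioms] L.hopf.comult_last_leg12
          P2.lact_mult P2.ract_mult P2.lact_ract P2.ract_closed P2.lact_closed x2)
    finally show ?thesis
      using c2 S2.sub.lact_closed[OF c2]
      by (simp add: S2.sub_lact S2.sub_ract unital_star_homD(4)[OF R.unital_star_hom_embed2] del: Z_simps)
  qed
  fix y assume y: "y \<in> bcarrier Z"
  then have yX: "y \<in> X" and yY: "y \<in> bcarrier Y" by (simp_all add: XY)
  show "\<nu> (x + y) = \<nu> x + \<nu> y"
    by (simp add: \<nu>_def clinear_simps[OF clinear_leg12] P1.ract_add_left P1.lact_add_right cl xY yY)
  \<comment> \<open>In the left inner product W* W cancels, and V a V* = \<rho>(a) remains.\<close>
  show "\<rho> (lip Z x y) = lip (ext1 H Z) (\<nu> x) (\<nu> y)"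
  proof (rule embed1_inject(1))
    have "L.embed1 (lip (ext1 H Z) (\<nu> x) (\<nu> y)) = lip (ext1 H Y) (\<nu> x) (\<nu> y)"
      by (rule S1.sub_lip) (intro \<nu>_closed xX yX)+
    also have "\<dots> = V \<odot>\<^bsub>coef1 H C\<^esub> (lip (ext1 H Y) (leg12 H x)
        (ract (ext1 H Y) (leg12 H y) (star1 W \<odot>\<^bsub>coef1 H D\<^esub> W)) \<odot>\<^bsub>coef1 H C\<^esub> astar (coef1 H C) V)"
      by (simp add: \<nu>_def P1.lip_lact P1.lip_lact_right P1.lip_ract P1.ract_mult cl xY yY R.C1.astar_astar L.C1.amult_assoc)
    also have "\<dots> = L.embed1 (\<rho> (lip Z x y))"
      by (simp add: T.W_isometry P1.ract_one leg12_Y L.rho_V embed_slice_lip xX yX cl xY yY)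
    finally show "L.embed1 (\<rho> (lip Z x y)) = L.embed1 (lip (ext1 H Z) (\<nu> x) (\<nu> y))" by simp
  qed
  \<comment> \<open>In the right inner product V* V cancels instead, and W b W* is the twisted
    \<sigma>(b).\<close>
  show "(T.map1 \<circ> \<sigma>) (rip Z x y) = rip (ext1 H Z) (\<nu> x) (\<nu> y)"
  proof (rule embed1_inject(2))
    have W: "R.embed1 (T.map1 (\<sigma> b)) = W \<odot>\<^bsub>coef1 H D\<^esub> (leg12 H (R.embed b) \<odot>\<^bsub>coef1 H D\<^esub> star1 W)" for b
      by (simp add: W_star_embed) (simp add: R.C1.amult_assoc[symmetric] T.W_coisometry R.C1.amult_one_left)
    have "R.embed1 (rip (ext1 H Z) (\<nu> x) (\<nu> y)) = rip (ext1 H Y) (\<nu> x) (\<nu> y)"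
      by (rule S1.sub_rip) (intro \<nu>_closed xX yX)+
    also have "\<dots> = rip (ext1 H Y) (ract (ext1 H Y) (leg12 H x) (star1 W))
        (lact (ext1 H Y) (astar (coef1 H C) V \<odot>\<^bsub>coef1 H C\<^esub> V) (ract (ext1 H Y) (leg12 H y) (star1 W)))"
      by (simp add: \<nu>_def P1.rip_lact P1.lact_mult cl xY yY)
    also have "\<dots> = W \<odot>\<^bsub>coef1 H D\<^esub> (rip (ext1 H Y) (leg12 H x) (leg12 H y) \<odot>\<^bsub>coef1 H D\<^esub> star1 W)"
      by (simp add: L.V_isometry P1.lact_one P1.rip_ract P1.rip_ract_left cl xY yY R.C1.astar_astar R.C1.amult_assoc)
    also have "\<dots> = R.embed1 ((T.map1 \<circ> \<sigma>) (rip Z x y))"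
      by (simp add: W leg12_Y embed_slice_rip xX yX xY yY)
    finally show "R.embed1 ((T.map1 \<circ> \<sigma>) (rip Z x y)) = R.embed1 (rip (ext1 H Z) (\<nu> x) (\<nu> y))" by simp
  qed
qed

end

section \<open>Strong Morita equivalence of the coactions\<close>

text \<open>A choice of arguments for every generator that occurs turns a linear combination of
  values of f into a finite family of pairs, indexed by the generators themselves. This produces the
  frames.\<close>

lemma cspan_indexed:
  fixes c :: "'c::complex_vector"
  assumes "c \<in> cspan {f x y | x y. x \<in> X \<and> y \<in> X}"
  shows "\<exists>(P :: 'c set) r p q. p ` P \<subseteq> X \<and> q ` P \<subseteq> X \<and> c = (\<Sum>i\<in>P. r i *\<^sub>C f (p i) (q i))"
proof -
  obtain P r where P: "P \<subseteq> {f x y | x y. x \<in> X \<and> y \<in> X}" "c = (\<Sum>i\<in>P. r i *\<^sub>C i)"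
    using assms unfolding cvector.span_explicit by blast
  then have "\<forall>i\<in>P. \<exists>s. fst s \<in> X \<and> snd s \<in> X \<and> i = f (fst s) (snd s)" by fastforce
  then obtain s where s: "\<And>i. i \<in> P \<Longrightarrow> fst (s i) \<in> X \<and> snd (s i) \<in> X \<and> i = f (fst (s i)) (snd (s i))"
    by metis
  have c: "c = (\<Sum>i\<in>P. r i *\<^sub>C f (fst (s i)) (snd (s i)))"
    unfolding P(2) by (intro sum.cong HOL.refl) (use s in metis)
  show ?thesis
    by (intro exI[of _ P] exI[of _ r] exI[of _ "\<lambda>i. fst (s i)"] exI[of _ "\<lambda>i. snd (s i)"]) (use s c in auto)
qed

theorem theorem6p2:
  fixes A :: "'a::complex_vector star_algebra"
    and B :: "'b::complex_vector star_algebra"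
    and H :: "'h::complex_vector hopf_algebra"
    and \<rho> :: "'a \<Rightarrow> ('a, 'h dual) tensor"
    and u :: "(('a, 'h dual) tensor, 'h dual) tensor"
    and \<sigma> :: "'b \<Rightarrow> ('b, 'h dual) tensor"
    and v :: "(('b, 'h dual) tensor, 'h dual) tensor"
    and C :: "('a, 'h) tensor star_algebra"
    and D :: "('b, 'h) tensor star_algebra"
    and Y :: "(('a, 'h) tensor, ('b, 'h) tensor, 'y::complex_vector) bimodule"
    and X :: "'y set"
  assumes "cstar_algebra A" and "cstar_algebra B" and "cstar_hopf_algebra H"
    and "twisted_coaction H A \<rho> u" and "twisted_coaction H B \<sigma> v"
    and "C = crossed_product H A \<rho> u" and "D = crossed_product H B \<sigma> v"
    and "inclusions_strongly_morita_equivalent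
      C (coefficient_algebra H) D (coefficient_algebra H) Y X"
    and "relative_commutant C (coefficient_algebra H) = range (\<lambda>z. z *\<^sub>C aone C)"
  shows "\<exists>\<theta>. cstar_hopf_automorphism (dual_hopf H) \<theta> \<and>
    (\<exists>(Z :: ('a, 'b, 'y) bimodule) \<nu>.
      coactions_strongly_morita_equivalent H A \<rho> u
        B (tensor_map id \<theta> \<circ> \<sigma>) (tensor_map (tensor_map id \<theta>) \<theta> v) Z \<nu>)"
proof -
  interpret M: inclusions_strongly_morita_equivalent "crossed_product H A \<rho> u" "coefficient_algebra H"
    "crossed_product H B \<sigma> v" "coefficient_algebra H" Y X
    using assms(6-8) by simp
  interpret L: twisted_crossed_product H A \<rho> u
    by (intro twisted_crossed_product.intro assms(4) M.left.cstar_algebra_axioms)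
  interpret R: twisted_crossed_product H B \<sigma> v
    by (intro twisted_crossed_product.intro assms(5) M.right.cstar_algebra_axioms)
  \<comment> \<open>The units of C and D lie in A and B, which are the spans of the inner products
    over X.\<close>
  have units: "\<one>\<^bsub>L.C\<^esub> \<in> cspan {lip Y x y |x y. x \<in> X \<and> y \<in> X}" "\<one>\<^bsub>R.C\<^esub> \<in> cspan {rip Y x y |x y. x \<in> X \<and> y \<in> X}"
    by (auto simp: M.X_lip_span M.X_rip_span L.coefficient_algebra_embed R.coefficient_algebra_embed
        simp flip: L.embed_one R.embed_one)
  obtain I :: "('a, 'h) tensor set" and r fx fy where
    I: "fx ` I \<subseteq> X" "fy ` I \<subseteq> X" "\<one>\<^bsub>L.C\<^esub> = (\<Sum>i\<in>I. r i *\<^sub>C lip Y (fx i) (fy i))"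
    using cspan_indexed[OF units(1)] by (elim exE conjE) (rule that, assumption+)
  obtain J :: "('b, 'h) tensor set" and t gx gy where
    J: "gx ` J \<subseteq> X" "gy ` J \<subseteq> X" "\<one>\<^bsub>R.C\<^esub> = (\<Sum>j\<in>J. t j *\<^sub>C rip Y (gx j) (gy j))"
    using cspan_indexed[OF units(2)] by (elim exE conjE) (rule that, assumption+)
  have XY: "x \<in> bcarrier Y" if "x \<in> X" for x using that M.X_subset by blast
  have scale: "z *\<^sub>C x \<in> X" if "x \<in> X" for x z using that M.X_subspace by (rule cvector.subspace_scale[rotated])
  \<comment> \<open>The scalars are absorbed into one vector of each pair, in the argument where the
    inner product is linear: the first for the left one, the second for the right one.\<close>
  interpret F: crossed_morita_frame H A \<rho> u B \<sigma> v Y X I "\<lambda>i. r i *\<^sub>C fx i" fy J gx "\<lambda>j. t j *\<^sub>C gy j"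
  proof (intro crossed_morita_frame.intro crossed_morita_frame_axioms.intro L.twisted_crossed_product_axioms
      R.twisted_crossed_product_axioms M.inclusions_strongly_morita_equivalent_axioms)
    show "(\<Sum>i\<in>I. lip Y (r i *\<^sub>C fx i) (fy i)) = \<one>\<^bsub>L.C\<^esub>" "(\<Sum>j\<in>J. rip Y (gx j) (t j *\<^sub>C gy j)) = \<one>\<^bsub>R.C\<^esub>"
      unfolding I(3) J(3) using I(1,2) J(1,2) by (auto intro!: sum.cong M.lip_scale M.rip_scale XY)
    show "relative_commutant L.C (coefficient_algebra H) \<subseteq> range (\<lambda>z. z *\<^sub>C \<one>\<^bsub>L.C\<^esub>)"
      using assms(6,9) by simp
  qed (use I J scale in auto)
  obtain \<theta> where \<theta>: "cstar_hopf_automorphism (dual_hopf H) \<theta>"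
    "\<And>\<psi>. F.transport1 \<psi> F.V = F.V \<odot>\<^bsub>coef1 H F.C\<^esub> (\<one>\<^bsub>F.C\<^esub> \<otimes>\<^sub>t \<theta> \<psi>)"
    using F.exists_automorphism by blast
  interpret G: crossed_morita_automorphism H A \<rho> u B \<sigma> v Y X I "\<lambda>i. r i *\<^sub>C fx i" fy J gx "\<lambda>j. t j *\<^sub>C gy j" \<theta>
    by (intro crossed_morita_automorphism.intro crossed_morita_automorphism_axioms.intro F.crossed_morita_frame_axioms \<theta>)
  show ?thesis using \<theta>(1) G.coactions_strongly_morita_equivalent_\<nu> by blast
qed

end
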